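(* In the setting described in the context, let $\mathfrak{h}\subset\mathfrak{g}_1$ be a Cartan subspace with complex span $\mathfrak{h}^{\mathbb{C}}$, let $W$ be the Weyl group of $(\mathfrak{g}^{\mathbb{C}},\theta)$ with respect to $\mathfrak{h}^{\mathbb{C}}$, and suppose $p_1,\ldots,p_N\in\mathfrak{h}$ (so ${}^\gamma p_j=p_j$) are such that for every $r\in\mathfrak{h}^{\mathbb{C}}$ the stabilizer $W_r$ is $W$-conjugate to exactly one $W_{p_j}$. Let $p$ be one of the $p_j$, and put $\mathcal{F}=\mathfrak{h}_p^{\mathbb{C},\circ}$ and $\Gamma_p=\mathcal{N}_W(W_p)/W_p$. Let $\varphi:\mathcal{N}_{\widehat{G}}(\mathcal{F})\to\Gamma_p$ be the homomorphism defined in the context. Suppose that $\mathrm{H}^1\widehat{G}=1$. Write $\mathrm{H}^1\Gamma_p=\{[\delta_1],\ldots,[\delta_s]\}$, where the $\delta_i\in\Gamma_p$ are cocycles. Suppose further that for $1\le i\le s$ there is a cocycle $n_i\in\mathcal{N}_{\widehat{G}}(\mathcal{F})$ with $\varphi(n_i)=\delta_i$. Let $g_i\in\widehat{G}$ be such that $g_i^{-1}\,{}^\gamma g_i=n_i$. Let $q\in\mathcal{F}$ and let $\mathcal{O}=\widehat{G}\cdot q$ be its orbit. Then $\mathcal{O}$ has real points if and only if there is a $q'\in\mathcal{O}\cap\mathcal{F}$ with ${}^\gamma q'=\delta_i^{-1}q'$ for an $i$ with $1\le i\le s$. In that case $g_i\cdot q'$ is a real point of $\mathcal{O}$.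
   Context: $\mathbb{Z}_m=\mathbb{Z}/m\mathbb{Z}$. $\mathfrak{g}^{\mathbb{C}}=\bigoplus_{i\in\mathbb{Z}_m}\mathfrak{g}^{\mathbb{C}}_i$ is a complex semisimple Lie algebra with a $\mathbb{Z}_m$-grading; $\theta$ is the corresponding automorphism of order $m$, $\theta(x)=\omega^i x$ for $x\in\mathfrak{g}^{\mathbb{C}}_i$, with $\omega$ a primitive $m$-th root of unity. $G$ is the identity component of $\mathrm{Aut}(\mathfrak{g}^{\mathbb{C}})$, and $G_0\subset G$ is the connected (reductive) subgroup with Lie algebra $\mathfrak{g}^{\mathbb{C}}_0$; it acts on $\mathfrak{g}^{\mathbb{C}}_1$. $\widehat{G}$ is a reductive complex algebraic group with a surjective morphism $\psi:\widehat{G}\to G_0$ whose differential is an isomorphism onto $\mathfrak{g}_0^{\mathbb{C}}$; $\widehat{G}$ acts on $\mathfrak{g}_1^{\mathbb{C}}$ by $g\cdot x=\psi(g)\cdot x$. Real structure: $\mathfrak{g}$ is a real form of $\mathfrak{g}^{\mathbb{C}}$ with associated conjugation $\sigma$ (conjugate-linear, involutive, preserving the bracket), assumed to leave every $\mathfrak{g}_i^{\mathbb{C}}$ invariant; $\mathfrak{g}_i=(\mathfrak{g}_i^{\mathbb{C}})^\sigma$. It induces an antiregular involution $\sigma$ of $G$ (satisfying $\sigma(\exp(\mathrm{ad}\,x))=\exp(\mathrm{ad}\,\sigma(x))$ for nilpotent $x$), preserving $G_0$. (An involution $\sigma$ of an algebraic group $H$ is antiregular if for every regular function $f$ on $H$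 the function $g\mapsto\overline{f(\sigma(g))}$ is regular.) $\widehat{G}$ is also equipped with an antiregular involution $\sigma$, and $\psi$ commutes with the involutions. $\Gamma=\mathrm{Gal}(\mathbb{C}/\mathbb{R})=\{1,\gamma\}$ acts on all these objects by letting $\gamma$ act as $\sigma$, written ${}^\gamma g$, ${}^\gamma x$. A point $x\in\mathfrak{g}_1^{\mathbb{C}}$ is real if ${}^\gamma x=x$, i.e. $x\in\mathfrak{g}_1$. An element $x$ is semisimple if $\mathrm{ad}\,x$ is. A Cartan subspace of $\mathfrak{g}_1$ (respectively $\mathfrak{g}_1^{\mathbb{C}}$) is a maximal subspace consisting of commuting semisimple elements; if $\mathfrak{h}$ is a Cartan subspace of $\mathfrak{g}_1$, its complex span $\mathfrak{h}^{\mathbb{C}}$ is a Cartan subspace of $\mathfrak{g}_1^{\mathbb{C}}$. The Weyl group is $W=\mathcal{N}_{G_0}(\mathfrak{h}^{\mathbb{C}})/\mathcal{Z}_{G_0}(\mathfrak{h}^{\mathbb{C}})$ (setwise modulo pointwise stabilizer), acting on $\mathfrak{h}^{\mathbb{C}}$; $\Gamma$ acts on $W$ via its action on $G_0$. For $r\in\mathfrak{h}^{\mathbb{C}}$, $W_r=\{w\in W\mid w\cdot r=r\}$ and $\mathfrak{h}_r^{\mathbb{C},\circ}=\{q\in\mathfrak{h}^{\mathbb{C}}\mid W_q=W_r\}$. Since ${}^\gamma p=p$, the groups $W_p$ and $\mathcal{N}_W(W_p)$ (normalizer in $W$) are $\Gamma$-stable, so $\Gamma$ acts on $\Gamma_p$.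 The group $\Gamma_p$ acts on $\mathcal{F}$ through $\mathcal{N}_W(W_p)$. $\mathcal{N}_{\widehat{G}}(\mathcal{F})=\{g\in\widehat{G}\mid gq\in\mathcal{F}\text{ for all }q\in\mathcal{F}\}$. The map $\varphi:\mathcal{N}_{\widehat{G}}(\mathcal{F})\to\Gamma_p$ is defined by: for $g\in\mathcal{N}_{\widehat{G}}(\mathcal{F})$ there is a $w\in\mathcal{N}_W(W_p)$ with $w\cdot p=g\cdot p$, and $\varphi(g)=wW_p$ (well defined, a group homomorphism). Galois cohomology: for a group $\mathcal{G}$ on which $\Gamma$ acts by automorphisms, a cocycle is $g\in\mathcal{G}$ with $g\,{}^\gamma g=1$; cocycles $g_1,g_2$ are equivalent if $g_1=h^{-1}g_2\,{}^\gamma h$ for some $h\in\mathcal{G}$; $\mathrm{H}^1\mathcal{G}$ is the set of equivalence classes $[g]$. $\mathrm{H}^1\widehat{G}=1$ means every cocycle in $\widehat{G}$ is equivalent to $1$ (so the $g_i$ exist). *)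

theory Defs
  imports "HOL-Analysis.Analysis" "HOL-Algebra.Group_Action"
begin

section \<open>Affine algebraic groups over the complex numbers\<close>

text \<open>
  An affine variety is a set \<open>X\<close> together with its algebra of regular functions, a finitely
  generated algebra of complex functions on \<open>X\<close> all of whose characters are the evaluations
  at a unique point of \<open>X\<close> (Nullstellensatz). Functions are extensional: they take the value
  \<open>undefined\<close> outside \<open>X\<close>.
\<close>

inductive_set function_algebra :: "'g set \<Rightarrow> ('g \<Rightarrow> complex) set \<Rightarrow> ('g \<Rightarrow> complex) set"
  for X :: "'g set" and S :: "('g \<Rightarrow> complex) set"
where
  generator: "f \<in> S \<Longrightarrow> restrict f X \<in> function_algebra X S"
| const: "(\<lambda>x\<in>X. c) \<in> function_algebra X S"
| add: "f \<in> function_algebra X S \<Longrightarrow> g \<in> function_algebra X S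
         \<Longrightarrow> (\<lambda>x\<in>X. f x + g x) \<in> function_algebra X S"
| mult: "f \<in> function_algebra X S \<Longrightarrow> g \<in> function_algebra X S
         \<Longrightarrow> (\<lambda>x\<in>X. f x * g x) \<in> function_algebra X S"

definition character ::
    "'g set \<Rightarrow> ('g \<Rightarrow> complex) set \<Rightarrow> (('g \<Rightarrow> complex) \<Rightarrow> complex) \<Rightarrow> bool" where
  "character X R ev \<longleftrightarrow>
     (\<forall>c. ev (\<lambda>x\<in>X. c) = c) \<and>
     (\<forall>f\<in>R. \<forall>g\<in>R. ev (\<lambda>x\<in>X. f x + g x) = ev f + ev g) \<and>
     (\<forall>f\<in>R. \<forall>g\<in>R. ev (\<lambda>x\<in>X. f x * g x) = ev f * ev g)"

definition affine_variety :: "'g set \<Rightarrow> ('g \<Rightarrow> complex) set \<Rightarrow> bool" where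
  "affine_variety X R \<longleftrightarrow>
     (\<exists>S. finite S \<and> R = function_algebra X S) \<and>
     (\<forall>ev. character X R ev \<longrightarrow> (\<exists>!x. x \<in> X \<and> (\<forall>f\<in>R. ev f = f x)))"

definition zariski :: "'g set \<Rightarrow> ('g \<Rightarrow> complex) set \<Rightarrow> 'g topology" where
  "zariski X R = topology_generated_by {{x \<in> X. f x \<noteq> 0} | f. f \<in> R}"

record 'g alg_group = "'g monoid" +
  regular :: "('g \<Rightarrow> complex) set"

abbreviation group_topology :: "'g alg_group \<Rightarrow> 'g topology" where
  "group_topology G \<equiv> zariski (carrier G) (regular G)"

text \<open>
  Regularity of the multiplication says that \<open>(x, y) \<mapsto> f (x y)\<close> lies in the tensor square
  of the algebra of regular functions, which is the algebra of regular functions on the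
  product variety.
\<close>

definition algebraic_group :: "'g alg_group \<Rightarrow> bool" where
  "algebraic_group G \<longleftrightarrow>
     group G \<and> affine_variety (carrier G) (regular G) \<and>
     (\<forall>f\<in>regular G. \<exists>(n::nat) a b.
        (\<forall>k<n. a k \<in> regular G \<and> b k \<in> regular G) \<and>
        (\<forall>x\<in>carrier G. \<forall>y\<in>carrier G. f (x \<otimes>\<^bsub>G\<^esub> y) = (\<Sum>k<n. a k x * b k y))) \<and>
     (\<forall>f\<in>regular G. (\<lambda>x\<in>carrier G. f (inv\<^bsub>G\<^esub> x)) \<in> regular G)"

definition connected_closed_subgroup :: "'g set \<Rightarrow> 'g alg_group \<Rightarrow> bool" where
  "connected_closed_subgroup H G \<longleftrightarrow>
     subgroup H G \<and> closedin (group_topology G) H \<and> connectedin (group_topology G) H"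

text \<open>
  An element is unipotent if right translation by it is locally unipotent on the algebra of
  regular functions.
\<close>

definition unipotent_element :: "'g alg_group \<Rightarrow> 'g \<Rightarrow> bool" where
  "unipotent_element G u \<longleftrightarrow>
     (\<forall>f\<in>regular G. \<exists>n. ((\<lambda>f. \<lambda>x\<in>carrier G. f (x \<otimes>\<^bsub>G\<^esub> u) - f x) ^^ n) f = (\<lambda>x\<in>carrier G. 0))"

text \<open>Reductive means trivial unipotent radical; connectedness is not required.\<close>

definition reductive_group :: "'g alg_group \<Rightarrow> bool" where
  "reductive_group G \<longleftrightarrow>
     algebraic_group G \<and>
     (\<forall>U. connected_closed_subgroup U G \<and> U \<lhd> G \<and> (\<forall>u\<in>U. unipotent_element G u)
        \<longrightarrow> U = {\<one>\<^bsub>G\<^esub>})"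

definition antiregular_involution :: "'g alg_group \<Rightarrow> ('g \<Rightarrow> 'g) \<Rightarrow> bool" where
  "antiregular_involution G \<tau> \<longleftrightarrow>
     \<tau> \<in> hom G G \<and> (\<forall>g\<in>carrier G. \<tau> (\<tau> g) = g) \<and>
     (\<forall>f\<in>regular G. (\<lambda>g\<in>carrier G. cnj (f (\<tau> g))) \<in> regular G)"

text \<open>The Lie algebra (as a vector space): the point derivations at the neutral element.\<close>

definition tangent_space :: "'g alg_group \<Rightarrow> (('g \<Rightarrow> complex) \<Rightarrow> complex) set" where
  "tangent_space G = {D \<in> extensional (regular G).
     (\<forall>f\<in>regular G. \<forall>g\<in>regular G. D (\<lambda>x\<in>carrier G. f x + g x) = D f + D g) \<and>
     (\<forall>c. \<forall>f\<in>regular G. D (\<lambda>x\<in>carrier G. c * f x) = c * D f) \<and>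
     (\<forall>f\<in>regular G. \<forall>g\<in>regular G.
        D (\<lambda>x\<in>carrier G. f x * g x) = f \<one>\<^bsub>G\<^esub> * D g + D f * g \<one>\<^bsub>G\<^esub>)}"


section \<open>Groups of linear transformations\<close>

text \<open>
  The regular functions on a closed subgroup of the general linear group are generated by the
  matrix coefficients of \<open>g\<close> and of \<open>g\<inverse>\<close>; as \<open>det (g\<inverse>) = 1 / det g\<close>, this is the usual
  algebra generated by the matrix coefficients of \<open>g\<close> and by \<open>1 / det g\<close>.
\<close>

definition linear_group ::
    "(complex \<Rightarrow> 'a::ab_group_add \<Rightarrow> 'a) \<Rightarrow> ('a \<Rightarrow> 'a) set \<Rightarrow> ('a \<Rightarrow> 'a) alg_group" where
  "linear_group sc H =
     \<lparr>carrier = H, monoid.mult = (\<circ>), one = id,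
      regular = function_algebra H
        ({(\<lambda>g. l (g v)) | l v. Vector_Spaces.linear sc (*) l} \<union>
         {(\<lambda>g. l (inv_into UNIV g v)) | l v. Vector_Spaces.linear sc (*) l})\<rparr>"

text \<open>
  The differential at the neutral element of a rational representation \<open>\<rho>\<close>: the endomorphism
  \<open>A\<close> belonging to the point derivation \<open>D\<close> has the matrix coefficients
  \<open>l (A v) = D (g \<mapsto> l (\<rho> g v))\<close>.
\<close>

definition differential ::
    "(complex \<Rightarrow> 'a::ab_group_add \<Rightarrow> 'a) \<Rightarrow> 'g alg_group \<Rightarrow> ('g \<Rightarrow> 'a \<Rightarrow> 'a)
      \<Rightarrow> (('g \<Rightarrow> complex) \<Rightarrow> complex) \<Rightarrow> 'a \<Rightarrow> 'a" where
  "differential sc G \<rho> D = (\<lambda>v. THE y. \<forall>l. Vector_Spaces.linear sc (*) l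
       \<longrightarrow> l y = D (\<lambda>g\<in>carrier G. l (\<rho> g v)))"

definition lie_algebra_of ::
    "(complex \<Rightarrow> 'a::ab_group_add \<Rightarrow> 'a) \<Rightarrow> ('a \<Rightarrow> 'a) set \<Rightarrow> ('a \<Rightarrow> 'a) set" where
  "lie_algebra_of sc H =
     differential sc (linear_group sc H) (\<lambda>g. g) ` tangent_space (linear_group sc H)"


section \<open>Graded complex semisimple Lie algebras\<close>

locale complex_lie_algebra = vector_space sc
  for sc :: "complex \<Rightarrow> 'a::ab_group_add \<Rightarrow> 'a" +
  fixes bracket :: "'a \<Rightarrow> 'a \<Rightarrow> 'a"
  assumes finite_dimensional: "\<exists>B. finite B \<and> span B = UNIV"
    and linear_bracket_right: "Vector_Spaces.linear sc sc (\<lambda>y. bracket x y)"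
    and linear_bracket_left: "Vector_Spaces.linear sc sc (\<lambda>x. bracket x y)"
    and bracket_self: "bracket x x = 0"
    and jacobi: "bracket x (bracket y z) + bracket y (bracket z x) + bracket z (bracket x y) = 0"
begin

definition lie_ideal :: "'a set \<Rightarrow> bool" where
  "lie_ideal I \<longleftrightarrow> subspace I \<and> (\<forall>x. \<forall>y\<in>I. bracket x y \<in> I)"

definition derived :: "'a set \<Rightarrow> 'a set" where
  "derived I = span {bracket x y | x y. x \<in> I \<and> y \<in> I}"

definition solvable :: "'a set \<Rightarrow> bool" where
  "solvable I \<longleftrightarrow> (\<exists>n. (derived ^^ n) I = {0})"

end

locale semisimple_lie_algebra = complex_lie_algebra +
  assumes semisimple: "lie_ideal I \<Longrightarrow> solvable I \<Longrightarrow> I = {0}"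

text \<open>
  The index set of the grading is \<open>\<nat>\<close>, with components that only depend on the residue class
  modulo \<open>m\<close>; in particular \<open>gr 1 = gr 0\<close> if \<open>m = 1\<close>.
\<close>

locale graded_lie_algebra = semisimple_lie_algebra +
  fixes m :: nat and gr :: "nat \<Rightarrow> 'a set"
  assumes m_pos: "m > 0"
    and gr_mod: "gr (i mod m) = gr i"
    and gr_subspace: "subspace (gr i)"
    and gr_direct_sum: "\<exists>!c. c \<in> (\<Pi>\<^sub>E i\<in>{..<m}. gr i) \<and> x = (\<Sum>i<m. c i)"
    and gr_bracket: "x \<in> gr i \<Longrightarrow> y \<in> gr j \<Longrightarrow> bracket x y \<in> gr (i + j)"

locale graded_lie_algebra_automorphism = graded_lie_algebra +
  fixes \<omega> :: complex and \<theta> :: "'a \<Rightarrow> 'a"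
  assumes primitive_root: "\<omega> ^ k = 1 \<longleftrightarrow> m dvd k"
    and theta_linear: "Vector_Spaces.linear sc sc \<theta>"
    and theta_gr: "x \<in> gr i \<Longrightarrow> \<theta> x = sc (\<omega> ^ i) x"
    and theta_order: "\<theta> ^^ k = id \<longleftrightarrow> m dvd k"

definition lie_automorphisms ::
    "(complex \<Rightarrow> 'a::ab_group_add \<Rightarrow> 'a) \<Rightarrow> ('a \<Rightarrow> 'a \<Rightarrow> 'a) \<Rightarrow> ('a \<Rightarrow> 'a) set" where
  "lie_automorphisms sc bracket =
     {g. Vector_Spaces.linear sc sc g \<and> bij g \<and>
         (\<forall>x y. g (bracket x y) = bracket (g x) (g y))}"

definition adjoint_group ::
    "(complex \<Rightarrow> 'a::ab_group_add \<Rightarrow> 'a) \<Rightarrow> ('a \<Rightarrow> 'a \<Rightarrow> 'a) \<Rightarrow> ('a \<Rightarrow> 'a) set" where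
  "adjoint_group sc bracket =
     connected_component_of_set
       (group_topology (linear_group sc (lie_automorphisms sc bracket))) id"

text \<open>
  A subspace \<open>V\<close> of the Lie algebra is identified with the space \<open>bracket ` V\<close> of the
  endomorphisms \<open>ad x = bracket x\<close>, \<open>x \<in> V\<close>.
\<close>

definition connected_subgroup_with_lie_algebra ::
    "(complex \<Rightarrow> 'a::ab_group_add \<Rightarrow> 'a) \<Rightarrow> ('a \<Rightarrow> 'a \<Rightarrow> 'a) \<Rightarrow> 'a set \<Rightarrow> ('a \<Rightarrow> 'a) set \<Rightarrow> bool" where
  "connected_subgroup_with_lie_algebra sc bracket V H \<longleftrightarrow>
     connected_closed_subgroup H (linear_group sc (adjoint_group sc bracket)) \<and>
     lie_algebra_of sc H = bracket ` V"

definition surjective_morphism_with_lie_algebra_iso ::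
    "(complex \<Rightarrow> 'a::ab_group_add \<Rightarrow> 'a) \<Rightarrow> ('a \<Rightarrow> 'a \<Rightarrow> 'a) \<Rightarrow> 'a set \<Rightarrow> ('a \<Rightarrow> 'a) set
      \<Rightarrow> 'g alg_group \<Rightarrow> ('g \<Rightarrow> 'a \<Rightarrow> 'a) \<Rightarrow> bool" where
  "surjective_morphism_with_lie_algebra_iso sc bracket V H Ghat \<psi> \<longleftrightarrow>
     \<psi> \<in> hom Ghat (linear_group sc H) \<and> \<psi> ` carrier Ghat = H \<and>
     (\<forall>f\<in>regular (linear_group sc H). (\<lambda>g\<in>carrier Ghat. f (\<psi> g)) \<in> regular Ghat) \<and>
     bij_betw (differential sc Ghat \<psi>) (tangent_space Ghat) (bracket ` V)"


section \<open>Real structures\<close>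

definition conjugation ::
    "(complex \<Rightarrow> 'a::ab_group_add \<Rightarrow> 'a) \<Rightarrow> ('a \<Rightarrow> 'a \<Rightarrow> 'a) \<Rightarrow> ('a \<Rightarrow> 'a) \<Rightarrow> bool" where
  "conjugation sc bracket \<sigma> \<longleftrightarrow>
     (\<forall>x y. \<sigma> (x + y) = \<sigma> x + \<sigma> y) \<and> (\<forall>c x. \<sigma> (sc c x) = sc (cnj c) (\<sigma> x)) \<and>
     (\<forall>x. \<sigma> (\<sigma> x) = x) \<and> (\<forall>x y. \<sigma> (bracket x y) = bracket (\<sigma> x) (\<sigma> y))"

definition real_points :: "('a \<Rightarrow> 'a) \<Rightarrow> 'a set \<Rightarrow> 'a set" where
  "real_points \<sigma> V = {x \<in> V. \<sigma> x = x}"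

text \<open>The involution induced by \<open>\<sigma>\<close> on groups of automorphisms.\<close>

definition conj_map :: "('a \<Rightarrow> 'a) \<Rightarrow> ('a \<Rightarrow> 'a) \<Rightarrow> ('a \<Rightarrow> 'a)" where
  "conj_map \<sigma> g = \<sigma> \<circ> g \<circ> \<sigma>"

lemma antiregular_involution_conj_map:
  assumes "conjugation sc bracket \<sigma>"
    and "\<And>g. g \<in> H \<Longrightarrow> bij g" and stable: "\<And>g. g \<in> H \<Longrightarrow> conj_map \<sigma> g \<in> H"
  shows "antiregular_involution (linear_group sc H) (conj_map \<sigma>)"
proof -
  let ?S = "{(\<lambda>g. l (g v)) | l v. Vector_Spaces.linear sc (*) l} \<union>
            {(\<lambda>g. l (inv_into UNIV g v)) | l v. Vector_Spaces.linear sc (*) l}"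
  have s: "\<sigma> (x + y) = \<sigma> x + \<sigma> y" "\<sigma> (sc c x) = sc (cnj c) (\<sigma> x)" "\<sigma> (\<sigma> x) = x" for c x y
    using assms(1) by (auto simp: conjugation_def)
  have lin: "Vector_Spaces.linear sc (*) (\<lambda>x. cnj (l (\<sigma> x)))"
    if "Vector_Spaces.linear sc (*) l" for l
  proof -
    interpret l: Vector_Spaces.linear sc "(*)" l by fact
    show ?thesis by unfold_locales (auto simp: s l.add l.scale)
  qed
  have inv_conj: "inv_into UNIV (conj_map \<sigma> g) v = \<sigma> (inv_into UNIV g (\<sigma> v))" if "bij g" for g v
  proof (rule inv_into_f_eq)
    show "inj (conj_map \<sigma> g)"
      using that s(3) unfolding conj_map_def inj_def bij_def by (metis comp_apply)
    show "conj_map \<sigma> g (\<sigma> (inv_into UNIV g (\<sigma> v))) = v"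
      using that by (simp add: conj_map_def s bij_is_surj surj_f_inv_f)
  qed simp
  have "(\<lambda>g\<in>H. cnj (f (conj_map \<sigma> g))) \<in> function_algebra H ?S"
    if "f \<in> function_algebra H ?S" for f
    using that
  proof induction
    case (generator f)
    then obtain l v where l: "Vector_Spaces.linear sc (*) l"
      and f: "f = (\<lambda>g. l (g v)) \<or> f = (\<lambda>g. l (inv_into UNIV g v))" by blast
    define l' where "l' = (\<lambda>x. cnj (l (\<sigma> x)))"
    have l': "Vector_Spaces.linear sc (*) l'" using lin[OF l] by (simp add: l'_def)
    from f show ?case
    proof
      assume f: "f = (\<lambda>g. l (g v))"
      have eq: "(\<lambda>g\<in>H. cnj (restrict f H (conj_map \<sigma> g))) = restrict (\<lambda>g. l' (g (\<sigma> v))) H"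
        by (rule restrict_ext) (simp add: f l'_def stable, simp add: conj_map_def)
      have "(\<lambda>g. l' (g (\<sigma> v))) \<in> ?S" using l' by blast
      then show ?thesis unfolding eq by (rule function_algebra.generator)
    next
      assume f: "f = (\<lambda>g. l (inv_into UNIV g v))"
      have eq: "(\<lambda>g\<in>H. cnj (restrict f H (conj_map \<sigma> g)))
              = restrict (\<lambda>g. l' (inv_into UNIV g (\<sigma> v))) H"
        by (rule restrict_ext) (simp add: f l'_def stable inv_conj assms(2))
      have "(\<lambda>g. l' (inv_into UNIV g (\<sigma> v))) \<in> ?S" using l' by blast
      then show ?thesis unfolding eq by (rule function_algebra.generator)
    qed
  next
    case (const c)
    have eq: "(\<lambda>g\<in>H. cnj ((\<lambda>x\<in>H. c) (conj_map \<sigma> g))) = (\<lambda>x\<in>H. cnj c)"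
      by (rule restrict_ext) (simp add: stable)
    show ?case unfolding eq by (rule function_algebra.const)
  next
    case (add f g)
    have eq: "(\<lambda>x\<in>H. cnj ((\<lambda>x\<in>H. f x + g x) (conj_map \<sigma> x)))
       = (\<lambda>x\<in>H. (\<lambda>x\<in>H. cnj (f (conj_map \<sigma> x))) x + (\<lambda>x\<in>H. cnj (g (conj_map \<sigma> x))) x)"
      by (rule restrict_ext) (simp add: stable)
    show ?case unfolding eq by (rule function_algebra.add[OF add.IH])
  next
    case (mult f g)
    have eq: "(\<lambda>x\<in>H. cnj ((\<lambda>x\<in>H. f x * g x) (conj_map \<sigma> x)))
       = (\<lambda>x\<in>H. (\<lambda>x\<in>H. cnj (f (conj_map \<sigma> x))) x * (\<lambda>x\<in>H. cnj (g (conj_map \<sigma> x))) x)"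
      by (rule restrict_ext) (simp add: stable)
    show ?case unfolding eq by (rule function_algebra.mult[OF mult.IH])
  qed
  moreover have "conj_map \<sigma> (g \<circ> h) = conj_map \<sigma> g \<circ> conj_map \<sigma> h"
    "conj_map \<sigma> (conj_map \<sigma> g) = g" for g h
    by (auto simp: conj_map_def s fun_eq_iff)
  ultimately show ?thesis
    by (auto simp: antiregular_involution_def linear_group_def hom_def stable)
qed

text \<open>For nilpotent \<open>x\<close> and large \<open>n\<close>, the sum is \<open>exp (ad x)\<close>.\<close>

lemma conj_map_exp:
  assumes "conjugation sc bracket \<sigma>"
  shows "conj_map \<sigma> (\<lambda>v. \<Sum>k<n. sc (1 / fact k) ((bracket x ^^ k) v))
       = (\<lambda>v. \<Sum>k<n. sc (1 / fact k) ((bracket (\<sigma> x) ^^ k) v))"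
proof
  fix v
  have s: "\<sigma> (x + y) = \<sigma> x + \<sigma> y" "\<sigma> (sc c x) = sc (cnj c) (\<sigma> x)" "\<sigma> (\<sigma> x) = x"
    "\<sigma> (bracket x y) = bracket (\<sigma> x) (\<sigma> y)" for c x y
    using assms by (auto simp: conjugation_def)
  have "\<sigma> 0 = 0" using s(1)[of 0 0] by simp
  have pow: "\<sigma> ((bracket x ^^ k) w) = (bracket (\<sigma> x) ^^ k) (\<sigma> w)" for k w
    by (induction k) (auto simp: s)
  have "\<sigma> (sum f A) = (\<Sum>k\<in>A. \<sigma> (f k))" for f and A :: "nat set"
    by (induction A rule: infinite_finite_induct) (auto simp: s \<open>\<sigma> 0 = 0\<close>)
  then show "conj_map \<sigma> (\<lambda>v. \<Sum>k<n. sc (1 / fact k) ((bracket x ^^ k) v)) v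
       = (\<Sum>k<n. sc (1 / fact k) ((bracket (\<sigma> x) ^^ k) v))"
    by (simp add: conj_map_def s pow)
qed


section \<open>Cartan subspaces and Weyl groups\<close>

definition semisimple_endomorphism ::
    "(complex \<Rightarrow> 'a::ab_group_add \<Rightarrow> 'a) \<Rightarrow> ('a \<Rightarrow> 'a) \<Rightarrow> bool" where
  "semisimple_endomorphism sc A \<longleftrightarrow>
     Vector_Spaces.linear sc sc A \<and>
     (\<forall>U. module.subspace sc U \<and> A ` U \<subseteq> U \<longrightarrow>
        (\<exists>U'. module.subspace sc U' \<and> A ` U' \<subseteq> U' \<and>
              U \<inter> U' = {0} \<and> {u + u' | u u'. u \<in> U \<and> u' \<in> U'} = UNIV))"

definition commuting_semisimple ::
    "(complex \<Rightarrow> 'a::ab_group_add \<Rightarrow> 'a) \<Rightarrow> ('a \<Rightarrow> 'a \<Rightarrow> 'a) \<Rightarrow> 'a set \<Rightarrow> bool" where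
  "commuting_semisimple sc bracket S \<longleftrightarrow>
     (\<forall>x\<in>S. semisimple_endomorphism sc (bracket x)) \<and> (\<forall>x\<in>S. \<forall>y\<in>S. bracket x y = 0)"

definition real_subspace :: "(complex \<Rightarrow> 'a::ab_group_add \<Rightarrow> 'a) \<Rightarrow> 'a set \<Rightarrow> bool" where
  "real_subspace sc S \<longleftrightarrow> module.subspace (\<lambda>r. sc (complex_of_real r)) S"

definition real_cartan_subspace ::
    "(complex \<Rightarrow> 'a::ab_group_add \<Rightarrow> 'a) \<Rightarrow> ('a \<Rightarrow> 'a \<Rightarrow> 'a) \<Rightarrow> 'a set \<Rightarrow> 'a set \<Rightarrow> bool" where
  "real_cartan_subspace sc bracket V h \<longleftrightarrow>
     real_subspace sc h \<and> h \<subseteq> V \<and> commuting_semisimple sc bracket h \<and>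
     (\<forall>h'. real_subspace sc h' \<and> h' \<subseteq> V \<and> commuting_semisimple sc bracket h' \<and> h \<subseteq> h'
        \<longrightarrow> h' = h)"

text \<open>The elements of the Weyl group are cosets of the pointwise stabilizer, i.e. sets of maps.\<close>

definition weyl_group :: "('a \<Rightarrow> 'a) set \<Rightarrow> 'a set \<Rightarrow> ('a \<Rightarrow> 'a) set monoid" where
  "weyl_group H V =
     \<lparr>carrier = {g \<in> H. g ` V = V}, monoid.mult = (\<circ>), one = id\<rparr> Mod {g \<in> H. \<forall>x\<in>V. g x = x}"

text \<open>
  The action of a coset \<open>C\<close>, for points on which all elements of \<open>C\<close> agree.
\<close>

definition coset_act :: "('c \<Rightarrow> 'a \<Rightarrow> 'a) \<Rightarrow> 'c set \<Rightarrow> 'a \<Rightarrow> 'a" where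
  "coset_act act C x = the_elem ((\<lambda>c. act c x) ` C)"

abbreviation weyl_act :: "('a \<Rightarrow> 'a) set \<Rightarrow> 'a \<Rightarrow> 'a" where
  "weyl_act \<equiv> coset_act (\<lambda>g x. g x)"

abbreviation weyl_stabilizer :: "('a \<Rightarrow> 'a) set monoid \<Rightarrow> 'a \<Rightarrow> ('a \<Rightarrow> 'a) set set" where
  "weyl_stabilizer W r \<equiv> stabilizer W weyl_act r"

definition stratum :: "('a \<Rightarrow> 'a) set monoid \<Rightarrow> 'a set \<Rightarrow> 'a \<Rightarrow> 'a set" where
  "stratum W V r = {q \<in> V. weyl_stabilizer W q = weyl_stabilizer W r}"

definition conjugate_subgroups :: "('g, 'z) monoid_scheme \<Rightarrow> 'g set \<Rightarrow> 'g set \<Rightarrow> bool" where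
  "conjugate_subgroups G A B \<longleftrightarrow> (\<exists>w\<in>carrier G. A = w <#\<^bsub>G\<^esub> B #>\<^bsub>G\<^esub> inv\<^bsub>G\<^esub> w)"

definition normalizer_quotient :: "('g, 'z) monoid_scheme \<Rightarrow> 'g set \<Rightarrow> 'g set monoid" where
  "normalizer_quotient G H = G\<lparr>carrier := normalizer G H\<rparr> Mod H"

definition set_normalizer :: "'g alg_group \<Rightarrow> ('g \<Rightarrow> 'a \<Rightarrow> 'a) \<Rightarrow> 'a set \<Rightarrow> 'g set" where
  "set_normalizer G act F = {g \<in> carrier G. \<forall>q\<in>F. act g q \<in> F}"

text \<open>
  The map from the normalizer of the stratum of \<open>p\<close> to \<open>normalizer_quotient W W\<^sub>p\<close>; it sends
  \<open>g\<close> to \<open>w W\<^sub>p\<close> for any \<open>w\<close> normalizing \<open>W\<^sub>p\<close> with \<open>w p = g p\<close>. All such \<open>w\<close> lie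
  in the same coset.
\<close>

definition component_map ::
    "('a \<Rightarrow> 'a) set monoid \<Rightarrow> 'a \<Rightarrow> ('g \<Rightarrow> 'a \<Rightarrow> 'a) \<Rightarrow> 'g \<Rightarrow> ('a \<Rightarrow> 'a) set set" where
  "component_map W p act g =
     (THE C. \<exists>w\<in>normalizer W (weyl_stabilizer W p).
        weyl_act w p = act g p \<and> C = w <#\<^bsub>W\<^esub> weyl_stabilizer W p)"


section \<open>Galois cohomology of the group of order two\<close>

definition cocycles :: "('g, 'z) monoid_scheme \<Rightarrow> ('g \<Rightarrow> 'g) \<Rightarrow> 'g set" where
  "cocycles G \<tau> = {g \<in> carrier G. g \<otimes>\<^bsub>G\<^esub> \<tau> g = \<one>\<^bsub>G\<^esub>}"

definition cohomology_class :: "('g, 'z) monoid_scheme \<Rightarrow> ('g \<Rightarrow> 'g) \<Rightarrow> 'g \<Rightarrow> 'g set" where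
  "cohomology_class G \<tau> g =
     {g' \<in> cocycles G \<tau>. \<exists>h\<in>carrier G. g' = inv\<^bsub>G\<^esub> h \<otimes>\<^bsub>G\<^esub> g \<otimes>\<^bsub>G\<^esub> \<tau> h}"

definition H1 :: "('g, 'z) monoid_scheme \<Rightarrow> ('g \<Rightarrow> 'g) \<Rightarrow> 'g set set" where
  "H1 G \<tau> = cohomology_class G \<tau> ` cocycles G \<tau>"

end

theory Submission
  imports Defs "HOL-Complex_Analysis.Complex_Analysis" "HOL-Computational_Algebra.Fundamental_Theorem_Algebra"
    "HOL-Algebra.Zassenhaus"
begin

text \<open>
  A real point \<open>\<psi> k q\<close> of the orbit shows that \<open>q\<close> and its conjugate are \<open>G0\<close>-conjugate elements of the
  Cartan subspace, hence conjugate by some \<open>w\<close> in the Weyl group (Vinberg). The class of \<open>w\<close> modulo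
  \<open>W\<^sub>p\<close> is a cocycle, and a coboundary turning its inverse into some \<open>\<delta>\<^sub>i\<close> moves \<open>q\<close> to the required
  \<open>q'\<close>. Conversely \<open>n\<^sub>i\<close> acts on the whole stratum as \<open>\<delta>\<^sub>i\<close>, so that \<open>g\<^sub>i q'\<close> is real.

  For Vinberg's theorem, the element \<open>q'\<close> is fixed and one works in its centralizer. By a contraction
  argument all elements of degree 1 near a given one \<open>y\<close> are conjugate to elements of the null space
  of \<open>ad y\<close>; hence along a line the null spaces of minimal dimension are conjugate, as the regular
  points of a complex line form a connected set. That \<open>G0\<close> respects the grading and contains the
  exponentials of \<open>ad (gr 0)\<close> is deduced from its Zariski topology by Krull's intersection theorem and
  from the one-parameter groups in a closed linear group.
\<close>

section \<open>Linear algebra\<close>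

text \<open>\<open>G0\<close> is known only through its Zariski topology and its point derivations.
  Passing from infinitesimal to global invariance is therefore done algebraically: a derivation that
  is the identity on the cotangent space at the identity forces functions into all powers of the
  maximal ideal.

  The Cartan subspace is maximal among real subspaces only. Its complex span is recovered as the set
  of semisimple degree-one elements of its centralizer, which requires the Jordan decomposition
  inside \<open>gr 1\<close>; this is why the Killing form and inner derivations appear. Null spaces
  of \<open>bracket y\<close> take the place of Cartan subspaces in the conjugacy argument because
  their dimension is semicontinuous; the Cartan subspace is read off from them at the end.

  The map \<open>\<phi>\<close> only sees the image of \<open>p\<close>. That \<open>n i\<close>
  acts as \<open>\<delta> i\<close> on all of \<open>F\<close> is a rigidity statement: an element
  of \<open>G0\<close> that fixes \<open>p\<close> and preserves the stratum fixes it pointwise. It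
  rests on the finiteness of the Weyl group.\<close>

locale fd_space = finite_dimensional_vector_space sc Basis
  for sc :: "complex \<Rightarrow> 'a::ab_group_add \<Rightarrow> 'a" and Basis :: "'a set"
begin

sublocale endo: finite_dimensional_vector_space_pair sc Basis sc Basis ..

sublocale functional: finite_dimensional_vector_space_pair_1 sc Basis "(*) :: complex \<Rightarrow> _" ..

abbreviation endo :: "('a \<Rightarrow> 'a) \<Rightarrow> bool" where
  "endo \<equiv> Vector_Spaces.linear sc sc"

abbreviation functional :: "('a \<Rightarrow> complex) \<Rightarrow> bool" where
  "functional \<equiv> Vector_Spaces.linear sc (*)"

lemma endoI:
  assumes "\<And>x y. f (x + y) = f x + f y" "\<And>c x. f (sc c x) = sc c (f x)"
  shows "endo f"
  by unfold_locales (use assms in auto)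

lemma functionalI:
  assumes "\<And>x y. f (x + y) = f x + f y" "\<And>c x. f (sc c x) = c * f x"
  shows "functional f"
  by unfold_locales (use assms in auto)

lemmas endo_simps = endo.linear_add endo.linear_scale endo.linear_diff endo.linear_neg endo.linear_0
  endo.linear_sum
lemmas functional_simps = functional.linear_add functional.linear_scale functional.linear_diff
  functional.linear_neg functional.linear_0 functional.linear_sum

lemma endo_funpow: "endo f \<Longrightarrow> endo (f ^^ k)"
proof (induction k)
  case 0
  show ?case by (simp add: endoI)
next
  case (Suc k)
  then show ?case by (intro endoI) (simp_all add: endo_simps)
qed

lemma endo_comp: "endo f \<Longrightarrow> endo g \<Longrightarrow> endo (\<lambda>x. f (g x))"
  by (intro endoI) (simp_all add: endo_simps)

lemma functional_comp: "functional l \<Longrightarrow> endo g \<Longrightarrow> functional (\<lambda>x. l (g x))"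
  by (intro functionalI) (simp_all add: endo_simps functional_simps)

lemma endo_eqI:
  assumes "endo f" "endo g" "span S = UNIV" "\<And>x. x \<in> S \<Longrightarrow> f x = g x"
  shows "f = g"
proof
  fix x
  have "x \<in> span S" using assms(3) by simp
  then show "f x = g x" using assms(1,2,4) endo.linear_eq_on by blast
qed

lemma subspace_kernel_endo: "endo f \<Longrightarrow> subspace {x. f x = 0}"
  by (auto intro!: subspaceI simp: endo_simps)

section \<open>Generalized eigenspaces and their decomposition\<close>

definition shift :: "('a \<Rightarrow> 'a) \<Rightarrow> complex \<Rightarrow> 'a \<Rightarrow> 'a" where
  "shift A \<mu> x = A x - sc \<mu> x"

definition gen_eigenspace :: "('a \<Rightarrow> 'a) \<Rightarrow> complex \<Rightarrow> 'a set" where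
  "gen_eigenspace A \<mu> = {v. \<exists>k. (shift A \<mu> ^^ k) v = 0}"

lemma endo_shift: "endo A \<Longrightarrow> endo (shift A \<mu>)"
  by (intro endoI) (simp_all add: shift_def endo_simps algebra_simps scale_right_distrib scale_right_diff_distrib)

lemma shift_0 [simp]: "shift A 0 = A"
  by (simp add: shift_def fun_eq_iff)

lemma gen_eigenspaceI: "(shift A \<mu> ^^ k) v = 0 \<Longrightarrow> v \<in> gen_eigenspace A \<mu>"
  by (auto simp: gen_eigenspace_def)

lemma funpow_0_mono:
  assumes "endo f" "(f ^^ k) v = 0" "k \<le> n"
  shows "(f ^^ n) v = 0"
proof -
  have "(f ^^ n) v = (f ^^ (n - k)) ((f ^^ k) v)"
    using assms(3) by (metis funpow_add le_add_diff_inverse2 o_apply)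
  then show ?thesis using assms by (simp add: endo_funpow endo_simps)
qed

lemma subspace_gen_eigenspace:
  assumes "endo A" shows "subspace (gen_eigenspace A \<mu>)"
proof (rule subspaceI)
  let ?f = "shift A \<mu>"
  have f: "endo ?f" "endo (?f ^^ k)" for k using assms by (simp_all add: endo_shift endo_funpow)
  show "0 \<in> gen_eigenspace A \<mu>" by (rule gen_eigenspaceI[where k = 0]) simp
  fix x y assume "x \<in> gen_eigenspace A \<mu>" "y \<in> gen_eigenspace A \<mu>"
  then obtain k j where "(?f ^^ k) x = 0" "(?f ^^ j) y = 0" by (auto simp: gen_eigenspace_def)
  then have "(?f ^^ (k + j)) x = 0" "(?f ^^ (k + j)) y = 0"
    using funpow_0_mono[OF f(1)] by (meson le_add1 le_add2)+
  then have "(?f ^^ (k + j)) (x + y) = 0" by (simp add: endo_simps f(2))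
  then show "x + y \<in> gen_eigenspace A \<mu>" by (rule gen_eigenspaceI)
next
  fix c x assume "x \<in> gen_eigenspace A \<mu>"
  then show "sc c x \<in> gen_eigenspace A \<mu>"
    using assms by (auto simp: gen_eigenspace_def endo_simps endo_funpow endo_shift)
qed

lemma funpow_commute:
  assumes "\<And>x. B (f x) = f (B x)" shows "B ((f ^^ k) x) = (f ^^ k) (B x)"
  by (induction k) (simp_all add: assms)

lemma gen_eigenspace_commute:
  assumes "endo A" "endo B" "\<And>x. B (A x) = A (B x)" "v \<in> gen_eigenspace A \<mu>"
  shows "B v \<in> gen_eigenspace A \<mu>"
proof -
  have "B (shift A \<mu> x) = shift A \<mu> (B x)" for x by (simp add: shift_def endo_simps assms)
  from funpow_commute[of B "shift A \<mu>", OF this] show ?thesis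
    using assms by (auto simp: gen_eigenspace_def) (metis endo.linear_0)
qed

lemma shift_in_gen: "endo A \<Longrightarrow> v \<in> gen_eigenspace A \<mu> \<Longrightarrow> shift A \<nu> v \<in> gen_eigenspace A \<mu>"
  by (rule gen_eigenspace_commute[where B = "shift A \<nu>"])
     (simp_all add: endo_shift, simp add: shift_def endo_simps)

lemma shift_commute: "endo A \<Longrightarrow> shift A \<nu> (shift A \<mu> x) = shift A \<mu> (shift A \<nu> x)"
  by (simp add: shift_def endo_simps scale_right_diff_distrib algebra_simps scale_left_commute)

lemma shift_diff: "shift A \<nu> w - shift A \<mu> w = sc (\<mu> - \<nu>) w"
  by (simp add: shift_def scale_left_diff_distrib)

text \<open>On this space \<open>shift A \<nu>\<close> is the nonzero scalar \<mu> - \<nu> plus a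
  nilpotent map. The induction on the nilpotency exponent builds its inverse: if u is a preimage of
  \<open>shift A \<mu> v\<close>, then v - u, divided by \<mu> - \<nu>, is a preimage of v.\<close>

lemma shift_surj_gen:
  assumes A: "endo A" and "v \<in> gen_eigenspace A \<mu>" "\<nu> \<noteq> \<mu>"
  shows "\<exists>u\<in>gen_eigenspace A \<mu>. shift A \<nu> u = v"
proof -
  have "\<exists>u\<in>gen_eigenspace A \<mu>. shift A \<nu> u = v" if "(shift A \<mu> ^^ k) v = 0" for k v
    using that
  proof (induction k arbitrary: v)
    case 0
    then show ?case
      using endo_shift[OF A] subspace_gen_eigenspace[OF A] by (intro bexI[of _ 0]) (auto simp: endo_simps subspace_0)
  next
    case (Suc k)
    then have "(shift A \<mu> ^^ k) (shift A \<mu> v) = 0" by (simp add: funpow_swap1)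
    then obtain u where u: "u \<in> gen_eigenspace A \<mu>" "shift A \<nu> u = shift A \<mu> v" using Suc.IH by blast
    have v: "v \<in> gen_eigenspace A \<mu>" using Suc.prems by (rule gen_eigenspaceI)
    have "shift A \<nu> (v - u) = sc (\<mu> - \<nu>) v"
      using u(2) shift_diff[of A \<nu> v \<mu>] by (simp add: endo_simps endo_shift[OF A])
    then have "shift A \<nu> (sc (1 / (\<mu> - \<nu>)) (v - u)) = v"
      using \<open>\<nu> \<noteq> \<mu>\<close> by (simp add: endo.linear_scale[OF endo_shift[OF A]])
    moreover have "sc (1 / (\<mu> - \<nu>)) (v - u) \<in> gen_eigenspace A \<mu>"
      using u v subspace_gen_eigenspace[OF A] by (simp add: subspace_scale subspace_diff)
    ultimately show ?case by blast
  qed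
  then show ?thesis using assms(2) by (auto simp: gen_eigenspace_def)
qed

definition poly_endo :: "complex poly \<Rightarrow> ('a \<Rightarrow> 'a) \<Rightarrow> 'a \<Rightarrow> 'a" where
  "poly_endo p A v = (\<Sum>i\<le>degree p. sc (coeff p i) ((A ^^ i) v))"

lemma poly_endo_eq:
  assumes "degree p \<le> n" shows "poly_endo p A v = (\<Sum>i\<le>n. sc (coeff p i) ((A ^^ i) v))"
  unfolding poly_endo_def using assms
  by (intro sum.mono_neutral_left) (auto simp: coeff_eq_0)

lemma poly_endo_linear_factor:
  assumes "endo A"
  shows "poly_endo ([:-\<mu>, 1:] * q) A v = poly_endo q A (shift A \<mu> v)"
proof -
  let ?n = "Suc (degree q)"
  have pA: "(A ^^ i) (shift A \<mu> v) = (A ^^ Suc i) v - sc \<mu> ((A ^^ i) v)" for i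
    using endo_funpow[OF assms, of i] by (simp add: shift_def endo_simps funpow_swap1)
  have "degree ([:-\<mu>, 1:] * q) \<le> ?n"
    by (rule order_trans[OF degree_mult_le]) simp
  then have "poly_endo ([:-\<mu>, 1:] * q) A v = (\<Sum>i\<le>?n. sc (coeff ([:-\<mu>, 1:] * q) i) ((A ^^ i) v))"
    by (rule poly_endo_eq)
  also have "\<dots> = (\<Sum>i\<le>?n. sc (coeff (pCons 0 q) i) ((A ^^ i) v)) - (\<Sum>i\<le>?n. sc (\<mu> * coeff q i) ((A ^^ i) v))"
    unfolding sum_subtractf[symmetric]
    by (rule sum.cong) (simp_all add: mult_pCons_left scale_left_diff_distrib[symmetric])
  also have "(\<Sum>i\<le>?n. sc (coeff (pCons 0 q) i) ((A ^^ i) v)) = (\<Sum>i\<le>degree q. sc (coeff q i) ((A ^^ Suc i) v))"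
    by (subst sum.atMost_Suc_shift) simp
  also have "(\<Sum>i\<le>?n. sc (\<mu> * coeff q i) ((A ^^ i) v)) = (\<Sum>i\<le>degree q. sc (\<mu> * coeff q i) ((A ^^ i) v))"
    by (simp add: coeff_eq_0)
  finally show ?thesis
    unfolding poly_endo_def[of q] pA
    by (simp add: scale_right_diff_distrib sum_subtractf mult.commute)
qed

text \<open>The predicate \<open>dependent\<close> speaks of sets and overlooks repetitions, so a
  sequence with two equal members is treated apart, with the coefficients 1 and -1.\<close>

lemma sequence_dependent:
  fixes w :: "nat \<Rightarrow> 'a"
  shows "\<exists>c. (\<exists>i\<le>card Basis. c i \<noteq> 0) \<and> (\<Sum>i\<le>card Basis. sc (c i) (w i)) = 0"
proof (cases "inj_on w {..card Basis}")
  case True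
  then have "card (w ` {..card Basis}) > card Basis" by (simp add: card_image)
  then have "dependent (w ` {..card Basis})"
    using independent_card_le_dim[of "w ` {..card Basis}" UNIV] by force
  then obtain u where u: "\<exists>v\<in>w ` {..card Basis}. u v \<noteq> 0" "(\<Sum>v\<in>w ` {..card Basis}. sc (u v) v) = 0"
    using dependent_finite[of "w ` {..card Basis}"] by auto
  then have "(\<Sum>i\<le>card Basis. sc (u (w i)) (w i)) = 0"
    by (simp add: sum.reindex[OF True])
  with u(1) show ?thesis by (intro exI[of _ "\<lambda>i. u (w i)"]) auto
next
  case False
  then obtain i j where ij: "i \<le> card Basis" "j \<le> card Basis" "i \<noteq> j" "w i = w j"
    by (auto simp: inj_on_def)
  define c where "c k = (if k = i then 1 else if k = j then - 1 else (0::complex))" for k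
  have "(\<Sum>k\<le>card Basis. sc (c k) (w k)) = (\<Sum>k\<in>{i, j}. sc (c k) (w k))"
    using ij by (intro sum.mono_neutral_right) (auto simp: c_def)
  also have "\<dots> = 0" using ij by (simp add: c_def)
  finally show ?thesis using ij by (intro exI[of _ c]) (auto simp: c_def)
qed

text \<open>The iterates of v up to the dimension are one too many to be independent. The polynomial
  depends on v, which suffices below, where vectors are decomposed one by one.\<close>

lemma poly_endo_annihilates:
  "\<exists>p. p \<noteq> 0 \<and> poly_endo p A v = 0"
proof -
  let ?n = "card Basis"
  obtain c where c: "\<exists>i\<le>?n. c i \<noteq> 0" "(\<Sum>i\<le>?n. sc (c i) ((A ^^ i) v)) = 0"
    using sequence_dependent[of "\<lambda>i. (A ^^ i) v"] by blast
  define p where "p = (\<Sum>i\<le>?n. monom (c i) i)"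
  have co: "coeff p i = (if i \<le> ?n then c i else 0)" for i
    by (simp add: p_def coeff_sum)
  then have "p \<noteq> 0" using c(1) by (metis coeff_0)
  moreover have "degree p \<le> ?n" by (rule degree_le) (simp add: co)
  then have "poly_endo p A v = 0" by (simp add: poly_endo_eq co c(2))
  ultimately show ?thesis by blast
qed

text \<open>The linear factors of an annihilating polynomial of v are removed one at a time; what
  has to be shown is that v lies in the span as soon as \<open>shift A \<nu> v\<close> does.\<close>

lemma span_gen_eigenspaces:
  assumes A: "endo A" shows "span (\<Union>\<mu>. gen_eigenspace A \<mu>) = UNIV"
proof -
  let ?S = "span (\<Union>\<mu>. gen_eigenspace A \<mu>)"
  have gS: "v \<in> ?S" if "v \<in> gen_eigenspace A \<mu>" for v \<mu> using that by (blast intro: span_base)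
  have step: "v \<in> ?S" if sv: "shift A \<nu> v \<in> ?S" for v \<nu>
  proof -
    \<comment> \<open>\<open>shift A \<nu>\<close> is onto every generalized eigenspace but its own.
      Hence every w in the span is an image up to some g belonging to \<nu>, and subtracting the
      preimage from v leaves an element of \<open>gen_eigenspace A \<nu>\<close>.\<close>
    have ex: "\<exists>x g. x \<in> ?S \<and> g \<in> gen_eigenspace A \<nu> \<and> w = shift A \<nu> x + g" if "w \<in> ?S" for w
      using that
    proof (induction rule: span_induct_alt)
      case base
      then show ?case
        using endo_shift[OF A] subspace_gen_eigenspace[OF A]
        by (intro exI[of _ 0]) (auto simp: endo_simps subspace_0 span_zero)
    next
      case (step c x y)
      then obtain x' g where y: "x' \<in> ?S" "g \<in> gen_eigenspace A \<nu>" "y = shift A \<nu> x' + g" by blast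
      obtain \<mu> where \<mu>: "x \<in> gen_eigenspace A \<mu>" using step by blast
      show ?case
      proof (cases "\<mu> = \<nu>")
        case True
        then have "sc c x + g \<in> gen_eigenspace A \<nu>"
          using \<mu> y subspace_gen_eigenspace[OF A] by (simp add: subspace_add subspace_scale)
        then show ?thesis using y by (intro exI[of _ x'] exI[of _ "sc c x + g"]) (simp add: algebra_simps)
      next
        case False
        then obtain u where u: "u \<in> gen_eigenspace A \<mu>" "shift A \<nu> u = x"
          using shift_surj_gen[OF A \<mu>] by metis
        then have "sc c u + x' \<in> ?S" using y gS by (simp add: span_add span_scale)
        moreover have "sc c x + y = shift A \<nu> (sc c u + x') + g"
          using u y by (simp add: endo_simps endo_shift[OF A])
        ultimately show ?thesis using y by blast
      qed
    qed
    then obtain x g where xg: "x \<in> ?S" "g \<in> gen_eigenspace A \<nu>" "shift A \<nu> v = shift A \<nu> x + g"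
      using ex[OF sv] by blast
    then have "shift A \<nu> (v - x) \<in> gen_eigenspace A \<nu>" by (simp add: endo_simps endo_shift[OF A])
    then obtain k where "(shift A \<nu> ^^ k) (shift A \<nu> (v - x)) = 0" by (auto simp: gen_eigenspace_def)
    then have "(shift A \<nu> ^^ Suc k) (v - x) = 0" by (simp add: funpow_swap1)
    then have "v - x \<in> ?S" using gS gen_eigenspaceI by metis
    from span_add[OF this xg(1)] show ?thesis by simp
  qed
  have "v \<in> ?S" if "p \<noteq> 0" "poly_endo p A v = 0" "degree p = n" for p v n
    using that
  proof (induction n arbitrary: p v)
    case 0
    then obtain c where "p = [:c:]" "c \<noteq> 0" by (metis degree_eq_zeroE pCons_0_0)
    then have "v = 0" using 0 by (simp add: poly_endo_def)
    then show ?case by (simp add: span_zero)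
  next
    case (Suc n)
    then obtain \<mu> where "poly p \<mu> = 0" using alg_closed_imp_poly_has_root[of p] by auto
    then obtain q where q: "p = [:-\<mu>, 1:] * q" by (meson dvdE poly_eq_0_iff_dvd)
    then have "q \<noteq> 0" using Suc by auto
    have "degree p = degree [:-\<mu>, 1:] + degree q" unfolding q using \<open>q \<noteq> 0\<close> by (intro degree_mult_eq) auto
    then have "degree q = n" using Suc.prems by simp
    moreover have "poly_endo q A (shift A \<mu> v) = 0"
      using Suc q poly_endo_linear_factor[OF A] by metis
    ultimately have "shift A \<mu> v \<in> ?S" using Suc.IH \<open>q \<noteq> 0\<close> by blast
    then show ?case by (rule step)
  qed
  then show ?thesis using poly_endo_annihilates[of A] by blast
qed

text \<open>The vectors \<open>shift A \<nu> v\<close> and \<open>shift A \<mu> v\<close> differ by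
  a nonzero multiple of v, and the second lies in U by induction on the nilpotency exponent.\<close>

lemma in_subspace_if_shift_in:
  assumes A: "endo A" and U: "subspace U" "A ` U \<subseteq> U"
    and "v \<in> gen_eigenspace A \<mu>" "shift A \<nu> v \<in> U" "\<nu> \<noteq> \<mu>"
  shows "v \<in> U"
proof -
  have inv: "shift A \<kappa> u \<in> U" if "u \<in> U" for u \<kappa>
    using U that by (auto simp: shift_def subspace_diff subspace_scale)
  have "v \<in> U" if "(shift A \<mu> ^^ k) v = 0" "shift A \<nu> v \<in> U" for k v
    using that
  proof (induction k arbitrary: v)
    case 0
    then show ?case using U by (simp add: subspace_0)
  next
    case (Suc k)
    have "shift A \<nu> (shift A \<mu> v) \<in> U" using inv[OF Suc.prems(2)] shift_commute[OF A] by metis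
    then have "shift A \<mu> v \<in> U" using Suc by (simp add: funpow_swap1)
    then have "sc (\<mu> - \<nu>) v \<in> U" using shift_diff[of A \<nu> v \<mu>] Suc.prems U subspace_diff by metis
    then have "sc (1 / (\<mu> - \<nu>)) (sc (\<mu> - \<nu>) v) \<in> U" by (rule subspace_scale[OF U(1)])
    moreover have "sc (1 / (\<mu> - \<nu>)) (sc (\<mu> - \<nu>) v) = v" using assms(6) by simp
    ultimately show ?case by (simp only:)
  qed
  then show ?thesis using assms by (auto simp: gen_eigenspace_def)
qed

lemma in_subspace_if_shift_pow_in:
  assumes A: "endo A" and U: "subspace U" "A ` U \<subseteq> U"
    and "v \<in> gen_eigenspace A \<mu>" "(shift A \<nu> ^^ k) v \<in> U" "\<nu> \<noteq> \<mu>"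
  shows "v \<in> U"
  using assms(4,5)
proof (induction k arbitrary: v)
  case (Suc k)
  then have "shift A \<nu> v \<in> U" using Suc.IH[of "shift A \<nu> v"] shift_in_gen[OF A] by (simp add: funpow_swap1)
  then show ?case using in_subspace_if_shift_in[OF A U Suc.prems(1) _ assms(6)] by blast
qed simp

text \<open>A power of \<open>shift A \<nu>\<close> kills the component at \<nu>, which shortens the
  sum, and it can be undone on the other components by the preceding lemma. The case U = {0} is the
  independence of the generalized eigenspaces.\<close>

lemma components_in_subspace:
  assumes A: "endo A" and U: "subspace U" "A ` U \<subseteq> U" and "finite M"
    and "\<And>\<mu>. \<mu> \<in> M \<Longrightarrow> v \<mu> \<in> gen_eigenspace A \<mu>" "(\<Sum>\<mu>\<in>M. v \<mu>) \<in> U" "\<mu> \<in> M"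
  shows "v \<mu> \<in> U"
  using assms(4-7)
proof (induction M arbitrary: v \<mu> rule: finite_induct)
  case (insert \<nu> M)
  then obtain k where k: "(shift A \<nu> ^^ k) (v \<nu>) = 0" unfolding gen_eigenspace_def by blast
  let ?f = "shift A \<nu> ^^ k"
  have f: "endo ?f" using A by (simp add: endo_shift endo_funpow)
  have fU: "?f u \<in> U" if "u \<in> U" for u
    using that by (induction k) (use U in \<open>auto simp: shift_def intro!: subspace_diff subspace_scale\<close>)
  have fg: "?f u \<in> gen_eigenspace A \<kappa>" if "u \<in> gen_eigenspace A \<kappa>" for u \<kappa>
    using that by (induction k) (auto intro: shift_in_gen[OF A])
  have "?f (\<Sum>\<mu>\<in>insert \<nu> M. v \<mu>) = (\<Sum>\<mu>\<in>M. ?f (v \<mu>))"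
    using insert(1,2) k by (simp add: endo_simps f)
  then have "(\<Sum>\<mu>\<in>M. ?f (v \<mu>)) \<in> U" using fU[OF insert.prems(2)] by simp
  then have *: "?f (v \<kappa>) \<in> U" if "\<kappa> \<in> M" for \<kappa>
    using that insert.prems(1) by (intro insert.IH[of "\<lambda>\<mu>. ?f (v \<mu>)"]) (auto intro: fg)
  have M: "v \<kappa> \<in> U" if "\<kappa> \<in> M" for \<kappa>
  proof (rule in_subspace_if_shift_pow_in[OF A U _ *[OF that]])
    show "v \<kappa> \<in> gen_eigenspace A \<kappa>" using that insert.prems(1) by blast
    show "\<nu> \<noteq> \<kappa>" using that insert(2) by blast
  qed
  show ?case
  proof (cases "\<mu> = \<nu>")
    case True
    have "(\<Sum>\<mu>\<in>insert \<nu> M. v \<mu>) - (\<Sum>\<mu>\<in>M. v \<mu>) \<in> U"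
      by (rule subspace_diff[OF U(1) insert.prems(2) subspace_sum[OF U(1) M]])
    then show ?thesis using True insert(1,2) by simp
  qed (use M insert.prems in blast)
qed simp

lemma gen_eigenspace_component:
  assumes A: "endo A" and "finite M" "\<And>\<mu>. \<mu> \<in> M \<Longrightarrow> v \<mu> \<in> gen_eigenspace A \<mu>"
    "(\<Sum>\<mu>\<in>M. v \<mu>) = 0" "\<mu> \<in> M"
  shows "v \<mu> = 0"
  using components_in_subspace[OF A _ _ assms(2,3), of "{0}" \<mu>] assms
  by (auto simp: subspace_single_0 endo_simps)

lemma gen_decomposition:
  assumes A: "endo A"
  obtains M x where "finite M" "\<And>\<mu>. \<mu> \<in> M \<Longrightarrow> x \<mu> \<in> gen_eigenspace A \<mu>" "v = (\<Sum>\<mu>\<in>M. x \<mu>)"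
proof -
  have "v \<in> span (\<Union>\<mu>. gen_eigenspace A \<mu>)" by (simp add: span_gen_eigenspaces[OF A])
  then have "\<exists>M x. finite M \<and> (\<forall>\<mu>\<in>M. x \<mu> \<in> gen_eigenspace A \<mu>) \<and> v = (\<Sum>\<mu>\<in>M. x \<mu>)"
  proof (induction rule: span_induct_alt)
    case base
    show ?case by (intro exI[of _ "{}"]) auto
  next
    case (step c w y)
    then obtain M x \<nu> where Mx: "finite M" "\<forall>\<mu>\<in>M. x \<mu> \<in> gen_eigenspace A \<mu>" "y = (\<Sum>\<mu>\<in>M. x \<mu>)"
      and w: "w \<in> gen_eigenspace A \<nu>" by blast
    define x' where "x' \<mu> = (if \<mu> \<in> M then x \<mu> else 0) + (if \<mu> = \<nu> then sc c w else 0)" for \<mu>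
    have "x' \<mu> \<in> gen_eigenspace A \<mu>" for \<mu>
      using Mx w subspace_gen_eigenspace[OF A, of \<mu>]
      by (auto simp: x'_def subspace_add subspace_scale subspace_0)
    moreover have "(\<Sum>\<mu>\<in>insert \<nu> M. x' \<mu>) = y + sc c w"
      unfolding x'_def sum.distrib using Mx(1,3)
      by (cases "\<nu> \<in> M") (auto simp: insert_absorb sum.insert_if intro!: sum.cong)
    ultimately show ?case using Mx(1) by (intro exI[of _ "insert \<nu> M"] exI[of _ x']) (simp add: add.commute)
  qed
  then show ?thesis using that by blast
qed

end

section \<open>Functionals and scalings of generalized eigenspaces\<close>

context fd_space
begin

lemma subspace_eq_span_basis:
  assumes "subspace U"
  obtains B where "B \<subseteq> U" "independent B" "span B = U" "finite B" "card B = dim U"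
proof -
  obtain B where B: "B \<subseteq> U" "independent B" "U \<subseteq> span B" "card B = dim U" by (rule basis_exists)
  then show ?thesis using that[of B] assms span_minimal[of B U] finiteI_independent by blast
qed

lemma spanning_set_basis:
  assumes "span S = UNIV"
  obtains B where "B \<subseteq> S" "independent B" "span B = UNIV" "finite B"
proof -
  obtain B where B: "B \<subseteq> S" "independent B" "S \<subseteq> span B" by (rule maximal_independent_subset)
  then have "span S \<subseteq> span B" by (intro span_minimal) auto
  then show ?thesis using that[of B] B assms finiteI_independent by blast
qed

lemma basis_expansion:
  assumes "independent B" "span B = UNIV"
  shows "(\<Sum>b\<in>B. sc (representation B v b) b) = v"
  using assms by (intro sum_representation_eq) (auto simp: finiteI_independent)

lemma coords_linear:
  assumes "independent B" "span B = UNIV"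
  shows "functional (\<lambda>v. representation B v b)"
  using linear_representation[OF assms] .

lemma separating_functional:
  assumes "subspace U" "v \<notin> U"
  shows "\<exists>l. functional l \<and> (\<forall>u\<in>U. l u = 0) \<and> l v = 1"
proof -
  obtain B where B: "B \<subseteq> U" "independent B" "span B = U" by (rule subspace_eq_span_basis[OF assms(1)])
  then have ind: "independent (insert v B)" using assms(2) by (simp add: independent_insertI)
  let ?l = "functional.construct (insert v B) (\<lambda>b. if b = v then 1 else 0)"
  have l: "functional ?l" by (rule functional.linear_construct[OF ind])
  have "v \<notin> B" using B assms(2) by blast
  then have "?l b = 0" if "b \<in> B" for b
    using that functional.construct_basis[OF ind, of b "\<lambda>b. if b = v then 1 else 0"] by auto
  then have "?l u = 0" if "u \<in> U" for u
    using that B(3) functional.linear_eq_0_on_span[OF l, of B u] by blast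
  moreover have "?l v = 1" by (simp add: functional.construct_basis[OF ind])
  ultimately show ?thesis using l by blast
qed

lemma functional_eqI:
  assumes "\<And>l. functional l \<Longrightarrow> l v = l w" shows "v = w"
proof (rule ccontr)
  assume "v \<noteq> w"
  then obtain l where "functional l" "l (v - w) = 1"
    using separating_functional[of "{0}" "v - w"] by auto
  then show False using assms[of l] by (simp add: functional_simps)
qed

lemma gen_eigenspace_scaling_exists:
  assumes A: "endo A"
  shows "\<exists>S. endo S \<and> (\<forall>\<mu>. \<forall>v\<in>gen_eigenspace A \<mu>. S v = sc (\<phi> \<mu>) v)"
proof -
  obtain B where B: "B \<subseteq> (\<Union>\<mu>. gen_eigenspace A \<mu>)" "independent B" "span B = UNIV" "finite B"
    using spanning_set_basis[OF span_gen_eigenspaces[OF A]] by metis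
  then obtain m where m: "\<And>b. b \<in> B \<Longrightarrow> b \<in> gen_eigenspace A (m b)"
    by (metis UN_E subsetD)
  define S where "S = endo.construct B (\<lambda>b. sc (\<phi> (m b)) b)"
  have S: "endo S" unfolding S_def by (rule endo.linear_construct[OF B(2)])
  have Sb: "S b = sc (\<phi> (m b)) b" if "b \<in> B" for b
    unfolding S_def using endo.construct_basis[OF B(2) that] .
  have "S v = sc (\<phi> \<mu>) v" if v: "v \<in> gen_eigenspace A \<mu>" for v \<mu>
  proof -
    let ?c = "representation B v"
    define part where "part \<nu> = (\<Sum>b\<in>{b\<in>B. m b = \<nu>}. sc (?c b) b)" for \<nu>
    \<comment> \<open>It has to be seen that v involves only basis vectors belonging to \<mu>. The
      parts of its expansion, minus v itself at \<mu>, sum to zero and therefore vanish one by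
      one.\<close>
    define x where "x \<nu> = part \<nu> - (if \<nu> = \<mu> then v else 0)" for \<nu>
    let ?M = "insert \<mu> (m ` B)"
    have "x \<nu> \<in> gen_eigenspace A \<nu>" for \<nu>
      unfolding x_def part_def using subspace_gen_eigenspace[OF A, of \<nu>] m v
      by (auto intro!: subspace_diff subspace_sum subspace_scale simp: subspace_0)
    moreover have "(\<Sum>\<nu>\<in>?M. x \<nu>) = 0"
    proof -
      have "(\<Sum>\<nu>\<in>?M. part \<nu>) = (\<Sum>b\<in>B. sc (?c b) b)"
        unfolding part_def using B(4) by (intro sum.group) auto
      then have "(\<Sum>\<nu>\<in>?M. part \<nu>) = v" using basis_expansion[OF B(2,3)] by simp
      then show ?thesis using B(4) by (simp add: x_def sum_subtractf)
    qed
    ultimately have x0: "x \<nu> = 0" if "\<nu> \<in> ?M" for \<nu>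
      using gen_eigenspace_component[OF A, of ?M x \<nu>] B(4) that by simp
    have c0: "?c b = 0" if "b \<in> B" "m b \<noteq> \<mu>" for b
    proof -
      have "part (m b) = 0" using x0[of "m b"] that by (simp add: x_def)
      then show ?thesis
        unfolding part_def using independentD[OF B(2), of "{b'\<in>B. m b' = m b}" ?c b] that B(4) by auto
    qed
    have "S v = S (\<Sum>b\<in>B. sc (?c b) b)" by (simp add: basis_expansion[OF B(2,3)])
    also have "\<dots> = (\<Sum>b\<in>B. sc (?c b) (sc (\<phi> (m b)) b))"
      unfolding endo.linear_sum[OF S] endo.linear_scale[OF S] using Sb by (intro sum.cong) auto
    also have "\<dots> = (\<Sum>b\<in>B. sc (\<phi> \<mu>) (sc (?c b) b))"
      by (rule sum.cong) (use c0 in \<open>auto simp: mult.commute\<close>)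
    also have "\<dots> = sc (\<phi> \<mu>) v"
      unfolding scale_sum_right[symmetric] by (simp only: basis_expansion[OF B(2,3)])
    finally show ?thesis .
  qed
  then show ?thesis using S by blast
qed

text \<open>For \<phi> the identity this is the semisimple part in the Jordan decomposition of A;
  for \<phi> = \<open>cnj\<close> it is the companion of A in Cartan's criterion. The choice is
  unique because the generalized eigenspaces span.\<close>

definition gen_scaling :: "(complex \<Rightarrow> complex) \<Rightarrow> ('a \<Rightarrow> 'a) \<Rightarrow> 'a \<Rightarrow> 'a" where
  "gen_scaling \<phi> A = (SOME S. endo S \<and> (\<forall>\<mu>. \<forall>v\<in>gen_eigenspace A \<mu>. S v = sc (\<phi> \<mu>) v))"

lemma gen_scaling:
  assumes "endo A"
  shows endo_gen_scaling: "endo (gen_scaling \<phi> A)"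
    and gen_scaling_eq: "v \<in> gen_eigenspace A \<mu> \<Longrightarrow> gen_scaling \<phi> A v = sc (\<phi> \<mu>) v"
  using someI_ex[OF gen_eigenspace_scaling_exists[OF assms, of \<phi>]] by (auto simp: gen_scaling_def)

abbreviation semisimple_part :: "('a \<Rightarrow> 'a) \<Rightarrow> 'a \<Rightarrow> 'a" where
  "semisimple_part \<equiv> gen_scaling (\<lambda>\<mu>. \<mu>)"

lemma endo_eq_on_gen:
  assumes "endo A" "endo f" "endo g" "\<And>\<mu> v. v \<in> gen_eigenspace A \<mu> \<Longrightarrow> f v = g v"
  shows "f = g"
  using assms by (intro endo_eqI[OF assms(2,3) span_gen_eigenspaces[OF assms(1)]]) auto

lemma gen_scaling_commute:
  assumes A: "endo A" and B: "endo B" and "\<And>x. B (A x) = A (B x)"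
  shows "B (gen_scaling \<phi> A v) = gen_scaling \<phi> A (B v)"
proof -
  have "(\<lambda>v. B (gen_scaling \<phi> A v)) = (\<lambda>v. gen_scaling \<phi> A (B v))"
    by (rule endo_eq_on_gen[OF A endo_comp[OF B endo_gen_scaling[OF A]] endo_comp[OF endo_gen_scaling[OF A] B]])
       (simp add: gen_scaling_eq[OF A] gen_scaling_eq[OF A gen_eigenspace_commute[OF assms]] endo_simps[OF B])
  then show ?thesis by metis
qed

section \<open>Diagonalizable endomorphisms\<close>

definition diagonalizable :: "('a \<Rightarrow> 'a) \<Rightarrow> bool" where
  "diagonalizable A \<longleftrightarrow> endo A \<and> span {v. \<exists>\<mu>. A v = sc \<mu> v} = UNIV"

lemma gen_scaling_diagonalizable:
  assumes A: "endo A" shows "diagonalizable (gen_scaling \<phi> A)"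
proof -
  have "(\<Union>\<mu>. gen_eigenspace A \<mu>) \<subseteq> {v. \<exists>\<mu>. gen_scaling \<phi> A v = sc \<mu> v}"
    using gen_scaling_eq[OF A] by blast
  from span_mono[OF this] show ?thesis
    unfolding diagonalizable_def span_gen_eigenspaces[OF A] using endo_gen_scaling[OF A] by auto
qed

lemma eigenvector_in_gen: "A v = sc \<mu> v \<Longrightarrow> v \<in> gen_eigenspace A \<mu>"
  by (rule gen_eigenspaceI[where k = 1]) (simp add: shift_def)

text \<open>A and its semisimple part agree on the eigenvectors of A. These span, so the two maps
  are equal.\<close>

lemma diagonalizable_gen:
  assumes "diagonalizable A" "v \<in> gen_eigenspace A \<mu>"
  shows "A v = sc \<mu> v"
proof -
  have A: "endo A" using assms by (simp add: diagonalizable_def)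
  have "gen_scaling (\<lambda>\<mu>. \<mu>) A = A"
    using assms(1) gen_scaling_eq[OF A eigenvector_in_gen[of A], of _ _ "\<lambda>\<mu>. \<mu>"] unfolding diagonalizable_def
    by (intro endo_eqI[of _ _ "{v. \<exists>\<mu>. A v = sc \<mu> v}"] endo_gen_scaling) auto
  then show ?thesis using gen_scaling_eq[OF A assms(2), of "\<lambda>\<mu>. \<mu>"] by simp
qed

text \<open>The linear factors of an annihilating polynomial of a vector of U are applied in turn.
  The last nonzero vector obtained is an eigenvector, and U is never left.\<close>

lemma invariant_eigenvector:
  assumes A: "endo A" and U: "subspace U" "A ` U \<subseteq> U" "U \<noteq> {0}"
  shows "\<exists>v\<in>U. v \<noteq> 0 \<and> (\<exists>\<mu>. A v = sc \<mu> v)"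
proof -
  have inv: "shift A \<kappa> u \<in> U" if "u \<in> U" for u \<kappa>
    using U that by (auto simp: shift_def subspace_diff subspace_scale)
  have "\<exists>v\<in>U. v \<noteq> 0 \<and> (\<exists>\<mu>. A v = sc \<mu> v)"
    if "p \<noteq> 0" "poly_endo p A v = 0" "degree p = n" "v \<in> U" "v \<noteq> 0" for p v n
    using that
  proof (induction n arbitrary: p v)
    case 0
    then obtain c where "p = [:c:]" "c \<noteq> 0" by (metis degree_eq_zeroE pCons_0_0)
    then show ?case using 0 by (simp add: poly_endo_def)
  next
    case (Suc n)
    then obtain \<mu> where "poly p \<mu> = 0" using alg_closed_imp_poly_has_root[of p] by auto
    then obtain q where q: "p = [:-\<mu>, 1:] * q" by (meson dvdE poly_eq_0_iff_dvd)
    then have "q \<noteq> 0" using Suc by auto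
    have "degree p = degree [:-\<mu>, 1:] + degree q" unfolding q using \<open>q \<noteq> 0\<close> by (intro degree_mult_eq) auto
    then have dq: "degree q = n" using Suc.prems by simp
    have pq: "poly_endo q A (shift A \<mu> v) = 0"
      using Suc.prems(2) poly_endo_linear_factor[OF A, of \<mu> q v] q by simp
    show ?case
    proof (cases "shift A \<mu> v = 0")
      case True
      then show ?thesis using Suc.prems by (auto simp: shift_def)
    next
      case False
      show ?thesis by (rule Suc.IH[OF \<open>q \<noteq> 0\<close> pq dq inv[OF Suc.prems(4)] False])
    qed
  qed
  moreover obtain v where "v \<in> U" "v \<noteq> 0" using U subspace_0 by blast
  ultimately show ?thesis using poly_endo_annihilates[of A v] by blast
qed

lemma span_eigenvectors_invariant:
  assumes "endo A" shows "A ` span {v. \<exists>\<mu>. A v = sc \<mu> v} \<subseteq> span {v. \<exists>\<mu>. A v = sc \<mu> v}"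
proof
  fix y assume "y \<in> A ` span {v. \<exists>\<mu>. A v = sc \<mu> v}"
  then obtain x where x: "x \<in> span {v. \<exists>\<mu>. A v = sc \<mu> v}" "y = A x" by blast
  from x(1) have "A x \<in> span {v. \<exists>\<mu>. A v = sc \<mu> v}"
  proof (induction rule: span_induct_alt)
    case base
    then show ?case using assms by (simp add: endo_simps span_zero)
  next
    case (step c x y)
    then show ?case by (auto simp: endo_simps[OF assms] intro!: span_add span_scale intro: span_base)
  qed
  then show "y \<in> span {v. \<exists>\<mu>. A v = sc \<mu> v}" by (simp add: x)
qed

text \<open>A stable complement of the span of all eigenvectors would contain a further eigenvector
  unless it is zero. Conversely, among the stable subspaces that meet U trivially one of largest
  dimension is a complement: an eigenvector outside the sum could be adjoined to it.\<close>

lemma semisimple_endomorphism_iff: "semisimple_endomorphism sc A \<longleftrightarrow> diagonalizable A"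
proof
  assume s: "semisimple_endomorphism sc A"
  then have A: "endo A" by (simp add: semisimple_endomorphism_def)
  let ?E = "span {v. \<exists>\<mu>. A v = sc \<mu> v}"
  obtain U where U: "subspace U" "A ` U \<subseteq> U" "?E \<inter> U = {0}" "{u + u' | u u'. u \<in> ?E \<and> u' \<in> U} = UNIV"
    using s[unfolded semisimple_endomorphism_def, THEN conjunct2, rule_format,
      OF conjI[OF subspace_span span_eigenvectors_invariant[OF A]]] by blast
  have "U = {0}"
  proof (rule ccontr)
    assume "U \<noteq> {0}"
    then obtain v \<mu> where "v \<in> U" "v \<noteq> 0" "A v = sc \<mu> v" using invariant_eigenvector[OF A U(1,2)] by blast
    moreover from this have "v \<in> ?E" by (blast intro: span_base)
    ultimately show False using U(3) by blast
  qed
  with U(4) have "?E = UNIV" by auto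
  then show "diagonalizable A" by (simp add: diagonalizable_def A)
next
  assume d: "diagonalizable A"
  then have A: "endo A" by (simp add: diagonalizable_def)
  have "\<exists>U'. subspace U' \<and> A ` U' \<subseteq> U' \<and> U \<inter> U' = {0} \<and> {u + u' | u u'. u \<in> U \<and> u' \<in> U'} = UNIV"
    if U: "subspace U" "A ` U \<subseteq> U" for U
  proof -
    define P where "P U' \<longleftrightarrow> subspace U' \<and> A ` U' \<subseteq> U' \<and> U \<inter> U' = {0}" for U'
    have "P {0}" using U A by (auto simp: P_def endo_simps subspace_0)
    moreover have "dim U' < Suc (card Basis)" for U'
      using dim_subset_UNIV[of U'] by (simp add: dimension_def)
    ultimately obtain U' where U': "P U'" and max: "\<And>U''. P U'' \<Longrightarrow> dim U'' \<le> dim U'"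
      using ex_has_greatest_nat[of P "{0}" dim "Suc (card Basis)"] by blast
    let ?T = "{u + u' | u u'. u \<in> U \<and> u' \<in> U'}"
    have T: "subspace ?T" using U U' by (auto simp: P_def intro: subspace_sums)
    have "v \<in> ?T" if v: "A v = sc \<mu> v" for v \<mu>
    proof (rule ccontr)
      assume nv: "v \<notin> ?T"
      have U'T: "U' \<subseteq> ?T"
      proof
        fix x assume "x \<in> U'"
        then show "x \<in> ?T" using U(1) subspace_0 by (intro CollectI exI[of _ 0] exI[of _ x]) auto
      qed
      let ?U'' = "span (insert v U')"
      have el: "\<exists>c u'. x = sc c v + u' \<and> u' \<in> U'" if x: "x \<in> ?U''" for x
      proof -
        from x obtain k where "x - sc k v \<in> span U'" by (auto simp: span_breakdown_eq)
        moreover have "span U' = U'" using U' by (simp add: P_def)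
        ultimately show ?thesis by (intro exI[of _ k] exI[of _ "x - sc k v"]) simp
      qed
      have "P ?U''"
        unfolding P_def
      proof (intro conjI)
        show "A ` ?U'' \<subseteq> ?U''"
        proof
          fix y assume "y \<in> A ` ?U''"
          then obtain c u' where "y = A (sc c v + u')" "u' \<in> U'" using el by blast
          then have "y = sc (c * \<mu>) v + A u'" "A u' \<in> U'" using v U' by (auto simp: endo_simps[OF A] P_def)
          then show "y \<in> ?U''" by (auto intro!: span_add span_scale intro: span_base)
        qed
        show "U \<inter> ?U'' = {0}"
        proof
          show "U \<inter> ?U'' \<subseteq> {0}"
          proof
            fix x assume x: "x \<in> U \<inter> ?U''"
            then obtain c u' where cu: "x = sc c v + u'" "u' \<in> U'" using el by blast
            have "c = 0"
            proof (rule ccontr)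
              assume "c \<noteq> 0"
              have "v = sc (1/c) (sc c v)" using \<open>c \<noteq> 0\<close> by simp
              also have "sc c v = x - u'" using cu by simp
              also have "sc (1/c) (x - u') = sc (1/c) x + sc (- (1/c)) u'"
                by (simp add: scale_right_diff_distrib)
              finally have "v = sc (1/c) x + sc (- (1/c)) u'" .
              moreover have "sc (1/c) x \<in> U" "sc (- (1/c)) u' \<in> U'"
                using x cu U U' by (auto simp: P_def intro!: subspace_scale simp del: scale_minus_left)
              ultimately have "v \<in> ?T" by blast
              with nv show False ..
            qed
            then have "x \<in> U \<inter> U'" using x cu by simp
            then show "x \<in> {0}" using U' unfolding P_def by blast
          qed
          show "{0} \<subseteq> U \<inter> ?U''" using U by (simp add: subspace_0 span_zero)
        qed
      qed simp
      then have "dim ?U'' \<le> dim U'" by (rule max)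
      moreover have "U' \<subseteq> ?U''" by (meson subset_insertI span_superset subset_trans)
      ultimately have "U' = ?U''" using U' by (intro subspace_dim_equal) (auto simp: P_def)
      then have "v \<in> U'" using span_base[of v "insert v U'"] by simp
      then show False using nv U'T by blast
    qed
    then have "span {v. \<exists>\<mu>. A v = sc \<mu> v} \<subseteq> ?T" using T by (intro span_minimal) auto
    then have "?T = UNIV" using d by (auto simp: diagonalizable_def)
    then show ?thesis using U' unfolding P_def by blast
  qed
  then show "semisimple_endomorphism sc A"
    using A by (simp add: semisimple_endomorphism_def)
qed

text \<open>The joint eigenspace U of the other maps is stable under A by commutation, so it
  contains the components of v in the generalized eigenspaces of A, and these components are genuine
  eigenvectors of A.\<close>

lemma joint_eigenvectors:
  assumes "finite X" "\<And>A. A \<in> X \<Longrightarrow> diagonalizable A"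
    "\<And>A B v. A \<in> X \<Longrightarrow> B \<in> X \<Longrightarrow> A (B v) = B (A v)"
  shows "span {v. \<forall>A\<in>X. \<exists>\<mu>. A v = sc \<mu> v} = UNIV"
  using assms
proof (induction X rule: finite_induct)
  case empty
  then show ?case by simp
next
  case (insert A X)
  let ?J = "{v. \<forall>A\<in>X. \<exists>\<mu>. A v = sc \<mu> v}"
  let ?J' = "{v. \<forall>A\<in>insert A X. \<exists>\<mu>. A v = sc \<mu> v}"
  have dA: "diagonalizable A" and A: "endo A" using insert.prems(1)[of A] by (auto simp: diagonalizable_def)
  have "v \<in> span ?J'" if v: "v \<in> ?J" for v
  proof -
    obtain a where a: "\<And>B. B \<in> X \<Longrightarrow> B v = sc (a B) v" using bchoice[of X "\<lambda>B \<mu>. B v = sc \<mu> v"] v by auto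
    define U where "U = {x. \<forall>B\<in>X. B x = sc (a B) x}"
    have E: "endo B" if "B \<in> X" for B using that insert.prems(1) by (auto simp: diagonalizable_def)
    have U: "subspace U"
      unfolding U_def by (rule subspaceI) (auto simp: endo_simps[OF E] scale_right_distrib scale_left_commute)
    have AU: "A ` U \<subseteq> U"
    proof
      fix y assume "y \<in> A ` U"
      then obtain x where x: "x \<in> U" "y = A x" by blast
      have "B (A x) = sc (a B) (A x)" if "B \<in> X" for B
      proof -
        have "B x = sc (a B) x" using x(1) that by (simp add: U_def)
        then show ?thesis using insert.prems(2)[of B A x] that by (simp add: endo_simps[OF A])
      qed
      then show "y \<in> U" by (simp add: U_def x(2))
    qed
    obtain M x where Mx: "finite M" "\<And>\<mu>. \<mu> \<in> M \<Longrightarrow> x \<mu> \<in> gen_eigenspace A \<mu>" "v = (\<Sum>\<mu>\<in>M. x \<mu>)"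
      by (rule gen_decomposition[OF A, of v]) blast
    have "v \<in> U" using a by (simp add: U_def)
    then have "x \<mu> \<in> U" if "\<mu> \<in> M" for \<mu>
      using components_in_subspace[OF A U AU Mx(1,2)] Mx(3) that by blast
    then have "x \<mu> \<in> ?J'" if "\<mu> \<in> M" for \<mu>
      using that diagonalizable_gen[OF dA Mx(2)[OF that]] by (auto simp: U_def)
    then show ?thesis unfolding Mx(3) by (blast intro: span_sum span_base)
  qed
  then have "span ?J \<subseteq> span ?J'" by (intro span_minimal) auto
  then show ?case using insert by auto
qed

section \<open>The trace\<close>

definition trace :: "('a \<Rightarrow> 'a) \<Rightarrow> complex" where
  "trace f = (\<Sum>b\<in>Basis. representation Basis (f b) b)"

lemma trace_basis_swap:
  assumes B: "independent B" "span B = UNIV" and C: "independent C" "span C = UNIV" and g: "endo g"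
  shows "(\<Sum>b\<in>B. representation B (g (f b)) b) = (\<Sum>b\<in>B. \<Sum>c\<in>C. representation C (f b) c * representation B (g c) b)"
proof (rule sum.cong[OF refl])
  fix b
  have "representation B (g (f b)) b = representation B (g (\<Sum>c\<in>C. sc (representation C (f b) c) c)) b"
    by (simp add: basis_expansion[OF C])
  also have "\<dots> = (\<Sum>c\<in>C. representation C (f b) c * representation B (g c) b)"
    by (simp add: endo_simps[OF g] functional_simps[OF coords_linear[OF B]])
  finally show "representation B (g (f b)) b = (\<Sum>c\<in>C. representation C (f b) c * representation B (g c) b)" .
qed

lemma sum_representation_cyclic:
  assumes B: "independent B" "span B = UNIV" and C: "independent C" "span C = UNIV" and "endo f" "endo g"
  shows "(\<Sum>b\<in>B. representation B (g (f b)) b) = (\<Sum>c\<in>C. representation C (f (g c)) c)"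
  unfolding trace_basis_swap[OF B C assms(6)] trace_basis_swap[OF C B assms(5)]
  by (subst sum.swap) (simp add: mult.commute)

lemma trace_eq:
  assumes "independent B" "span B = UNIV" "endo f"
  shows "trace f = (\<Sum>b\<in>B. representation B (f b) b)"
proof -
  have "endo (\<lambda>x. x)" by (rule endoI) simp_all
  from sum_representation_cyclic[OF independent_Basis span_Basis assms(1,2) this assms(3)]
  show ?thesis by (simp add: trace_def)
qed

lemma trace_commute: "endo f \<Longrightarrow> endo g \<Longrightarrow> trace (\<lambda>x. f (g x)) = trace (\<lambda>x. g (f x))"
  unfolding trace_def
  by (rule sum_representation_cyclic[OF independent_Basis span_Basis independent_Basis span_Basis])

lemma trace_add: "trace (\<lambda>x. f x + g x) = trace f + trace g"
  using functional.linear_add[OF coords_linear[OF independent_Basis span_Basis]]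
  by (simp add: trace_def sum.distrib)

lemma trace_scale: "trace (\<lambda>x. sc c (f x)) = c * trace f"
  using functional.linear_scale[OF coords_linear[OF independent_Basis span_Basis]]
  by (simp add: trace_def sum_distrib_left)

lemma trace_diff: "trace (\<lambda>x. f x - g x) = trace f - trace g"
  using functional.linear_diff[OF coords_linear[OF independent_Basis span_Basis]]
  by (simp add: trace_def sum_subtractf)

text \<open>A basis adapted to the kernels of the powers of T makes T strictly triangular: T sends
  the kernel of each power into that of the preceding one, so no basis vector occurs in its own
  image.\<close>

lemma trace_nilpotent:
  assumes T: "endo T" and "gen_eigenspace T 0 = UNIV"
  shows "trace T = 0"
proof -
  have "\<exists>k. (T ^^ k) v = 0" for v using assms(2) by (auto simp: gen_eigenspace_def)
  then obtain k where k: "\<And>v. (T ^^ k v) v = 0" by metis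
  define K where "K = Max (k ` Basis)"
  have "(T ^^ K) b = 0" if "b \<in> Basis" for b
    using funpow_0_mono[OF T k] that finite_Basis by (simp add: K_def)
  moreover have "endo (\<lambda>x. 0)" by (rule endoI) auto
  ultimately have "T ^^ K = (\<lambda>x. 0)"
    using endo_funpow[OF T] span_Basis by (intro endo_eqI[of _ _ Basis]) auto
  have "\<exists>B. independent B \<and> span B = {v. (T ^^ j) v = 0} \<and> (\<forall>b\<in>B. representation B (T b) b = 0)" for j
  proof (induction j)
    case 0
    show ?case by (intro exI[of _ "{}"]) (use independent_empty in simp)
  next
    case (Suc j)
    then obtain B where B: "independent B" "span B = {v. (T ^^ j) v = 0}" "\<And>b. b \<in> B \<Longrightarrow> representation B (T b) b = 0"
      by blast
    let ?V = "{v. (T ^^ Suc j) v = 0}"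
    have V: "subspace ?V" using endo_funpow[OF T, of "Suc j"] by (rule subspace_kernel_endo)
    have TV: "T v \<in> span B" if "v \<in> ?V" for v using that by (simp add: B(2) funpow_swap1)
    have "span B \<subseteq> ?V" unfolding B(2) using funpow_0_mono[OF T] by (auto simp del: funpow.simps)
    then have "B \<subseteq> ?V" using span_superset by blast
    then obtain C where C: "B \<subseteq> C" "C \<subseteq> ?V" "independent C" "?V \<subseteq> span C"
      using maximal_independent_subset_extend[OF _ B(1)] by blast
    have "representation C (T b) b = 0" if "b \<in> C" for b
    proof -
      have "representation C (T b) b = representation B (T b) b"
        using representation_extend[OF C(3) TV C(1)] C(2) that by (metis subsetD)
      also have "\<dots> = 0" using B(3) representation_ne_zero by blast
      finally show ?thesis .
    qed
    moreover have "span C = ?V" using C V by (intro antisym span_minimal)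
    ultimately show ?case using C(3) by blast
  qed
  then obtain B where B: "independent B" "span B = {v. (T ^^ K) v = 0}" "\<forall>b\<in>B. representation B (T b) b = 0"
    by blast
  then have "span B = UNIV" using \<open>T ^^ K = (\<lambda>x. 0)\<close> by simp
  then show ?thesis using trace_eq[OF B(1) _ T] B(3) by simp
qed

lemma gen_eigenbasis:
  assumes A: "endo A"
  obtains B m where "independent B" "span B = UNIV" "finite B" "\<And>b. b \<in> B \<Longrightarrow> b \<in> gen_eigenspace A (m b)"
proof -
  obtain B where B: "B \<subseteq> (\<Union>\<mu>. gen_eigenspace A \<mu>)" "independent B" "span B = UNIV" "finite B"
    using spanning_set_basis[OF span_gen_eigenspaces[OF A]] by metis
  then obtain m where m: "\<And>b. b \<in> B \<Longrightarrow> b \<in> gen_eigenspace A (m b)"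
    by (metis UN_E subsetD)
  show ?thesis by (rule that[of B m]) (use B(2-4) m in auto)
qed

text \<open>The trace of \<open>A\<close> times its conjugated semisimple part is the sum of the squared moduli of
  the eigenvalues.\<close>

lemma nilpotent_if_trace_zero:
  assumes A: "endo A" and "trace (\<lambda>x. A (gen_scaling cnj A x)) = 0"
  shows "gen_eigenspace A 0 = UNIV"
proof -
  let ?S = "gen_scaling cnj A"
  have S: "endo ?S" by (rule endo_gen_scaling[OF A])
  have SA: "A (?S x) = ?S (A x)" for x by (rule gen_scaling_commute[OF A A]) simp
  obtain B m where B: "independent B" "span B = UNIV" "finite B"
    and m: "\<And>b. b \<in> B \<Longrightarrow> b \<in> gen_eigenspace A (m b)" by (rule gen_eigenbasis[OF A]) blast
  \<comment> \<open>On \<open>gen_eigenspace A \<mu>\<close> the map \<open>?N\<close> is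
    \<open>cnj \<mu>\<close> times \<open>shift A \<mu>\<close>, hence nilpotent. So A times
    \<open>?S\<close> has the same trace as the diagonal map \<open>?P\<close>, whose eigenvalues
    are the squared moduli.\<close>
  let ?P = "gen_scaling (\<lambda>\<mu>. \<mu> * cnj \<mu>) A"
  let ?N = "\<lambda>x. A (?S x) - ?P x"
  have P: "endo ?P" by (rule endo_gen_scaling[OF A])
  have N: "endo ?N" by (intro endoI) (simp_all add: endo_simps[OF A] endo_simps[OF S] endo_simps[OF P] scale_right_diff_distrib algebra_simps)
  have "v \<in> gen_eigenspace ?N 0" if v: "v \<in> gen_eigenspace A \<mu>" for v \<mu>
  proof -
    have Nv: "?N w = sc (cnj \<mu>) (shift A \<mu> w)" if "w \<in> gen_eigenspace A \<mu>" for w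
      using that by (simp add: gen_scaling_eq[OF A] shift_def endo_simps[OF A] scale_right_diff_distrib mult.commute)
    have pow: "(?N ^^ k) w = sc (cnj \<mu> ^ k) ((shift A \<mu> ^^ k) w) \<and> (?N ^^ k) w \<in> gen_eigenspace A \<mu>"
      if w: "w \<in> gen_eigenspace A \<mu>" for k w
    proof (induction k)
      case (Suc k)
      have e: "(?N ^^ Suc k) w = sc (cnj \<mu>) (shift A \<mu> ((?N ^^ k) w))" using Nv[OF conjunct2[OF Suc.IH]] by simp
      then have m: "(?N ^^ Suc k) w \<in> gen_eigenspace A \<mu>"
        using subspace_scale[OF subspace_gen_eigenspace[OF A] shift_in_gen[OF A conjunct2[OF Suc.IH]]] by metis
      note e
      also have "sc (cnj \<mu>) (shift A \<mu> ((?N ^^ k) w)) = sc (cnj \<mu> ^ Suc k) ((shift A \<mu> ^^ Suc k) w)"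
        using Suc by (simp add: endo_simps[OF endo_shift[OF A]])
      finally show ?case using m by blast
    qed (use w in simp)
    obtain k where "(shift A \<mu> ^^ k) v = 0" using v by (auto simp: gen_eigenspace_def)
    then have "(?N ^^ k) v = 0" using pow[OF v] by simp
    then show ?thesis by (intro gen_eigenspaceI[where k = k]) simp
  qed
  then have "span (\<Union>\<mu>. gen_eigenspace A \<mu>) \<subseteq> gen_eigenspace ?N 0"
    using subspace_gen_eigenspace[OF N] by (intro span_minimal) auto
  then have "trace ?N = 0" using N by (intro trace_nilpotent) (auto simp: span_gen_eigenspaces[OF A])
  then have "trace ?P = 0" using assms(2) by (simp add: trace_diff)
  moreover have "trace ?P = (\<Sum>b\<in>B. m b * cnj (m b))"
    unfolding trace_eq[OF B(1,2) P]
  proof (rule sum.cong[OF refl])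
    fix b assume "b \<in> B"
    then show "representation B (?P b) b = m b * cnj (m b)"
      using gen_scaling_eq[OF A m] functional.linear_scale[OF coords_linear[OF B(1,2)]] representation_basis[OF B(1)]
      by simp
  qed
  ultimately have "(\<Sum>b\<in>B. complex_of_real ((cmod (m b))\<^sup>2)) = 0" by (simp only: complex_norm_square)
  then have "(\<Sum>b\<in>B. (cmod (m b))\<^sup>2) = 0" unfolding of_real_sum[symmetric] of_real_eq_0_iff .
  then have "m b = 0" if "b \<in> B" for b using that B(3) by (simp add: sum_nonneg_eq_0_iff)
  then have "B \<subseteq> gen_eigenspace A 0" using m by fastforce
  then have "span B \<subseteq> gen_eigenspace A 0" using subspace_gen_eigenspace[OF A] by (intro span_minimal)
  then show ?thesis using B by auto
qed

end

section \<open>Semisimple Lie algebras\<close>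

locale lie_space = complex_lie_algebra sc bracket + fd_space sc Basis
  for sc :: "complex \<Rightarrow> 'a::ab_group_add \<Rightarrow> 'a" and bracket and Basis
begin

lemma endo_bracket: "endo (bracket x)"
  using linear_bracket_right[of x] by (simp add: eta_contract_eq)

lemma bracket_simps:
  "bracket x (y + z) = bracket x y + bracket x z"
  "bracket (x + y) z = bracket x z + bracket y z"
  "bracket x (y - z) = bracket x y - bracket x z"
  "bracket (x - y) z = bracket x z - bracket y z"
  "bracket x (sc c y) = sc c (bracket x y)"
  "bracket (sc c x) y = sc c (bracket x y)"
  "bracket x (- y) = - bracket x y"
  "bracket (- x) y = - bracket x y"
  "bracket x 0 = 0" "bracket 0 x = 0"
  using endo_simps[OF linear_bracket_left] endo_simps[OF linear_bracket_right] by auto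

lemma bracket_sum_left: "bracket (sum f A) y = (\<Sum>a\<in>A. bracket (f a) y)"
  using endo.linear_sum[OF linear_bracket_left] .

lemma bracket_sum_right: "bracket x (sum f A) = (\<Sum>a\<in>A. bracket x (f a))"
  using endo.linear_sum[OF linear_bracket_right] .

lemma bracket_swap: "bracket x y = - bracket y x"
proof -
  have "bracket (x + y) (x + y) = 0" by (rule bracket_self)
  then have "bracket x x + bracket y x + (bracket x y + bracket y y) = 0" by (simp only: bracket_simps)
  then have "bracket x y + bracket y x = 0" by (simp add: bracket_self add.commute)
  then show ?thesis by (simp add: eq_neg_iff_add_eq_0)
qed

lemma jacobi_derivation: "bracket x (bracket y z) = bracket (bracket x y) z + bracket y (bracket x z)"
proof -
  have "bracket x (bracket y z) + bracket y (bracket z x) + bracket z (bracket x y) = 0" by (rule jacobi)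
  moreover have "bracket y (bracket z x) = - bracket y (bracket x z)"
    by (subst bracket_swap[of z x]) (simp add: bracket_simps)
  moreover have "bracket z (bracket x y) = - bracket (bracket x y) z" by (rule bracket_swap)
  ultimately show ?thesis by (simp add: algebra_simps)
qed

lemma subspace_centralizer: "subspace {y. bracket x y = 0}"
  by (rule subspaceI) (auto simp: bracket_simps)

section \<open>Engel's theorem\<close>

definition acts_unipotently :: "'a set \<Rightarrow> bool" where
  "acts_unipotently E \<longleftrightarrow>
     (\<forall>U U'. subspace U \<and> subspace U' \<and> U' \<subset> U \<and>
        (\<forall>e\<in>E. bracket e ` U \<subseteq> U \<and> bracket e ` U' \<subseteq> U') \<longrightarrow>
        (\<exists>v\<in>U - U'. \<forall>e\<in>E. bracket e v \<in> U'))"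

lemma acts_unipotentlyD:
  assumes "acts_unipotently E" "subspace U" "subspace U'" "U' \<subset> U"
    "\<And>e v. e \<in> E \<Longrightarrow> v \<in> U \<Longrightarrow> bracket e v \<in> U" "\<And>e v. e \<in> E \<Longrightarrow> v \<in> U' \<Longrightarrow> bracket e v \<in> U'"
  shows "\<exists>v. v \<in> U \<and> v \<notin> U' \<and> (\<forall>e\<in>E. bracket e v \<in> U')"
proof -
  have "\<exists>v\<in>U - U'. \<forall>e\<in>E. bracket e v \<in> U'"
    by (rule assms(1)[unfolded acts_unipotently_def, rule_format]) (use assms in auto)
  then show ?thesis by blast
qed

lemma span_insert_elem:
  assumes "subspace E" "z \<in> span (insert x E)"
  obtains c e where "e \<in> E" "z = sc c x + e"
proof -
  obtain k where "z - sc k x \<in> span E" using assms(2) by (auto simp: span_breakdown_eq)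
  moreover have "span E = E" using assms(1) by simp
  ultimately show ?thesis using that[of "z - sc k x" k] by simp
qed

text \<open>Since x normalizes E, the vectors that E kills modulo U' are stable under
  \<open>bracket x\<close>. Applying the nilpotent \<open>bracket x\<close> repeatedly to one of
  them, the last iterate outside U' is killed modulo U' by x as well.\<close>

lemma acts_unipotently_insert:
  assumes E: "subspace E" "acts_unipotently E" and x: "\<And>e. e \<in> E \<Longrightarrow> bracket e x \<in> E"
    "gen_eigenspace (bracket x) 0 = UNIV"
  shows "acts_unipotently (span (insert x E))"
  unfolding acts_unipotently_def
proof (intro allI impI, elim conjE)
  fix U U' assume U: "subspace U" and U': "subspace U'" and sub: "U' \<subset> U"
    and inv: "\<forall>e\<in>span (insert x E). bracket e ` U \<subseteq> U \<and> bracket e ` U' \<subseteq> U'"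
  have xs: "x \<in> span (insert x E)" and Es: "e \<in> span (insert x E)" if "e \<in> E" for e
    using that by (auto intro: span_base)
  have Ux: "bracket x v \<in> U" if "v \<in> U" for v using inv span_base[of x "insert x E"] that by blast
  have U'x: "bracket x v \<in> U'" if "v \<in> U'" for v using inv span_base[of x "insert x E"] that by blast
  have UE: "bracket e v \<in> U" if "e \<in> E" "v \<in> U" for v e using inv Es[OF that(1)] that(2) by blast
  have U'E: "bracket e v \<in> U'" if "e \<in> E" "v \<in> U'" for v e using inv Es[OF that(1)] that(2) by blast
  obtain v where v: "v \<in> U" "v \<notin> U'" "\<And>e. e \<in> E \<Longrightarrow> bracket e v \<in> U'"
    using acts_unipotentlyD[OF E(2) U U' sub UE U'E] by blast
  have X: "(bracket x ^^ j) v \<in> U \<and> (\<forall>e\<in>E. bracket e ((bracket x ^^ j) v) \<in> U')" for j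
  proof (induction j)
    case (Suc j)
    let ?w = "(bracket x ^^ j) v"
    have "bracket e (bracket x ?w) \<in> U'" if "e \<in> E" for e
      unfolding jacobi_derivation[of e x ?w]
      using Suc that x(1)[OF that] U'x by (intro subspace_add[OF U']) blast+
    then show ?case using Suc Ux by simp
  qed (use v in simp)
  obtain k where "(bracket x ^^ k) v = 0"
    using x(2) by (auto simp: gen_eigenspace_def)
  then have ex: "\<exists>k. (bracket x ^^ k) v \<in> U'" using subspace_0[OF U'] by metis
  define j where "j = (LEAST k. (bracket x ^^ k) v \<in> U')"
  have j: "(bracket x ^^ j) v \<in> U'" unfolding j_def using ex by (rule LeastI_ex)
  then have "j \<noteq> 0" using v(2) by (metis eq_id_iff funpow_0)
  then obtain i where i: "j = Suc i" using not0_implies_Suc by blast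
  then have ni: "(bracket x ^^ i) v \<notin> U'" using not_less_Least[of i "\<lambda>k. (bracket x ^^ k) v \<in> U'"] unfolding j_def by simp
  have "bracket z ((bracket x ^^ i) v) \<in> U'" if z: "z \<in> span (insert x E)" for z
  proof -
    obtain c e where ce: "e \<in> E" "z = sc c x + e" by (rule span_insert_elem[OF E(1) z])
    have "bracket z ((bracket x ^^ i) v) = sc c ((bracket x ^^ j) v) + bracket e ((bracket x ^^ i) v)"
      by (simp add: ce i bracket_simps)
    then show ?thesis using U' j X[of i] ce(1) by (simp add: subspace_add subspace_scale)
  qed
  then show "\<exists>v\<in>U - U'. \<forall>e\<in>span (insert x E). bracket e v \<in> U'" using X[of i] ni by blast
qed

text \<open>\<open>acts_unipotently\<close> speaks of all subquotients U/U' so that the maximal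
  subalgebra E can be applied to D/E: if E is proper, a vector of D/E killed by E normalizes E and
  can be adjoined to it.\<close>

lemma engel:
  assumes D: "subspace D" "\<And>x y. x \<in> D \<Longrightarrow> y \<in> D \<Longrightarrow> bracket x y \<in> D"
    and nil: "\<And>x. x \<in> D \<Longrightarrow> gen_eigenspace (bracket x) 0 = UNIV"
  shows "acts_unipotently D"
proof -
  define P where "P E \<longleftrightarrow> subspace E \<and> E \<subseteq> D \<and> (\<forall>x\<in>E. \<forall>y\<in>E. bracket x y \<in> E) \<and> acts_unipotently E" for E
  have "acts_unipotently {0}"
    unfolding acts_unipotently_def by (auto simp: bracket_simps subspace_0)
  then have P0: "P {0}" using subspace_0[OF D(1)] by (simp add: P_def bracket_simps)
  have "dim U < Suc (card Basis)" for U
    using dim_subset_UNIV[of U] by (simp add: dimension_def)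
  then obtain E where E: "P E" and max: "\<And>E'. P E' \<Longrightarrow> dim E' \<le> dim E"
    using ex_has_greatest_nat[of P "{0}" dim "Suc (card Basis)", OF P0] by blast
  have sE: "subspace E" and ED: "E \<subseteq> D" and cl: "\<And>x y. x \<in> E \<Longrightarrow> y \<in> E \<Longrightarrow> bracket x y \<in> E"
    and aE: "acts_unipotently E" using E by (auto simp: P_def)
  have "E = D"
  proof (rule ccontr)
    assume "E \<noteq> D"
    then have "E \<subset> D" using ED by blast
    have DE: "\<And>e v. e \<in> E \<Longrightarrow> v \<in> D \<Longrightarrow> bracket e v \<in> D" using D(2) ED by blast
    obtain x where x: "x \<in> D" "x \<notin> E" "\<And>e. e \<in> E \<Longrightarrow> bracket e x \<in> E"
      using acts_unipotentlyD[OF aE D(1) sE \<open>E \<subset> D\<close> DE cl] by blast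
    let ?E' = "span (insert x E)"
    have sub: "?E' \<subseteq> D" using x(1) ED D(1) by (intro span_minimal) auto
    have EE': "E \<subseteq> ?E'" using span_superset[of "insert x E"] by blast
    have "bracket y z \<in> ?E'" if y: "y \<in> ?E'" and z: "z \<in> ?E'" for y z
    proof -
      obtain c e where ce: "e \<in> E" "y = sc c x + e" by (rule span_insert_elem[OF sE y])
      obtain c' e' where ce': "e' \<in> E" "z = sc c' x + e'" by (rule span_insert_elem[OF sE z])
      have "bracket y z = sc c (- bracket e' x) + sc c' (bracket e x) + bracket e e'"
        unfolding ce(2) ce'(2) using bracket_swap[of x e'] by (simp add: bracket_simps bracket_self)
      also have "\<dots> \<in> E"
        using x(3) ce(1) ce'(1) cl sE by (intro subspace_add subspace_scale subspace_neg) auto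
      finally show ?thesis using EE' by blast
    qed
    then have "P ?E'" using sub acts_unipotently_insert[OF sE aE x(3) nil[OF x(1)]] by (simp add: P_def)
    then have "dim ?E' \<le> dim E" by (rule max)
    then have "E = ?E'" using sE EE' by (intro subspace_dim_equal) auto
    then show False using x(2) span_base[of x "insert x E"] by simp
  qed
  then show ?thesis using aE by simp
qed

section \<open>Derivations and the Killing form\<close>

definition derivation :: "('a \<Rightarrow> 'a) \<Rightarrow> bool" where
  "derivation D \<longleftrightarrow> endo D \<and> (\<forall>x y. D (bracket x y) = bracket (D x) y + bracket x (D y))"

lemma derivation_bracket: "derivation (bracket x)"
  unfolding derivation_def using endo_bracket jacobi_derivation by blast

text \<open>By the Leibniz rule \<open>shift A (\<mu> + \<nu>)\<close> acts on a bracket as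
  \<open>shift A \<mu>\<close> on the first factor plus \<open>shift A \<nu>\<close> on the second.
  The induction is on the sum of the two nilpotency exponents.\<close>

lemma bracket_in_gen:
  assumes A: "derivation A" and x: "x \<in> gen_eigenspace A \<mu>" and y: "y \<in> gen_eigenspace A \<nu>"
  shows "bracket x y \<in> gen_eigenspace A (\<mu> + \<nu>)"
proof -
  have eA: "endo A" and dA: "\<And>x y. A (bracket x y) = bracket (A x) y + bracket x (A y)"
    using A by (auto simp: derivation_def)
  let ?s = "shift A (\<mu> + \<nu>)"
  have s: "?s (bracket x y) = bracket (shift A \<mu> x) y + bracket x (shift A \<nu> y)" for x y
    by (simp add: shift_def dA bracket_simps scale_left_distrib)
  have es: "endo (?s ^^ n)" for n by (intro endo_funpow endo_shift eA)
  have "(?s ^^ n) (bracket x y) = 0"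
    if "(shift A \<mu> ^^ i) x = 0" "(shift A \<nu> ^^ j) y = 0" "i + j = n" for n i j x y
    using that
  proof (induction n arbitrary: i j x y)
    case 0
    then show ?case by (simp add: bracket_simps)
  next
    case (Suc n)
    have 1: "(?s ^^ n) (bracket (shift A \<mu> x) y) = 0"
    proof (cases i)
      case 0
      then show ?thesis using Suc.prems endo_simps[OF endo_shift[OF eA]] endo_simps[OF es] by (simp add: bracket_simps)
    next
      case (Suc i')
      then show ?thesis using Suc.IH[of i' "shift A \<mu> x" j y] Suc.prems by (simp add: funpow_swap1)
    qed
    have 2: "(?s ^^ n) (bracket x (shift A \<nu> y)) = 0"
    proof (cases j)
      case 0
      then show ?thesis using Suc.prems endo_simps[OF endo_shift[OF eA]] endo_simps[OF es] by (simp add: bracket_simps)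
    next
      case (Suc j')
      then show ?thesis using Suc.IH[of i x j' "shift A \<nu> y"] Suc.prems by (simp add: funpow_swap1)
    qed
    have "(?s ^^ Suc n) (bracket x y) = (?s ^^ n) (?s (bracket x y))" by (simp add: funpow_swap1)
    then show ?case using 1 2 by (simp add: s endo_simps[OF es])
  qed
  then show ?thesis using x y unfolding gen_eigenspace_def by blast
qed

text \<open>On generalized eigenvectors the Leibniz rule is the additivity of \<phi>, because
  eigenvalues add under the bracket; it is then extended linearly in one argument after the
  other.\<close>

lemma derivation_gen_scaling:
  assumes A: "derivation A" and add: "\<And>a b. \<phi> (a + b) = \<phi> a + \<phi> b"
  shows "derivation (gen_scaling \<phi> A)"
proof -
  have eA: "endo A" using A by (simp add: derivation_def)
  let ?S = "gen_scaling \<phi> A"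
  have eS: "endo ?S" by (rule endo_gen_scaling[OF eA])
  have 1: "?S (bracket x y) = bracket (?S x) y + bracket x (?S y)"
    if "x \<in> gen_eigenspace A \<mu>" "y \<in> gen_eigenspace A \<nu>" for x y \<mu> \<nu>
    using gen_scaling_eq[OF eA bracket_in_gen[OF A that]] gen_scaling_eq[OF eA that(1)] gen_scaling_eq[OF eA that(2)]
    by (simp add: bracket_simps add scale_left_distrib)
  have 2: "?S (bracket x y) = bracket (?S x) y + bracket x (?S y)" if y: "y \<in> gen_eigenspace A \<nu>" for x y \<nu>
  proof -
    have "(\<lambda>x. ?S (bracket x y)) = (\<lambda>x. bracket (?S x) y + bracket x (?S y))"
      by (rule endo_eq_on_gen[OF eA]) (auto intro!: endoI simp: bracket_simps endo_simps[OF eS] scale_right_distrib algebra_simps 1[OF _ y])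
    then show ?thesis by meson
  qed
  have "?S (bracket x y) = bracket (?S x) y + bracket x (?S y)" for x y
  proof -
    have "(\<lambda>y. ?S (bracket x y)) = (\<lambda>y. bracket (?S x) y + bracket x (?S y))"
      by (rule endo_eq_on_gen[OF eA]) (auto intro!: endoI simp: bracket_simps endo_simps[OF eS] scale_right_distrib algebra_simps 2)
    then show ?thesis by meson
  qed
  then show ?thesis using eS by (simp add: derivation_def)
qed

definition killing :: "'a \<Rightarrow> 'a \<Rightarrow> complex" where
  "killing x y = trace (\<lambda>z. bracket x (bracket y z))"

lemma killing_linear:
  "killing (x + x') y = killing x y + killing x' y"
  "killing x (y + y') = killing x y + killing x y'"
  "killing (sc c x) y = c * killing x y"
  "killing x (sc c y) = c * killing x y"
  unfolding killing_def by (simp_all add: bracket_simps trace_add trace_scale)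

text \<open>The identity tr([A,B]F) = tr(A[B,F]) with F left free: F = ad z gives the invariance of
  the Killing form, F a scaling of ad x gives Cartan's criterion.\<close>

lemma trace_commutator:
  assumes "endo f"
  shows "trace (\<lambda>z. bracket (bracket a b) (f z)) = trace (\<lambda>z. bracket a (bracket b (f z) - f (bracket b z)))"
proof -
  have "trace (\<lambda>z. bracket (bracket a b) (f z)) = trace (\<lambda>z. bracket a (bracket b (f z)) - bracket b (bracket a (f z)))"
    by (simp add: jacobi_derivation[of a b])
  also have "\<dots> = trace (\<lambda>z. bracket a (bracket b (f z))) - trace (\<lambda>z. bracket b (bracket a (f z)))"
    by (rule trace_diff)
  also have "trace (\<lambda>z. bracket b (bracket a (f z))) = trace (\<lambda>z. bracket a (f (bracket b z)))"
    by (rule trace_commute[OF endo_bracket endo_comp[OF endo_bracket assms]])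
  also have "trace (\<lambda>z. bracket a (bracket b (f z))) - trace (\<lambda>z. bracket a (f (bracket b z)))
     = trace (\<lambda>z. bracket a (bracket b (f z) - f (bracket b z)))"
    by (simp add: trace_diff[symmetric] bracket_simps)
  finally show ?thesis .
qed

lemma killing_invariant: "killing (bracket x y) z = killing x (bracket y z)"
proof -
  have "bracket y (bracket z w) - bracket z (bracket y w) = bracket (bracket y z) w" for w
    by (simp add: jacobi_derivation[of y z w])
  then show ?thesis
    unfolding killing_def trace_commutator[OF endo_bracket] by simp
qed

lemma lie_ideal_derived:
  assumes "lie_ideal I" shows "lie_ideal (derived I)"
  unfolding lie_ideal_def
proof (intro conjI allI ballI)
  show "subspace (derived I)" by (simp add: derived_def)
  fix x y assume "y \<in> derived I"
  then show "bracket x y \<in> derived I"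
    unfolding derived_def
  proof (induction y rule: span_induct_alt)
    case base
    then show ?case by (simp add: bracket_simps span_zero)
  next
    case (step c b y)
    then obtain u v where uv: "u \<in> I" "v \<in> I" "b = bracket u v" by blast
    have "bracket x b = bracket (bracket x u) v + bracket u (bracket x v)"
      by (simp add: uv jacobi_derivation[of x u v])
    moreover have "bracket x u \<in> I" "bracket x v \<in> I" using assms uv by (auto simp: lie_ideal_def)
    ultimately have "bracket x b \<in> span {bracket x y |x y. x \<in> I \<and> y \<in> I}"
      using uv by (auto intro!: span_add intro: span_base)
    then show ?case using step by (simp add: bracket_simps span_add span_scale)
  qed
qed

end

section \<open>Cartan's criterion, inner derivations and the Jordan decomposition\<close>

locale semisimple_lie_space = semisimple_lie_algebra sc bracket + lie_space sc bracket Basis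
  for sc :: "complex \<Rightarrow> 'a::ab_group_add \<Rightarrow> 'a" and bracket and Basis
begin

lemma abelian_ideal_zero:
  assumes "lie_ideal I" "\<And>x y. x \<in> I \<Longrightarrow> y \<in> I \<Longrightarrow> bracket x y = 0"
  shows "I = {0}"
proof (rule semisimple[OF assms(1)])
  have "derived I \<subseteq> {0}"
    unfolding derived_def by (rule span_minimal) (use assms(2) in auto)
  moreover have "0 \<in> derived I" by (simp add: derived_def span_zero)
  ultimately show "solvable I" unfolding solvable_def by (intro exI[of _ 1]) auto
qed

lemma center_zero:
  assumes "\<And>y. bracket x y = 0" shows "x = 0"
proof -
  have "{z. \<forall>y. bracket z y = 0} = {0}"
  proof (rule abelian_ideal_zero)
    have "bracket x z = 0" if "\<forall>y. bracket z y = 0" for x z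
      using bracket_swap[of x z] that by simp
    then show "lie_ideal {z. \<forall>y. bracket z y = 0}"
      unfolding lie_ideal_def by (auto intro!: subspaceI simp: bracket_simps)
  qed auto
  then show ?thesis using assms by blast
qed

lemma bracket_eqI:
  assumes "\<And>z. bracket x z = bracket y z" shows "x = y"
  using center_zero[of "x - y"] assms by (simp add: bracket_simps)

text \<open>By Engel's theorem a nonzero D would have a nonzero center, and the center of an ideal
  is an abelian ideal.\<close>

lemma unipotent_ideal_zero:
  assumes D: "lie_ideal D" and "\<And>x. x \<in> D \<Longrightarrow> gen_eigenspace (bracket x) 0 = UNIV"
  shows "D = {0}"
proof (rule ccontr)
  assume "D \<noteq> {0}"
  have sD: "subspace D" and DD: "\<And>x y. y \<in> D \<Longrightarrow> bracket x y \<in> D" using D by (auto simp: lie_ideal_def)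
  have aD: "acts_unipotently D" by (rule engel[OF sD DD assms(2)])
  have D0: "{0} \<subset> D" using \<open>D \<noteq> {0}\<close> subspace_0[OF sD] by blast
  have b0: "\<And>e v. e \<in> D \<Longrightarrow> v \<in> {0} \<Longrightarrow> bracket e v \<in> {0}" by (simp add: bracket_simps)
  obtain v where "v \<in> D" "v \<notin> {0}" "\<And>e. e \<in> D \<Longrightarrow> bracket e v \<in> {0}"
    using acts_unipotentlyD[OF aD sD subspace_single_0 D0 DD b0] by blast
  then have v: "v \<in> D" "v \<noteq> 0" "\<And>e. e \<in> D \<Longrightarrow> bracket e v = 0" by auto
  let ?Z = "{z\<in>D. \<forall>e\<in>D. bracket e z = 0}"
  have "?Z = {0}"
  proof (rule abelian_ideal_zero)
    have "bracket e (bracket x z) = 0" if "z \<in> ?Z" "e \<in> D" for e x z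
    proof -
      have "bracket e x \<in> D"
        using DD[OF that(2), of x] bracket_swap[of e x] subspace_neg[OF sD] by metis
      then show ?thesis unfolding jacobi_derivation[of e x z] using that by (simp add: bracket_simps)
    qed
    then show "lie_ideal ?Z"
      unfolding lie_ideal_def using sD DD
      by (auto intro!: subspaceI simp: bracket_simps subspace_0 subspace_add subspace_scale)
  qed auto
  then show False using v by blast
qed

text \<open>Cartan's criterion. Let K be the radical of the form and x in its derived ideal. The
  conjugated semisimple part T of ad x is a derivation, so [ad b, T] is inner and tr([ad a, ad b] T)
  is a value of the Killing form at a; it vanishes for a in K. Hence ad x is nilpotent, the derived
  ideal of K is zero by Engel, and K is an abelian ideal.\<close>

lemma killing_nondegenerate:
  assumes "\<And>y. killing x y = 0" shows "x = 0"
proof -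
  let ?K = "{x. \<forall>y. killing x y = 0}"
  have killing0: "killing 0 y = 0" for y using killing_linear(3)[of 0 0 y] by simp
  have K: "lie_ideal ?K"
    unfolding lie_ideal_def
  proof (intro conjI allI ballI)
    show "subspace ?K" by (rule subspaceI) (auto simp: killing_linear killing0)
    fix x y assume "y \<in> ?K"
    have "killing (bracket x y) z = - killing (bracket y x) z" for z
      using killing_linear(3)[of "-1" "bracket y x" z] bracket_swap[of x y] by simp
    then show "bracket x y \<in> ?K" using \<open>y \<in> ?K\<close> by (simp add: killing_invariant)
  qed
  have "derived ?K = {0}"
  proof (rule unipotent_ideal_zero[OF lie_ideal_derived[OF K]])
    fix x assume x: "x \<in> derived ?K"
    let ?T = "gen_scaling cnj (bracket x)"
    have T: "derivation ?T" by (rule derivation_gen_scaling[OF derivation_bracket]) simp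
    then have eT: "endo ?T" and dT: "\<And>b z. bracket b (?T z) - ?T (bracket b z) = - bracket (?T b) z"
      by (auto simp: derivation_def)
    have "trace (\<lambda>z. bracket w (?T z)) = 0" if "w \<in> derived ?K" for w
      using that unfolding derived_def
    proof (induction w rule: span_induct_alt)
      case base
      then show ?case using trace_scale[of 0 "\<lambda>x. 0"] by (simp add: bracket_simps)
    next
      case (step c w y)
      then obtain a b where ab: "w = bracket a b" "a \<in> ?K" by blast
      have "trace (\<lambda>z. bracket w (?T z)) = trace (\<lambda>z. sc (-1) (bracket a (bracket (?T b) z)))"
        unfolding ab(1) trace_commutator[OF eT] dT by (simp add: bracket_simps)
      also have "\<dots> = 0" unfolding trace_scale using ab(2) by (simp add: killing_def)
      finally show ?case using step by (simp add: bracket_simps trace_add trace_scale)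
    qed
    then have "trace (\<lambda>z. bracket x (?T z)) = 0" using x by blast
    then show "gen_eigenspace (bracket x) 0 = UNIV" by (rule nilpotent_if_trace_zero[OF endo_bracket])
  qed
  then have "bracket u v = 0" if "u \<in> ?K" "v \<in> ?K" for u v
    using that span_base[of "bracket u v" "{bracket x y |x y. x \<in> ?K \<and> y \<in> ?K}"]
    unfolding derived_def by blast
  from abelian_ideal_zero[OF K this] show ?thesis using assms by blast
qed

text \<open>Nondegeneracy provides y such that \<open>killing y z\<close> is the trace of D composed
  with ad z for every z; then D - ad y is shown to vanish.\<close>

lemma derivation_inner:
  assumes D: "derivation D"
  obtains y where "D = bracket y"
proof -
  have eD: "endo D" and dD: "\<And>x y. D (bracket x y) = bracket (D x) y + bracket x (D y)"
    using D by (auto simp: derivation_def)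
  \<comment> \<open>The map \<kappa> records the functional \<open>killing y\<close> by its values
    on the basis. This makes it an endomorphism, so that injectivity yields surjectivity.\<close>
  define \<kappa> where "\<kappa> y = (\<Sum>b\<in>Basis. sc (killing y b) b)" for y
  have e\<kappa>: "endo \<kappa>"
    by (rule endoI) (simp_all add: \<kappa>_def killing_linear scale_left_distrib sum.distrib scale_sum_right)
  have f_kill: "functional (killing y)" for y by (rule functionalI) (simp_all add: killing_linear)
  have f_D: "functional (\<lambda>z. trace (\<lambda>v. D (bracket z v)))"
    by (rule functionalI) (simp_all add: bracket_simps endo_simps[OF eD] trace_add trace_scale)
  have ext: "l = l'" if "functional l" "functional l'" "\<And>b. b \<in> Basis \<Longrightarrow> l b = l' b" for l l'
  proof
    fix z
    have "z \<in> span Basis" by (simp add: span_Basis)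
    then show "l z = l' z" using functional.linear_eq_on[OF that(1,2), of z Basis] that(3) by blast
  qed
  have "inj \<kappa>"
    unfolding endo.linear_inj_iff_eq_0[OF e\<kappa>]
  proof (intro allI impI)
    fix y assume "\<kappa> y = 0"
    then have "killing y b = 0" if "b \<in> Basis" for b
      using independentD[OF independent_Basis finite_Basis subset_refl, of "killing y" b] that by (simp add: \<kappa>_def)
    then have "killing y = (\<lambda>z. 0)" by (intro ext f_kill functionalI) auto
    then show "y = 0" by (intro killing_nondegenerate) simp
  qed
  then have "surj \<kappa>" by (rule linear_inj_imp_surj[OF e\<kappa>])
  then obtain y where "(\<Sum>b\<in>Basis. sc (trace (\<lambda>v. D (bracket b v))) b) = \<kappa> y" by (rule surjE)
  then have y: "\<kappa> y = (\<Sum>b\<in>Basis. sc (trace (\<lambda>v. D (bracket b v))) b)" by (rule sym)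
  then have "(\<Sum>b\<in>Basis. sc (killing y b - trace (\<lambda>v. D (bracket b v))) b) = 0"
    by (simp add: \<kappa>_def scale_left_diff_distrib sum_subtractf)
  then have "killing y b = trace (\<lambda>v. D (bracket b v))" if "b \<in> Basis" for b
    using independentD[OF independent_Basis finite_Basis subset_refl, of "\<lambda>b. killing y b - trace (\<lambda>v. D (bracket b v))" b] that
    by simp
  then have ky: "killing y = (\<lambda>z. trace (\<lambda>v. D (bracket z v)))" by (intro ext f_kill f_D)
  \<comment> \<open>The derivation E has trace zero against every ad z. As ad (E x) is the
    commutator of E and ad x, cyclicity of the trace rewrites \<open>killing (E x) z\<close> as the
    trace of E composed with ad [x, z].\<close>
  define E where "E x = D x - bracket y x" for x
  have dE: "E (bracket x z) = bracket (E x) z + bracket x (E z)" for x z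
    by (simp add: E_def dD jacobi_derivation[of y x z] bracket_simps algebra_simps)
  have eE: "endo E"
    by (rule endoI) (simp_all add: E_def endo_simps[OF eD] bracket_simps scale_right_diff_distrib algebra_simps)
  have trE: "trace (\<lambda>v. E (bracket z v)) = 0" for z
    using fun_cong[OF ky, of z] by (simp add: E_def trace_diff killing_def)
  have "E x = 0" for x
  proof (rule killing_nondegenerate)
    fix z
    have "killing (E x) z = trace (\<lambda>v. E (bracket x (bracket z v)) - bracket x (E (bracket z v)))"
      by (simp add: killing_def dE)
    also have "\<dots> = trace (\<lambda>v. E (bracket x (bracket z v))) - trace (\<lambda>v. bracket x (E (bracket z v)))"
      by (rule trace_diff)
    also have "trace (\<lambda>v. bracket x (E (bracket z v))) = trace (\<lambda>v. E (bracket z (bracket x v)))"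
      by (rule trace_commute[OF endo_bracket endo_comp[OF eE endo_bracket]])
    also have "trace (\<lambda>v. E (bracket x (bracket z v))) - trace (\<lambda>v. E (bracket z (bracket x v)))
       = trace (\<lambda>v. E (bracket (bracket x z) v))"
      by (simp add: trace_diff[symmetric] jacobi_derivation[of x z] endo_simps[OF eE])
    finally show "killing (E x) z = 0" by (simp add: trE)
  qed
  then have "D = bracket y" by (auto simp: E_def)
  then show ?thesis by (rule that)
qed

lemma jordan_semisimple:
  obtains s where "bracket s = semisimple_part (bracket x)"
  using derivation_inner[OF derivation_gen_scaling[OF derivation_bracket, of "\<lambda>\<mu>. \<mu>" x]] by metis

end

section \<open>Exponentials\<close>

context fd_space
begin

abbreviation coord :: "'a \<Rightarrow> 'a \<Rightarrow> complex" where
  "coord b v \<equiv> representation Basis v b"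

lemma functional_coord: "functional (coord b)"
  using coords_linear[OF independent_Basis span_Basis] .

lemmas coord_simps = functional_simps[OF functional_coord]

lemma coord_expansion: "(\<Sum>b\<in>Basis. sc (coord b v) b) = v"
  by (rule basis_expansion[OF independent_Basis span_Basis])

lemma functional_expansion:
  assumes l: "functional l" shows "l v = (\<Sum>b\<in>Basis. coord b v * l b)"
  using arg_cong[OF coord_expansion[of v], of l]
  unfolding functional.linear_sum[OF l] functional.linear_scale[OF l] by (rule sym)

lemma coord_eqI:
  assumes "\<And>b. b \<in> Basis \<Longrightarrow> coord b v = coord b w" shows "v = w"
proof -
  have "(\<Sum>b\<in>Basis. sc (coord b v) b) = (\<Sum>b\<in>Basis. sc (coord b w) b)"
    by (rule sum.cong) (simp_all only: assms)
  then show ?thesis unfolding coord_expansion .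
qed

lemma coord_sum_Basis: "b \<in> Basis \<Longrightarrow> coord b (\<Sum>c\<in>Basis. sc (f c) c) = f b"
  using finite_Basis by (simp add: coord_simps representation_basis[OF independent_Basis] if_distrib sum.delta' cong: if_cong)

text \<open>The type \<open>'a\<close> carries no norm or topology; the l1 norm of the coordinates
  serves for all estimates.\<close>

definition nrm :: "'a \<Rightarrow> real" where
  "nrm v = (\<Sum>b\<in>Basis. cmod (coord b v))"

lemma nrm_nonneg [simp]: "nrm v \<ge> 0"
  by (simp add: nrm_def sum_nonneg)

lemma nrm_0 [simp]: "nrm 0 = 0"
  by (simp add: nrm_def coord_simps)

lemma nrm_eq_0: "nrm v = 0 \<Longrightarrow> v = 0"
  by (rule coord_eqI) (simp add: nrm_def sum_nonneg_eq_0_iff[OF finite_Basis] coord_simps)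

lemma nrm_add: "nrm (v + w) \<le> nrm v + nrm w"
  unfolding nrm_def sum.distrib[symmetric] by (rule sum_mono) (simp add: coord_simps norm_triangle_ineq)

lemma nrm_scale: "nrm (sc c v) = cmod c * nrm v"
  by (simp add: nrm_def coord_simps norm_mult sum_distrib_left)

lemma nrm_minus: "nrm (- v) = nrm v"
  by (simp add: nrm_def coord_simps)

lemma nrm_diff: "nrm (v - w) \<le> nrm v + nrm w"
  using nrm_add[of v "- w"] by (simp add: nrm_minus)

lemma nrm_minus_commute: "nrm (v - w) = nrm (w - v)"
  using nrm_minus[of "v - w"] by simp

lemma coord_le_nrm: "b \<in> Basis \<Longrightarrow> cmod (coord b v) \<le> nrm v"
  unfolding nrm_def using finite_Basis by (intro member_le_sum) auto

lemma functional_bound: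
  assumes l: "functional l"
  shows "\<exists>C\<ge>0. \<forall>v. cmod (l v) \<le> C * nrm v"
proof (intro exI conjI allI)
  let ?C = "\<Sum>b\<in>Basis. cmod (l b)"
  show "?C \<ge> 0" by (simp add: sum_nonneg)
  fix v
  have "cmod (l v) \<le> (\<Sum>b\<in>Basis. cmod (coord b v) * cmod (l b))"
    unfolding functional_expansion[OF l, of v] norm_mult[symmetric] by (rule norm_sum)
  also have "\<dots> \<le> (\<Sum>b\<in>Basis. nrm v * cmod (l b))"
    by (rule sum_mono) (simp add: coord_le_nrm mult_right_mono)
  finally show "cmod (l v) \<le> ?C * nrm v" by (simp add: sum_distrib_left mult.commute)
qed

lemma endo_bound:
  assumes A: "endo A"
  shows "\<exists>C\<ge>0. \<forall>v. nrm (A v) \<le> C * nrm v"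
proof -
  have "\<exists>C. C \<ge> 0 \<and> (\<forall>v. cmod (coord b (A v)) \<le> C * nrm v)" for b
    using functional_bound[OF functional_comp[OF functional_coord A]] by blast
  then obtain C where C: "\<And>b. C b \<ge> 0" "\<And>b v. cmod (coord b (A v)) \<le> C b * nrm v" by metis
  have "nrm (A v) \<le> (\<Sum>b\<in>Basis. C b) * nrm v" for v
    unfolding nrm_def[of "A v"] sum_distrib_right by (rule sum_mono) (rule C(2))
  moreover have "(\<Sum>b\<in>Basis. C b) \<ge> 0" by (simp add: sum_nonneg C(1))
  ultimately show ?thesis by blast
qed

lemma endo_pow_bound:
  assumes C: "C \<ge> 0" "\<And>v. nrm (A v) \<le> C * nrm v"
  shows "nrm ((A ^^ n) v) \<le> C ^ n * nrm v"
proof (induction n)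
  case (Suc n)
  have "nrm ((A ^^ Suc n) v) \<le> C * nrm ((A ^^ n) v)" using C(2) by simp
  also have "\<dots> \<le> C * (C ^ n * nrm v)" using Suc C(1) by (rule mult_left_mono)
  finally show ?case by simp
qed simp

lemma expo_summable:
  assumes A: "endo A" and l: "functional l"
  shows "summable (\<lambda>n. l ((A ^^ n) v) / fact n * t ^ n)"
proof -
  obtain C where C: "C \<ge> 0" "\<And>v. nrm (A v) \<le> C * nrm v" using endo_bound[OF A] by blast
  obtain K where K: "K \<ge> 0" "\<And>v. cmod (l v) \<le> K * nrm v" using functional_bound[OF l] by blast
  have s: "summable (\<lambda>n. K * nrm v * (inverse (fact n) * (C * cmod t) ^ n))"
    by (intro summable_mult summable_exp)
  have "norm (l ((A ^^ n) v) / fact n * t ^ n) \<le> K * nrm v * (inverse (fact n) * (C * cmod t) ^ n)" for n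
  proof -
    have "cmod (l ((A ^^ n) v)) \<le> K * nrm ((A ^^ n) v)" by (rule K(2))
    also have "\<dots> \<le> K * (C ^ n * nrm v)" using endo_pow_bound[OF C] K(1) by (rule mult_left_mono)
    finally have "cmod (l ((A ^^ n) v)) * (inverse (fact n) * cmod t ^ n) \<le> K * (C ^ n * nrm v) * (inverse (fact n) * cmod t ^ n)"
      by (rule mult_right_mono) simp
    then show ?thesis by (simp add: norm_mult norm_divide norm_power power_mult_distrib field_simps)
  qed
  then show ?thesis by (intro summable_comparison_test'[OF s])
qed

text \<open>This is exp(tA). The series is summed coordinate by coordinate because \<open>'a\<close>
  has no topology; by \<open>expo_sums\<close> every functional then sees the usual exponential
  series.\<close>

definition expo :: "('a \<Rightarrow> 'a) \<Rightarrow> complex \<Rightarrow> 'a \<Rightarrow> 'a" where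
  "expo A t v = (\<Sum>b\<in>Basis. sc (\<Sum>n. coord b ((A ^^ n) v) / fact n * t ^ n) b)"

lemma expo_sums:
  assumes A: "endo A" and l: "functional l"
  shows "(\<lambda>n. l ((A ^^ n) v) / fact n * t ^ n) sums l (expo A t v)"
proof -
  have "(\<lambda>n. \<Sum>b\<in>Basis. (coord b ((A ^^ n) v) / fact n * t ^ n) * l b) sums
     (\<Sum>b\<in>Basis. (\<Sum>n. coord b ((A ^^ n) v) / fact n * t ^ n) * l b)"
    by (intro sums_sum sums_mult2 summable_sums expo_summable[OF A functional_coord])
  also have "(\<Sum>b\<in>Basis. (\<Sum>n. coord b ((A ^^ n) v) / fact n * t ^ n) * l b) = l (expo A t v)"
    unfolding expo_def functional.linear_sum[OF l] functional.linear_scale[OF l] by (rule refl)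
  also have "(\<lambda>n. \<Sum>b\<in>Basis. (coord b ((A ^^ n) v) / fact n * t ^ n) * l b) = (\<lambda>n. l ((A ^^ n) v) / fact n * t ^ n)"
  proof
    fix n
    have "l ((A ^^ n) v) / fact n * t ^ n = (\<Sum>b\<in>Basis. coord b ((A ^^ n) v) * l b / fact n * t ^ n)"
      by (simp only: functional_expansion[OF l, of "(A ^^ n) v"] sum_divide_distrib sum_distrib_right)
    also have "\<dots> = (\<Sum>b\<in>Basis. (coord b ((A ^^ n) v) / fact n * t ^ n) * l b)"
      by (rule sum.cong) simp_all
    finally show "(\<Sum>b\<in>Basis. (coord b ((A ^^ n) v) / fact n * t ^ n) * l b) = l ((A ^^ n) v) / fact n * t ^ n"
      by (rule sym)
  qed
  finally show ?thesis .
qed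

lemma expo_suminf: "endo A \<Longrightarrow> functional l \<Longrightarrow> l (expo A t v) = (\<Sum>n. l ((A ^^ n) v) / fact n * t ^ n)"
  using expo_sums by (rule sums_unique)

lemma expo_0 [simp]: assumes A: "endo A" shows "expo A 0 v = v"
proof (rule functional_eqI)
  fix l assume l: "functional l"
  show "l (expo A 0 v) = l v"
    unfolding expo_suminf[OF A l] powser_zero by simp
qed

lemma endo_expo: assumes A: "endo A" shows "endo (expo A t)"
proof (rule endoI)
  fix x y
  show "expo A t (x + y) = expo A t x + expo A t y"
  proof (rule functional_eqI)
    fix l assume l: "functional l"
    have "(\<lambda>n. l ((A ^^ n) x) / fact n * t ^ n + l ((A ^^ n) y) / fact n * t ^ n) sums (l (expo A t x) + l (expo A t y))"
      by (intro sums_add expo_sums A l)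
    then have "(\<lambda>n. l ((A ^^ n) (x + y)) / fact n * t ^ n) sums (l (expo A t x) + l (expo A t y))"
      by (simp add: endo_simps[OF endo_funpow[OF A]] functional_simps[OF l] add_divide_distrib distrib_right)
    then show "l (expo A t (x + y)) = l (expo A t x + expo A t y)"
      unfolding functional.linear_add[OF l] by (rule sums_unique2[OF expo_sums[OF A l]])
  qed
next
  fix c x
  show "expo A t (sc c x) = sc c (expo A t x)"
  proof (rule functional_eqI)
    fix l assume l: "functional l"
    have "(\<lambda>n. c * (l ((A ^^ n) x) / fact n * t ^ n)) sums (c * l (expo A t x))"
      by (intro sums_mult expo_sums A l)
    moreover have "l ((A ^^ n) (sc c x)) / fact n * t ^ n = c * (l ((A ^^ n) x) / fact n * t ^ n)" for n
      unfolding endo.linear_scale[OF endo_funpow[OF A]] functional.linear_scale[OF l] by simp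
    ultimately have "(\<lambda>n. l ((A ^^ n) (sc c x)) / fact n * t ^ n) sums (c * l (expo A t x))"
      by (simp only:)
    then show "l (expo A t (sc c x)) = l (sc c (expo A t x))"
      unfolding functional.linear_scale[OF l] by (rule sums_unique2[OF expo_sums[OF A l]])
  qed
qed

lemma expo_commute:
  assumes A: "endo A" and B: "endo B" and BA: "\<And>x. B (A x) = A (B x)"
  shows "B (expo A t v) = expo A t (B v)"
proof (rule functional_eqI)
  fix l assume l: "functional l"
  have "l (B (expo A t v)) = (\<Sum>n. l (B ((A ^^ n) v)) / fact n * t ^ n)"
    by (rule expo_suminf[OF A functional_comp[OF l B]])
  then show "l (B (expo A t v)) = l (expo A t (B v))"
    by (simp add: expo_suminf[OF A l] funpow_commute[of B A, OF BA])
qed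

lemma expo_fixed:
  assumes A: "endo A" and "A v = 0" shows "expo A t v = v"
proof (rule functional_eqI)
  fix l assume l: "functional l"
  have "(A ^^ n) v = (if n = 0 then v else 0)" for n
    by (induction n) (auto simp: assms(2) endo_simps[OF A])
  then have "(\<lambda>n. l ((A ^^ n) v) / fact n * t ^ n) = (\<lambda>n. if n = 0 then l v else 0)"
    by (auto simp: fun_eq_iff functional_simps[OF l])
  then have "(\<lambda>n. l ((A ^^ n) v) / fact n * t ^ n) sums l v" using sums_single[of 0 "\<lambda>_. l v"] by simp
  then show "l (expo A t v) = l v" by (rule sums_unique2[OF expo_sums[OF A l]])
qed

lemma expo_in_subspace:
  assumes A: "endo A" and U: "subspace U" "\<And>u. u \<in> U \<Longrightarrow> A u \<in> U" "v \<in> U"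
  shows "expo A t v \<in> U"
proof (rule ccontr)
  assume "expo A t v \<notin> U"
  then obtain l where l: "functional l" "\<forall>u\<in>U. l u = 0" "l (expo A t v) = 1"
    using separating_functional[OF U(1)] by blast
  have "(A ^^ n) v \<in> U" for n by (induction n) (auto simp: U)
  then have "l (expo A t v) = 0" using l(2) by (simp add: expo_suminf[OF A l(1)])
  then show False using l(3) by simp
qed

text \<open>A weak derivative, tested on functionals; in finite dimension this is the ordinary
  derivative of a curve.\<close>

definition has_vd :: "(complex \<Rightarrow> 'a) \<Rightarrow> 'a \<Rightarrow> complex \<Rightarrow> bool" where
  "has_vd w w' t \<longleftrightarrow> (\<forall>l. functional l \<longrightarrow> ((\<lambda>t. l (w t)) has_field_derivative l w') (at t))"

lemma has_vdD: "has_vd w w' t \<Longrightarrow> functional l \<Longrightarrow> ((\<lambda>t. l (w t)) has_field_derivative l w') (at t)"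
  by (simp add: has_vd_def)

lemma has_vd_expo: assumes A: "endo A" shows "has_vd (\<lambda>t. expo A t v) (expo A t (A v)) t"
  unfolding has_vd_def
proof (intro allI impI)
  fix l assume l: "functional l"
  let ?c = "\<lambda>n. l ((A ^^ n) v) / fact n"
  have "((\<lambda>t. \<Sum>n. ?c n * t ^ n) has_field_derivative (\<Sum>n. diffs ?c n * t ^ n)) (at t)"
    by (intro termdiffs_strong_converges_everywhere expo_summable A l)
  moreover have "diffs ?c = (\<lambda>n. l ((A ^^ n) (A v)) / fact n)"
    by (simp add: diffs_def fun_eq_iff funpow_swap1 field_simps del: of_nat_Suc)
  ultimately show "((\<lambda>t. l (expo A t v)) has_field_derivative l (expo A t (A v))) (at t)"
    by (simp add: expo_suminf[OF A l])
qed

text \<open>Operator and vector both vary. Expanding the vector in the basis reduces the claim to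
  the product rule for complex functions.\<close>

lemma has_vd_expo_comp:
  assumes A: "endo A" and w: "has_vd w w' t"
  shows "has_vd (\<lambda>t. expo A t (w t)) (expo A t w' + expo A t (A (w t))) t"
  unfolding has_vd_def
proof (intro allI impI)
  fix l assume l: "functional l"
  have lE: "functional (\<lambda>v. l (expo A t v))" for t by (rule functional_comp[OF l endo_expo[OF A]])
  have "((\<lambda>t. \<Sum>b\<in>Basis. coord b (w t) * l (expo A t b)) has_field_derivative
     (\<Sum>b\<in>Basis. coord b w' * l (expo A t b) + l (expo A t (A b)) * coord b (w t))) (at t)"
    by (rule DERIV_sum, rule DERIV_mult[OF has_vdD[OF w functional_coord] has_vdD[OF has_vd_expo[OF A] l]])
  moreover have "(\<Sum>b\<in>Basis. coord b w' * l (expo A t b) + l (expo A t (A b)) * coord b (w t))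
     = l (expo A t w' + expo A t (A (w t)))"
    unfolding functional.linear_add[OF l] functional_expansion[OF lE, of t w']
      functional_expansion[OF functional_comp[OF lE A], of t "w t"] sum.distrib
    by (simp add: mult.commute)
  ultimately show "((\<lambda>t. l (expo A t (w t))) has_field_derivative l (expo A t w' + expo A t (A (w t)))) (at t)"
    by (subst functional_expansion[OF lE]) (simp only:)
qed

lemma has_vd_zero_constant:
  assumes "\<And>t. has_vd w 0 t" shows "w t = w 0"
proof (rule functional_eqI)
  fix l assume l: "functional l"
  have "((\<lambda>t. l (w t)) has_field_derivative 0) (at t within UNIV)" for t
    using has_vdD[OF assms l] by (simp add: functional_simps[OF l])
  then obtain c where "\<forall>t\<in>UNIV. l (w t) = c"
    using has_field_derivative_zero_constant[of UNIV "\<lambda>t. l (w t)"] by auto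
  then show "l (w t) = l (w 0)" by simp
qed

lemma endo_uminus: "endo A \<Longrightarrow> endo (\<lambda>x. - A x)"
  by (rule endoI) (simp_all only: endo.linear_add endo.linear_scale scale_minus_right minus_add_distrib)

text \<open>The curve exp(-tA) exp(tA) v has derivative zero, so it keeps its value at t =
  0.\<close>

lemma expo_inverse:
  assumes A: "endo A" shows "expo (\<lambda>x. - A x) t (expo A t v) = v"
proof -
  let ?B = "\<lambda>x. - A x"
  have B: "endo ?B" by (rule endo_uminus[OF A])
  have AE: "A (expo A t v) = expo A t (A v)" for t v by (rule expo_commute[OF A A]) simp
  have "has_vd (\<lambda>t. expo ?B t (expo A t v)) 0 t" for t
    using has_vd_expo_comp[OF B has_vd_expo[OF A, of v]]
    by (simp add: AE endo_simps[OF endo_expo[OF B]])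
  from has_vd_zero_constant[of "\<lambda>t. expo ?B t (expo A t v)", OF this] show ?thesis by (simp add: A B)
qed

lemma expo_inverse': "endo A \<Longrightarrow> expo A t (expo (\<lambda>x. - A x) t v) = v"
  using expo_inverse[OF endo_uminus, of A t v] by simp

lemma bij_expo: "endo A \<Longrightarrow> bij (expo A t)"
  by (rule o_bij[of "expo (\<lambda>x. - A x) t"]) (auto simp: fun_eq_iff expo_inverse expo_inverse')

lemma inv_expo: "endo A \<Longrightarrow> inv_into UNIV (expo A t) v = expo (\<lambda>x. - A x) t v"
  by (rule inv_into_f_eq) (auto simp: bij_is_inj[OF bij_expo] expo_inverse')

definition matrix_coeffs :: "(('a \<Rightarrow> 'a) \<Rightarrow> complex) set" where
  "matrix_coeffs = {(\<lambda>g. l (g v)) | l v. functional l} \<union> {(\<lambda>g. l (inv_into UNIV g v)) | l v. functional l}"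

lemma regular_linear_group: "regular (linear_group sc H) = function_algebra H matrix_coeffs"
  by (simp add: linear_group_def matrix_coeffs_def)

end

context lie_space
begin

lemma has_vd_bracket:
  assumes x: "has_vd x x' t" and y: "has_vd y y' t"
  shows "has_vd (\<lambda>t. bracket (x t) (y t)) (bracket x' (y t) + bracket (x t) y') t"
  unfolding has_vd_def
proof (intro allI impI)
  fix l assume l: "functional l"
  have ex: "l (bracket u v) = (\<Sum>b\<in>Basis. \<Sum>c\<in>Basis. coord b u * coord c v * l (bracket b c))" for u v
  proof -
    have "functional (\<lambda>u. l (bracket u v))" for v
      by (rule functionalI) (simp_all add: bracket_simps functional_simps[OF l])
    from functional_expansion[OF this, of u v]
    have "l (bracket u v) = (\<Sum>b\<in>Basis. coord b u * l (bracket b v))" .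
    also have "\<dots> = (\<Sum>b\<in>Basis. \<Sum>c\<in>Basis. coord b u * coord c v * l (bracket b c))"
    proof (rule sum.cong[OF refl])
      fix b
      have "l (bracket b v) = (\<Sum>c\<in>Basis. coord c v * l (bracket b c))"
        by (rule functional_expansion[OF functional_comp[OF l endo_bracket]])
      then show "coord b u * l (bracket b v) = (\<Sum>c\<in>Basis. coord b u * coord c v * l (bracket b c))"
        by (simp only: sum_distrib_left mult.assoc)
    qed
    finally show ?thesis .
  qed
  have r: "(a * d + e * c) * k = a * d * k + c * e * k" for a d e c k :: complex
    by (simp add: distrib_right)
  have "((\<lambda>t. \<Sum>b\<in>Basis. \<Sum>c\<in>Basis. coord b (x t) * coord c (y t) * l (bracket b c)) has_field_derivative
     (\<Sum>b\<in>Basis. \<Sum>c\<in>Basis. (coord b x' * coord c (y t) + coord c y' * coord b (x t)) * l (bracket b c))) (at t)"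
    by (rule DERIV_sum, rule DERIV_sum, rule DERIV_cmult_right,
        rule DERIV_mult[OF has_vdD[OF x functional_coord] has_vdD[OF y functional_coord]])
  moreover have "(\<Sum>b\<in>Basis. \<Sum>c\<in>Basis. (coord b x' * coord c (y t) + coord c y' * coord b (x t)) * l (bracket b c))
     = l (bracket x' (y t) + bracket (x t) y')"
    unfolding functional.linear_add[OF l] ex[of x' "y t"] ex[of "x t" y'] sum.distrib[symmetric] r
    by (rule refl)
  moreover have "(\<lambda>t. l (bracket (x t) (y t))) = (\<lambda>t. \<Sum>b\<in>Basis. \<Sum>c\<in>Basis. coord b (x t) * coord c (y t) * l (bracket b c))"
    by (rule ext) (rule ex)
  ultimately show "((\<lambda>t. l (bracket (x t) (y t))) has_field_derivative l (bracket x' (y t) + bracket (x t) y')) (at t)"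
    by (simp only:)
qed

text \<open>By the Leibniz rule the curve exp(-tD) [exp(tD) x, exp(tD) y] has derivative zero, so it
  is constantly [x, y].\<close>

lemma expo_derivation_bracket:
  assumes D: "derivation D"
  shows "expo D t (bracket x y) = bracket (expo D t x) (expo D t y)"
proof -
  have eD: "endo D" and dD: "\<And>x y. D (bracket x y) = bracket (D x) y + bracket x (D y)"
    using D by (auto simp: derivation_def)
  let ?B = "\<lambda>x. - D x"
  have B: "endo ?B" by (rule endo_uminus[OF eD])
  have DE: "expo D t (D v) = D (expo D t v)" for t v by (rule expo_commute[OF eD eD, symmetric]) simp
  let ?w = "\<lambda>t. expo ?B t (bracket (expo D t x) (expo D t y))"
  have "has_vd ?w 0 t" for t
    using has_vd_expo_comp[OF B has_vd_bracket[OF has_vd_expo[OF eD, where v = x and t = t] has_vd_expo[OF eD, where v = y and t = t]]]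
    by (simp add: DE dD endo_simps[OF endo_expo[OF B]])
  from has_vd_zero_constant[of ?w, OF this]
  have "expo ?B t (bracket (expo D t x) (expo D t y)) = bracket x y" by (simp add: eD B)
  then have "expo D t (expo ?B t (bracket (expo D t x) (expo D t y))) = expo D t (bracket x y)" by simp
  then show ?thesis by (simp add: expo_inverse'[OF eD])
qed

lemma expo_automorphism: "derivation D \<Longrightarrow> expo D t \<in> lie_automorphisms sc bracket"
  by (simp add: lie_automorphisms_def expo_derivation_bracket endo_expo bij_expo derivation_def)

end

section \<open>Closed linear groups\<close>

text \<open>The generators extend, and with them constants, sums and products. This moves a regular
  function from a subgroup to the larger set whose Zariski topology is in force.\<close>

lemma function_algebra_extend:
  assumes "H \<subseteq> X" "f \<in> function_algebra H S"
  shows "\<exists>f'\<in>function_algebra X S. f = restrict f' H"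
  using assms(2)
proof induction
  case (generator f)
  have "restrict f H = restrict (restrict f X) H" using assms(1) by (auto simp: fun_eq_iff restrict_def)
  then show ?case using function_algebra.generator[OF generator] by blast
next
  case (const c)
  have "(\<lambda>x\<in>H. c) = restrict (\<lambda>x\<in>X. c) H" using assms(1) by (auto simp: fun_eq_iff restrict_def)
  then show ?case using function_algebra.const by blast
next
  case (add f g)
  then obtain f' g' where fg: "f' \<in> function_algebra X S" "f = restrict f' H" "g' \<in> function_algebra X S" "g = restrict g' H"
    by blast
  then have "(\<lambda>x\<in>H. f x + g x) = restrict (\<lambda>x\<in>X. f' x + g' x) H"
    using assms(1) by (auto simp: fun_eq_iff restrict_def)
  then show ?case using function_algebra.add[OF fg(1,3)] by blast
next
  case (mult f g)
  then obtain f' g' where fg: "f' \<in> function_algebra X S" "f = restrict f' H" "g' \<in> function_algebra X S" "g = restrict g' H"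
    by blast
  then have "(\<lambda>x\<in>H. f x * g x) = restrict (\<lambda>x\<in>X. f' x * g' x) H"
    using assms(1) by (auto simp: fun_eq_iff restrict_def)
  then show ?case using function_algebra.mult[OF fg(1,3)] by blast
qed

text \<open>The nonvanishing sets are closed under intersection by taking products, so they form a
  base and not only a subbase of the topology.\<close>

lemma zariski_open_iff:
  "openin (zariski X (function_algebra X S)) U \<longleftrightarrow>
     U \<subseteq> X \<and> (\<forall>x\<in>U. \<exists>f\<in>function_algebra X S. f x \<noteq> 0 \<and> {y \<in> X. f y \<noteq> 0} \<subseteq> U)"
    (is "_ \<longleftrightarrow> ?R U")
proof
  let ?B = "{{x \<in> X. f x \<noteq> 0} |f. f \<in> function_algebra X S}"
  assume "openin (zariski X (function_algebra X S)) U"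
  then have "generate_topology_on ?B U" unfolding zariski_def by (rule openin_topology_generated_by)
  then show "?R U"
  proof induction
    case (Int a b)
    show ?case
    proof (intro conjI ballI)
      show "a \<inter> b \<subseteq> X" using Int by blast
      fix x assume x: "x \<in> a \<inter> b"
      then obtain f g where fg: "f \<in> function_algebra X S" "f x \<noteq> 0" "{y \<in> X. f y \<noteq> 0} \<subseteq> a"
        "g \<in> function_algebra X S" "g x \<noteq> 0" "{y \<in> X. g y \<noteq> 0} \<subseteq> b" using Int by blast
      have "x \<in> X" using x Int by blast
      then show "\<exists>f\<in>function_algebra X S. f x \<noteq> 0 \<and> {y \<in> X. f y \<noteq> 0} \<subseteq> a \<inter> b"
        using fg by (intro bexI[OF _ function_algebra.mult[OF fg(1,4)]]) auto
    qed
  next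
    case (UN K)
    show ?case
    proof (intro conjI ballI)
      show "\<Union> K \<subseteq> X" using UN by blast
      fix x assume "x \<in> \<Union> K"
      then obtain k where k: "k \<in> K" "x \<in> k" by blast
      then obtain f where "f \<in> function_algebra X S" "f x \<noteq> 0" "{y \<in> X. f y \<noteq> 0} \<subseteq> k" using UN by blast
      then show "\<exists>f\<in>function_algebra X S. f x \<noteq> 0 \<and> {y \<in> X. f y \<noteq> 0} \<subseteq> \<Union> K" using k by blast
    qed
  qed auto
next
  assume R: "?R U"
  have "openin (zariski X (function_algebra X S)) {y \<in> X. f y \<noteq> 0}" if "f \<in> function_algebra X S" for f
    unfolding zariski_def using that by (intro topology_generated_by_Basis) blast
  then have "openin (zariski X (function_algebra X S)) (\<Union>{{y \<in> X. f y \<noteq> 0} |f. f \<in> function_algebra X S \<and> {y \<in> X. f y \<noteq> 0} \<subseteq> U})"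
    by (intro openin_Union) auto
  moreover have "\<Union>{{y \<in> X. f y \<noteq> 0} |f. f \<in> function_algebra X S \<and> {y \<in> X. f y \<noteq> 0} \<subseteq> U} = U"
    using R by blast
  ultimately show "openin (zariski X (function_algebra X S)) U" by simp
qed

lemma topspace_zariski [simp]: "topspace (zariski X (function_algebra X S)) = X"
proof
  have "openin (zariski X (function_algebra X S)) X"
    unfolding zariski_open_iff by (auto intro!: bexI[OF _ function_algebra.const[of 1]])
  then show "X \<subseteq> topspace (zariski X (function_algebra X S))" by (rule openin_subset)
  show "topspace (zariski X (function_algebra X S)) \<subseteq> X"
    using openin_topspace[of "zariski X (function_algebra X S)"] unfolding zariski_open_iff by blast
qed

lemma zariski_closed_separation:
  assumes "closedin (zariski X (function_algebra X S)) C" "x \<in> X" "x \<notin> C"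
  shows "\<exists>f\<in>function_algebra X S. f x \<noteq> 0 \<and> (\<forall>y\<in>C. f y = 0)"
proof -
  have "openin (zariski X (function_algebra X S)) (X - C)" and C: "C \<subseteq> X"
    using assms(1) by (auto simp: closedin_def)
  then obtain f where "f \<in> function_algebra X S" "f x \<noteq> 0" "{y \<in> X. f y \<noteq> 0} \<subseteq> X - C"
    unfolding zariski_open_iff using assms(2,3) by blast
  then show ?thesis using C by blast
qed

text \<open>Nonvanishing sets pull back to Euclidean open sets, so the curve is continuous into the
  Zariski topology and transports the connectedness of the complex plane.\<close>

lemma connectedin_zariski_curve:
  fixes c :: "complex \<Rightarrow> 'g"
  assumes "\<And>t. c t \<in> X" "\<And>f. f \<in> function_algebra X S \<Longrightarrow> continuous_on UNIV (\<lambda>t. f (c t))"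
  shows "connectedin (zariski X (function_algebra X S)) (range c)"
proof -
  have "continuous_map euclidean (zariski X (function_algebra X S)) c"
    unfolding zariski_def
  proof (rule continuous_on_generated_topo)
    fix U assume "U \<in> {{x \<in> X. f x \<noteq> 0} |f. f \<in> function_algebra X S}"
    then obtain f where f: "f \<in> function_algebra X S" "U = {x \<in> X. f x \<noteq> 0}" by blast
    have "open {t. f (c t) \<noteq> 0}"
      using assms(2)[OF f(1)] by (intro open_Collect_neq) auto
    then show "openin euclidean (c -` U \<inter> topspace euclidean)"
      using assms(1) by (simp add: f(2) vimage_def)
  next
    show "c ` topspace euclidean \<subseteq> \<Union> {{x \<in> X. f x \<noteq> 0} |f. f \<in> function_algebra X S}"
    proof
      fix y assume "y \<in> c ` topspace euclidean"
      then have y: "y \<in> X" using assms(1) by blast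
      have "{x \<in> X. (\<lambda>x\<in>X. (1::complex)) x \<noteq> 0} \<in> {{x \<in> X. f x \<noteq> 0} |f. f \<in> function_algebra X S}"
        using function_algebra.const by blast
      then show "y \<in> \<Union> {{x \<in> X. f x \<noteq> 0} |f. f \<in> function_algebra X S}" by (rule UnionI) (use y in simp)
    qed
  qed
  then show ?thesis
    by (rule connectedin_continuous_map_image) (simp add: connectedin_iff_connected connected_UNIV)
qed

section \<open>Regular functions and point derivations of a linear group\<close>

context fd_space
begin

abbreviation regular_functions :: "('a \<Rightarrow> 'a) set \<Rightarrow> (('a \<Rightarrow> 'a) \<Rightarrow> complex) set" where
  "regular_functions H \<equiv> function_algebra H matrix_coeffs"

lemma matrix_coeffs_cases:
  assumes "f \<in> matrix_coeffs"
  obtains l v where "functional l" "f = (\<lambda>g. l (g v))" | l v where "functional l" "f = (\<lambda>g. l (inv_into UNIV g v))"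
  using assms unfolding matrix_coeffs_def by blast

lemma regular_coeff: "functional l \<Longrightarrow> (\<lambda>g\<in>H. l (g v)) \<in> regular_functions H"
  by (rule function_algebra.generator) (auto simp: matrix_coeffs_def)

lemma regular_inv_coeff: "functional l \<Longrightarrow> (\<lambda>g\<in>H. l (inv_into UNIV g v)) \<in> regular_functions H"
  by (rule function_algebra.generator) (auto simp: matrix_coeffs_def)

lemma inv_comp: "bij f \<Longrightarrow> bij g \<Longrightarrow> inv_into UNIV (f \<circ> g) v = inv_into UNIV g (inv_into UNIV f v)"
  by (simp add: o_inv_distrib)

lemma endo_inv: "endo g \<Longrightarrow> bij g \<Longrightarrow> endo (inv_into UNIV g)"
  using inj_linear_imp_inv_linear bij_is_inj by blast

end

locale linear_group_space = fd_space +
  fixes G0 :: "('a \<Rightarrow> 'a) set"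
  assumes G0_endo: "g \<in> G0 \<Longrightarrow> endo g" and G0_bij: "g \<in> G0 \<Longrightarrow> bij g"
    and G0_id: "id \<in> G0" and G0_comp: "g \<in> G0 \<Longrightarrow> k \<in> G0 \<Longrightarrow> g \<circ> k \<in> G0"
begin

text \<open>The function may live on a larger set X, so that the lemma covers translation inside
  \<open>G0\<close> as well as functions taken from the ambient group.\<close>

lemma regular_translate:
  assumes "f \<in> regular_functions X" "G0 \<subseteq> X" "k \<in> G0"
  shows "(\<lambda>x\<in>G0. f (k \<circ> x)) \<in> regular_functions G0"
  using assms(1)
proof induction
  case (generator f)
  from generator show ?case
  proof (cases rule: matrix_coeffs_cases)
    case (1 l v)
    have "(\<lambda>x\<in>G0. restrict f X (k \<circ> x)) = (\<lambda>x\<in>G0. l (k (x v)))"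
      using assms G0_comp by (auto simp: fun_eq_iff restrict_def 1)
    moreover have "(\<lambda>x\<in>G0. l (k (x v))) \<in> regular_functions G0"
      using regular_coeff[OF functional_comp[OF 1(1) G0_endo[OF assms(3)]]] .
    ultimately show ?thesis by (simp only:)
  next
    case (2 l v)
    have "(\<lambda>x\<in>G0. restrict f X (k \<circ> x)) = (\<lambda>x\<in>G0. l (inv_into UNIV x (inv_into UNIV k v)))"
      using assms G0_comp inv_comp[OF G0_bij[OF assms(3)] G0_bij] by (auto simp: fun_eq_iff restrict_def 2)
    moreover have "(\<lambda>x\<in>G0. l (inv_into UNIV x (inv_into UNIV k v))) \<in> regular_functions G0"
      using regular_inv_coeff[OF 2(1)] .
    ultimately show ?thesis by (simp only:)
  qed
next
  case (const c)
  have "(\<lambda>x\<in>G0. (\<lambda>x\<in>X. c) (k \<circ> x)) = (\<lambda>x\<in>G0. c)"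
    using assms G0_comp by (auto simp: fun_eq_iff restrict_def)
  then show ?case by (simp only: function_algebra.const)
next
  case (add f g)
  have "(\<lambda>x\<in>G0. (\<lambda>x\<in>X. f x + g x) (k \<circ> x)) = (\<lambda>x\<in>G0. (\<lambda>x\<in>G0. f (k \<circ> x)) x + (\<lambda>x\<in>G0. g (k \<circ> x)) x)"
    using assms G0_comp by (auto simp: fun_eq_iff restrict_def)
  then show ?case using function_algebra.add[OF add.IH] by (simp only:)
next
  case (mult f g)
  have "(\<lambda>x\<in>G0. (\<lambda>x\<in>X. f x * g x) (k \<circ> x)) = (\<lambda>x\<in>G0. (\<lambda>x\<in>G0. f (k \<circ> x)) x * (\<lambda>x\<in>G0. g (k \<circ> x)) x)"
    using assms G0_comp by (auto simp: fun_eq_iff restrict_def)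
  then show ?case using function_algebra.mult[OF mult.IH] by (simp only:)
qed

lemma tangent_spaceD:
  assumes "D \<in> tangent_space (linear_group sc G0)"
  shows "f \<in> regular_functions G0 \<Longrightarrow> g \<in> regular_functions G0 \<Longrightarrow> D (\<lambda>x\<in>G0. f x + g x) = D f + D g"
    and "f \<in> regular_functions G0 \<Longrightarrow> D (\<lambda>x\<in>G0. c * f x) = c * D f"
    and "f \<in> regular_functions G0 \<Longrightarrow> g \<in> regular_functions G0 \<Longrightarrow> D (\<lambda>x\<in>G0. f x * g x) = f id * D g + D f * g id"
  using assms unfolding tangent_space_def by (auto simp: regular_linear_group) (auto simp: linear_group_def)

lemma regular_scale: "f \<in> regular_functions H \<Longrightarrow> (\<lambda>x\<in>H. c * f x) \<in> regular_functions H"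
proof -
  assume "f \<in> regular_functions H"
  from function_algebra.mult[OF function_algebra.const[of c] this]
  show ?thesis by (simp add: restrict_def cong: if_cong)
qed

lemma tangent_const:
  assumes D: "D \<in> tangent_space (linear_group sc G0)"
  shows "D (\<lambda>x\<in>G0. c) = 0"
proof -
  have one: "(\<lambda>x\<in>G0. 1) \<in> regular_functions G0" by (rule function_algebra.const)
  have "(\<lambda>x\<in>G0. (\<lambda>x\<in>G0. 1::complex) x * (\<lambda>x\<in>G0. 1) x) = (\<lambda>x\<in>G0. 1)" by (auto simp: fun_eq_iff restrict_def)
  then have "D (\<lambda>x\<in>G0. 1) = 0" using tangent_spaceD(3)[OF D one one] G0_id by simp
  moreover have "(\<lambda>x\<in>G0. c * (\<lambda>x\<in>G0. 1) x) = (\<lambda>x\<in>G0. c)" by (auto simp: fun_eq_iff restrict_def)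
  ultimately show ?thesis using tangent_spaceD(2)[OF D one, of c] by simp
qed

lemma tangent_sum:
  assumes D: "D \<in> tangent_space (linear_group sc G0)" and "finite I"
    "\<And>i. i \<in> I \<Longrightarrow> f i \<in> regular_functions G0"
  shows "(\<lambda>x\<in>G0. \<Sum>i\<in>I. f i x) \<in> regular_functions G0 \<and> D (\<lambda>x\<in>G0. \<Sum>i\<in>I. f i x) = (\<Sum>i\<in>I. D (f i))"
  using assms(2,3)
proof (induction I rule: finite_induct)
  case empty
  show ?case unfolding sum.empty using tangent_const[OF D, of 0] function_algebra.const[of 0 G0] by blast
next
  case (insert i I)
  have fi: "f i \<in> regular_functions G0" and IH: "(\<lambda>x\<in>G0. \<Sum>i\<in>I. f i x) \<in> regular_functions G0"
    "D (\<lambda>x\<in>G0. \<Sum>i\<in>I. f i x) = (\<Sum>i\<in>I. D (f i))" using insert.IH insert.prems by blast+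
  have "(\<lambda>x\<in>G0. \<Sum>i\<in>insert i I. f i x) = (\<lambda>x\<in>G0. f i x + (\<lambda>x\<in>G0. \<Sum>i\<in>I. f i x) x)"
    using insert(1,2) by (auto simp: fun_eq_iff restrict_def)
  moreover have "(\<Sum>i\<in>insert i I. D (f i)) = D (f i) + (\<Sum>i\<in>I. D (f i))" using insert(1,2) by simp
  ultimately show ?case
    using function_algebra.add[OF fi IH(1)] tangent_spaceD(1)[OF D fi IH(1)] IH(2) by (simp only:)
qed

lemma tangent_coeff_expansion:
  assumes D: "D \<in> tangent_space (linear_group sc G0)" and l: "functional l"
    and y: "y = (\<Sum>b\<in>Basis. sc (D (\<lambda>g\<in>G0. coord b (g v))) b)"
  shows "D (\<lambda>g\<in>G0. l (g v)) = l y"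
proof -
  have "(\<lambda>g\<in>G0. l (g v)) = (\<lambda>g\<in>G0. \<Sum>b\<in>Basis. (\<lambda>g\<in>G0. l b * (\<lambda>g\<in>G0. coord b (g v)) g) g)"
  proof (rule restrict_ext)
    fix g assume "g \<in> G0"
    then show "l (g v) = (\<Sum>b\<in>Basis. (\<lambda>g\<in>G0. l b * (\<lambda>g\<in>G0. coord b (g v)) g) g)"
      using functional_expansion[OF l, of "g v"] by (simp add: mult.commute)
  qed
  moreover have "D (\<lambda>g\<in>G0. \<Sum>b\<in>Basis. (\<lambda>g\<in>G0. l b * (\<lambda>g\<in>G0. coord b (g v)) g) g)
     = (\<Sum>b\<in>Basis. D (\<lambda>g\<in>G0. l b * (\<lambda>g\<in>G0. coord b (g v)) g))"
    using tangent_sum[OF D finite_Basis, of "\<lambda>b. (\<lambda>g\<in>G0. l b * (\<lambda>g\<in>G0. coord b (g v)) g)"]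
      regular_scale[OF regular_coeff[OF functional_coord]] by blast
  moreover have "D (\<lambda>g\<in>G0. l b * (\<lambda>g\<in>G0. coord b (g v)) g) = l b * D (\<lambda>g\<in>G0. coord b (g v))" for b
    by (rule tangent_spaceD(2)[OF D regular_coeff[OF functional_coord]])
  ultimately show ?thesis
    by (simp add: y functional.linear_sum[OF l] functional.linear_scale[OF l] mult.commute)
qed

lemma differential_coeff:
  assumes D: "D \<in> tangent_space (linear_group sc G0)" and l: "functional l"
  shows "D (\<lambda>g\<in>G0. l (g v)) = l (differential sc (linear_group sc G0) (\<lambda>g. g) D v)"
proof -
  define y where "y = (\<Sum>b\<in>Basis. sc (D (\<lambda>g\<in>G0. coord b (g v))) b)"
  have y: "\<And>l. functional l \<Longrightarrow> D (\<lambda>g\<in>G0. l (g v)) = l y"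
    by (rule tangent_coeff_expansion[OF D _ y_def])
  have "differential sc (linear_group sc G0) (\<lambda>g. g) D v = (THE y. \<forall>l. functional l \<longrightarrow> l y = D (\<lambda>g\<in>G0. l (g v)))"
    by (simp add: differential_def linear_group_def)
  also have "\<dots> = y"
    by (rule the_equality) (auto simp: y intro: functional_eqI)
  finally show ?thesis using y[OF l] by simp
qed

text \<open>The derivative of a regular function along the one-parameter group generated by \<open>A\<close>, and along
  the left-invariant vector field given by a point derivation with differential \<open>A\<close>.\<close>

lemma regular_derivative:
  assumes D: "D \<in> tangent_space (linear_group sc G0)" and A: "endo A"
    and DA: "\<And>l v. functional l \<Longrightarrow> D (\<lambda>g\<in>G0. l (g v)) = l (A v)"
    and X: "G0 \<subseteq> X" and f: "f \<in> regular_functions X"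
  shows "\<exists>f'\<in>regular_functions X. (\<forall>k\<in>G0. D (\<lambda>x\<in>G0. f (k \<circ> x)) = f' k) \<and>
     ((\<forall>t. expo A t \<in> X) \<longrightarrow> (\<forall>t. ((\<lambda>t. f (expo A t)) has_field_derivative f' (expo A t)) (at t)))"
  using f
proof induction
  case (generator f)
  have AE: "expo A t (A v) = A (expo A t v)" for t v by (rule expo_commute[OF A A, symmetric]) simp
  from generator show ?case
  proof (cases rule: matrix_coeffs_cases)
    case (1 l v)
    let ?f' = "\<lambda>g\<in>X. l (g (A v))"
    have "D (\<lambda>x\<in>G0. restrict f X (k \<circ> x)) = ?f' k" if k: "k \<in> G0" for k
    proof -
      have "(\<lambda>x\<in>G0. restrict f X (k \<circ> x)) = (\<lambda>x\<in>G0. l (k (x v)))"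
        using k X G0_comp by (auto simp: fun_eq_iff restrict_def 1)
      then show ?thesis using DA[OF functional_comp[OF 1(1) G0_endo[OF k]], of v] k X by auto
    qed
    moreover have "((\<lambda>t. restrict f X (expo A t)) has_field_derivative ?f' (expo A t)) (at t)" if "\<forall>t. expo A t \<in> X" for t
      using that has_vdD[OF has_vd_expo[OF A] 1(1), of v t] by (simp add: 1)
    ultimately show ?thesis using regular_coeff[OF 1(1)] by blast
  next
    case (2 l v)
    let ?f' = "\<lambda>g\<in>X. - l (A (inv_into UNIV g v))"
    have lA: "functional (\<lambda>x. - l (A x))"
      by (rule functionalI) (simp_all only: endo.linear_add[OF A] endo.linear_scale[OF A] functional_simps[OF 2(1)] minus_add_distrib mult_minus_right)
    \<comment> \<open>D is applied to the constant function l w, written as the sum over b of l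
      (x^-1 b) times the b-coordinate of x w. The Leibniz rule then determines the derivative of the
      inverse.\<close>
    have inv_coeff: "D (\<lambda>x\<in>G0. l (inv_into UNIV x w)) = - l (A w)" for w
    proof -
      let ?p = "\<lambda>b. \<lambda>x\<in>G0. (\<lambda>x\<in>G0. l (inv_into UNIV x b)) x * (\<lambda>x\<in>G0. coord b (x w)) x"
      have "(\<lambda>x\<in>G0. \<Sum>b\<in>Basis. ?p b x) = (\<lambda>x\<in>G0. l w)"
      proof (rule restrict_ext)
        fix x assume x: "x \<in> G0"
        have "l w = l (inv_into UNIV x (x w))" using G0_bij[OF x] by (simp add: bij_is_inj)
        also have "\<dots> = (\<Sum>b\<in>Basis. coord b (x w) * l (inv_into UNIV x b))"
          by (rule functional_expansion[OF functional_comp[OF 2(1) endo_inv[OF G0_endo[OF x] G0_bij[OF x]]]])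
        finally show "(\<Sum>b\<in>Basis. ?p b x) = l w" using x by (simp add: mult.commute)
      qed
      then have "0 = D (\<lambda>x\<in>G0. \<Sum>b\<in>Basis. ?p b x)" using tangent_const[OF D] by simp
      also have "\<dots> = (\<Sum>b\<in>Basis. D (?p b))"
        using tangent_sum[OF D finite_Basis, of ?p]
          function_algebra.mult[OF regular_inv_coeff[OF 2(1)] regular_coeff[OF functional_coord]] by blast
      also have "\<dots> = (\<Sum>b\<in>Basis. l b * coord b (A w) + D (\<lambda>x\<in>G0. l (inv_into UNIV x b)) * coord b w)"
        unfolding tangent_spaceD(3)[OF D regular_inv_coeff[OF 2(1)] regular_coeff[OF functional_coord]] DA[OF functional_coord]
        using G0_id by simp
      also have "\<dots> = l (A w) + (\<Sum>b\<in>Basis. D (\<lambda>x\<in>G0. l (inv_into UNIV x b)) * coord b w)"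
        unfolding sum.distrib using functional_expansion[OF 2(1), of "A w"] by (simp add: mult.commute)
      also have "(\<Sum>b\<in>Basis. D (\<lambda>x\<in>G0. l (inv_into UNIV x b)) * coord b w) = D (\<lambda>x\<in>G0. l (inv_into UNIV x w))"
      proof -
        let ?q = "\<lambda>b. \<lambda>x\<in>G0. coord b w * (\<lambda>x\<in>G0. l (inv_into UNIV x b)) x"
        have "(\<lambda>x\<in>G0. l (inv_into UNIV x w)) = (\<lambda>x\<in>G0. \<Sum>b\<in>Basis. ?q b x)"
        proof (rule restrict_ext)
          fix x assume x: "x \<in> G0"
          have "l (inv_into UNIV x w) = (\<Sum>b\<in>Basis. coord b w * l (inv_into UNIV x b))"
            by (rule functional_expansion[OF functional_comp[OF 2(1) endo_inv[OF G0_endo[OF x] G0_bij[OF x]]]])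
          then show "l (inv_into UNIV x w) = (\<Sum>b\<in>Basis. ?q b x)" using x by simp
        qed
        moreover have "D (\<lambda>x\<in>G0. \<Sum>b\<in>Basis. ?q b x) = (\<Sum>b\<in>Basis. D (?q b))"
          using tangent_sum[OF D finite_Basis, of ?q] regular_scale[OF regular_inv_coeff[OF 2(1)]] by blast
        ultimately show ?thesis
          unfolding tangent_spaceD(2)[OF D regular_inv_coeff[OF 2(1)]] by (simp add: mult.commute)
      qed
      finally show ?thesis by (simp add: eq_neg_iff_add_eq_0 add.commute)
    qed
    have "D (\<lambda>x\<in>G0. restrict f X (k \<circ> x)) = ?f' k" if k: "k \<in> G0" for k
    proof -
      have "(\<lambda>x\<in>G0. restrict f X (k \<circ> x)) = (\<lambda>x\<in>G0. l (inv_into UNIV x (inv_into UNIV k v)))"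
        using k X G0_comp inv_comp[OF G0_bij[OF k] G0_bij] by (auto simp: fun_eq_iff restrict_def 2)
      then show ?thesis using inv_coeff[of "inv_into UNIV k v"] k X by auto
    qed
    moreover have "((\<lambda>t. restrict f X (expo A t)) has_field_derivative ?f' (expo A t)) (at t)" if "\<forall>t. expo A t \<in> X" for t
    proof -
      let ?B = "\<lambda>x. - A x"
      have B: "endo ?B" by (rule endo_uminus[OF A])
      have "expo ?B t (?B v) = ?B (expo ?B t v)" by (rule expo_commute[OF B B, symmetric]) simp
      then show ?thesis
        using that has_vdD[OF has_vd_expo[OF B] 2(1), of v t] by (simp add: 2 inv_expo[OF A] functional.linear_neg[OF 2(1)])
    qed
    moreover have "?f' \<in> regular_functions X" using regular_inv_coeff[OF lA] by simp
    ultimately show ?thesis by blast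
  qed
next
  case (const c)
  have "(\<lambda>x\<in>G0. (\<lambda>x\<in>X. c) (k \<circ> x)) = (\<lambda>x\<in>G0. c)" if "k \<in> G0" for k
    using that X G0_comp by (auto simp: fun_eq_iff restrict_def)
  then have "\<forall>k\<in>G0. D (\<lambda>x\<in>G0. (\<lambda>x\<in>X. c) (k \<circ> x)) = (\<lambda>x\<in>X. 0) k"
    using tangent_const[OF D] X by auto
  moreover have "(\<forall>t. expo A t \<in> X) \<longrightarrow> (\<forall>t. ((\<lambda>t. (\<lambda>x\<in>X. c) (expo A t)) has_field_derivative (\<lambda>x\<in>X. 0) (expo A t)) (at t))"
    by simp
  ultimately show ?case by (intro bexI[of _ "\<lambda>x\<in>X. 0"] conjI function_algebra.const)
next
  case (add f g)
  then obtain f' g' where fg: "f' \<in> regular_functions X" "g' \<in> regular_functions X"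
    "\<forall>k\<in>G0. D (\<lambda>x\<in>G0. f (k \<circ> x)) = f' k" "\<forall>k\<in>G0. D (\<lambda>x\<in>G0. g (k \<circ> x)) = g' k"
    "(\<forall>t. expo A t \<in> X) \<longrightarrow> (\<forall>t. ((\<lambda>t. f (expo A t)) has_field_derivative f' (expo A t)) (at t))"
    "(\<forall>t. expo A t \<in> X) \<longrightarrow> (\<forall>t. ((\<lambda>t. g (expo A t)) has_field_derivative g' (expo A t)) (at t))"
    by blast
  let ?f' = "\<lambda>x\<in>X. f' x + g' x"
  have "D (\<lambda>x\<in>G0. (\<lambda>x\<in>X. f x + g x) (k \<circ> x)) = ?f' k" if k: "k \<in> G0" for k
  proof -
    have "(\<lambda>x\<in>G0. (\<lambda>x\<in>X. f x + g x) (k \<circ> x)) = (\<lambda>x\<in>G0. (\<lambda>x\<in>G0. f (k \<circ> x)) x + (\<lambda>x\<in>G0. g (k \<circ> x)) x)"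
      using k X G0_comp by (auto simp: fun_eq_iff restrict_def)
    then show ?thesis
      using tangent_spaceD(1)[OF D regular_translate[OF add.hyps(1) X k] regular_translate[OF add.hyps(2) X k]] fg(3,4) k X
      by auto
  qed
  moreover have "((\<lambda>t. (\<lambda>x\<in>X. f x + g x) (expo A t)) has_field_derivative ?f' (expo A t)) (at t)" if "\<forall>t. expo A t \<in> X" for t
    using that DERIV_add[OF fg(5)[rule_format, OF that[rule_format]] fg(6)[rule_format, OF that[rule_format]]] by simp
  ultimately show ?case using function_algebra.add[OF fg(1,2)] by blast
next
  case (mult f g)
  then obtain f' g' where fg: "f' \<in> regular_functions X" "g' \<in> regular_functions X"
    "\<forall>k\<in>G0. D (\<lambda>x\<in>G0. f (k \<circ> x)) = f' k" "\<forall>k\<in>G0. D (\<lambda>x\<in>G0. g (k \<circ> x)) = g' k"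
    "(\<forall>t. expo A t \<in> X) \<longrightarrow> (\<forall>t. ((\<lambda>t. f (expo A t)) has_field_derivative f' (expo A t)) (at t))"
    "(\<forall>t. expo A t \<in> X) \<longrightarrow> (\<forall>t. ((\<lambda>t. g (expo A t)) has_field_derivative g' (expo A t)) (at t))"
    by blast
  let ?f' = "\<lambda>x\<in>X. (\<lambda>x\<in>X. f' x * g x) x + (\<lambda>x\<in>X. g' x * f x) x"
  have "D (\<lambda>x\<in>G0. (\<lambda>x\<in>X. f x * g x) (k \<circ> x)) = ?f' k" if k: "k \<in> G0" for k
  proof -
    have "(\<lambda>x\<in>G0. (\<lambda>x\<in>X. f x * g x) (k \<circ> x)) = (\<lambda>x\<in>G0. (\<lambda>x\<in>G0. f (k \<circ> x)) x * (\<lambda>x\<in>G0. g (k \<circ> x)) x)"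
      using k X G0_comp by (auto simp: fun_eq_iff restrict_def)
    then show ?thesis
      using tangent_spaceD(3)[OF D regular_translate[OF mult.hyps(1) X k] regular_translate[OF mult.hyps(2) X k]] fg(3,4) k X G0_id
      by (auto simp: mult.commute)
  qed
  moreover have "((\<lambda>t. (\<lambda>x\<in>X. f x * g x) (expo A t)) has_field_derivative ?f' (expo A t)) (at t)" if "\<forall>t. expo A t \<in> X" for t
    using that DERIV_mult[OF fg(5)[rule_format, OF that[rule_format]] fg(6)[rule_format, OF that[rule_format]]] by simp
  ultimately show ?case
    using function_algebra.add[OF function_algebra.mult[OF fg(1) mult.hyps(2)] function_algebra.mult[OF fg(2) mult.hyps(1)]] by blast
qed

text \<open>The functions vanishing on \<open>G0\<close> are stable under the derivative along the
  invariant field. For such an f, the entire function f (exp(tA)) has all derivatives zero at t = 0,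
  so it vanishes identically; a point outside the closed set \<open>G0\<close> could be separated by
  some f.\<close>

lemma expo_in_closed_group:
  assumes D: "D \<in> tangent_space (linear_group sc G0)" and A: "endo A"
    and DA: "\<And>l v. functional l \<Longrightarrow> D (\<lambda>g\<in>G0. l (g v)) = l (A v)"
    and X: "G0 \<subseteq> X" "\<And>t. expo A t \<in> X" and closed: "closedin (zariski X (regular_functions X)) G0"
  shows "expo A t \<in> G0"
proof (rule ccontr)
  assume "expo A t \<notin> G0"
  then obtain f where f: "f \<in> regular_functions X" "f (expo A t) \<noteq> 0" "\<forall>y\<in>G0. f y = 0"
    using zariski_closed_separation[OF closed X(2)] by blast
  define P where "P f \<longleftrightarrow> f \<in> regular_functions X \<and> (\<forall>y\<in>G0. f y = 0)" for f
  have "\<exists>f'. P f' \<and> (\<forall>t. ((\<lambda>t. f (expo A t)) has_field_derivative f' (expo A t)) (at t))" if "P f" for f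
  proof -
    have fX: "f \<in> regular_functions X" using \<open>P f\<close> by (simp add: P_def)
    obtain f' where f': "f' \<in> regular_functions X" "\<forall>k\<in>G0. D (\<lambda>x\<in>G0. f (k \<circ> x)) = f' k"
      "\<forall>t. ((\<lambda>t. f (expo A t)) has_field_derivative f' (expo A t)) (at t)"
      using regular_derivative[OF D A DA X(1) fX] X(2) by blast
    have "f' k = 0" if k: "k \<in> G0" for k
    proof -
      have "(\<lambda>x\<in>G0. f (k \<circ> x)) = (\<lambda>x\<in>G0. 0)" using k G0_comp \<open>P f\<close> by (auto simp: fun_eq_iff restrict_def P_def)
      then show ?thesis using f'(2) k tangent_const[OF D, of 0] by auto
    qed
    then show ?thesis using f' by (auto simp: P_def)
  qed
  then obtain d where d: "\<And>f. P f \<Longrightarrow> P (d f)"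
    "\<And>f t. P f \<Longrightarrow> ((\<lambda>t. f (expo A t)) has_field_derivative d f (expo A t)) (at t)" by metis
  have Pn: "P ((d ^^ n) f)" for n by (induction n) (use f d(1) in \<open>auto simp: P_def\<close>)
  let ?F = "\<lambda>t. f (expo A t)"
  have "(deriv ^^ n) ?F = (\<lambda>t. (d ^^ n) f (expo A t))" for n
  proof (induction n)
    case (Suc n)
    then show ?case using DERIV_imp_deriv[OF d(2)[OF Pn]] by auto
  qed simp
  moreover have "expo A 0 = id" using A by (auto simp: fun_eq_iff)
  ultimately have "(deriv ^^ n) ?F 0 = 0" for n using Pn[of n] G0_id by (simp add: P_def)
  moreover have "?F holomorphic_on UNIV"
    using d(2)[OF Pn[of 0]] by (auto simp: holomorphic_on_open)
  ultimately have "?F t = 0" using holomorphic_fun_eq_0_on_connected[of ?F UNIV 0 t] by auto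
  then show False using f(2) by simp
qed

end

section \<open>Noetherian function algebras\<close>

text \<open>Functions are total here, unlike the extensional ones in \<open>regular\<close>;
  \<open>retract\<close> later connects the two.\<close>

definition fun_subalgebra :: "('x \<Rightarrow> complex) set \<Rightarrow> bool" where
  "fun_subalgebra A \<longleftrightarrow> (\<forall>c. (\<lambda>x. c) \<in> A) \<and>
     (\<forall>f\<in>A. \<forall>g\<in>A. (\<lambda>x. f x + g x) \<in> A \<and> (\<lambda>x. f x * g x) \<in> A)"

inductive_set ideal_gen :: "('x \<Rightarrow> complex) set \<Rightarrow> ('x \<Rightarrow> complex) set \<Rightarrow> ('x \<Rightarrow> complex) set"
  for A S
where
  zero: "(\<lambda>x. 0) \<in> ideal_gen A S"
| step: "c \<in> A \<Longrightarrow> s \<in> S \<Longrightarrow> g \<in> ideal_gen A S \<Longrightarrow> (\<lambda>x. c x * s x + g x) \<in> ideal_gen A S"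

text \<open>Stated for arbitrary generating sets, with the finite subset drawn from S itself: in
  Hilbert's basis theorem this picks out finitely many of the leading coefficients.\<close>

definition noetherian :: "('x \<Rightarrow> complex) set \<Rightarrow> bool" where
  "noetherian A \<longleftrightarrow> (\<forall>S\<subseteq>A. \<exists>T\<subseteq>S. finite T \<and> S \<subseteq> ideal_gen A T)"

lemma fun_subalgebraD:
  assumes "fun_subalgebra A"
  shows "(\<lambda>x. c) \<in> A" "f \<in> A \<Longrightarrow> g \<in> A \<Longrightarrow> (\<lambda>x. f x + g x) \<in> A" "f \<in> A \<Longrightarrow> g \<in> A \<Longrightarrow> (\<lambda>x. f x * g x) \<in> A"
  using assms by (auto simp: fun_subalgebra_def)

lemma fun_subalgebra_scale:
  assumes "fun_subalgebra A" "f \<in> A" shows "(\<lambda>x. c * f x) \<in> A"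
  using fun_subalgebraD(3)[OF assms(1) fun_subalgebraD(1)[OF assms(1)] assms(2)] .

lemma fun_subalgebra_diff:
  assumes "fun_subalgebra A" "f \<in> A" "g \<in> A" shows "(\<lambda>x. f x - g x) \<in> A"
  using fun_subalgebraD(2)[OF assms(1,2) fun_subalgebra_scale[OF assms(1,3), of "-1"]] by simp

lemma fun_subalgebra_sum:
  assumes "fun_subalgebra A" "finite I" "\<And>i. i \<in> I \<Longrightarrow> f i \<in> A"
  shows "(\<lambda>x. \<Sum>i\<in>I. f i x) \<in> A"
  using assms(2,3)
  by (induction I rule: finite_induct) (simp_all add: fun_subalgebraD[OF assms(1)])

lemma fun_subalgebra_power:
  assumes "fun_subalgebra A" "f \<in> A" shows "(\<lambda>x. f x ^ n) \<in> A"
  by (induction n) (simp_all add: fun_subalgebraD[OF assms(1)] assms(2))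

lemma fun_subalgebra_prod:
  assumes "fun_subalgebra A" "finite I" "\<And>i. i \<in> I \<Longrightarrow> f i \<in> A"
  shows "(\<lambda>x. \<Prod>i\<in>I. f i x) \<in> A"
  using assms(2,3)
  by (induction I rule: finite_induct) (simp_all add: fun_subalgebraD[OF assms(1)])

lemma ideal_gen_mono: "S \<subseteq> T \<Longrightarrow> ideal_gen A S \<subseteq> ideal_gen A T"
proof
  fix f assume "S \<subseteq> T" "f \<in> ideal_gen A S"
  from this(2) show "f \<in> ideal_gen A T"
    by induction (use \<open>S \<subseteq> T\<close> in \<open>auto intro: ideal_gen.intros\<close>)
qed

lemma ideal_gen_subset:
  assumes "fun_subalgebra A" "S \<subseteq> A" shows "ideal_gen A S \<subseteq> A"
proof
  fix f assume "f \<in> ideal_gen A S"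
  then show "f \<in> A"
  proof induction
    case zero
    then show ?case by (rule fun_subalgebraD(1)[OF assms(1)])
  next
    case (step c s g)
    then have "s \<in> A" using assms(2) by blast
    from fun_subalgebraD(2)[OF assms(1) fun_subalgebraD(3)[OF assms(1) step.hyps(1) this] step.IH] show ?case .
  qed
qed

lemma ideal_gen_base:
  assumes "fun_subalgebra A" "s \<in> S" shows "s \<in> ideal_gen A S"
  using ideal_gen.step[OF fun_subalgebraD(1)[OF assms(1), of 1] assms(2) ideal_gen.zero] by simp

lemma ideal_gen_add:
  assumes "f \<in> ideal_gen A S" "g \<in> ideal_gen A S" shows "(\<lambda>x. f x + g x) \<in> ideal_gen A S"
  using assms
proof (induction f)
  case (step c s f)
  from ideal_gen.step[OF step.hyps(1,2) step.IH[OF step.prems]] show ?case by (simp add: add.assoc)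
qed simp

lemma ideal_gen_mult:
  assumes A: "fun_subalgebra A" and "f \<in> ideal_gen A S" "a \<in> A"
  shows "(\<lambda>x. a x * f x) \<in> ideal_gen A S"
  using assms(2)
proof induction
  case zero
  show ?case using ideal_gen.zero[of A S] by simp
next
  case (step c s g)
  have "(\<lambda>x. a x * c x) \<in> A" using A assms(3) step.hyps(1) by (rule fun_subalgebraD)
  from ideal_gen.step[OF this step.hyps(2) step.IH] show ?case by (simp add: algebra_simps)
qed

lemma ideal_gen_minimal:
  assumes "fun_subalgebra A" "S \<subseteq> ideal_gen A T" shows "ideal_gen A S \<subseteq> ideal_gen A T"
proof
  fix f assume "f \<in> ideal_gen A S"
  then show "f \<in> ideal_gen A T"
  proof induction
    case (step c s g)
    then show ?case using assms by (intro ideal_gen_add ideal_gen_mult) auto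
  qed (rule ideal_gen.zero)
qed

lemma ideal_gen_scale:
  assumes "fun_subalgebra A" "f \<in> ideal_gen A S" shows "(\<lambda>x. c * f x) \<in> ideal_gen A S"
  using ideal_gen_mult[OF assms fun_subalgebraD(1)[OF assms(1)]] .

lemma ideal_gen_diff:
  assumes "fun_subalgebra A" "f \<in> ideal_gen A S" "g \<in> ideal_gen A S" shows "(\<lambda>x. f x - g x) \<in> ideal_gen A S"
  using ideal_gen_add[OF assms(2) ideal_gen_scale[OF assms(1,3), of "-1"]] by simp

lemma ideal_gen_sum:
  assumes "finite I" "\<And>i. i \<in> I \<Longrightarrow> f i \<in> ideal_gen A S"
  shows "(\<lambda>x. \<Sum>i\<in>I. f i x) \<in> ideal_gen A S"
  using assms by (induction I rule: finite_induct) (simp_all add: ideal_gen.zero ideal_gen_add)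

lemma ideal_gen_finite:
  assumes "f \<in> ideal_gen A S" shows "\<exists>T\<subseteq>S. finite T \<and> f \<in> ideal_gen A T"
  using assms
proof induction
  case zero
  show ?case using ideal_gen.zero by blast
next
  case (step c s g)
  then obtain T where T: "T \<subseteq> S" "finite T" "g \<in> ideal_gen A T" by blast
  have "g \<in> ideal_gen A (insert s T)" using T(3) ideal_gen_mono[of T "insert s T" A] by blast
  then have "(\<lambda>x. c x * s x + g x) \<in> ideal_gen A (insert s T)" using step.hyps by (intro ideal_gen.step) auto
  then show ?case using T step.hyps by (intro exI[of _ "insert s T"]) auto
qed

section \<open>Hilbert's basis theorem\<close>

definition poly_ext :: "('x \<Rightarrow> complex) set \<Rightarrow> ('x \<Rightarrow> complex) \<Rightarrow> ('x \<Rightarrow> complex) set" where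
  "poly_ext A s = {f. \<exists>d p. (\<forall>i\<le>d. p i \<in> A) \<and> f = (\<lambda>x. \<Sum>i\<le>d. p i x * s x ^ i)}"

lemma poly_extI: "(\<And>i. i \<le> d \<Longrightarrow> p i \<in> A) \<Longrightarrow> (\<lambda>x. \<Sum>i\<le>d. p i x * s x ^ i) \<in> poly_ext A s"
  unfolding poly_ext_def by blast

lemma poly_ext_monomial:
  assumes A: "fun_subalgebra A" and "a \<in> A" shows "(\<lambda>x. a x * s x ^ k) \<in> poly_ext A s"
proof -
  have "(\<lambda>x. \<Sum>i\<le>k. (if i = k then a else (\<lambda>x. 0)) x * s x ^ i) \<in> poly_ext A s"
    by (rule poly_extI) (use assms fun_subalgebraD(1)[OF A] in auto)
  moreover have "(\<Sum>i\<le>k. (if i = k then a else (\<lambda>x. 0)) x * s x ^ i) = a x * s x ^ k" for x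
  proof -
    have "(\<Sum>i\<le>k. (if i = k then a else (\<lambda>x. 0)) x * s x ^ i) = (\<Sum>i\<le>k. if i = k then a x * s x ^ k else 0)"
      by (rule sum.cong) auto
    then show ?thesis by simp
  qed
  ultimately show ?thesis by simp
qed

lemma poly_ext_add:
  assumes A: "fun_subalgebra A" and f: "f \<in> poly_ext A s" and g: "g \<in> poly_ext A s"
  shows "(\<lambda>x. f x + g x) \<in> poly_ext A s"
proof -
  obtain d p where p: "\<And>i. i \<le> d \<Longrightarrow> p i \<in> A" "f = (\<lambda>x. \<Sum>i\<le>d. p i x * s x ^ i)"
    using f by (auto simp: poly_ext_def)
  obtain e q where q: "\<And>i. i \<le> e \<Longrightarrow> q i \<in> A" "g = (\<lambda>x. \<Sum>i\<le>e. q i x * s x ^ i)"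
    using g by (auto simp: poly_ext_def)
  let ?p = "\<lambda>i. if i \<le> d then p i else (\<lambda>x. 0)" and ?q = "\<lambda>i. if i \<le> e then q i else (\<lambda>x. 0)"
  have "(\<lambda>x. \<Sum>i\<le>d + e. (\<lambda>x. ?p i x + ?q i x) x * s x ^ i) \<in> poly_ext A s"
    by (rule poly_extI) (use p(1) q(1) fun_subalgebraD[OF A] in auto)
  moreover have "(\<Sum>i\<le>d + e. (\<lambda>x. ?p i x + ?q i x) x * s x ^ i) = f x + g x" for x
  proof -
    have "(\<Sum>i\<le>d + e. ?p i x * s x ^ i) = (\<Sum>i\<le>d. p i x * s x ^ i)"
      by (rule sum.mono_neutral_cong_right) auto
    moreover have "(\<Sum>i\<le>d + e. ?q i x * s x ^ i) = (\<Sum>i\<le>e. q i x * s x ^ i)"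
      by (rule sum.mono_neutral_cong_right) auto
    ultimately show ?thesis by (simp only: p(2) q(2) distrib_right sum.distrib)
  qed
  ultimately show ?thesis by simp
qed

lemma poly_ext_sum:
  assumes A: "fun_subalgebra A" and "finite I" "\<And>i. i \<in> I \<Longrightarrow> f i \<in> poly_ext A s"
  shows "(\<lambda>x. \<Sum>i\<in>I. f i x) \<in> poly_ext A s"
  using assms(2,3)
proof (induction I rule: finite_induct)
  case empty
  show ?case using poly_ext_monomial[OF A fun_subalgebraD(1)[OF A, of 0], of s 0] by simp
next
  case (insert i I)
  then show ?case using poly_ext_add[OF A, of "f i" s "\<lambda>x. \<Sum>i\<in>I. f i x"] by simp
qed

lemma poly_ext_mult:
  assumes A: "fun_subalgebra A" and f: "f \<in> poly_ext A s" and g: "g \<in> poly_ext A s"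
  shows "(\<lambda>x. f x * g x) \<in> poly_ext A s"
proof -
  obtain d p where p: "\<And>i. i \<le> d \<Longrightarrow> p i \<in> A" "f = (\<lambda>x. \<Sum>i\<le>d. p i x * s x ^ i)"
    using f by (auto simp: poly_ext_def)
  obtain e q where q: "\<And>i. i \<le> e \<Longrightarrow> q i \<in> A" "g = (\<lambda>x. \<Sum>i\<le>e. q i x * s x ^ i)"
    using g by (auto simp: poly_ext_def)
  have "(\<lambda>x. \<Sum>i\<le>d. (\<lambda>x. \<Sum>j\<le>e. (\<lambda>x. (p i x * q j x) * s x ^ (i + j)) x) x) \<in> poly_ext A s"
    by (intro poly_ext_sum[OF A] poly_ext_monomial[OF A] fun_subalgebraD(3)[OF A]) (auto simp: p(1) q(1))
  moreover have "(\<Sum>i\<le>d. (\<lambda>x. \<Sum>j\<le>e. (\<lambda>x. (p i x * q j x) * s x ^ (i + j)) x) x) = f x * g x" for x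
    unfolding p(2) q(2) sum_product by (intro sum.cong refl) (simp add: power_add)
  ultimately show ?thesis by simp
qed

lemma fun_subalgebra_poly_ext: "fun_subalgebra A \<Longrightarrow> fun_subalgebra (poly_ext A s)"
  unfolding fun_subalgebra_def[of "poly_ext A s"]
  using poly_ext_add[of A _ s] poly_ext_mult[of A _ s] poly_ext_monomial[of A _ s 0] fun_subalgebraD(1)[of A] by auto

text \<open>As s may be algebraic over A, an element has no intrinsic degree: \<open>deg\<close> is
  the least degree of a representing polynomial, and leading coefficients refer to a chosen
  representation of that degree. Elements f n of least degree outside the ideal of the earlier ones
  are picked; a relation between their leading coefficients would produce one of smaller
  degree.\<close>

theorem noetherian_poly_ext:
  assumes A: "fun_subalgebra A" and N: "noetherian A"
  shows "noetherian (poly_ext A s)"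
  unfolding noetherian_def
proof (intro allI impI)
  let ?B = "poly_ext A s"
  have B: "fun_subalgebra ?B" by (rule fun_subalgebra_poly_ext[OF A])
  fix S assume S: "S \<subseteq> ?B"
  let ?I = "ideal_gen ?B S"
  have IB: "?I \<subseteq> ?B" by (rule ideal_gen_subset[OF B S])
  have "\<exists>T\<subseteq>?I. finite T \<and> ?I \<subseteq> ideal_gen ?B T"
  proof (rule ccontr)
    assume nfg: "\<not> ?thesis"
    define R where "R d p f \<longleftrightarrow> (\<forall>i\<le>d. p i \<in> A) \<and> f = (\<lambda>x. \<Sum>i\<le>d. p i x * s x ^ i)" for d p and f :: "'a \<Rightarrow> complex"
    define deg where "deg f = (LEAST d. \<exists>p. R d p f)" for f
    have "\<exists>f\<in>?I - ideal_gen ?B T. \<forall>g\<in>?I - ideal_gen ?B T. deg f \<le> deg g" if T: "T \<subseteq> ?I" "finite T" for T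
    proof -
      have "\<not> ?I \<subseteq> ideal_gen ?B T" using nfg T by blast
      then obtain f where "f \<in> ?I - ideal_gen ?B T" by blast
      then show ?thesis using ex_has_least_nat[of "\<lambda>f. f \<in> ?I - ideal_gen ?B T" f deg] by blast
    qed
    then have "\<forall>T. \<exists>f. T \<subseteq> ?I \<and> finite T \<longrightarrow> f \<in> ?I - ideal_gen ?B T \<and> (\<forall>g\<in>?I - ideal_gen ?B T. deg f \<le> deg g)"
      by blast
    from choice[OF this] obtain pick where pick: "\<And>T. T \<subseteq> ?I \<Longrightarrow> finite T \<Longrightarrow> pick T \<in> ?I - ideal_gen ?B T"
      "\<And>T g. T \<subseteq> ?I \<Longrightarrow> finite T \<Longrightarrow> g \<in> ?I - ideal_gen ?B T \<Longrightarrow> deg (pick T) \<le> deg g" by blast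
    define T where "T n = rec_nat {} (\<lambda>_ X. insert (pick X) X) n" for n
    have T0: "T 0 = {}" and TS: "T (Suc n) = insert (pick (T n)) (T n)" for n by (simp_all add: T_def)
    have T: "T n \<subseteq> ?I \<and> finite (T n)" for n
    proof (induction n)
      case (Suc n)
      then show ?case using pick(1)[of "T n"] by (auto simp: TS)
    qed (simp add: T0)
    define f where "f n = pick (T n)" for n
    have Tf: "T n = f ` {..<n}" for n by (induction n) (simp_all add: T0 TS f_def lessThan_Suc)
    have f: "f n \<in> ?I" "f n \<notin> ideal_gen ?B (T n)" for n using pick(1)[of "T n"] T by (auto simp: f_def)
    have min: "deg (f n) \<le> deg g" if "g \<in> ?I" "g \<notin> ideal_gen ?B (T n)" for g n
      using pick(2)[of "T n" g] T that by (auto simp: f_def)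
    have rep: "\<exists>p. R (deg g) p g" if "g \<in> ?B" for g
    proof -
      have "\<exists>d p. R d p g" using that by (auto simp: poly_ext_def R_def)
      then show ?thesis unfolding deg_def by (rule LeastI_ex)
    qed
    have "\<forall>n. \<exists>p. R (deg (f n)) p (f n)" using rep f(1) IB by blast
    from choice[OF this] obtain p where p: "\<And>n. R (deg (f n)) (p n) (f n)" by blast
    have pA: "p n i \<in> A" if "i \<le> deg (f n)" for n i using p that by (simp add: R_def)
    have fp: "f n = (\<lambda>x. \<Sum>i\<le>deg (f n). p n i x * s x ^ i)" for n using p unfolding R_def by blast
    define a where "a n = p n (deg (f n))" for n
    have aA: "range a \<subseteq> A" using pA by (auto simp: a_def)
    obtain T' where T': "T' \<subseteq> range a" "finite T'" "range a \<subseteq> ideal_gen A T'"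
      using N[unfolded noetherian_def, rule_format, OF aA] by blast
    obtain M where M: "finite M" "T' = a ` M" using finite_subset_image[OF T'(2,1)] by blast
    from M(1)[unfolded finite_nat_set_iff_bounded] obtain n where n: "\<forall>i\<in>M. i < n" by blast
    have "a n \<in> ideal_gen A T'" using T'(3) by blast
    moreover have "ideal_gen A T' \<subseteq> ideal_gen A (a ` {..<n})" using M(2) n by (intro ideal_gen_mono) auto
    ultimately have an: "a n \<in> ideal_gen A (a ` {..<n})" by blast
    have mono: "deg (f i) \<le> deg (f n)" if "i < n" for i
    proof (rule min)
      show "f n \<in> ?I" by (rule f)
      have "T i \<subseteq> T n" using that by (auto simp: Tf)
      then show "f n \<notin> ideal_gen ?B (T i)" using f(2)[of n] ideal_gen_mono[of "T i" "T n" ?B] by blast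
    qed
    let ?d = "deg (f n)"
    \<comment> \<open>Each b in the ideal of the earlier leading coefficients is the coefficient at
      \<open>?d\<close> of a member of the ideal of the earlier f j. Their degrees are at most
      \<open>?d\<close> by \<open>mono\<close>, so a power of s raises each of them to that
      degree.\<close>
    have lift: "\<exists>h q. h \<in> ideal_gen ?B (T n) \<and> (\<forall>i<?d. q i \<in> A) \<and>
        h = (\<lambda>x. b x * s x ^ ?d + (\<Sum>i<?d. q i x * s x ^ i))" if "b \<in> ideal_gen A (a ` {..<n})" for b
      using that
    proof induction
      case zero
      show ?case
        by (intro exI[of _ "\<lambda>x. 0"] exI[of _ "\<lambda>i x. 0"]) (auto intro: ideal_gen.zero fun_subalgebraD[OF A])
    next
      case (step c b g)
      then obtain h q where h: "h \<in> ideal_gen ?B (T n)" "\<And>i. i < ?d \<Longrightarrow> q i \<in> A"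
        "h = (\<lambda>x. g x * s x ^ ?d + (\<Sum>i<?d. q i x * s x ^ i))" by blast
      obtain j where j: "j < n" "b = a j" using step by blast
      let ?e = "?d - deg (f j)"
      have de: "?d = ?e + deg (f j)" using mono[OF j(1)] by simp
      let ?h = "\<lambda>x. (\<lambda>x. c x * s x ^ ?e) x * f j x + h x"
      have "?h \<in> ideal_gen ?B (T n)"
        by (rule ideal_gen.step[OF poly_ext_monomial[OF A step.hyps(1)] _ h(1)]) (use j(1) in \<open>simp add: Tf\<close>)
      moreover define r where "r i = (if ?e \<le> i then (\<lambda>x. c x * p j (i - ?e) x + q i x) else q i)" for i
      have "r i \<in> A" if "i < ?d" for i
        unfolding r_def using that h(2)[OF that] pA[of "i - ?e" j] step.hyps(1)
        by (auto intro!: fun_subalgebraD[OF A])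
      moreover have "?h x = (c x * b x + g x) * s x ^ ?d + (\<Sum>i<?d. r i x * s x ^ i)" for x
      proof -
        have "(\<Sum>i<?d. r i x * s x ^ i) = (\<Sum>i<?d. (if ?e \<le> i then c x * p j (i - ?e) x * s x ^ i else 0)) + (\<Sum>i<?d. q i x * s x ^ i)"
          unfolding sum.distrib[symmetric] by (rule sum.cong) (auto simp: r_def distrib_right)
        also have "(\<Sum>i<?d. (if ?e \<le> i then c x * p j (i - ?e) x * s x ^ i else 0)) = (\<Sum>k<deg (f j). c x * p j k x * s x ^ (k + ?e))"
        proof -
          have "(\<Sum>i<?d. (if ?e \<le> i then c x * p j (i - ?e) x * s x ^ i else 0)) = (\<Sum>i\<in>{?e..<?d}. c x * p j (i - ?e) x * s x ^ i)"
            by (rule sum.mono_neutral_cong_right) auto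
          also have "\<dots> = (\<Sum>k<deg (f j). c x * p j k x * s x ^ (k + ?e))"
          proof -
            have "{?e..<?d} = {0 + ?e..<deg (f j) + ?e}" using mono[OF j(1)] by simp
            then show ?thesis
              by (simp only: sum.shift_bounds_nat_ivl lessThan_atLeast0 add_diff_cancel_right')
          qed
          finally show ?thesis .
        qed
        also have "\<dots> = c x * s x ^ ?e * (\<Sum>k<deg (f j). p j k x * s x ^ k)"
          unfolding sum_distrib_left by (rule sum.cong) (simp_all add: power_add)
        finally have e1: "(\<Sum>i<?d. r i x * s x ^ i) = c x * s x ^ ?e * (\<Sum>k<deg (f j). p j k x * s x ^ k) + (\<Sum>i<?d. q i x * s x ^ i)" .
        have "f j x = (\<Sum>k\<le>deg (f j). p j k x * s x ^ k)" using fp[of j] by metis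
        also have "\<dots> = (\<Sum>k<deg (f j). p j k x * s x ^ k) + b x * s x ^ deg (f j)"
          by (simp add: lessThan_Suc_atMost[symmetric] j(2) a_def)
        finally have e2: "f j x = (\<Sum>k<deg (f j). p j k x * s x ^ k) + b x * s x ^ deg (f j)" .
        have e3: "s x ^ ?d = s x ^ ?e * s x ^ deg (f j)" using de by (metis power_add)
        show ?thesis unfolding e1 e2 h(3) e3 by (simp only: algebra_simps)
      qed
      ultimately show ?case by (intro exI[of _ ?h] exI[of _ r]) auto
    qed
    obtain h q where h: "h \<in> ideal_gen ?B (T n)" "\<And>i. i < ?d \<Longrightarrow> q i \<in> A"
      "h = (\<lambda>x. a n x * s x ^ ?d + (\<Sum>i<?d. q i x * s x ^ i))" using lift[OF an] by blast
    have fn: "f n x = (\<Sum>i<?d. p n i x * s x ^ i) + a n x * s x ^ ?d" for x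
    proof -
      have "f n x = (\<Sum>i\<le>?d. p n i x * s x ^ i)" by (rule fun_cong[OF fp])
      then show ?thesis by (simp only: lessThan_Suc_atMost[symmetric] sum.lessThan_Suc a_def)
    qed
    let ?g = "\<lambda>x. f n x - h x"
    have TI: "ideal_gen ?B (T n) \<subseteq> ?I" by (rule ideal_gen_minimal[OF B conjunct1[OF T]])
    have g: "?g x = (\<Sum>i<?d. (p n i x - q i x) * s x ^ i)" for x
    proof -
      have "h x = a n x * s x ^ ?d + (\<Sum>i<?d. q i x * s x ^ i)" by (rule fun_cong[OF h(3)])
      then have "?g x = (\<Sum>i<?d. p n i x * s x ^ i) - (\<Sum>i<?d. q i x * s x ^ i)" using fn[of x] by simp
      then show ?thesis by (simp only: left_diff_distrib sum_subtractf)
    qed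
    have gI: "?g \<in> ?I" by (rule ideal_gen_diff[OF B f(1) subsetD[OF TI h(1)]])
    have gn: "?g \<notin> ideal_gen ?B (T n)"
    proof
      assume "?g \<in> ideal_gen ?B (T n)"
      from ideal_gen_add[OF this h(1)] show False using f(2)[of n] by simp
    qed
    have le: "?d \<le> deg ?g" by (rule min[OF gI gn])
    \<comment> \<open>The difference \<open>?g\<close> is represented in degree below
      \<open>?d\<close>, against the choice of f n; for \<open>?d\<close> = 0 the empty sum makes it
      zero, which lies in every ideal.\<close>
    show False
    proof (cases ?d)
      case 0
      then have "?g = (\<lambda>x. 0)" using g by auto
      then show False using gn ideal_gen.zero[of ?B "T n"] by metis
    next
      case (Suc k)
      have "(\<lambda>x. p n i x - q i x) \<in> A" if "i \<le> k" for i
        by (rule fun_subalgebra_diff[OF A pA h(2)]) (use that Suc in auto)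
      moreover have "?g = (\<lambda>x. \<Sum>i\<le>k. (p n i x - q i x) * s x ^ i)"
        by (rule ext) (simp only: g Suc lessThan_Suc_atMost)
      ultimately have "R k (\<lambda>i x. p n i x - q i x) ?g" unfolding R_def by blast
      then have "deg ?g \<le> k" unfolding deg_def by (intro Least_le) blast
      then show False using le Suc by simp
    qed
  qed
  then obtain T where T: "T \<subseteq> ?I" "finite T" "?I \<subseteq> ideal_gen ?B T" by blast
  \<comment> \<open>The finite set T lies in the ideal but not necessarily in S. Each of its members
    is a combination of finitely many elements of S, and these together generate.\<close>
  have "\<forall>t\<in>T. \<exists>U\<subseteq>S. finite U \<and> t \<in> ideal_gen ?B U" using T(1) ideal_gen_finite by blast
  then obtain U where U: "\<And>t. t \<in> T \<Longrightarrow> U t \<subseteq> S \<and> finite (U t) \<and> t \<in> ideal_gen ?B (U t)" by metis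
  have "T \<subseteq> ideal_gen ?B (\<Union>(U ` T))"
    using U ideal_gen_mono[of _ "\<Union>(U ` T)" ?B] by blast
  then have "?I \<subseteq> ideal_gen ?B (\<Union>(U ` T))" using ideal_gen_minimal[OF B] T(3) by blast
  then have "S \<subseteq> ideal_gen ?B (\<Union>(U ` T))" using ideal_gen_base[OF B] by blast
  then show "\<exists>T\<subseteq>S. finite T \<and> S \<subseteq> ideal_gen ?B T" using T(2) U by (intro exI[of _ "\<Union>(U ` T)"]) auto
qed

lemma fun_subalgebra_function_algebra: "fun_subalgebra (function_algebra UNIV S)"
  unfolding fun_subalgebra_def
  using function_algebra.const[of _ UNIV S] function_algebra.add[of _ UNIV S] function_algebra.mult[of _ UNIV S]
  by (auto simp: restrict_UNIV)

text \<open>Without generators only the constants remain, and any nonzero constant generates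
  everything; each further generator is a polynomial extension.\<close>

lemma noetherian_function_algebra:
  fixes S :: "('x \<Rightarrow> complex) set"
  assumes "finite S" shows "noetherian (function_algebra UNIV S)"
  using assms
proof (induction S rule: finite_induct)
  case empty
  let ?C = "function_algebra UNIV {} :: ('x \<Rightarrow> complex) set"
  have C: "fun_subalgebra ?C" by (rule fun_subalgebra_function_algebra)
  have const: "\<exists>c. f = (\<lambda>x. c)" if "f \<in> ?C" for f
    using that by induction (auto simp: restrict_UNIV)
  show ?case
    unfolding noetherian_def
  proof (intro allI impI)
    fix S assume S: "S \<subseteq> ?C"
    show "\<exists>T\<subseteq>S. finite T \<and> S \<subseteq> ideal_gen ?C T"
    proof (cases "S \<subseteq> {\<lambda>x. 0}")
      case True
      then show ?thesis using ideal_gen.zero by (intro exI[of _ "{}"]) auto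
    next
      case False
      then obtain c where c: "(\<lambda>x. c) \<in> S" "c \<noteq> 0" using S const by blast
      have "f \<in> ideal_gen ?C {\<lambda>x. c}" if fS: "f \<in> S" for f
      proof -
        obtain d where d: "f = (\<lambda>x. d)" using const S fS by blast
        have "(\<lambda>x. (d / c) * c) \<in> ideal_gen ?C {\<lambda>x. c}"
          by (rule ideal_gen_scale[OF C ideal_gen_base[OF C]]) simp
        then show ?thesis using c(2) by (simp add: d)
      qed
      then show ?thesis using c(1) by (intro exI[of _ "{\<lambda>x. c}"]) auto
    qed
  qed
next
  case (insert s S)
  let ?A = "function_algebra UNIV S"
  have A: "fun_subalgebra ?A" by (rule fun_subalgebra_function_algebra)
  have B: "fun_subalgebra (poly_ext ?A s)" by (rule fun_subalgebra_poly_ext[OF A])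
  have "function_algebra UNIV (insert s S) = poly_ext ?A s"
  proof
    have sA: "f \<in> poly_ext ?A s" if "f \<in> ?A" for f using poly_ext_monomial[OF A that, of s 0] by simp
    have ss: "s \<in> poly_ext ?A s" using poly_ext_monomial[OF A fun_subalgebraD(1)[OF A, of 1], of s 1] by simp
    show "function_algebra UNIV (insert s S) \<subseteq> poly_ext ?A s"
    proof
      fix f assume "f \<in> function_algebra UNIV (insert s S)"
      then show "f \<in> poly_ext ?A s"
      proof induction
        case (generator f)
        then show ?case using ss sA function_algebra.generator[of f S UNIV] by (auto simp: restrict_UNIV)
      qed (use fun_subalgebraD[OF B] in \<open>auto simp: restrict_UNIV\<close>)
    qed
    show "poly_ext ?A s \<subseteq> function_algebra UNIV (insert s S)"
    proof
      fix f assume "f \<in> poly_ext ?A s"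
      then obtain d p where p: "\<And>i. i \<le> d \<Longrightarrow> p i \<in> ?A" "f = (\<lambda>x. \<Sum>i\<le>d. p i x * s x ^ i)"
        by (auto simp: poly_ext_def)
      have C: "fun_subalgebra (function_algebra UNIV (insert s S))" by (rule fun_subalgebra_function_algebra)
      have "g \<in> function_algebra UNIV (insert s S)" if "g \<in> ?A" for g
        using that
        by induction (use fun_subalgebraD[OF C] function_algebra.generator[of _ "insert s S" UNIV] in \<open>auto simp: restrict_UNIV\<close>)
      moreover have "s \<in> function_algebra UNIV (insert s S)"
        using function_algebra.generator[of s "insert s S" UNIV] by (simp add: restrict_UNIV)
      ultimately show "f \<in> function_algebra UNIV (insert s S)"
        unfolding p(2) using p(1)
        by (intro fun_subalgebra_sum[OF C] fun_subalgebraD(3)[OF C] fun_subalgebra_power[OF C]) auto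
    qed
  qed
  then show ?case using noetherian_poly_ext[OF A insert.IH] by simp
qed

section \<open>Krull's intersection theorem at a point\<close>

definition point_ideal :: "('x \<Rightarrow> complex) set \<Rightarrow> 'x \<Rightarrow> ('x \<Rightarrow> complex) set" where
  "point_ideal A x0 = {f \<in> A. f x0 = 0}"

fun point_ideal_power :: "('x \<Rightarrow> complex) set \<Rightarrow> 'x \<Rightarrow> nat \<Rightarrow> ('x \<Rightarrow> complex) set" where
  "point_ideal_power A x0 0 = A"
| "point_ideal_power A x0 (Suc n) =
     ideal_gen A {(\<lambda>x. z x * f x) | z f. z \<in> point_ideal A x0 \<and> f \<in> point_ideal_power A x0 n}"

context
  fixes A :: "('x \<Rightarrow> complex) set" and x0 :: 'x
  assumes A: "fun_subalgebra A"
begin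

abbreviation mx where "mx \<equiv> point_ideal A x0"
abbreviation mp where "mp \<equiv> point_ideal_power A x0"

lemma point_ideal_subset: "mx \<subseteq> A"
  by (auto simp: point_ideal_def)

lemma point_ideal_power_subset: "mp n \<subseteq> A"
proof (induction n)
  case (Suc n)
  show ?case
    unfolding point_ideal_power.simps
  proof (rule ideal_gen_subset[OF A], rule subsetI)
    fix h assume "h \<in> {(\<lambda>x. z x * f x) | z f. z \<in> mx \<and> f \<in> mp n}"
    then obtain z f where "h = (\<lambda>x. z x * f x)" "z \<in> A" "f \<in> A" using Suc point_ideal_subset by blast
    then show "h \<in> A" using fun_subalgebraD(3)[OF A] by blast
  qed
qed simp

lemma point_ideal_power_add: "f \<in> mp n \<Longrightarrow> g \<in> mp n \<Longrightarrow> (\<lambda>x. f x + g x) \<in> mp n"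
  by (cases n) (auto intro: ideal_gen_add fun_subalgebraD(2)[OF A])

lemma point_ideal_power_mult: "f \<in> mp n \<Longrightarrow> a \<in> A \<Longrightarrow> (\<lambda>x. a x * f x) \<in> mp n"
  by (cases n) (auto intro: ideal_gen_mult[OF A] fun_subalgebraD(3)[OF A])

lemma point_ideal_power_scale: "f \<in> mp n \<Longrightarrow> (\<lambda>x. c * f x) \<in> mp n"
  using point_ideal_power_mult[OF _ fun_subalgebraD(1)[OF A]] .

lemma point_ideal_power_diff: "f \<in> mp n \<Longrightarrow> g \<in> mp n \<Longrightarrow> (\<lambda>x. f x - g x) \<in> mp n"
  using point_ideal_power_add[of f n "\<lambda>x. - 1 * g x"] point_ideal_power_scale[of g n "-1"] by simp

lemma point_ideal_power_Suc: "z \<in> mx \<Longrightarrow> f \<in> mp n \<Longrightarrow> (\<lambda>x. z x * f x) \<in> mp (Suc n)"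
  unfolding point_ideal_power.simps by (rule ideal_gen_base[OF A]) blast

lemma point_ideal_power_mult2:
  assumes "w \<in> mp 2" "f \<in> mp n" shows "(\<lambda>x. w x * f x) \<in> mp (Suc (Suc n))"
proof -
  let ?S = "{(\<lambda>x. z x * f x) | z f. z \<in> mx \<and> f \<in> mp (Suc 0)}"
  have "w \<in> ideal_gen A ?S" using assms(1) by (simp only: numeral_2_eq_2 point_ideal_power.simps(2))
  then show ?thesis
  proof induction
    case zero
    then show ?case using ideal_gen.zero by simp
  next
    case (step c s g)
    then obtain z y where s: "s = (\<lambda>x. z x * y x)" "z \<in> mx" "y \<in> mp (Suc 0)" by blast
    from s(3) have "(\<lambda>x. y x * f x) \<in> mp (Suc n)"
      unfolding point_ideal_power.simps(2)[of A x0 0]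
    proof induction
      case zero
      then show ?case using ideal_gen.zero by simp
    next
      case (step d t g)
      then obtain z' u where t: "t = (\<lambda>x. z' x * u x)" "z' \<in> mx" "u \<in> A" by auto
      have "(\<lambda>x. z' x * ((\<lambda>x. (\<lambda>x. d x * u x) x * f x) x)) \<in> mp (Suc n)"
        by (intro point_ideal_power_Suc t(2) point_ideal_power_mult[OF assms(2)] fun_subalgebraD(3)[OF A step.hyps(1) t(3)])
      from point_ideal_power_add[OF this step.IH] show ?case by (simp add: t algebra_simps)
    qed
    from point_ideal_power_mult[OF point_ideal_power_Suc[OF s(2) this] step.hyps(1)]
    have "(\<lambda>x. c x * (z x * (y x * f x))) \<in> mp (Suc (Suc n))" .
    from point_ideal_power_add[OF this step.IH] show ?case by (simp add: s algebra_simps)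
  qed
qed

lemma point_ideal_power_1: "f \<in> mx \<Longrightarrow> f \<in> mp (Suc 0)"
  using point_ideal_power_Suc[of f "\<lambda>x. 1" 0] fun_subalgebraD(1)[OF A] by simp

text \<open>Products of elements of the maximal ideal are expanded in its generators; counting
  exponents is what the pigeonhole argument below requires.\<close>

lemma point_ideal_monomials:
  assumes Z: "finite Z" "Z \<subseteq> mx" "mx \<subseteq> ideal_gen A Z"
  shows "mp n \<subseteq> ideal_gen A {(\<lambda>x. \<Prod>z\<in>Z. z x ^ e z) | e. (\<Sum>z\<in>Z. e z) = n}"
proof (induction n)
  case 0
  have "(\<lambda>x. \<Prod>z\<in>Z. z x ^ (\<lambda>z. 0) z) \<in> {(\<lambda>x. \<Prod>z\<in>Z. z x ^ e z) | e. (\<Sum>z\<in>Z. e z) = 0}" by fastforce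
  from ideal_gen_mult[OF A ideal_gen_base[OF A this]] show ?case by auto
next
  case (Suc n)
  let ?V = "\<lambda>n. {(\<lambda>x. \<Prod>z\<in>Z. z x ^ e z) | e. (\<Sum>z\<in>Z. e z) = n}"
  have zV: "(\<lambda>x. z x * f x) \<in> ideal_gen A (?V (Suc n))" if z: "z \<in> Z" and f: "f \<in> ideal_gen A (?V n)" for z f
    using f
  proof induction
    case zero
    show ?case using ideal_gen.zero[of A "?V (Suc n)"] by simp
  next
    case (step c s g)
    then obtain e where e: "s = (\<lambda>x. \<Prod>z\<in>Z. z x ^ e z)" "(\<Sum>z\<in>Z. e z) = n" by blast
    let ?e = "e(z := Suc (e z))"
    have "(\<Sum>z\<in>Z. ?e z) = Suc n"
      using z Z(1) e(2) by (simp add: sum.remove[of Z z])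
    then have V: "(\<lambda>x. \<Prod>z\<in>Z. z x ^ ?e z) \<in> ?V (Suc n)" by blast
    have "(\<Prod>z\<in>Z. z x ^ ?e z) = z x * s x" for x
      using z Z(1) by (simp add: e(1) prod.remove[of Z z])
    then have "(\<lambda>x. z x * s x) \<in> ?V (Suc n)" using V by simp
    from ideal_gen.step[OF step.hyps(1) this step.IH] show ?case by (simp add: algebra_simps)
  qed
  have "(\<lambda>x. z x * f x) \<in> ideal_gen A (?V (Suc n))" if z: "z \<in> mx" and f: "f \<in> mp n" for z f
  proof -
    have fV: "f \<in> ideal_gen A (?V n)" using f Suc by blast
    have "z \<in> ideal_gen A Z" using z Z(3) by blast
    then show ?thesis
    proof induction
      case zero
      show ?case using ideal_gen.zero[of A "?V (Suc n)"] by simp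
    next
      case (step c s g)
      from ideal_gen_add[OF ideal_gen_mult[OF A zV[OF step.hyps(2) fV] step.hyps(1)] step.IH]
      show ?case by (simp add: algebra_simps)
    qed
  qed
  then show ?case
    unfolding point_ideal_power.simps(2) by (intro ideal_gen_minimal[OF A]) blast
qed

definition is_ideal :: "('x \<Rightarrow> complex) set \<Rightarrow> bool" where
  "is_ideal Q \<longleftrightarrow> Q \<subseteq> A \<and> (\<lambda>x. 0) \<in> Q \<and> (\<forall>f\<in>Q. \<forall>g\<in>Q. (\<lambda>x. f x + g x) \<in> Q) \<and> (\<forall>a\<in>A. \<forall>f\<in>Q. (\<lambda>x. a x * f x) \<in> Q)"

lemma is_idealD:
  assumes "is_ideal Q"
  shows "Q \<subseteq> A" "(\<lambda>x. 0) \<in> Q" "f \<in> Q \<Longrightarrow> g \<in> Q \<Longrightarrow> (\<lambda>x. f x + g x) \<in> Q"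
    "a \<in> A \<Longrightarrow> f \<in> Q \<Longrightarrow> (\<lambda>x. a x * f x) \<in> Q"
  using assms by (simp_all add: is_ideal_def)

lemma ideal_gen_in_ideal: "is_ideal Q \<Longrightarrow> S \<subseteq> Q \<Longrightarrow> ideal_gen A S \<subseteq> Q"
proof
  fix f assume Q: "is_ideal Q" "S \<subseteq> Q" and "f \<in> ideal_gen A S"
  from this(3) show "f \<in> Q"
  proof induction
    case (step c s g)
    have "s \<in> Q" using Q(2) step.hyps(2) by blast
    from is_idealD(3)[OF Q(1) is_idealD(4)[OF Q(1) step.hyps(1) this] step.IH] show ?case .
  qed (rule is_idealD(2)[OF Q(1)])
qed

text \<open>Some power z^(s z) of every generator z lies in Q. By the pigeonhole principle a
  monomial whose degree exceeds the sum of the s z contains one of these powers.\<close>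

lemma point_ideal_power_in_ideal:
  assumes Q: "is_ideal Q" and N: "noetherian A"
    and nil: "\<And>a. a \<in> mx \<Longrightarrow> \<exists>s. (\<lambda>x. a x ^ s) \<in> Q"
  shows "\<exists>n. mp n \<subseteq> Q"
proof -
  obtain Z where Z: "Z \<subseteq> mx" "finite Z" "mx \<subseteq> ideal_gen A Z"
    using N[unfolded noetherian_def, rule_format, OF point_ideal_subset] by blast
  have "\<forall>z\<in>Z. \<exists>s. (\<lambda>x. z x ^ s) \<in> Q" using nil Z(1) by blast
  from bchoice[OF this] obtain s where s: "\<And>z. z \<in> Z \<Longrightarrow> (\<lambda>x. z x ^ s z) \<in> Q" by blast
  let ?n = "Suc (\<Sum>z\<in>Z. s z)"
  have "(\<lambda>x. \<Prod>z\<in>Z. z x ^ e z) \<in> Q" if e: "(\<Sum>z\<in>Z. e z) = ?n" for e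
  proof -
    have "\<exists>z\<in>Z. s z \<le> e z"
    proof (rule ccontr)
      assume "\<not> ?thesis"
      then have "(\<Sum>z\<in>Z. e z) \<le> (\<Sum>z\<in>Z. s z)" by (intro sum_mono) (meson nat_le_linear)
      then show False using e by simp
    qed
    then obtain z where z: "z \<in> Z" "s z \<le> e z" by blast
    let ?r = "\<lambda>x. z x ^ (e z - s z) * (\<Prod>z\<in>Z - {z}. z x ^ e z)"
    have "?r \<in> A"
      using Z z(1) point_ideal_subset
      by (intro fun_subalgebraD(3)[OF A] fun_subalgebra_power[OF A] fun_subalgebra_prod[OF A]) auto
    from is_idealD(4)[OF Q this s[OF z(1)]] have "(\<lambda>x. ?r x * (z x ^ s z)) \<in> Q" .
    moreover have "?r x * (z x ^ s z) = (\<Prod>z\<in>Z. z x ^ e z)" for x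
    proof -
      have "z x ^ e z = z x ^ (e z - s z) * z x ^ s z" using z(2) by (metis power_add le_add_diff_inverse2)
      then show ?thesis using prod.remove[OF Z(2) z(1), of "\<lambda>z. z x ^ e z"] by simp
    qed
    ultimately show ?thesis by simp
  qed
  then have "ideal_gen A {(\<lambda>x. \<Prod>z\<in>Z. z x ^ e z) | e. (\<Sum>z\<in>Z. e z) = ?n} \<subseteq> Q"
    by (intro ideal_gen_in_ideal[OF Q]) blast
  then have "mp ?n \<subseteq> Q" by (rule subset_trans[OF point_ideal_monomials[OF Z(2,1,3)]])
  then show ?thesis by blast
qed

text \<open>Let m be the ideal of the point and Q a maximal ideal among those that contain m F and
  meet A F only in m F. Every element of m has a power in Q, so Q contains a power of m and
  therefore F. Hence F = z F with z in m, and e = 1 - z.\<close>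

theorem krull_intersection:
  assumes N: "noetherian A" and F: "F \<in> A" "\<And>n. F \<in> mp n"
  shows "\<exists>e\<in>A. e x0 \<noteq> 0 \<and> (\<forall>x. e x * F x = 0)"
proof -
  let ?mF = "{(\<lambda>x. z x * F x) | z. z \<in> mx}"
  define \<Q> where "\<Q> = {Q. is_ideal Q \<and> ?mF \<subseteq> Q \<and> (\<forall>u\<in>A. (\<lambda>x. u x * F x) \<in> Q \<longrightarrow> (\<lambda>x. u x * F x) \<in> ?mF)}"
  have mmI: "z \<in> mx \<Longrightarrow> (\<lambda>x. z x * F x) \<in> ?mF" for z by blast
  have "?mF \<in> \<Q>"
  proof -
    have "is_ideal ?mF"
      unfolding is_ideal_def
    proof (intro conjI ballI)
      show "?mF \<subseteq> A" using F(1) point_ideal_subset fun_subalgebraD(3)[OF A] by blast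
      have "(\<lambda>x. 0) \<in> mx" using fun_subalgebraD(1)[OF A] by (simp add: point_ideal_def)
      from mmI[OF this] show "(\<lambda>x. 0) \<in> ?mF" by simp
      fix f g assume "f \<in> ?mF" "g \<in> ?mF"
      then obtain z y where zy: "z \<in> mx" "y \<in> mx" "f = (\<lambda>x. z x * F x)" "g = (\<lambda>x. y x * F x)" by blast
      then have "(\<lambda>x. z x + y x) \<in> mx" using fun_subalgebraD(2)[OF A] by (simp add: point_ideal_def)
      from mmI[OF this] show "(\<lambda>x. f x + g x) \<in> ?mF" by (simp add: zy distrib_right)
    next
      fix a f assume "a \<in> A" "f \<in> ?mF"
      then obtain z where z: "z \<in> mx" "f = (\<lambda>x. z x * F x)" by blast
      then have "(\<lambda>x. a x * z x) \<in> mx" using fun_subalgebraD(3)[OF A \<open>a \<in> A\<close>] by (simp add: point_ideal_def)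
      from mmI[OF this] show "(\<lambda>x. a x * f x) \<in> ?mF" by (simp add: z mult.assoc)
    qed
    then show ?thesis by (simp only: \<Q>_def mem_Collect_eq subset_refl simp_thms) blast
  qed
  then have ne: "\<Q> \<noteq> {}" by blast
  have chain: "\<Union>C \<in> \<Q>" if C: "C \<noteq> {}" "subset.chain \<Q> C" for C
  proof -
    have CQ: "Q \<in> C \<Longrightarrow> Q \<in> \<Q>" for Q using C(2) by (auto simp: subset.chain_def)
    have Ci: "is_ideal Q" if "Q \<in> C" for Q using CQ[OF that] unfolding \<Q>_def by blast
    have "is_ideal (\<Union>C)"
      unfolding is_ideal_def
    proof (intro conjI ballI)
      show "\<Union>C \<subseteq> A" using is_idealD(1)[OF Ci] by blast
      show "(\<lambda>x. 0) \<in> \<Union>C" using is_idealD(2)[OF Ci] C(1) by blast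
      fix f g assume "f \<in> \<Union>C" "g \<in> \<Union>C"
      then obtain Q Q' where QQ: "Q \<in> C" "f \<in> Q" "Q' \<in> C" "g \<in> Q'" by blast
      then have "Q \<subseteq> Q' \<or> Q' \<subseteq> Q" using C(2) by (auto simp: subset.chain_def)
      then obtain P where "P \<in> C" "f \<in> P" "g \<in> P" using QQ by blast
      then show "(\<lambda>x. f x + g x) \<in> \<Union>C" using is_idealD(3)[OF Ci] by blast
    next
      fix a f assume "a \<in> A" "f \<in> \<Union>C"
      then obtain P where P: "P \<in> C" "f \<in> P" by blast
      from is_idealD(4)[OF Ci[OF P(1)] \<open>a \<in> A\<close> P(2)] P(1) show "(\<lambda>x. a x * f x) \<in> \<Union>C" by blast
    qed
    moreover have "?mF \<subseteq> \<Union>C" using CQ C(1) unfolding \<Q>_def by blast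
    moreover have "(\<lambda>x. u x * F x) \<in> ?mF" if "u \<in> A" "(\<lambda>x. u x * F x) \<in> \<Union>C" for u
      using that CQ unfolding \<Q>_def by blast
    ultimately show ?thesis unfolding \<Q>_def by blast
  qed
  obtain Q where Q: "Q \<in> \<Q>" and max: "\<And>Q'. Q' \<in> \<Q> \<Longrightarrow> Q \<subseteq> Q' \<Longrightarrow> Q' = Q"
    using subset_Zorn_nonempty[OF ne chain] by blast
  have iQ: "is_ideal Q" and mFQ: "?mF \<subseteq> Q"
    and QF: "\<And>u. u \<in> A \<Longrightarrow> (\<lambda>x. u x * F x) \<in> Q \<Longrightarrow> (\<lambda>x. u x * F x) \<in> ?mF"
    using Q by (auto simp only: \<Q>_def mem_Collect_eq)
  have Q_add: "\<And>f g. f \<in> Q \<Longrightarrow> g \<in> Q \<Longrightarrow> (\<lambda>x. f x + g x) \<in> Q"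
    and Q_mult: "\<And>a f. a \<in> A \<Longrightarrow> f \<in> Q \<Longrightarrow> (\<lambda>x. a x * f x) \<in> Q" and Q_0: "(\<lambda>x. 0) \<in> Q" and QA: "Q \<subseteq> A"
    using iQ by (auto simp only: is_ideal_def)
  have "\<exists>s. (\<lambda>x. a x ^ s) \<in> Q" if a: "a \<in> mx" for a
  proof -
    have aA: "a \<in> A" using a point_ideal_subset by blast
    \<comment> \<open>The colon ideals of Q by the powers a^j increase with j. Their union U is
      finitely generated, so it is already the colon ideal by some a^s.\<close>
    define U where "U = {r \<in> A. \<exists>j. (\<lambda>x. r x * a x ^ j) \<in> Q}"
    have "U \<subseteq> A" by (auto simp: U_def)
    then obtain T where T: "T \<subseteq> U" "finite T" "U \<subseteq> ideal_gen A T"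
      using N[unfolded noetherian_def, rule_format] by blast
    have "\<forall>t\<in>T. \<exists>j. (\<lambda>x. t x * a x ^ j) \<in> Q" using T(1) by (auto simp: U_def)
    from bchoice[OF this] obtain j where j: "\<And>t. t \<in> T \<Longrightarrow> (\<lambda>x. t x * a x ^ j t) \<in> Q" by blast
    obtain s where s: "\<And>t. t \<in> T \<Longrightarrow> j t \<le> s" using T(2) by (meson finite_imageI finite_nat_set_iff_bounded_le imageI)
    have Us: "(\<lambda>x. r x * a x ^ s) \<in> Q" if "r \<in> U" for r
    proof -
      have "r \<in> ideal_gen A T" using T(3) that by blast
      then show ?thesis
      proof induction
        case zero
        show ?case using Q_0 by simp
      next
        case (step c t g)
        have "(\<lambda>x. (\<lambda>x. c x * a x ^ (s - j t)) x * (t x * a x ^ j t)) \<in> Q"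
          by (intro Q_mult j step fun_subalgebraD(3)[OF A] fun_subalgebra_power[OF A] aA)
        moreover have "(\<lambda>x. c x * a x ^ (s - j t)) x * (t x * a x ^ j t) = c x * t x * a x ^ s" for x
        proof -
          have "a x ^ s = a x ^ (s - j t) * a x ^ j t" using s[OF step.hyps(2)] by (metis power_add le_add_diff_inverse2)
          then show ?thesis by simp
        qed
        ultimately have "(\<lambda>x. c x * t x * a x ^ s) \<in> Q" by simp
        from Q_add[OF this step.IH] show ?case by (simp add: distrib_right)
      qed
    qed
    \<comment> \<open>Adjoining a^s keeps the defining property of Q: if u F = q + r a^s,
      multiplying by a brings r a^(s+1) into Q, so r is in U and r a^s was in Q already. By
      maximality a^s lies in Q.\<close>
    let ?Q' = "{(\<lambda>x. q x + r x * a x ^ s) | q r. q \<in> Q \<and> r \<in> A}"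
    have Q'I: "q \<in> Q \<Longrightarrow> r \<in> A \<Longrightarrow> (\<lambda>x. q x + r x * a x ^ s) \<in> ?Q'" for q r by blast
    have QQ': "Q \<subseteq> ?Q'"
    proof
      fix q assume "q \<in> Q"
      from Q'I[OF this fun_subalgebraD(1)[OF A, of 0]] show "q \<in> ?Q'" by simp
    qed
    have "?Q' \<in> \<Q>"
    proof -
      have "is_ideal ?Q'"
        unfolding is_ideal_def
      proof (intro conjI ballI)
        show "?Q' \<subseteq> A"
          using QA aA by (auto intro!: fun_subalgebraD(2,3)[OF A] fun_subalgebra_power[OF A])
        show "(\<lambda>x. 0) \<in> ?Q'" using QQ' Q_0 by blast
        fix f g assume "f \<in> ?Q'" "g \<in> ?Q'"
        then obtain q r q' r' where fg: "f = (\<lambda>x. q x + r x * a x ^ s)" "q \<in> Q" "r \<in> A"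
          "g = (\<lambda>x. q' x + r' x * a x ^ s)" "q' \<in> Q" "r' \<in> A" by blast
        from Q'I[OF Q_add[OF fg(2,5)] fun_subalgebraD(2)[OF A fg(3,6)]]
        show "(\<lambda>x. f x + g x) \<in> ?Q'" by (simp add: fg(1,4) algebra_simps)
      next
        fix b f assume b: "b \<in> A" and "f \<in> ?Q'"
        then obtain q r where f: "f = (\<lambda>x. q x + r x * a x ^ s)" "q \<in> Q" "r \<in> A" by blast
        from Q'I[OF Q_mult[OF b f(2)] fun_subalgebraD(3)[OF A b f(3)]]
        show "(\<lambda>x. b x * f x) \<in> ?Q'" by (simp add: f(1) algebra_simps)
      qed
      moreover have "?mF \<subseteq> ?Q'" using mFQ QQ' by blast
      moreover have "(\<lambda>x. u x * F x) \<in> ?mF" if u: "u \<in> A" "(\<lambda>x. u x * F x) \<in> ?Q'" for u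
      proof -
        obtain q r where qr: "(\<lambda>x. u x * F x) = (\<lambda>x. q x + r x * a x ^ s)" "q \<in> Q" "r \<in> A" using u(2) by blast
        have "(\<lambda>x. a x * u x) \<in> mx" using a fun_subalgebraD(3)[OF A aA u(1)] by (simp add: point_ideal_def)
        from mmI[OF this] have 1: "(\<lambda>x. a x * u x * F x) \<in> Q" using mFQ by blast
        have "(\<lambda>x. a x * u x * F x + (-1) * (a x * q x)) \<in> Q"
          by (intro Q_add[OF 1] Q_mult[OF fun_subalgebraD(1)[OF A]] Q_mult[OF aA qr(2)])
        moreover have "a x * u x * F x + (-1) * (a x * q x) = r x * a x ^ Suc s" for x
          using arg_cong[OF fun_cong[OF qr(1), of x], of "\<lambda>y. a x * y"] by (simp add: algebra_simps)
        ultimately have "(\<lambda>x. r x * a x ^ Suc s) \<in> Q" by (simp only:)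
        then have "r \<in> U" unfolding U_def using qr(3) by blast
        from Q_add[OF qr(2) Us[OF this]] have "(\<lambda>x. u x * F x) \<in> Q" by (simp only: qr(1))
        then show ?thesis by (rule QF[OF u(1)])
      qed
      ultimately show ?thesis unfolding \<Q>_def by blast
    qed
    from max[OF this QQ'] have "?Q' = Q" .
    moreover have "(\<lambda>x. a x ^ s) \<in> ?Q'" using Q'I[OF Q_0 fun_subalgebraD(1)[OF A, of 1]] by simp
    ultimately show ?thesis by blast
  qed
  then obtain n where "mp n \<subseteq> Q" using point_ideal_power_in_ideal[OF iQ N] by blast
  then have "F \<in> Q" using F(2) by blast
  then have "(\<lambda>x. (\<lambda>x. 1) x * F x) \<in> ?mF" by (intro QF fun_subalgebraD(1)[OF A]) simp
  then obtain z where z: "z \<in> mx" "(\<lambda>x. 1 * F x) = (\<lambda>x. z x * F x)" by blast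
  have "(1 - z x) * F x = 0" for x using fun_cong[OF z(2), of x] by (simp add: algebra_simps)
  moreover have "(\<lambda>x. 1 - z x) \<in> A"
    using z(1) point_ideal_subset by (intro fun_subalgebra_diff[OF A] fun_subalgebraD(1)[OF A]) blast
  moreover have "1 - z x0 \<noteq> 0" using z(1) by (simp add: point_ideal_def)
  ultimately show ?thesis by (intro bexI[of _ "\<lambda>x. 1 - z x"]) auto
qed

text \<open>Euler's identity: a derivation inducing the identity on \<open>mx / mx\<^sup>2\<close> multiplies the elements of
  \<open>mx\<^sup>n\<close> by \<open>n\<close> modulo \<open>mx\<^sup>n\<^sup>+\<^sup>1\<close>.\<close>

lemma euler_power:
  assumes E: "\<And>f. f \<in> A \<Longrightarrow> E f \<in> mx"
    and E_add: "\<And>f g. f \<in> A \<Longrightarrow> g \<in> A \<Longrightarrow> E (\<lambda>x. f x + g x) = (\<lambda>x. E f x + E g x)"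
    and E_mult: "\<And>f g. f \<in> A \<Longrightarrow> g \<in> A \<Longrightarrow> E (\<lambda>x. f x * g x) = (\<lambda>x. f x * E g x + E f x * g x)"
    and E_id: "\<And>y. y \<in> mx \<Longrightarrow> (\<lambda>x. E y x - y x) \<in> mp 2"
    and f: "f \<in> mp n"
  shows "(\<lambda>x. E f x - of_nat n * f x) \<in> mp (Suc n)"
  using f
proof (induction n arbitrary: f)
  case 0
  then show ?case using point_ideal_power_1[OF E] by simp
next
  case (Suc n)
  have E0: "E (\<lambda>x. 0) = (\<lambda>x. 0)"
    using E_add[of "\<lambda>x. 0" "\<lambda>x. 0"] fun_subalgebraD(1)[OF A, of 0] by (simp add: fun_eq_iff)
  let ?S = "{(\<lambda>x. z x * f x) | z f. z \<in> mx \<and> f \<in> mp n}"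
  have SA: "?S \<subseteq> A" using point_ideal_subset point_ideal_power_subset fun_subalgebraD(3)[OF A] by blast
  from Suc.prems show ?case
    unfolding point_ideal_power.simps(2)[of A x0 n]
  proof induction
    case zero
    show ?case using ideal_gen.zero by (simp add: E0)
  next
    case (step c s g)
    then obtain z f where s: "s = (\<lambda>x. z x * f x)" "z \<in> mx" "f \<in> mp n" by blast
    have zA: "z \<in> A" and fA: "f \<in> A" and sA: "s \<in> A" using s(2,3) step.hyps(2) SA point_ideal_subset point_ideal_power_subset by blast+
    have gA: "g \<in> A" using step.hyps(3) ideal_gen_subset[OF A SA] by blast
    have csA: "(\<lambda>x. c x * s x) \<in> A" by (rule fun_subalgebraD(3)[OF A step.hyps(1) sA])
    have sm: "s \<in> mp (Suc n)" unfolding s(1) by (rule point_ideal_power_Suc[OF s(2,3)])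
    have 1: "(\<lambda>x. z x * (E f x - of_nat n * f x)) \<in> mp (Suc (Suc n))"
      by (rule point_ideal_power_Suc[OF s(2) Suc.IH[OF s(3)]])
    have 2: "(\<lambda>x. (E z x - z x) * f x) \<in> mp (Suc (Suc n))"
      by (rule point_ideal_power_mult2[OF E_id[OF s(2)] s(3)])
    have "(\<lambda>x. E s x - of_nat (Suc n) * s x) \<in> mp (Suc (Suc n))"
      using point_ideal_power_add[OF 1 2] unfolding s(1) E_mult[OF zA fA] by (simp add: algebra_simps)
    from point_ideal_power_mult[OF this step.hyps(1)]
    have 3: "(\<lambda>x. c x * (E s x - of_nat (Suc n) * s x)) \<in> mp (Suc (Suc n))" .
    have 4: "(\<lambda>x. E c x * s x) \<in> mp (Suc (Suc n))" by (rule point_ideal_power_Suc[OF E[OF step.hyps(1)] sm])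
    have "E (\<lambda>x. c x * s x + g x) = (\<lambda>x. c x * E s x + E c x * s x + E g x)"
      using E_add[OF csA gA] E_mult[OF step.hyps(1) sA] by simp
    then have "(\<lambda>x. E (\<lambda>x. c x * s x + g x) x - of_nat (Suc n) * (c x * s x + g x)) =
      (\<lambda>x. (c x * (E s x - of_nat (Suc n) * s x) + E c x * s x) + (E g x - of_nat (Suc n) * g x))"
      by (simp add: algebra_simps)
    then show ?case using point_ideal_power_add[OF point_ideal_power_add[OF 3 4] step.IH] by (simp only:)
  qed
qed

text \<open>On m^n modulo m^(n+1) the derivation E is multiplication by n, while it sends \<F> into
  m \<F>. So if \<F> lies in m^n with n \<ge> 1, then n f, and therefore f, lies in m^(n+1). Thus
  \<F> lies in every power of m, and Krull's theorem applies.\<close>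

lemma vanishes_near_point:
  assumes N: "noetherian A"
    and E: "\<And>f. f \<in> A \<Longrightarrow> E f \<in> mx"
    and E_add: "\<And>f g. f \<in> A \<Longrightarrow> g \<in> A \<Longrightarrow> E (\<lambda>x. f x + g x) = (\<lambda>x. E f x + E g x)"
    and E_mult: "\<And>f g. f \<in> A \<Longrightarrow> g \<in> A \<Longrightarrow> E (\<lambda>x. f x * g x) = (\<lambda>x. f x * E g x + E f x * g x)"
    and E_id: "\<And>y. y \<in> mx \<Longrightarrow> (\<lambda>x. E y x - y x) \<in> mp 2"
    and \<F>: "\<F> \<subseteq> mx" "\<And>f. f \<in> \<F> \<Longrightarrow> E f \<in> ideal_gen A {(\<lambda>x. z x * f' x) | z f'. z \<in> mx \<and> f' \<in> \<F>}"
    and f: "f \<in> \<F>"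
  shows "\<exists>e\<in>A. e x0 \<noteq> 0 \<and> (\<forall>x. e x * f x = 0)"
proof -
  have 1: "\<F> \<subseteq> mp (Suc n)" for n
  proof (induction n)
    case 0
    then show ?case using \<F>(1) point_ideal_power_1 by blast
  next
    case (Suc n)
    show ?case
    proof
      fix f assume f: "f \<in> \<F>"
      have "ideal_gen A {(\<lambda>x. z x * f' x) | z f'. z \<in> mx \<and> f' \<in> \<F>} \<subseteq> mp (Suc (Suc n))"
        unfolding point_ideal_power.simps(2)[of A x0 "Suc n"] using Suc by (intro ideal_gen_mono) blast
      then have 1: "E f \<in> mp (Suc (Suc n))" using \<F>(2)[OF f] by blast
      have "f \<in> mp (Suc n)" using Suc f by blast
      from euler_power[of E, OF E E_add E_mult E_id this]
      have "(\<lambda>x. E f x - of_nat (Suc n) * f x) \<in> mp (Suc (Suc n))" .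
      from point_ideal_power_diff[OF 1 this] have "(\<lambda>x. of_nat (Suc n) * f x) \<in> mp (Suc (Suc n))" by simp
      from point_ideal_power_scale[OF this, of "1 / of_nat (Suc n)"]
      show "f \<in> mp (Suc (Suc n))" by (simp del: of_nat_Suc)
    qed
  qed
  have fA: "f \<in> A" using f \<F>(1) point_ideal_subset by blast
  have "f \<in> mp n" for n
  proof (cases n)
    case 0
    then show ?thesis using fA by simp
  next
    case (Suc k)
    then show ?thesis using 1[of k] f by blast
  qed
  from krull_intersection[OF N fA this] show ?thesis .
qed

end

text \<open>Z represents a basis of m/m^2 and \<open>\<kappa> f\<close> the coordinates of the class
  of f - f x0. Everything is stated modulo \<open>point_ideal_power A x0 2\<close>, so that no
  quotient space has to be formed.\<close>

lemma cotangent_coordinates: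
  fixes A :: "('x \<Rightarrow> complex) set"
  assumes A: "fun_subalgebra A" and N: "noetherian A"
  obtains Z \<kappa> where "finite Z" "Z \<subseteq> point_ideal A x0"
    "\<And>f. f \<in> A \<Longrightarrow> (\<lambda>x. f x - f x0 - (\<Sum>z\<in>Z. \<kappa> f z * z x)) \<in> point_ideal_power A x0 2"
    "\<And>c z. (\<lambda>x. \<Sum>z\<in>Z. c z * z x) \<in> point_ideal_power A x0 2 \<Longrightarrow> z \<in> Z \<Longrightarrow> c z = 0"
proof -
  let ?m = "point_ideal A x0" and ?m2 = "point_ideal_power A x0 2"
  define P where "P Z \<longleftrightarrow> finite Z \<and> Z \<subseteq> ?m \<and> (\<forall>y\<in>?m. \<exists>c. (\<lambda>x. y x - (\<Sum>z\<in>Z. c z * z x)) \<in> ?m2)" for Z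
  have mA: "?m \<subseteq> A" by (rule point_ideal_subset[OF A])
  have m2: "(\<lambda>x. z x * y x) \<in> ?m2" if "z \<in> ?m" "y \<in> ?m" for z y
    using point_ideal_power_Suc[OF A that(1) point_ideal_power_1[OF A that(2)]] by (simp add: numeral_2_eq_2)
  have add2: "(\<lambda>x. f x + g x) \<in> ?m2" if "f \<in> ?m2" "g \<in> ?m2" for f g
    using point_ideal_power_add[OF A that] .
  have diff2: "(\<lambda>x. f x - g x) \<in> ?m2" if "f \<in> ?m2" "g \<in> ?m2" for f g
    using point_ideal_power_diff[OF A that] .
  have scale2: "(\<lambda>x. c * f x) \<in> ?m2" if "f \<in> ?m2" for f c
    using point_ideal_power_scale[OF A that] .
  have zero2: "(\<lambda>x. 0) \<in> ?m2"
    using ideal_gen.zero by (simp add: numeral_2_eq_2)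
  have "\<exists>Z. P Z"
  proof -
    obtain Z where Z: "Z \<subseteq> ?m" "finite Z" "?m \<subseteq> ideal_gen A Z"
      using N[unfolded noetherian_def, rule_format, OF mA] by blast
    have "\<exists>c. (\<lambda>x. y x - (\<Sum>z\<in>Z. c z * z x)) \<in> ?m2" if "y \<in> ideal_gen A Z" for y
      using that
    proof induction
      case zero
      show ?case using zero2 by (intro exI[of _ "\<lambda>z. 0"]) simp
    next
      case (step a s g)
      then obtain c where c: "(\<lambda>x. g x - (\<Sum>z\<in>Z. c z * z x)) \<in> ?m2" by blast
      have "(\<lambda>x. a x - a x0) \<in> ?m"
        using fun_subalgebra_diff[OF A step.hyps(1) fun_subalgebraD(1)[OF A]] by (simp add: point_ideal_def)
      from add2[OF m2[OF this] c] have 1: "(\<lambda>x. (a x - a x0) * s x + (g x - (\<Sum>z\<in>Z. c z * z x))) \<in> ?m2"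
        using Z(1) step.hyps(2) by blast
      let ?c = "c(s := c s + a x0)"
      have "(\<Sum>z\<in>Z. ?c z * z x) = a x0 * s x + (\<Sum>z\<in>Z. c z * z x)" for x
        using Z(2) step.hyps(2) by (simp add: sum.remove[of Z s] distrib_right)
      then have "(\<lambda>x. (a x * s x + g x) - (\<Sum>z\<in>Z. ?c z * z x)) = (\<lambda>x. (a x - a x0) * s x + (g x - (\<Sum>z\<in>Z. c z * z x)))"
        by (simp add: algebra_simps)
      then show ?case using 1 by (intro exI[of _ ?c]) (simp only:)
    qed
    then show ?thesis using Z by (intro exI[of _ Z]) (auto simp: P_def)
  qed
  then obtain Z where Z: "P Z" and min: "\<And>Z'. P Z' \<Longrightarrow> card Z \<le> card Z'"
    using ex_has_least_nat[of P _ card] by blast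
  have fZ: "finite Z" and Zm: "Z \<subseteq> ?m" and Zc: "\<And>y. y \<in> ?m \<Longrightarrow> \<exists>c. (\<lambda>x. y x - (\<Sum>z\<in>Z. c z * z x)) \<in> ?m2"
    using Z by (auto simp: P_def)
  have "\<exists>c. (\<lambda>x. f x - f x0 - (\<Sum>z\<in>Z. c z * z x)) \<in> ?m2" if "f \<in> A" for f
  proof (rule Zc)
    show "(\<lambda>x. f x - f x0) \<in> ?m"
      using fun_subalgebra_diff[OF A that fun_subalgebraD(1)[OF A]] by (simp add: point_ideal_def)
  qed
  then have "\<forall>f. \<exists>c. f \<in> A \<longrightarrow> (\<lambda>x. f x - f x0 - (\<Sum>z\<in>Z. c z * z x)) \<in> ?m2" by blast
  from choice[OF this] obtain \<kappa> where \<kappa>: "\<And>f. f \<in> A \<Longrightarrow> (\<lambda>x. f x - f x0 - (\<Sum>z\<in>Z. \<kappa> f z * z x)) \<in> ?m2" by blast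
  \<comment> \<open>If \<open>c z\<close> were nonzero, z could be expressed by the other members of
    Z modulo m^2 and dropped, against the minimality of Z.\<close>
  have ind: "c z = 0" if c: "(\<lambda>x. \<Sum>z\<in>Z. c z * z x) \<in> ?m2" and z: "z \<in> Z" for c z
  proof (rule ccontr)
    assume nz: "c z \<noteq> 0"
    have "P (Z - {z})"
      unfolding P_def
    proof (intro conjI ballI)
      fix y assume "y \<in> ?m"
      then obtain d where d: "(\<lambda>x. y x - (\<Sum>z\<in>Z. d z * z x)) \<in> ?m2" using Zc by blast
      let ?e = "\<lambda>w. d w - (d z / c z) * c w"
      have "(\<lambda>x. y x - (\<Sum>z\<in>Z. d z * z x) + (d z / c z) * (\<Sum>z\<in>Z. c z * z x)) \<in> ?m2"
        by (intro add2 d scale2 c)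
      moreover have "y x - (\<Sum>z\<in>Z. d z * z x) + (d z / c z) * (\<Sum>z\<in>Z. c z * z x) = y x - (\<Sum>w\<in>Z - {z}. ?e w * w x)" for x
      proof -
        have "(\<Sum>w\<in>Z - {z}. ?e w * w x) = (\<Sum>w\<in>Z. ?e w * w x)"
          using fZ z nz by (simp add: sum.remove[of Z z])
        also have "\<dots> = (\<Sum>w\<in>Z. d w * w x) - (d z / c z) * (\<Sum>w\<in>Z. c w * w x)"
          unfolding sum_distrib_left sum_subtractf[symmetric] by (rule sum.cong) (simp_all add: left_diff_distrib)
        finally show ?thesis by simp
      qed
      ultimately show "\<exists>c. (\<lambda>x. y x - (\<Sum>w\<in>Z - {z}. c w * w x)) \<in> ?m2" by (intro exI[of _ ?e]) (simp only:)
    qed (use fZ Zm in auto)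
    from min[OF this] show False using card_Diff1_less[OF fZ z] by simp
  qed
  show ?thesis by (rule that[of Z \<kappa>]) (fact fZ Zm \<kappa> ind)+
qed

lemma leibniz_rearrange:
  fixes a b k k' w F G p q :: complex
  shows "(a * k + k' * b) * w = a * (k * w) + b * (k' * w)"
    and "a * (G - b - p) + b * (F - a - q) + (F - a) * (G - b) = F * G - a * b - (a * p + b * q)"
  by (simp_all add: algebra_simps)

section \<open>From the Lie algebra to the connected group\<close>

context linear_group_space
begin

text \<open>Composition with this map turns a function on \<open>G0\<close> into a total one, with
  the value at \<open>id\<close> off \<open>G0\<close>; the Noetherian theory for total functions
  then applies to \<open>ring\<close>.\<close>

definition retract :: "('a \<Rightarrow> 'a) \<Rightarrow> 'a \<Rightarrow> 'a" where
  "retract x = (if x \<in> G0 then x else id)"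

lemma retract: "retract x \<in> G0" "x \<in> G0 \<Longrightarrow> retract x = x" "retract id = id"
  using G0_id by (auto simp: retract_def)

definition ring :: "(('a \<Rightarrow> 'a) \<Rightarrow> complex) set" where
  "ring = {(\<lambda>x. r (retract x)) | r. r \<in> regular_functions G0}"

lemma ringI: "r \<in> regular_functions G0 \<Longrightarrow> (\<lambda>x. r (retract x)) \<in> ring"
  by (auto simp: ring_def)

lemma ring_retract: "f \<in> ring \<Longrightarrow> f (retract x) = f x"
  by (auto simp: ring_def retract)

lemma fun_subalgebra_ring: "fun_subalgebra ring"
  unfolding fun_subalgebra_def
proof (intro conjI allI ballI)
  fix c
  from ringI[OF function_algebra.const[of c]] show "(\<lambda>x. c) \<in> ring" by (simp add: retract)
next
  fix f g assume "f \<in> ring" "g \<in> ring"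
  then obtain r r' where r: "r \<in> regular_functions G0" "f = (\<lambda>x. r (retract x))"
    "r' \<in> regular_functions G0" "g = (\<lambda>x. r' (retract x))" by (auto simp: ring_def)
  from ringI[OF function_algebra.add[OF r(1,3)]] show "(\<lambda>x. f x + g x) \<in> ring" by (simp add: r retract)
  from ringI[OF function_algebra.mult[OF r(1,3)]] show "(\<lambda>x. f x * g x) \<in> ring" by (simp add: r retract)
qed

text \<open>Every matrix coefficient, of x or of its inverse, is a combination of those taken with
  respect to \<open>Basis\<close>, so finitely many functions generate the ring.\<close>

lemma noetherian_ring: "noetherian ring"
proof -
  let ?S1 = "(\<lambda>(b, c) x. coord b (retract x c)) ` (Basis \<times> Basis)"
  let ?S2 = "(\<lambda>(b, c) x. coord b (inv_into UNIV (retract x) c)) ` (Basis \<times> Basis)"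
  let ?S = "?S1 \<union> ?S2"
  let ?F = "function_algebra UNIV ?S"
  have F: "fun_subalgebra ?F" by (rule fun_subalgebra_function_algebra)
  have R: "fun_subalgebra ring" by (rule fun_subalgebra_ring)
  have ex: "l (T v) = (\<Sum>b\<in>Basis. \<Sum>c\<in>Basis. (l b * coord c v) * coord b (T c))" if "functional l" "endo T" for l T v
  proof -
    have "l (T v) = (\<Sum>b\<in>Basis. coord b (T v) * l b)" by (rule functional_expansion[OF that(1)])
    also have "\<dots> = (\<Sum>b\<in>Basis. (\<Sum>c\<in>Basis. coord c v * coord b (T c)) * l b)"
    proof (rule sum.cong[OF refl])
      fix b
      have "coord b (T v) = (\<Sum>c\<in>Basis. coord c v * coord b (T c))"
        by (rule functional_expansion[OF functional_comp[OF functional_coord that(2)]])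
      then show "coord b (T v) * l b = (\<Sum>c\<in>Basis. coord c v * coord b (T c)) * l b" by (simp only:)
    qed
    also have "\<dots> = (\<Sum>b\<in>Basis. \<Sum>c\<in>Basis. (l b * coord c v) * coord b (T c))"
      unfolding sum_distrib_right by (intro sum.cong refl) (simp only: mult_ac)
    finally show ?thesis .
  qed
  have gen: "(\<lambda>x. \<Sum>b\<in>Basis. \<Sum>c\<in>Basis. a b c * f b c x) \<in> ?F" if "\<And>b c. b \<in> Basis \<Longrightarrow> c \<in> Basis \<Longrightarrow> f b c \<in> ?S" for a f
  proof -
    have "f b c \<in> ?F" if "b \<in> Basis" "c \<in> Basis" for b c
      using function_algebra.generator[OF \<open>\<And>b c. b \<in> Basis \<Longrightarrow> c \<in> Basis \<Longrightarrow> f b c \<in> ?S\<close>[OF that], of UNIV]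
      by (simp only: restrict_UNIV)
    then show ?thesis by (intro fun_subalgebra_sum[OF F] finite_Basis fun_subalgebra_scale[OF F])
  qed
  have "ring = ?F"
  proof
    have "(\<lambda>x. r (retract x)) \<in> ?F" if "r \<in> regular_functions G0" for r
      using that
    proof induction
      case (generator f)
      from generator show ?case
      proof (cases rule: matrix_coeffs_cases)
        case (1 l v)
        have "restrict f G0 (retract x) = (\<Sum>b\<in>Basis. \<Sum>c\<in>Basis. (l b * coord c v) * coord b (retract x c))" for x
          using ex[OF 1(1) G0_endo[OF retract(1)[of x]], of v] retract(1)[of x] by (simp only: 1 restrict_apply if_True)
        moreover have "(\<lambda>x. \<Sum>b\<in>Basis. \<Sum>c\<in>Basis. (l b * coord c v) * coord b (retract x c)) \<in> ?F"
          by (rule gen[of "\<lambda>b c x. coord b (retract x c)"]) auto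
        ultimately show ?thesis by (simp only:)
      next
        case (2 l v)
        have "restrict f G0 (retract x) = (\<Sum>b\<in>Basis. \<Sum>c\<in>Basis. (l b * coord c v) * coord b (inv_into UNIV (retract x) c))" for x
          using ex[OF 2(1) endo_inv[OF G0_endo[OF retract(1)[of x]] G0_bij[OF retract(1)[of x]]], of v] retract(1)[of x]
          by (simp only: 2 restrict_apply if_True)
        moreover have "(\<lambda>x. \<Sum>b\<in>Basis. \<Sum>c\<in>Basis. (l b * coord c v) * coord b (inv_into UNIV (retract x) c)) \<in> ?F"
          by (rule gen[of "\<lambda>b c x. coord b (inv_into UNIV (retract x) c)"]) auto
        ultimately show ?thesis by (simp only:)
      qed
    next
      case (const c)
      show ?case using fun_subalgebraD(1)[OF F] retract(1) by simp
    next
      case (add f g)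
      from fun_subalgebraD(2)[OF F add.IH] show ?case using retract(1) by simp
    next
      case (mult f g)
      from fun_subalgebraD(3)[OF F mult.IH] show ?case using retract(1) by simp
    qed
    then show "ring \<subseteq> ?F" by (auto simp: ring_def)
    have S: "s \<in> ring" if "s \<in> ?S" for s
    proof -
      from that consider b c where "s = (\<lambda>x. coord b (retract x c))" | b c where "s = (\<lambda>x. coord b (inv_into UNIV (retract x) c))"
        by auto
      then show ?thesis
      proof cases
        case 1
        show ?thesis using ringI[OF regular_coeff[OF functional_coord]] retract(1) by (simp add: 1)
      next
        case 2
        show ?thesis using ringI[OF regular_inv_coeff[OF functional_coord]] retract(1) by (simp add: 2)
      qed
    qed
    show "?F \<subseteq> ring"
    proof
      fix f assume "f \<in> ?F"
      then show "f \<in> ring"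
      proof induction
        case (generator s)
        then show ?case using S by (simp only: restrict_UNIV)
      qed (use fun_subalgebraD[OF R] in \<open>simp_all add: restrict_UNIV\<close>)
    qed
  qed
  then show ?thesis using noetherian_function_algebra[of ?S] finite_Basis by simp
qed

text \<open>The invariant fields of the coordinate derivations combine to a derivation E that is the
  identity on m/m^2. As the Lie algebra preserves U, it sends coefficients l (x v), with l zero on U
  and v in U, into m times such coefficients. By \<open>vanishes_near_point\<close> these
  coefficients vanish near the identity.\<close>

lemma vanishing_near_identity:
  assumes U: "subspace U"
    and inv: "\<And>D v. D \<in> tangent_space (linear_group sc G0) \<Longrightarrow> v \<in> U \<Longrightarrow>
       differential sc (linear_group sc G0) (\<lambda>g. g) D v \<in> U"
    and l: "functional l" "\<And>u. u \<in> U \<Longrightarrow> l u = 0" and v: "v \<in> U"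
  shows "\<exists>e\<in>ring. e id \<noteq> 0 \<and> (\<forall>x\<in>G0. e x * l (x v) = 0)"
proof -
  let ?m = "point_ideal ring id" and ?m2 = "point_ideal_power ring id 2"
  note R = fun_subalgebra_ring
  obtain Z \<kappa> where fZ: "finite Z" and Zm: "Z \<subseteq> ?m"
    and \<kappa>: "\<And>f. f \<in> ring \<Longrightarrow> (\<lambda>x. f x - f id - (\<Sum>z\<in>Z. \<kappa> f z * z x)) \<in> ?m2"
    and ind: "\<And>c z. (\<lambda>x. \<Sum>z\<in>Z. c z * z x) \<in> ?m2 \<Longrightarrow> z \<in> Z \<Longrightarrow> c z = 0"
    by (rule cotangent_coordinates[OF R noetherian_ring, of id]) blast
  have add2: "(\<lambda>x. f x + g x) \<in> ?m2" if "f \<in> ?m2" "g \<in> ?m2" for f g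
    using point_ideal_power_add[OF R that] .
  have diff2: "(\<lambda>x. f x - g x) \<in> ?m2" if "f \<in> ?m2" "g \<in> ?m2" for f g
    using point_ideal_power_diff[OF R that] .
  have scale2: "(\<lambda>x. c * f x) \<in> ?m2" if "f \<in> ?m2" for f c
    using point_ideal_power_scale[OF R that] .
  have m2: "(\<lambda>x. z x * y x) \<in> ?m2" if "z \<in> ?m" "y \<in> ?m" for z y
    using point_ideal_power_Suc[OF R that(1) point_ideal_power_1[OF R that(2)]] by (simp add: numeral_2_eq_2)
  have zero2: "(\<lambda>x. 0) \<in> ?m2" using ideal_gen.zero by (simp add: numeral_2_eq_2)
  have minus_id: "(\<lambda>x. f x - f id) \<in> ?m" if "f \<in> ring" for f
    using fun_subalgebra_diff[OF R that fun_subalgebraD(1)[OF R]] by (simp add: point_ideal_def)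
  have \<kappa>_eq: "\<kappa> f z = c z" if f: "f \<in> ring" and c: "(\<lambda>x. f x - f id - (\<Sum>z\<in>Z. c z * z x)) \<in> ?m2" and z: "z \<in> Z" for f c z
  proof -
    have "(\<lambda>x. (f x - f id - (\<Sum>z\<in>Z. c z * z x)) - (f x - f id - (\<Sum>z\<in>Z. \<kappa> f z * z x))) \<in> ?m2"
      by (rule diff2[OF c \<kappa>[OF f]])
    then have "(\<lambda>x. \<Sum>z\<in>Z. (\<kappa> f z - c z) * z x) \<in> ?m2"
      by (simp add: left_diff_distrib sum_subtractf)
    from ind[OF this z] show ?thesis by simp
  qed
  have \<kappa>_add: "\<kappa> (\<lambda>x. f x + g x) z = \<kappa> f z + \<kappa> g z" if f: "f \<in> ring" and g: "g \<in> ring" and z: "z \<in> Z" for f g z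
  proof (rule \<kappa>_eq[OF fun_subalgebraD(2)[OF R f g] _ z])
    show "(\<lambda>x. f x + g x - (f id + g id) - (\<Sum>z\<in>Z. (\<kappa> f z + \<kappa> g z) * z x)) \<in> ?m2"
      using add2[OF \<kappa>[OF f] \<kappa>[OF g]] by (simp add: distrib_right sum.distrib algebra_simps)
  qed
  have \<kappa>_scale: "\<kappa> (\<lambda>x. a * f x) z = a * \<kappa> f z" if f: "f \<in> ring" and z: "z \<in> Z" for f z a
  proof (rule \<kappa>_eq[OF fun_subalgebra_scale[OF R f] _ z])
    have "(\<lambda>x. a * f x - a * f id - (\<Sum>z\<in>Z. a * \<kappa> f z * z x)) = (\<lambda>x. a * (f x - f id - (\<Sum>z\<in>Z. \<kappa> f z * z x)))"
    proof
      fix x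
      have "(\<Sum>z\<in>Z. a * \<kappa> f z * z x) = a * (\<Sum>z\<in>Z. \<kappa> f z * z x)"
        by (simp only: sum_distrib_left mult.assoc)
      then show "a * f x - a * f id - (\<Sum>z\<in>Z. a * \<kappa> f z * z x) = a * (f x - f id - (\<Sum>z\<in>Z. \<kappa> f z * z x))"
        by (simp only: right_diff_distrib)
    qed
    then show "(\<lambda>x. a * f x - a * f id - (\<Sum>z\<in>Z. a * \<kappa> f z * z x)) \<in> ?m2" using scale2[OF \<kappa>[OF f]] by (simp only:)
  qed
  have \<kappa>_mult: "\<kappa> (\<lambda>x. f x * g x) z = f id * \<kappa> g z + \<kappa> f z * g id" if f: "f \<in> ring" and g: "g \<in> ring" and z: "z \<in> Z" for f g z
  proof (rule \<kappa>_eq[OF fun_subalgebraD(3)[OF R f g] _ z])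
    have "(\<lambda>x. f id * (g x - g id - (\<Sum>z\<in>Z. \<kappa> g z * z x)) + g id * (f x - f id - (\<Sum>z\<in>Z. \<kappa> f z * z x))
        + (f x - f id) * (g x - g id)) \<in> ?m2"
      by (intro add2 scale2 \<kappa> f g m2 minus_id)
    moreover have "f id * (g x - g id - (\<Sum>z\<in>Z. \<kappa> g z * z x)) + g id * (f x - f id - (\<Sum>z\<in>Z. \<kappa> f z * z x))
        + (f x - f id) * (g x - g id) = f x * g x - f id * g id - (\<Sum>z\<in>Z. (f id * \<kappa> g z + \<kappa> f z * g id) * z x)" for x
    proof -
      have "(\<Sum>z\<in>Z. (f id * \<kappa> g z + \<kappa> f z * g id) * z x) = f id * (\<Sum>z\<in>Z. \<kappa> g z * z x) + g id * (\<Sum>z\<in>Z. \<kappa> f z * z x)"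
        unfolding sum_distrib_left sum.distrib[symmetric] leibniz_rearrange(1) by (rule refl)
      then show ?thesis by (simp only: leibniz_rearrange(2))
    qed
    ultimately show "(\<lambda>x. f x * g x - f id * g id - (\<Sum>z\<in>Z. (f id * \<kappa> g z + \<kappa> f z * g id) * z x)) \<in> ?m2" by (simp only:)
  qed
  \<comment> \<open>The coordinate of the cotangent class at z obeys the Leibniz rule at
    \<open>id\<close>. So it is a point derivation, to which the hypothesis \<open>inv\<close>
    applies.\<close>
  define D where "D z = (\<lambda>r\<in>regular_functions G0. \<kappa> (\<lambda>x. r (retract x)) z)" for z
  have D_apply: "D z r = \<kappa> (\<lambda>x. r (retract x)) z" if "r \<in> regular_functions G0" for r z using that by (simp add: D_def)
  have D: "D z \<in> tangent_space (linear_group sc G0)" if z: "z \<in> Z" for z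
    unfolding tangent_space_def regular_linear_group
  proof (intro CollectI conjI ballI allI)
    show "D z \<in> extensional (regular_functions G0)" by (auto simp: D_def extensional_def)
  next
    fix f g assume f: "f \<in> regular_functions G0" and g: "g \<in> regular_functions G0"
    have "(\<lambda>x. (\<lambda>x\<in>G0. f x + g x) (retract x)) = (\<lambda>x. f (retract x) + g (retract x))" by (simp add: retract)
    then show "D z (\<lambda>x\<in>carrier (linear_group sc G0). f x + g x) = D z f + D z g"
      using \<kappa>_add[OF ringI[OF f] ringI[OF g] z] function_algebra.add[OF f g] f g
      by (simp only: D_apply) (simp add: linear_group_def D_apply function_algebra.add[OF f g])
    have "(\<lambda>x. (\<lambda>x\<in>G0. f x * g x) (retract x)) = (\<lambda>x. f (retract x) * g (retract x))" by (simp add: retract)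
    then show "D z (\<lambda>x\<in>carrier (linear_group sc G0). f x * g x)
        = f \<one>\<^bsub>linear_group sc G0\<^esub> * D z g + D z f * g \<one>\<^bsub>linear_group sc G0\<^esub>"
      using \<kappa>_mult[OF ringI[OF f] ringI[OF g] z] f g
      by (simp only: D_apply) (simp add: linear_group_def D_apply function_algebra.mult[OF f g] retract)
  next
    fix c f assume f: "f \<in> regular_functions G0"
    have "(\<lambda>x. (\<lambda>x\<in>G0. c * f x) (retract x)) = (\<lambda>x. c * f (retract x))" by (simp add: retract)
    then show "D z (\<lambda>x\<in>carrier (linear_group sc G0). c * f x) = c * D z f"
      using \<kappa>_scale[OF ringI[OF f] z] f
      by (simp only: D_apply) (simp add: linear_group_def D_apply regular_scale[OF f])
  qed
  define A where "A z = differential sc (linear_group sc G0) (\<lambda>g. g) (D z)" for z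
  have DA: "D z (\<lambda>g\<in>G0. l (g v)) = l (A z v)" if "z \<in> Z" "functional l" for z l v
    unfolding A_def by (rule differential_coeff[OF D[OF that(1)] that(2)])
  have eA: "endo (A z)" if z: "z \<in> Z" for z
  proof (rule endoI)
    fix x y
    show "A z (x + y) = A z x + A z y"
    proof (rule functional_eqI)
      fix l assume l: "functional l"
      have "(\<lambda>g\<in>G0. l (g (x + y))) = (\<lambda>g\<in>G0. (\<lambda>g\<in>G0. l (g x)) g + (\<lambda>g\<in>G0. l (g y)) g)"
        by (rule restrict_ext) (simp add: endo_simps(1)[OF G0_endo] functional_simps[OF l])
      then have "D z (\<lambda>g\<in>G0. l (g (x + y))) = D z (\<lambda>g\<in>G0. l (g x)) + D z (\<lambda>g\<in>G0. l (g y))"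
        using tangent_spaceD(1)[OF D[OF z] regular_coeff[OF l] regular_coeff[OF l]] by (simp only:)
      then show "l (A z (x + y)) = l (A z x + A z y)"
        by (simp only: DA[OF z l] functional_simps(1)[OF l])
    qed
  next
    fix c x
    show "A z (sc c x) = sc c (A z x)"
    proof (rule functional_eqI)
      fix l assume l: "functional l"
      have "(\<lambda>g\<in>G0. l (g (sc c x))) = (\<lambda>g\<in>G0. c * (\<lambda>g\<in>G0. l (g x)) g)"
        by (rule restrict_ext) (simp add: endo.linear_scale[OF G0_endo] functional_simps[OF l])
      then have "D z (\<lambda>g\<in>G0. l (g (sc c x))) = c * D z (\<lambda>g\<in>G0. l (g x))"
        using tangent_spaceD(2)[OF D[OF z] regular_coeff[OF l]] by (simp only:)
      then show "l (A z (sc c x)) = l (sc c (A z x))"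
        by (simp only: DA[OF z l] functional_simps(2)[OF l])
    qed
  qed
  \<comment> \<open>The derivative of f along the left-invariant field of \<open>D z\<close>, made
    total by \<open>retract\<close>.\<close>
  define T where "T z f k = \<kappa> (\<lambda>x. f (retract k \<circ> retract x)) z" for z f k
  have trans: "(\<lambda>x. f (retract k \<circ> retract x)) \<in> ring" if f: "f \<in> ring" for f k
  proof -
    obtain r where r: "r \<in> regular_functions G0" "f = (\<lambda>x. r (retract x))" using f by (auto simp: ring_def)
    have "(\<lambda>x. f (retract k \<circ> retract x)) = (\<lambda>x. (\<lambda>x\<in>G0. r (retract k \<circ> x)) (retract x))"
      using retract(1) retract(2)[OF G0_comp[OF retract(1) retract(1)]] by (simp add: r(2))
    then show ?thesis using ringI[OF regular_translate[OF r(1) subset_refl retract(1)[of k]]] by (simp only:)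
  qed
  have T_ring: "T z f \<in> ring" if z: "z \<in> Z" and f: "f \<in> ring" for z f
  proof -
    obtain r where r: "r \<in> regular_functions G0" "f = (\<lambda>x. r (retract x))" using f by (auto simp: ring_def)
    obtain r' where r': "r' \<in> regular_functions G0" "\<forall>k\<in>G0. D z (\<lambda>x\<in>G0. r (k \<circ> x)) = r' k"
      using regular_derivative[OF D[OF z] eA[OF z] DA[OF z] subset_refl r(1)] by blast
    have "T z f k = r' (retract k)" for k
    proof -
      have "(\<lambda>x. f (retract k \<circ> retract x)) = (\<lambda>x. (\<lambda>x\<in>G0. r (retract k \<circ> x)) (retract x))"
        using retract(1) retract(2)[OF G0_comp[OF retract(1) retract(1)]] by (simp add: r(2))
      then have "T z f k = D z (\<lambda>x\<in>G0. r (retract k \<circ> x))"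
        unfolding T_def D_apply[OF regular_translate[OF r(1) subset_refl retract(1)]] by (simp only:)
      then show ?thesis using r'(2) retract(1) by simp
    qed
    then show ?thesis using ringI[OF r'(1)] by presburger
  qed
  \<comment> \<open>An Euler field: each coordinate z times the derivative in its direction.\<close>
  define E where "E f = (\<lambda>x. \<Sum>z\<in>Z. T z f x * z x)" for f
  have zR: "z \<in> ring" if "z \<in> Z" for z using that Zm by (auto simp: point_ideal_def)
  have E_m: "E f \<in> ?m" if "f \<in> ring" for f
  proof -
    have "E f \<in> ring"
      unfolding E_def by (intro fun_subalgebra_sum[OF R fZ] fun_subalgebraD(3)[OF R] T_ring zR that)
    moreover have "E f id = 0" unfolding E_def using Zm by (intro sum.neutral) (auto simp: point_ideal_def)
    ultimately show ?thesis by (simp add: point_ideal_def)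
  qed
  have E_add: "E (\<lambda>x. f x + g x) = (\<lambda>x. E f x + E g x)" if f: "f \<in> ring" and g: "g \<in> ring" for f g
    unfolding E_def sum.distrib[symmetric] T_def
    by (intro ext sum.cong refl) (simp add: \<kappa>_add[OF trans[OF f] trans[OF g]] distrib_right)
  have E_mult: "E (\<lambda>x. f x * g x) = (\<lambda>x. f x * E g x + E f x * g x)" if f: "f \<in> ring" and g: "g \<in> ring" for f g
  proof -
    have *: "\<kappa> (\<lambda>x. f (retract k \<circ> retract x) * g (retract k \<circ> retract x)) z * z k
        = f k * (T z g k * z k) + T z f k * z k * g k" if "z \<in> Z" for z k
    proof -
      have "f (retract k \<circ> retract id) = f k" "g (retract k \<circ> retract id) = g k"
        using ring_retract[OF f, of k] ring_retract[OF g, of k] by (simp_all add: retract(3))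
      then show ?thesis
        unfolding \<kappa>_mult[OF trans[OF f] trans[OF g] that] T_def by (simp only: distrib_left distrib_right mult_ac add_ac)
    qed
    show ?thesis
      unfolding E_def sum_distrib_left sum_distrib_right sum.distrib[symmetric] T_def[of _ "\<lambda>x. f x * g x"]
      by (intro ext sum.cong refl *)
  qed
  have T_id: "T z f id = \<kappa> f z" if f: "f \<in> ring" for z f
    unfolding T_def using ring_retract[OF f] by (simp add: retract)
  \<comment> \<open>E y - y is the sum of the products (T z y - T z y id) z, whose factors both lie
    in m, minus the remainder of y after its linear part. All of this is in m^2.\<close>
  have E_id: "(\<lambda>x. E y x - y x) \<in> ?m2" if y: "y \<in> ?m" for y
  proof -
    have yR: "y \<in> ring" and y0: "y id = 0" using y by (auto simp: point_ideal_def)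
    have T2: "(\<lambda>x. (T z y x - T z y id) * z x) \<in> ?m2" if "z \<in> Z" for z
      using that Zm by (intro m2 minus_id T_ring yR) auto
    have "(\<lambda>x. \<Sum>z\<in>Z. (T z y x - T z y id) * z x) \<in> ?m2"
      unfolding numeral_2_eq_2 point_ideal_power.simps(2)[of ring id "Suc 0"]
      by (rule ideal_gen_sum[OF fZ T2[unfolded numeral_2_eq_2 point_ideal_power.simps(2)[of ring id "Suc 0"]]])
    from diff2[OF this \<kappa>[OF yR]]
    have "(\<lambda>x. (\<Sum>z\<in>Z. (T z y x - T z y id) * z x) - (y x - y id - (\<Sum>z\<in>Z. \<kappa> y z * z x))) \<in> ?m2" .
    moreover have "(\<Sum>z\<in>Z. (T z y x - T z y id) * z x) - (y x - y id - (\<Sum>z\<in>Z. \<kappa> y z * z x)) = E y x - y x" for x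
      by (simp add: E_def T_id[OF yR] y0 left_diff_distrib sum_subtractf)
    ultimately show ?thesis by simp
  qed
  \<comment> \<open>The whole family is needed, since \<open>T z\<close> replaces v by
    \<open>A z v\<close>, which stays in U but differs from v.\<close>
  define \<F> where "\<F> = {(\<lambda>x. l (retract x v)) | l v. functional l \<and> (\<forall>u\<in>U. l u = 0) \<and> v \<in> U}"
  have F_m: "\<F> \<subseteq> ?m"
  proof
    fix f assume "f \<in> \<F>"
    then obtain l v where f: "f = (\<lambda>x. l (retract x v))" "functional l" "\<forall>u\<in>U. l u = 0" "v \<in> U" by (auto simp: \<F>_def)
    have "f \<in> ring" using ringI[OF regular_coeff[OF f(2), where H = G0 and v = v]] retract(1) by (simp add: f(1))
    then show "f \<in> ?m" using f by (simp add: point_ideal_def retract)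
  qed
  have E_F: "E f \<in> ideal_gen ring {(\<lambda>x. z x * f' x) | z f'. z \<in> ?m \<and> f' \<in> \<F>}" if "f \<in> \<F>" for f
  proof -
    obtain l v where f: "f = (\<lambda>x. l (retract x v))" "functional l" "\<forall>u\<in>U. l u = 0" "v \<in> U" using \<open>f \<in> \<F>\<close> by (auto simp: \<F>_def)
    have "T z f = (\<lambda>k. l (retract k (A z v)))" if z: "z \<in> Z" for z
    proof
      fix k
      have lk: "functional (\<lambda>x. l (retract k x))" by (rule functional_comp[OF f(2) G0_endo[OF retract(1)]])
      have "(\<lambda>x. f (retract k \<circ> retract x)) = (\<lambda>x. (\<lambda>g\<in>G0. l (retract k (g v))) (retract x))"
        using retract(1) retract(2)[OF G0_comp[OF retract(1) retract(1)]] by (simp add: f(1))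
      then have "T z f k = D z (\<lambda>g\<in>G0. l (retract k (g v)))"
        unfolding T_def D_apply[OF regular_coeff[OF lk]] by (simp only:)
      then show "T z f k = l (retract k (A z v))" using DA[OF z lk] by simp
    qed
    moreover have "A z v \<in> U" if "z \<in> Z" for z unfolding A_def using inv[OF D[OF that] f(4)] .
    ultimately have TF: "T z f \<in> \<F>" if "z \<in> Z" for z using that f(2,3) by (auto simp: \<F>_def)
    have "(\<lambda>x. z x * T z f x) \<in> ideal_gen ring {(\<lambda>x. z x * f' x) | z f'. z \<in> ?m \<and> f' \<in> \<F>}" if "z \<in> Z" for z
      using that Zm TF[OF that] by (intro ideal_gen_base[OF R]) blast
    from ideal_gen_sum[OF fZ this] show ?thesis unfolding E_def by (simp only: mult.commute)
  qed
  have "(\<lambda>x. l (retract x v)) \<in> \<F>" using l v by (auto simp: \<F>_def)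
  from vanishes_near_point[where E = E, OF R noetherian_ring E_m E_add E_mult E_id F_m E_F this]
  obtain e where "e \<in> ring" "e id \<noteq> 0" "\<forall>x. e x * l (retract x v) = 0" by blast
  then show ?thesis by (intro bexI[of _ e]) (auto simp: retract_def)
qed

text \<open>The matrix entries that prevent x from preserving U vanish on a Zariski neighbourhood of
  the identity. Translating it shows that the stabilizer of U and its complement in
  \<open>G0\<close> are both relatively open.\<close>

theorem invariant_subspace_connected_group:
  assumes U: "subspace U"
    and inv: "\<And>D v. D \<in> tangent_space (linear_group sc G0) \<Longrightarrow> v \<in> U \<Longrightarrow>
       differential sc (linear_group sc G0) (\<lambda>g. g) D v \<in> U"
    and G0_inv: "\<And>g. g \<in> G0 \<Longrightarrow> inv_into UNIV g \<in> G0"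
    and con: "connectedin (zariski X (regular_functions X)) G0"
    and g: "g \<in> G0" and v: "v \<in> U"
  shows "g v \<in> U"
proof -
  note R = fun_subalgebra_ring
  have X: "G0 \<subseteq> X" using connectedin_subset_topspace[OF con] by simp
  obtain B where B: "B \<subseteq> U" "independent B" "span B = U" "finite B" by (rule subspace_eq_span_basis[OF U])
  obtain C where BC: "B \<subseteq> C" and "C \<subseteq> UNIV" and indC: "independent C" and "UNIV \<subseteq> span C"
    by (rule maximal_independent_subset_extend[OF subset_UNIV B(2)])
  then have C: "B \<subseteq> C" "independent C" "span C = UNIV" by auto
  have fC: "finite C" by (rule finiteI_independent[OF C(2)])
  have co0: "representation C u c = 0" if "u \<in> U" "c \<in> C - B" for u c
  proof -
    have "representation C u = representation B u"
      using that B(3) by (intro representation_extend[OF C(2) _ C(1)]) simp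
    then show ?thesis using representation_ne_zero[of B u c] that by auto
  qed
  have inU: "u \<in> U" if "\<And>c. c \<in> C - B \<Longrightarrow> representation C u c = 0" for u
  proof -
    have "u = (\<Sum>c\<in>C. sc (representation C u c) c)" by (simp add: basis_expansion[OF C(2,3)])
    also have "\<dots> = (\<Sum>c\<in>B. sc (representation C u c) c)"
      using that C(1) fC by (intro sum.mono_neutral_right) auto
    also have "\<dots> \<in> U" using B(1) U by (intro subspace_sum subspace_scale) auto
    finally show ?thesis .
  qed
  \<comment> \<open>U is preserved by x if the images of the basis B have no coefficient along C -
    B. Each such entry is killed by its own function e, nonzero at \<open>id\<close>.\<close>
  have "\<exists>e. e \<in> ring \<and> e id \<noteq> 0 \<and> (\<forall>x\<in>G0. e x * representation C (x (snd p)) (fst p) = 0)"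
    if p: "p \<in> (C - B) \<times> B" for p
  proof -
    have c: "fst p \<in> C - B" and b: "snd p \<in> U" using p B(1) by auto
    show ?thesis
      using vanishing_near_identity[OF U inv coords_linear[OF C(2,3), of "fst p"] co0[OF _ c] b] by blast
  qed
  then have "\<forall>p\<in>(C - B) \<times> B. \<exists>e. e \<in> ring \<and> e id \<noteq> 0 \<and> (\<forall>x\<in>G0. e x * representation C (x (snd p)) (fst p) = 0)"
    by blast
  from bchoice[OF this] obtain e where e': "\<forall>p\<in>(C - B) \<times> B. e p \<in> ring \<and> e p id \<noteq> 0 \<and>
      (\<forall>x\<in>G0. e p x * representation C (x (snd p)) (fst p) = 0)" by blast
  have e: "e (c, b) \<in> ring \<and> e (c, b) id \<noteq> 0 \<and> (\<forall>x\<in>G0. e (c, b) x * representation C (x b) c = 0)"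
    if "c \<in> C - B" "b \<in> B" for c b
    using bspec[OF e', of "(c, b)"] that by simp
  \<comment> \<open>The product of all these functions is nonzero at \<open>id\<close>, and wherever
    it is nonzero all the entries vanish.\<close>
  define E where "E x = (\<Prod>p\<in>(C - B) \<times> B. e p x)" for x
  have fin: "finite ((C - B) \<times> B)" using fC B(4) by simp
  have E_ring: "E \<in> ring"
  proof -
    have "(\<lambda>x. \<Prod>p\<in>(C - B) \<times> B. e p x) \<in> ring" by (rule fun_subalgebra_prod[OF R fin]) (use e in auto)
    then show ?thesis unfolding E_def[abs_def] .
  qed
  have E_id: "E id \<noteq> 0" using e fin by (auto simp: E_def)
  have E_U: "x u \<in> U" if x: "x \<in> G0" "E x \<noteq> 0" and u: "u \<in> U" for x u
  proof -
    have "x b \<in> U" if b: "b \<in> B" for b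
    proof (rule inU)
      fix c assume c: "c \<in> C - B"
      have "e (c, b) x \<noteq> 0" using x(2) b c fin by (auto simp: E_def prod_zero_iff)
      then show "representation C (x b) c = 0" using e[OF c b] x(1) by auto
    qed
    then have "x ` B \<subseteq> U" by blast
    then have "span (x ` B) \<subseteq> U" by (rule span_minimal[OF _ U])
    moreover have "span (x ` B) = x ` span B" by (rule endo.linear_span_image[OF G0_endo[OF x(1)]])
    ultimately show ?thesis using B(3) u by blast
  qed
  define K where "K = {k \<in> G0. \<forall>u\<in>U. k u \<in> U}"
  \<comment> \<open>An injective map of U into itself is onto by dimension, so the inverse preserves
    U too.\<close>
  have K_inv: "inv_into UNIV k u \<in> U" if k: "k \<in> K" and u: "u \<in> U" for k u
  proof -
    have kG: "k \<in> G0" and kU: "k ` U \<subseteq> U" using k by (auto simp: K_def)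
    have "inj_on k U" using G0_bij[OF kG] by (meson bij_is_inj inj_on_subset subset_UNIV)
    then have "dim (k ` U) = dim U"
      using endo.dim_image_eq[OF G0_endo[OF kG], of U] iffD2[OF span_eq_iff U] by simp
    then have "k ` U = U"
      using kU U endo.linear_subspace_image[OF G0_endo[OF kG] U] by (intro subspace_dim_equal) auto
    then obtain u' where "u' \<in> U" "u = k u'" using u by blast
    then show ?thesis using G0_bij[OF kG] by (simp add: bij_is_inj)
  qed
  have "\<exists>N. openin (zariski X (regular_functions X)) N \<and> k \<in> N \<and> (\<forall>x\<in>N \<inter> G0. inv_into UNIV k \<circ> x \<in> K)" if k: "k \<in> G0" for k
  proof -
    obtain r where r: "r \<in> regular_functions G0" "E = (\<lambda>x. r (retract x))" using E_ring by (auto simp: ring_def)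
    have ki: "inv_into UNIV k \<in> G0" by (rule G0_inv[OF k])
    obtain f where f: "f \<in> regular_functions X" "(\<lambda>x\<in>G0. r (inv_into UNIV k \<circ> x)) = restrict f G0"
      using function_algebra_extend[OF X regular_translate[OF r(1) subset_refl ki]] by blast
    have fx: "f x = E (inv_into UNIV k \<circ> x)" if "x \<in> G0" for x
      using fun_cong[OF f(2), of x] that G0_comp[OF ki that] by (simp add: r(2) retract(2))
    let ?N = "{x \<in> X. f x \<noteq> 0}"
    have "openin (zariski X (regular_functions X)) ?N" unfolding zariski_open_iff using f(1) by blast
    moreover have "inv_into UNIV k \<circ> k = id" using G0_bij[OF k] by (simp add: bij_is_inj)
    then have "k \<in> ?N" using fx[OF k] E_id k X by auto
    moreover have "inv_into UNIV k \<circ> x \<in> K" if "x \<in> ?N \<inter> G0" for x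
      using that fx[of x] E_U[OF G0_comp[OF ki, of x]] G0_comp[OF ki, of x] by (auto simp: K_def)
    ultimately show ?thesis by blast
  qed
  then obtain N where N: "\<And>k. k \<in> G0 \<Longrightarrow> openin (zariski X (regular_functions X)) (N k)" "\<And>k. k \<in> G0 \<Longrightarrow> k \<in> N k"
    "\<And>k x. k \<in> G0 \<Longrightarrow> x \<in> N k \<Longrightarrow> x \<in> G0 \<Longrightarrow> inv_into UNIV k \<circ> x \<in> K" by (metis IntI)
  have dec: "x = k \<circ> (inv_into UNIV k \<circ> x)" if "k \<in> G0" for k x :: "'a \<Rightarrow> 'a"
    using G0_bij[OF that] by (simp add: fun_eq_iff bij_is_surj surj_f_inv_f)
  \<comment> \<open>\<open>?E1\<close> meets \<open>G0\<close> in K and \<open>?E2\<close> meets it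
    in the complement of K: within \<open>N k\<close> an element differs from k by a member of
    K.\<close>
  let ?E1 = "\<Union>(N ` K)" and ?E2 = "\<Union>(N ` (G0 - K))"
  have "g \<in> K"
  proof (rule ccontr)
    assume "g \<notin> K"
    have KG: "K \<subseteq> G0" by (auto simp: K_def)
    have o1: "openin (zariski X (regular_functions X)) ?E1" using N(1) KG by (intro openin_Union) auto
    have o2: "openin (zariski X (regular_functions X)) ?E2" using N(1) by (intro openin_Union) auto
    have E1: "x \<in> K" if "x \<in> ?E1" "x \<in> G0" for x
    proof -
      obtain k where k: "k \<in> K" "x \<in> N k" using \<open>x \<in> ?E1\<close> by blast
      have "inv_into UNIV k \<circ> x \<in> K" using N(3) k KG that(2) by blast
      then have "k ((inv_into UNIV k \<circ> x) u) \<in> U" if "u \<in> U" for u using k(1) that unfolding K_def by blast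
      moreover have "x u = k ((inv_into UNIV k \<circ> x) u)" for u
        using fun_cong[OF dec[of k x], of u] k(1) KG by auto
      ultimately have "x u \<in> U" if "u \<in> U" for u using that by metis
      then show ?thesis using that(2) by (simp add: K_def)
    qed
    have E2: "x \<notin> K" if "x \<in> ?E2" "x \<in> G0" for x
    proof
      assume xK: "x \<in> K"
      obtain k where k: "k \<in> G0" "k \<notin> K" "x \<in> N k" using \<open>x \<in> ?E2\<close> by blast
      let ?y = "inv_into UNIV k \<circ> x"
      have y: "?y \<in> K" using N(3)[OF k(1,3) that(2)] .
      have "k u \<in> U" if u: "u \<in> U" for u
      proof -
        have "?y (inv_into UNIV ?y u) = u" using y G0_bij by (auto simp: K_def bij_is_surj surj_f_inv_f simp del: o_apply)
        moreover have "x (inv_into UNIV ?y u) = (k \<circ> ?y) (inv_into UNIV ?y u)" by (rule fun_cong[OF dec[OF k(1)]])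
        ultimately have "x (inv_into UNIV ?y u) = k u" by (simp only: comp_apply[of k])
        moreover have "x (inv_into UNIV ?y u) \<in> U" using K_inv[OF y u] xK by (simp only: K_def mem_Collect_eq)
        ultimately show ?thesis by (simp only:)
      qed
      then show False using k by (simp add: K_def)
    qed
    have "id \<in> K" using G0_id by (simp add: K_def)
    then have "?E1 \<inter> G0 \<noteq> {}" using N(2) G0_id by blast
    moreover have "?E2 \<inter> G0 \<noteq> {}" using N(2)[OF g] g \<open>g \<notin> K\<close> by blast
    moreover have "G0 \<subseteq> ?E1 \<union> ?E2" using N(2) by blast
    moreover have "?E1 \<inter> ?E2 \<inter> G0 = {}" using E1 E2 by blast
    ultimately show False using con o1 o2 unfolding connectedin by blast
  qed
  then show ?thesis using v by (simp add: K_def)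
qed

end

section \<open>Null spaces of regular elements\<close>

lemma of_nat_le_fact: "of_nat n / fact n \<le> (1 :: real)"
proof -
  have "of_nat n \<le> (of_nat (fact n) :: real)" using fact_ge_self[of n] unfolding of_nat_le_iff .
  then show ?thesis by (simp add: divide_le_eq)
qed

lemma one_divide_mult: "(1 / f) * (a * b * c) = (a / f) * (b * c)" for a b c f :: real
  by simp

lemma polynomial_function_sum:
  fixes f :: "'i \<Rightarrow> complex \<Rightarrow> complex"
  assumes "\<And>i. i \<in> I \<Longrightarrow> \<exists>p. \<forall>t. f i t = poly p t"
  shows "\<exists>p. \<forall>t. (\<Sum>i\<in>I. f i t) = poly p t"
proof -
  have "\<forall>i\<in>I. \<exists>p. \<forall>t. f i t = poly p t" using assms by blast
  from bchoice[OF this] obtain p where p: "\<forall>i\<in>I. \<forall>t. f i t = poly (p i) t" by blast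
  have "(\<Sum>i\<in>I. f i t) = poly (\<Sum>i\<in>I. p i) t" for t
    unfolding poly_sum using p by (intro sum.cong) auto
  then show ?thesis by blast
qed

section \<open>Polynomial curves, limits and bounds\<close>

context fd_space
begin

definition poly_curve :: "(complex \<Rightarrow> 'a) \<Rightarrow> bool" where
  "poly_curve w \<longleftrightarrow> (\<forall>b\<in>Basis. \<exists>p. \<forall>t. coord b (w t) = poly p t)"

lemma poly_curve_functional:
  assumes "poly_curve w" "functional l" shows "\<exists>p. \<forall>t. l (w t) = poly p t"
proof -
  have "\<exists>p. \<forall>t. coord b (w t) * l b = poly p t" if b: "b \<in> Basis" for b
  proof -
    obtain p where "\<forall>t. coord b (w t) = poly p t" using assms(1) b by (auto simp: poly_curve_def)
    then have "\<forall>t. coord b (w t) * l b = poly (smult (l b) p) t" by simp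
    then show ?thesis by blast
  qed
  from polynomial_function_sum[where I = Basis and f = "\<lambda>b t. coord b (w t) * l b", OF this] show ?thesis
    by (simp only: functional_expansion[OF assms(2), symmetric])
qed

lemma poly_curve_diff_scale:
  assumes "poly_curve v" "poly_curve w" "\<exists>p. \<forall>t. f t = poly p t" "\<exists>p. \<forall>t. g t = poly p t"
  shows "poly_curve (\<lambda>t. sc (f t) (v t) - sc (g t) (w t))"
  unfolding poly_curve_def
proof
  fix b assume b: "b \<in> Basis"
  obtain p q p' q' where "\<forall>t. coord b (v t) = poly p t" "\<forall>t. coord b (w t) = poly q t"
    "\<forall>t. f t = poly p' t" "\<forall>t. g t = poly q' t"
    using assms b unfolding poly_curve_def by blast
  then have "\<forall>t. coord b (sc (f t) (v t) - sc (g t) (w t)) = poly (p' * p - q' * q) t"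
    by (simp add: coord_simps)
  then show "\<exists>p. \<forall>t. coord b (sc (f t) (v t) - sc (g t) (w t)) = poly p t" by blast
qed

text \<open>The induction on \<open>J\<close> performs one step of Gaussian elimination.\<close>

lemma independent_cofinite:
  assumes "finite J" "\<And>j. j \<in> J \<Longrightarrow> poly_curve (v j)"
    "\<And>x. (\<Sum>j\<in>J. sc (x j) (v j t0)) = 0 \<Longrightarrow> \<forall>j\<in>J. x j = 0"
  shows "finite {t. \<exists>x. (\<Sum>j\<in>J. sc (x j) (v j t)) = 0 \<and> (\<exists>j\<in>J. x j \<noteq> 0)}"
  using assms
proof (induction J arbitrary: v rule: finite_induct)
  case empty
  then show ?case by simp
next
  case (insert k J)
  have "v k t0 \<noteq> 0"
  proof
    assume "v k t0 = 0"
    then have "(\<Sum>j\<in>insert k J. sc ((\<lambda>j. if j = k then 1 else 0) j) (v j t0)) = 0"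
      using insert(1,2) by (simp add: if_distrib[of "\<lambda>c. sc c _"] cong: if_cong)
    from insert.prems(2)[OF this] show False by auto
  qed
  \<comment> \<open>The pivot coordinate: along v k it is a polynomial in t that is nonzero at t0,
    so it has finitely many zeros. Away from them a dependence of the v gives one of the reduced
    vectors w.\<close>
  then obtain b where b: "b \<in> Basis" "coord b (v k t0) \<noteq> 0" using coord_eqI[of "v k t0" 0] by (auto simp: coord_simps)
  define c where "c j t = coord b (v j t)" for j t
  have cp: "\<exists>p. \<forall>t. c j t = poly p t" if "j \<in> insert k J" for j
    unfolding c_def using insert.prems(1)[OF that] b(1) by (auto simp: poly_curve_def)
  obtain p where p: "\<forall>t. c k t = poly p t" using cp by blast
  define w where "w j t = sc (c k t) (v j t) - sc (c j t) (v k t)" for j t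
  have red: "(\<Sum>j\<in>J. sc (x j) (w j t)) = sc (c k t) (\<Sum>j\<in>J. sc (x j) (v j t)) - sc (\<Sum>j\<in>J. x j * c j t) (v k t)" for x t
    unfolding w_def scale_right_diff_distrib sum_subtractf scale_sum_right scale_sum_left
    by (simp add: mult.commute)
  have "finite {t. \<exists>x. (\<Sum>j\<in>J. sc (x j) (w j t)) = 0 \<and> (\<exists>j\<in>J. x j \<noteq> 0)}"
  proof (rule insert.IH)
    fix j assume j: "j \<in> J"
    show "poly_curve (w j)"
      unfolding w_def[abs_def] using j insert.prems(1) cp by (intro poly_curve_diff_scale) auto
  next
    fix x assume x: "(\<Sum>j\<in>J. sc (x j) (w j t0)) = 0"
    let ?y = "\<lambda>j. if j = k then - (\<Sum>j\<in>J. x j * c j t0) else c k t0 * x j"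
    have "(\<Sum>j\<in>insert k J. sc (?y j) (v j t0)) = sc (- (\<Sum>j\<in>J. x j * c j t0)) (v k t0) + (\<Sum>j\<in>J. sc (c k t0 * x j) (v j t0))"
      using insert(1,2) by (subst sum.insert) (auto intro!: sum.cong)
    also have "(\<Sum>j\<in>J. sc (c k t0 * x j) (v j t0)) = sc (c k t0) (\<Sum>j\<in>J. sc (x j) (v j t0))"
      by (simp only: scale_sum_right scale_scale)
    finally have "(\<Sum>j\<in>insert k J. sc (?y j) (v j t0)) = 0" using x red[of x t0] by (simp add: scale_minus_left)
    from insert.prems(2)[OF this] have y0: "\<forall>j\<in>insert k J. ?y j = 0" .
    have "c k t0 * x j = 0" if "j \<in> J" for j
      using bspec[OF y0, of j] that insert(2) by (cases "j = k") auto
    then show "\<forall>j\<in>J. x j = 0" using b(2) by (simp add: c_def)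
  qed
  moreover have "finite {t. poly p t = 0}"
  proof (rule poly_roots_finite)
    have "poly p t0 \<noteq> 0" using b(2) p by (metis c_def)
    then show "p \<noteq> 0" by auto
  qed
  moreover have "{t. \<exists>x. (\<Sum>j\<in>insert k J. sc (x j) (v j t)) = 0 \<and> (\<exists>j\<in>insert k J. x j \<noteq> 0)}
    \<subseteq> {t. \<exists>x. (\<Sum>j\<in>J. sc (x j) (w j t)) = 0 \<and> (\<exists>j\<in>J. x j \<noteq> 0)} \<union> {t. poly p t = 0}"
  proof
    fix t assume "t \<in> {t. \<exists>x. (\<Sum>j\<in>insert k J. sc (x j) (v j t)) = 0 \<and> (\<exists>j\<in>insert k J. x j \<noteq> 0)}"
    then obtain x where x: "(\<Sum>j\<in>insert k J. sc (x j) (v j t)) = 0" "\<exists>j\<in>insert k J. x j \<noteq> 0" by blast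
    have s: "(\<Sum>j\<in>J. sc (x j) (v j t)) = - sc (x k) (v k t)"
      using x(1) insert(1,2) by (simp add: eq_neg_iff_add_eq_0 add.commute)
    have "coord b (\<Sum>j\<in>J. sc (x j) (v j t)) = coord b (- sc (x k) (v k t))" using s by (simp only:)
    then have cs: "(\<Sum>j\<in>J. x j * c j t) = - (x k * c k t)" by (simp add: coord_simps c_def)
    have "(\<Sum>j\<in>J. sc (x j) (w j t)) = 0" unfolding red s cs by (simp add: mult.commute)
    moreover have "\<exists>j\<in>J. x j \<noteq> 0" if "poly p t \<noteq> 0"
    proof (rule ccontr)
      assume "\<not> (\<exists>j\<in>J. x j \<noteq> 0)"
      then have "(\<Sum>j\<in>J. x j * c j t) = 0" by (intro sum.neutral) auto
      then have "x k * c k t = 0" using cs by simp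
      then have "x k = 0" using that p by simp
      then show False using x(2) \<open>\<not> (\<exists>j\<in>J. x j \<noteq> 0)\<close> by blast
    qed
    ultimately show "t \<in> {t. \<exists>x. (\<Sum>j\<in>J. sc (x j) (w j t)) = 0 \<and> (\<exists>j\<in>J. x j \<noteq> 0)} \<union> {t. poly p t = 0}" by blast
  qed
  ultimately show ?case using finite_subset[OF _ finite_UnI] by blast
qed

text \<open>Completeness for \<open>nrm\<close>: each coordinate is a telescoping series dominated
  by a geometric one.\<close>

lemma geometric_limit:
  assumes "\<And>k. nrm (w (Suc k) - w k) \<le> C * (1/2) ^ k"
  shows "\<exists>x. (\<lambda>k. nrm (w k - x)) \<longlonglongrightarrow> 0"
proof -
  have "\<exists>c. (\<lambda>k. coord b (w k)) \<longlonglongrightarrow> c" if b: "b \<in> Basis" for b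
  proof -
    have "summable (\<lambda>k. coord b (w (Suc k)) - coord b (w k))"
    proof (rule summable_comparison_test')
      show "summable (\<lambda>k. C * (1/2) ^ k)" by (intro summable_mult summable_geometric) simp
      fix k
      have "cmod (coord b (w (Suc k)) - coord b (w k)) = cmod (coord b (w (Suc k) - w k))" by (simp only: coord_simps)
      also have "\<dots> \<le> nrm (w (Suc k) - w k)" by (rule coord_le_nrm[OF b])
      finally show "norm (coord b (w (Suc k)) - coord b (w k)) \<le> C * (1/2) ^ k" using assms[of k] by simp
    qed
    then obtain s where s: "(\<lambda>k. coord b (w (Suc k)) - coord b (w k)) sums s" by (auto simp: summable_def)
    then have "(\<lambda>n. \<Sum>k<n. coord b (w (Suc k)) - coord b (w k)) \<longlonglongrightarrow> s" by (simp add: sums_def)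
    moreover have "(\<Sum>k<n. coord b (w (Suc k)) - coord b (w k)) = coord b (w n) - coord b (w 0)" for n
      by (rule sum_lessThan_telescope)
    ultimately have "(\<lambda>n. coord b (w n) - coord b (w 0)) \<longlonglongrightarrow> s" by (simp only:)
    from tendsto_add[OF this tendsto_const[of "coord b (w 0)"]] show ?thesis by auto
  qed
  then have "\<forall>b\<in>Basis. \<exists>c. (\<lambda>k. coord b (w k)) \<longlonglongrightarrow> c" by blast
  from bchoice[OF this] obtain c where c: "\<And>b. b \<in> Basis \<Longrightarrow> (\<lambda>k. coord b (w k)) \<longlonglongrightarrow> c b" by blast
  let ?x = "\<Sum>b\<in>Basis. sc (c b) b"
  have "(\<lambda>k. \<Sum>b\<in>Basis. cmod (coord b (w k) - c b)) \<longlonglongrightarrow> (\<Sum>b\<in>Basis. 0)"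
    using c by (intro tendsto_sum) (metis LIM_zero tendsto_norm_zero)
  moreover have "nrm (w k - ?x) = (\<Sum>b\<in>Basis. cmod (coord b (w k) - c b))" for k
    unfolding nrm_def by (intro sum.cong refl) (simp only: functional.linear_diff[OF functional_coord] coord_sum_Basis)
  ultimately show ?thesis by (intro exI[of _ ?x]) (simp only: sum.neutral_const)
qed

lemma limit_in_subspace:
  assumes "subspace U" "\<And>k. w k \<in> U" "(\<lambda>k. nrm (w k - x)) \<longlonglongrightarrow> 0"
  shows "x \<in> U"
proof (rule ccontr)
  assume "x \<notin> U"
  then obtain l where l: "functional l" "\<forall>u\<in>U. l u = 0" "l x = 1" using separating_functional[OF assms(1)] by blast
  obtain C where C: "C \<ge> 0" "\<forall>v. cmod (l v) \<le> C * nrm v" using functional_bound[OF l(1)] by blast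
  have "1 \<le> C * nrm (w k - x)" for k
  proof -
    have "cmod (l (w k - x)) = 1" using l assms(2) by (simp add: functional.linear_diff[OF l(1)])
    then show ?thesis using C(2) by metis
  qed
  moreover have "(\<lambda>k. C * nrm (w k - x)) \<longlonglongrightarrow> C * 0" by (intro tendsto_mult tendsto_const assms(3))
  ultimately have "1 \<le> C * 0" by (intro LIMSEQ_le_const) auto
  then show False by simp
qed

text \<open>Only weak convergence is assumed. It includes convergence of every coordinate, so the
  bound on partial sums passes to the limit.\<close>

lemma nrm_series_bound:
  assumes s: "\<And>l. functional l \<Longrightarrow> (\<lambda>n. l (a n)) sums l x" and b: "\<And>n. nrm (a n) \<le> c n" and c: "c sums S"
  shows "nrm x \<le> S"
proof -
  have "nrm (\<Sum>n<N. a n) \<le> S" for N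
  proof -
    have "nrm (\<Sum>n<N. a n) \<le> (\<Sum>n<N. c n)"
    proof (induction N)
      case (Suc N)
      have "nrm (\<Sum>n<Suc N. a n) \<le> nrm (\<Sum>n<N. a n) + nrm (a N)" by (simp add: nrm_add)
      then show ?case using Suc b[of N] by simp
    qed simp
    also have "\<dots> \<le> S"
    proof -
      have "0 \<le> c n" for n using b[of n] nrm_nonneg[of "a n"] by linarith
      then show ?thesis using sum_le_suminf[OF sums_summable[OF c], of "{..<N}"] sums_unique[OF c] by simp
    qed
    finally show ?thesis .
  qed
  moreover have "(\<lambda>N. nrm (\<Sum>n<N. a n)) \<longlonglongrightarrow> nrm x"
    unfolding nrm_def
  proof (intro tendsto_sum tendsto_norm)
    fix b
    show "(\<lambda>N. coord b (\<Sum>n<N. a n)) \<longlonglongrightarrow> coord b x"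
      using s[OF functional_coord] by (simp only: functional.linear_sum[OF functional_coord] sums_def)
  qed
  ultimately show ?thesis by (intro LIMSEQ_le_const2) auto
qed

text \<open>A linear left inverse on M exists and is bounded; adding 1 to its bound makes the
  constant positive.\<close>

lemma injective_bound:
  assumes T: "endo T" and M: "subspace M" and inj: "\<And>m. m \<in> M \<Longrightarrow> T m = 0 \<Longrightarrow> m = 0"
  shows "\<exists>C>0. \<forall>m\<in>M. nrm m \<le> C * nrm (T m)"
proof -
  have "inj_on T M"
  proof (rule inj_onI)
    fix x y assume "x \<in> M" "y \<in> M" "T x = T y"
    then show "x = y" using inj[of "x - y"] subspace_diff[OF M] by (simp add: endo.linear_diff[OF T])
  qed
  then obtain g where g: "endo g" "\<forall>v\<in>M. g (T v) = v"
    using endo.linear_exists_left_inverse_on[OF T M] by blast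
  obtain C where C: "C \<ge> 0" "\<forall>v. nrm (g v) \<le> C * nrm v" using endo_bound[OF g(1)] by blast
  have "nrm m \<le> (C + 1) * nrm (T m)" if "m \<in> M" for m
  proof -
    have "nrm m \<le> C * nrm (T m)" using C(2) g(2) that by metis
    then show ?thesis using nrm_nonneg[of "T m"] unfolding distrib_right mult_1 by linarith
  qed
  then show ?thesis using C(1) by (intro exI[of _ "C + 1"]) auto
qed

end

section \<open>Conjugation near a point\<close>

context lie_space
begin

lemma bracket_bound: "\<exists>C\<ge>0. \<forall>x y. nrm (bracket x y) \<le> C * nrm x * nrm y"
proof -
  have "\<exists>C. C \<ge> 0 \<and> (\<forall>y. nrm (bracket b y) \<le> C * nrm y)" for b using endo_bound[OF endo_bracket] by blast
  then have "\<forall>b. \<exists>C. C \<ge> 0 \<and> (\<forall>y. nrm (bracket b y) \<le> C * nrm y)" by blast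
  from choice[OF this] obtain C where C: "\<And>b. C b \<ge> 0" "\<And>b y. nrm (bracket b y) \<le> C b * nrm y" by blast
  let ?C = "\<Sum>b\<in>Basis. C b"
  have sumn: "nrm (\<Sum>b\<in>B. f b) \<le> (\<Sum>b\<in>B. nrm (f b))" if "finite B" for B and f :: "'a \<Rightarrow> 'a"
    using that
  proof (induction B rule: finite_induct)
    case (insert b B)
    then show ?case using nrm_add[of "f b" "\<Sum>b\<in>B. f b"] by simp
  qed simp
  have "nrm (bracket x y) \<le> ?C * nrm x * nrm y" for x y
  proof -
    have "bracket x y = (\<Sum>b\<in>Basis. sc (coord b x) (bracket b y))"
      using arg_cong[OF coord_expansion[of x], of "\<lambda>x. bracket x y"]
      by (simp only: bracket_sum_left bracket_simps(6))
    then have "nrm (bracket x y) \<le> (\<Sum>b\<in>Basis. nrm (sc (coord b x) (bracket b y)))"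
      using sumn[OF finite_Basis] by (simp only:)
    also have "\<dots> \<le> (\<Sum>b\<in>Basis. nrm x * (C b * nrm y))"
    proof (rule sum_mono)
      fix b assume b: "b \<in> Basis"
      show "nrm (sc (coord b x) (bracket b y)) \<le> nrm x * (C b * nrm y)"
        unfolding nrm_scale by (rule mult_mono[OF coord_le_nrm[OF b] C(2)]) simp_all
    qed
    also have "\<dots> = ?C * nrm x * nrm y" by (simp only: sum_distrib_left sum_distrib_right mult_ac)
    finally show ?thesis .
  qed
  then show ?thesis using C(1) by (intro exI[of _ ?C]) (simp add: sum_nonneg)
qed

text \<open>One factor is exchanged at a time. The summand with \<open>of_nat n\<close> stems from
  changing w in one of the n operators, whose norms are at most \<kappa> \<rho>; the other summand
  stems from changing the vector x.\<close>

lemma iterate_lipschitz: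
  assumes \<kappa>: "\<kappa> \<ge> 0" "\<And>w v. nrm (bracket (U w) v) \<le> \<kappa> * nrm w * nrm v" and U: "endo U"
    and w: "nrm w \<le> \<rho>" "nrm w' \<le> \<rho>" and x: "nrm x' \<le> M" "nrm (x - x') \<le> \<zeta> * nrm (w - w')" and r: "\<rho> \<ge> 0" "\<zeta> \<ge> 0" "M \<ge> 0"
  shows "nrm ((bracket (U w) ^^ n) x - (bracket (U w') ^^ n) x')
    \<le> (of_nat n * (\<kappa> * \<rho>) ^ (n - 1) * (\<kappa> * M) + (\<kappa> * \<rho>) ^ n * \<zeta>) * nrm (w - w')"
proof (induction n)
  case 0
  then show ?case using x by simp
next
  case (Suc n)
  let ?d = "nrm (w - w')" and ?q = "\<kappa> * \<rho>"
  let ?A = "bracket (U w)" and ?A' = "bracket (U w')"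
  have A': "nrm ((?A' ^^ n) x') \<le> ?q ^ n * M"
  proof -
    have "nrm (?A' v) \<le> ?q * nrm v" for v
    proof -
      have "\<kappa> * nrm w' * nrm v \<le> \<kappa> * \<rho> * nrm v" using w(2) \<kappa>(1) by (intro mult_right_mono mult_left_mono) auto
      then show ?thesis using \<kappa>(2)[of w' v] by linarith
    qed
    then have "nrm ((?A' ^^ n) x') \<le> ?q ^ n * nrm x'" using \<kappa>(1) r by (intro endo_pow_bound) auto
    also have "\<dots> \<le> ?q ^ n * M" using x(1) \<kappa>(1) r by (intro mult_left_mono) auto
    finally show ?thesis .
  qed
  have "(?A ^^ Suc n) x - (?A' ^^ Suc n) x' = ?A ((?A ^^ n) x - (?A' ^^ n) x') + bracket (U (w - w')) ((?A' ^^ n) x')"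
    by (simp add: bracket_simps endo.linear_diff[OF U])
  then have "nrm ((?A ^^ Suc n) x - (?A' ^^ Suc n) x')
     \<le> nrm (?A ((?A ^^ n) x - (?A' ^^ n) x')) + nrm (bracket (U (w - w')) ((?A' ^^ n) x'))"
    using nrm_add by (simp only:)
  also have "nrm (bracket (U (w - w')) ((?A' ^^ n) x')) \<le> \<kappa> * ?d * (?q ^ n * M)"
    using \<kappa>(2)[of "w - w'" "(?A' ^^ n) x'"] mult_left_mono[OF A', of "\<kappa> * ?d"] \<kappa>(1) by simp
  also have "nrm (?A ((?A ^^ n) x - (?A' ^^ n) x')) \<le> ?q * ((of_nat n * ?q ^ (n - 1) * (\<kappa> * M) + ?q ^ n * \<zeta>) * ?d)"
  proof -
    have "nrm (?A ((?A ^^ n) x - (?A' ^^ n) x')) \<le> \<kappa> * nrm w * nrm ((?A ^^ n) x - (?A' ^^ n) x')" by (rule \<kappa>(2))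
    also have "\<dots> \<le> ?q * nrm ((?A ^^ n) x - (?A' ^^ n) x')"
      using w(1) \<kappa>(1) by (intro mult_right_mono mult_left_mono) auto
    also have "\<dots> \<le> ?q * ((of_nat n * ?q ^ (n - 1) * (\<kappa> * M) + ?q ^ n * \<zeta>) * ?d)"
      using Suc \<kappa>(1) r by (intro mult_left_mono) auto
    finally show ?thesis .
  qed
  also have "?q * ((of_nat n * ?q ^ (n - 1) * (\<kappa> * M) + ?q ^ n * \<zeta>) * ?d) + \<kappa> * ?d * (?q ^ n * M)
      = (of_nat (Suc n) * ?q ^ n * (\<kappa> * M) + ?q ^ Suc n * \<zeta>) * ?d"
    by (cases n) (simp_all add: field_simps)
  finally show ?case by simp
qed

text \<open>A contraction argument: \<open>w \<mapsto> exp (ad (U w)) (y + Z w)\<close> is \<open>y + w\<close> up to a term with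
  small Lipschitz constant.\<close>

theorem local_conjugation:
  assumes L0: "subspace L0" and L1: "subspace L1" and N1: "subspace N1"
    and y: "y \<in> L1" and L01: "\<And>u v. u \<in> L0 \<Longrightarrow> v \<in> L1 \<Longrightarrow> bracket u v \<in> L1" and N1L: "N1 \<subseteq> L1"
    and split: "\<And>v. v \<in> L1 \<Longrightarrow> \<exists>u\<in>L0. v - bracket u y \<in> N1" and \<epsilon>: "\<epsilon> > 0"
  shows "\<exists>\<delta>>0. \<forall>v\<in>L1. nrm v < \<delta> \<longrightarrow>
    (\<exists>u\<in>L0. \<exists>z\<in>N1. nrm z < \<epsilon> \<and> expo (bracket u) 1 (y + z) = y + v)"
proof -
  obtain B where B: "B \<subseteq> L1" "independent B" "span B = L1" "finite B" by (rule subspace_eq_span_basis[OF L1])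
  have "\<forall>b\<in>B. \<exists>u. u \<in> L0 \<and> b - bracket u y \<in> N1" using split B(1) by blast
  from bchoice[OF this] obtain u where u: "\<And>b. b \<in> B \<Longrightarrow> u b \<in> L0 \<and> b - bracket (u b) y \<in> N1" by blast
  \<comment> \<open>The splitting is made linear by choosing it on a basis of L1: w = [U w, y] + Z w
    with U w in L0 and Z w in N1.\<close>
  define U where "U = endo.construct B u"
  have eU: "endo U" unfolding U_def by (rule endo.linear_construct[OF B(2)])
  have Ub: "U b = u b" if "b \<in> B" for b unfolding U_def by (rule endo.construct_basis[OF B(2) that])
  define Z where "Z w = w - bracket (U w) y" for w
  have eZ: "endo Z"
    by (rule endoI) (simp_all add: Z_def endo.linear_add[OF eU] endo.linear_scale[OF eU] bracket_simps scale_right_diff_distrib)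
  have "span B \<subseteq> {w. U w \<in> L0 \<and> Z w \<in> N1}"
  proof (rule span_minimal)
    show "B \<subseteq> {w. U w \<in> L0 \<and> Z w \<in> N1}" using u Ub by (auto simp: Z_def)
    show "subspace {w. U w \<in> L0 \<and> Z w \<in> N1}"
      by (rule subspaceI)
         (auto simp: endo_simps[OF eU] endo_simps[OF eZ] subspace_0[OF L0] subspace_0[OF N1]
            subspace_add[OF L0] subspace_add[OF N1] subspace_scale[OF L0] subspace_scale[OF N1])
  qed
  then have UL: "U w \<in> L0" and ZN: "Z w \<in> N1" if "w \<in> L1" for w using that B(3) by auto
  obtain Cb where Cb: "Cb \<ge> 0" "\<And>x y. nrm (bracket x y) \<le> Cb * nrm x * nrm y" using bracket_bound by blast
  obtain CU where CU: "CU \<ge> 0" "\<And>w. nrm (U w) \<le> CU * nrm w" using endo_bound[OF eU] by blast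
  obtain \<zeta> where \<zeta>: "\<zeta> \<ge> 0" "\<And>w. nrm (Z w) \<le> \<zeta> * nrm w" using endo_bound[OF eZ] by blast
  define \<kappa> where "\<kappa> = Cb * CU"
  have \<kappa>0: "\<kappa> \<ge> 0" using Cb CU by (simp add: \<kappa>_def)
  have \<kappa>: "nrm (bracket (U w) v) \<le> \<kappa> * nrm w * nrm v" for w v
  proof -
    have "Cb * nrm (U w) * nrm v \<le> Cb * (CU * nrm w) * nrm v"
      using CU(2) Cb(1) by (intro mult_right_mono mult_left_mono) auto
    then show ?thesis using Cb(2)[of "U w" v] by (simp add: \<kappa>_def mult.assoc)
  qed
  define M where "M = nrm y + \<zeta>"
  have M0: "M \<ge> 0" using \<zeta>(1) by (simp add: M_def)
  \<comment> \<open>The coefficient in the Lipschitz estimate of the nonlinear part: the term n = 1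
    needs 2 \<zeta>, the terms n \<ge> 2 need \<kappa> M + \<zeta>.\<close>
  define H where "H = \<kappa> * M + 2 * \<zeta>"
  have H0: "H \<ge> 0" using \<kappa>0 M0 \<zeta>(1) by (simp add: H_def)
  \<comment> \<open>S collects the requirements on 1/\<rho>: the summand 1 gives \<rho> \<le> 1, the
    others give in turn \<kappa> \<rho> \<le> 1/2 for geometric decay, 8 \<kappa> \<rho> H \<le> 1/2
    for the contraction, and \<zeta> \<rho> < \<epsilon> for the size of z.\<close>
  define S where "S = 1 + 2 * \<kappa> + 16 * \<kappa> * H + 2 * \<zeta> / \<epsilon>"
  have S1: "S \<ge> 1" using \<kappa>0 H0 \<zeta>(1) \<epsilon> by (simp add: S_def)
  define \<rho> where "\<rho> = 1 / S"
  have \<rho>: "\<rho> > 0" "\<rho> \<le> 1" using S1 by (simp_all add: \<rho>_def)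
  have pos: "0 \<le> 16 * \<kappa> * H" "0 \<le> 2 * \<zeta> / \<epsilon>" using \<kappa>0 H0 \<zeta>(1) \<epsilon> by simp_all
  have \<kappa>\<rho>: "\<kappa> * \<rho> \<le> 1/2"
    unfolding \<rho>_def using S1 pos \<kappa>0 by (simp add: field_simps S_def)
  have H\<rho>: "8 * (\<kappa> * \<rho> * H) \<le> 1/2"
  proof -
    have "16 * \<kappa> * H \<le> S" using pos \<kappa>0 by (simp add: S_def)
    then have "16 * \<kappa> * H * \<rho> \<le> S * \<rho>" using \<rho> by (intro mult_right_mono) auto
    also have "S * \<rho> = 1" using S1 by (simp add: \<rho>_def)
    finally show ?thesis by (simp add: mult_ac)
  qed
  have \<zeta>\<rho>: "\<zeta> * \<rho> < \<epsilon>"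
  proof -
    have "2 * \<zeta> / \<epsilon> \<le> S" using pos \<kappa>0 by (simp add: S_def)
    then have "2 * \<zeta> / \<epsilon> * \<rho> \<le> S * \<rho>" using \<rho> by (intro mult_right_mono) auto
    also have "S * \<rho> = 1" using S1 by (simp add: \<rho>_def)
    finally have "2 * (\<zeta> * \<rho>) \<le> \<epsilon>" using \<epsilon> by (simp add: field_simps)
    then show ?thesis using \<epsilon> by linarith
  qed
  define \<Phi> where "\<Phi> w = expo (bracket (U w)) 1 (y + Z w)" for w
  define Q where "Q w = \<Phi> w - y - w" for w
  \<comment> \<open>The exponential series of \<Phi> w with y + w removed. From n = 0 and n = 1 only
    [U w, Z w] remains, because [U w, y] + Z w = w.\<close>
  define a where "a n w = (if n = 0 then 0 else if n = 1 then bracket (U w) (Z w)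
     else sc (1 / fact n) ((bracket (U w) ^^ n) (y + Z w)))" for n :: nat and w
  have Qs: "(\<lambda>n. l (a n w)) sums l (Q w)" if l: "functional l" for l w
  proof -
    let ?f = "\<lambda>n. l ((bracket (U w) ^^ n) (y + Z w)) / fact n * 1 ^ n"
    have f: "?f sums l (\<Phi> w)" unfolding \<Phi>_def by (rule expo_sums[OF endo_bracket l])
    let ?g = "\<lambda>n. if n \<in> {0, 1} then ?f n - l (a n w) else 0"
    have "?g sums (\<Sum>n\<in>{0, 1}. ?f n - l (a n w))" by (rule sums_If_finite_set) simp
    from sums_diff[OF f this]
    have "(\<lambda>n. ?f n - ?g n) sums (l (\<Phi> w) - (\<Sum>n\<in>{0::nat, 1}. ?f n - l (a n w)))" .
    moreover have "?f n - ?g n = l (a n w)" for n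
      by (auto simp: a_def functional.linear_scale[OF l])
    moreover have "(\<Sum>n\<in>{0::nat, 1}. ?f n - l (a n w)) = l (y + w)"
      by (simp add: a_def bracket_simps Z_def functional_simps[OF l])
    ultimately show ?thesis by (simp only: Q_def functional_simps[OF l] diff_diff_add)
  qed
  have lip: "nrm (Q w - Q w') \<le> 1/2 * nrm (w - w')" if w: "nrm w \<le> \<rho>" "nrm w' \<le> \<rho>" for w w'
  proof -
    let ?d = "nrm (w - w')" and ?q = "\<kappa> * \<rho>"
    have q0: "0 \<le> ?q" using \<kappa>0 \<rho> by simp
    have xM: "nrm (y + Z w') \<le> M"
    proof -
      have "\<zeta> * nrm w' \<le> \<zeta> * 1" using w(2) \<rho>(2) \<zeta>(1) by (intro mult_left_mono) auto
      then show ?thesis using nrm_add[of y "Z w'"] \<zeta>(2)[of w'] by (simp add: M_def)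
    qed
    have Zd: "nrm (Z w - Z w') \<le> \<zeta> * ?d" using \<zeta>(2)[of "w - w'"] by (simp add: endo.linear_diff[OF eZ])
    have xd: "nrm ((y + Z w) - (y + Z w')) \<le> \<zeta> * ?d" using Zd by simp
    \<comment> \<open>The factor \<open>4 * (1/2) ^ n\<close> equals (1/2)^m for n = m + 2 and
      exceeds 1 for n = 1. Its sum over all n is 8, the factor occurring in
      \<open>H\<rho>\<close>.\<close>
    have bound: "nrm (a n w - a n w') \<le> (?q * H * ?d) * (4 * (1/2) ^ n)" for n
    proof -
      have B0: "0 \<le> ?q * H * ?d" using q0 H0 by simp
      consider "n = 0" | "n = 1" | m where "n = Suc (Suc m)" by (metis One_nat_def not0_implies_Suc)
      then show ?thesis
      proof cases
        case 1
        then show ?thesis using B0 by (simp add: a_def)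
      next
        case 2
        have "a n w - a n w' = bracket (U (w - w')) (Z w) + bracket (U w') (Z (w - w'))"
          by (simp add: 2 a_def bracket_simps endo.linear_diff[OF eU] endo.linear_diff[OF eZ])
        then have "nrm (a n w - a n w') \<le> nrm (bracket (U (w - w')) (Z w)) + nrm (bracket (U w') (Z (w - w')))"
          using nrm_add by (simp only:)
        also have "\<dots> \<le> \<kappa> * ?d * (\<zeta> * \<rho>) + \<kappa> * \<rho> * (\<zeta> * ?d)"
        proof (rule add_mono)
          have "nrm (Z w) \<le> \<zeta> * \<rho>" using \<zeta>(2)[of w] mult_left_mono[OF w(1) \<zeta>(1)] by linarith
          then have "\<kappa> * ?d * nrm (Z w) \<le> \<kappa> * ?d * (\<zeta> * \<rho>)" using \<kappa>0 by (intro mult_left_mono) auto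
          then show "nrm (bracket (U (w - w')) (Z w)) \<le> \<kappa> * ?d * (\<zeta> * \<rho>)" using \<kappa>[of "w - w'" "Z w"] by linarith
          have "\<kappa> * nrm w' * nrm (Z (w - w')) \<le> \<kappa> * \<rho> * (\<zeta> * ?d)"
            using \<kappa>0 w(2) \<zeta> \<rho> by (intro mult_mono) auto
          then show "nrm (bracket (U w') (Z (w - w'))) \<le> \<kappa> * \<rho> * (\<zeta> * ?d)" using \<kappa>[of w' "Z (w - w')"] by linarith
        qed
        also have "\<dots> = ?q * (2 * \<zeta>) * ?d" by (simp add: mult_ac)
        also have "\<dots> \<le> ?q * H * ?d"
          using q0 \<kappa>0 M0 by (intro mult_right_mono mult_left_mono) (auto simp: H_def)
        also have "\<dots> = (?q * H * ?d) * 1" by simp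
        also have "\<dots> \<le> (?q * H * ?d) * (4 * (1/2) ^ n)" by (rule mult_left_mono[OF _ B0]) (simp add: 2)
        finally show ?thesis .
      next
        case 3
        let ?E = "of_nat n * ?q ^ (n - 1) * (\<kappa> * M) + ?q ^ n * \<zeta>"
        have "a n w - a n w' = sc (1 / fact n) ((bracket (U w) ^^ n) (y + Z w) - (bracket (U w') ^^ n) (y + Z w'))"
          by (simp add: 3 a_def scale_right_diff_distrib del: funpow.simps fact_Suc)
        then have "nrm (a n w - a n w') = (1 / fact n) * nrm ((bracket (U w) ^^ n) (y + Z w) - (bracket (U w') ^^ n) (y + Z w'))"
          by (simp only: nrm_scale) (simp add: norm_divide)
        also have "\<dots> \<le> (1 / fact n) * (?E * ?d)"
          using iterate_lipschitz[OF \<kappa>0 \<kappa> eU w xM xd less_imp_le[OF \<rho>(1)] \<zeta>(1) M0] by (intro mult_left_mono) auto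
        also have "\<dots> \<le> ?q * H * ?d * (1/2) ^ m"
        proof -
          have f1: "1 / fact n \<le> (1::real)" by (simp add: fact_ge_1)
          have f2: "of_nat n / fact n \<le> (1::real)"
            by (rule of_nat_le_fact)
          have qm: "?q ^ m \<le> (1/2) ^ m" using q0 \<kappa>\<rho> by (intro power_mono) auto
          have t1: "(1 / fact n) * (of_nat n * ?q ^ (n - 1) * (\<kappa> * M)) \<le> ?q * (1/2) ^ m * (\<kappa> * M)"
          proof -
            have "?q ^ (n - 1) = ?q * ?q ^ m" by (simp add: 3)
            then have "(1 / fact n) * (of_nat n * ?q ^ (n - 1) * (\<kappa> * M)) = (of_nat n / fact n) * (?q * ?q ^ m * (\<kappa> * M))"
              by (simp only: one_divide_mult)
            also have "\<dots> \<le> 1 * (?q * ?q ^ m * (\<kappa> * M))" using f2 q0 \<kappa>0 M0 by (intro mult_right_mono) auto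
            also have "\<dots> \<le> ?q * (1/2) ^ m * (\<kappa> * M)"
              unfolding mult_1 using qm q0 \<kappa>0 M0 by (intro mult_right_mono mult_left_mono) auto
            finally show ?thesis .
          qed
          have t2: "(1 / fact n) * (?q ^ n * \<zeta>) \<le> ?q * (1/2) ^ m * \<zeta>"
          proof -
            have "(1 / fact n) * (?q ^ n * \<zeta>) \<le> 1 * (?q ^ n * \<zeta>)" using f1 q0 \<zeta>(1) by (intro mult_right_mono) auto
            moreover have "?q ^ n = ?q * ?q ^ m * ?q" by (simp add: 3)
            moreover have "?q * ?q ^ m * ?q \<le> ?q * (1/2) ^ m * 1" using qm q0 \<kappa>\<rho> by (intro mult_mono mult_left_mono) auto
            then have "?q * ?q ^ m * ?q * \<zeta> \<le> ?q * (1/2) ^ m * 1 * \<zeta>" using \<zeta>(1) by (rule mult_right_mono)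
            ultimately show ?thesis by (simp only: mult_1_left mult_1_right)
          qed
          have "(1 / fact n) * ?E \<le> ?q * (1/2) ^ m * (\<kappa> * M) + ?q * (1/2) ^ m * \<zeta>"
            unfolding distrib_left using t1 t2 by (rule add_mono)
          also have "\<dots> = ?q * (1/2) ^ m * (\<kappa> * M + \<zeta>)" by (simp only: distrib_left)
          also have "\<dots> \<le> ?q * (1/2) ^ m * H" using q0 \<zeta>(1) by (intro mult_left_mono) (auto simp: H_def)
          finally have "(1 / fact n) * ?E * ?d \<le> ?q * (1/2) ^ m * H * ?d" by (rule mult_right_mono) simp
          then show ?thesis by (simp only: mult_ac)
        qed
        also have "\<dots> = (?q * H * ?d) * (4 * (1/2) ^ n)" by (simp add: 3)
        finally show ?thesis .
      qed
    qed
    have "nrm (Q w - Q w') \<le> (?q * H * ?d) * (4 * 2)"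
    proof (rule nrm_series_bound[OF _ bound])
      show "(\<lambda>n. l (a n w - a n w')) sums l (Q w - Q w')" if l: "functional l" for l
        unfolding functional.linear_diff[OF l] by (intro sums_diff Qs l)
      have "(\<lambda>n. (1/2::real) ^ n) sums 2" using geometric_sums[of "1/2::real"] by simp
      then show "(\<lambda>n. (?q * H * ?d) * (4 * (1/2) ^ n)) sums ((?q * H * ?d) * (4 * 2))" by (intro sums_mult)
    qed
    also have "\<dots> = (8 * (?q * H)) * ?d" by simp
    also have "\<dots> \<le> 1/2 * ?d" using H\<rho> by (intro mult_right_mono) auto
    finally show ?thesis .
  qed
  have "bracket (U 0) = (\<lambda>x. 0)" by (simp add: endo.linear_0[OF eU] bracket_simps fun_eq_iff)
  then have Q0: "Q 0 = 0"
    using expo_fixed[OF endo_bracket, of "U 0" y] by (simp add: Q_def \<Phi>_def endo.linear_0[OF eZ])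
  have Qb: "nrm (Q w) \<le> 1/2 * nrm w" if "nrm w \<le> \<rho>" for w
    using lip[OF that, of 0] \<rho> by (simp add: Q0)
  have QL: "Q w \<in> L1" if "w \<in> L1" for w
    unfolding Q_def \<Phi>_def using that ZN[OF that] N1L y
    by (intro subspace_diff[OF L1] expo_in_subspace[OF endo_bracket L1] L01 UL subspace_add[OF L1]) auto
  have main: "\<exists>u\<in>L0. \<exists>z\<in>N1. nrm z < \<epsilon> \<and> expo (bracket u) 1 (y + z) = y + v" if v: "v \<in> L1" "nrm v < \<rho> / 2" for v
  proof -
    \<comment> \<open>Solving \<Phi> w = y + v means finding a fixed point of T. With
      \<open>nrm v < \<rho> / 2\<close> this map preserves the ball of radius \<rho> in L1 and
      halves distances there.\<close>
    define T where "T w = v - Q w" for w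
    define w where "w k = (T ^^ k) 0" for k
    have wS: "w (Suc k) = T (w k)" and w0: "w 0 = 0" for k by (simp_all add: w_def)
    have wb: "w k \<in> L1 \<and> nrm (w k) \<le> \<rho>" for k
    proof (induction k)
      case 0
      then show ?case using \<rho> by (simp add: w0 subspace_0[OF L1])
    next
      case (Suc k)
      have "nrm (T (w k)) \<le> nrm v + nrm (Q (w k))" unfolding T_def by (rule nrm_diff)
      moreover have "nrm (Q (w k)) \<le> 1/2 * \<rho>" using Qb[of "w k"] Suc by auto
      ultimately have "nrm (T (w k)) \<le> \<rho>" using v(2) by linarith
      moreover have "T (w k) \<in> L1" unfolding T_def using subspace_diff[OF L1 v(1) QL] Suc by blast
      ultimately show ?case by (simp add: wS)
    qed
    have Tl: "nrm (T x - T x') \<le> 1/2 * nrm (x - x')" if "nrm x \<le> \<rho>" "nrm x' \<le> \<rho>" for x x'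
    proof -
      have "T x - T x' = - (Q x - Q x')" by (simp add: T_def)
      then show ?thesis using lip[OF that] by (simp only: nrm_minus)
    qed
    have "nrm (w (Suc k) - w k) \<le> nrm (w 1) * (1/2) ^ k" for k
    proof (induction k)
      case 0
      then show ?case by (simp add: w0)
    next
      case (Suc k)
      have "nrm (w (Suc (Suc k)) - w (Suc k)) \<le> 1/2 * nrm (w (Suc k) - w k)"
        unfolding wS[of "Suc k"] wS[of k] using Tl wb wS[of k] by (metis wS)
      then show ?case using Suc by simp
    qed
    from geometric_limit[OF this] obtain x where x: "(\<lambda>k. nrm (w k - x)) \<longlonglongrightarrow> 0" by blast
    have xL: "x \<in> L1" using limit_in_subspace[OF L1 _ x] wb by blast
    have "nrm x \<le> nrm (w k - x) + \<rho>" for k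
      using nrm_diff[of "w k" "w k - x"] wb[of k] by simp
    moreover have "(\<lambda>k. nrm (w k - x) + \<rho>) \<longlonglongrightarrow> 0 + \<rho>" by (intro tendsto_add x tendsto_const)
    ultimately have xb: "nrm x \<le> 0 + \<rho>" by (intro LIMSEQ_le_const) auto
    have "nrm (T x - x) \<le> nrm (w k - x) + nrm (w (Suc k) - x)" for k
    proof -
      have "T x - x = (T x - T (w k)) + (w (Suc k) - x)" by (simp add: wS)
      then have "nrm (T x - x) \<le> nrm (T x - T (w k)) + nrm (w (Suc k) - x)" using nrm_add by (simp only:)
      moreover have "nrm (T x - T (w k)) \<le> 1/2 * nrm (x - w k)" using Tl[of x "w k"] xb wb[of k] by simp
      ultimately show ?thesis using nrm_minus_commute[of x "w k"] nrm_nonneg[of "w k - x"] by linarith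
    qed
    moreover have "(\<lambda>k. nrm (w k - x) + nrm (w (Suc k) - x)) \<longlonglongrightarrow> 0 + 0"
      by (intro tendsto_add x LIMSEQ_Suc[OF x])
    ultimately have "nrm (T x - x) \<le> 0 + 0" by (intro LIMSEQ_le_const) auto
    then have "T x - x = 0" using nrm_nonneg[of "T x - x"] by (intro nrm_eq_0) linarith
    then have "v = x + Q x" by (simp add: T_def eq_diff_eq add.commute) (metis add.commute diff_add_cancel)
    then have "\<Phi> x = y + v" by (simp add: Q_def)
    moreover have "nrm (Z x) < \<epsilon>"
    proof -
      have "nrm (Z x) \<le> \<zeta> * \<rho>" using \<zeta>(2)[of x] mult_left_mono[of "nrm x" \<rho> \<zeta>] xb \<zeta>(1) by simp
      then show ?thesis using \<zeta>\<rho> by linarith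
    qed
    ultimately show ?thesis using UL[OF xL] ZN[OF xL] unfolding \<Phi>_def by blast
  qed
  show ?thesis using \<rho> main by (intro exI[of _ "\<rho> / 2"]) auto
qed

end

section \<open>Null spaces and the semicontinuity of their dimension\<close>

context fd_space
begin

text \<open>The kernels of the powers grow strictly until they become constant, so this happens
  within the dimension. A fixed exponent is wanted because the corresponding power of ad y is then
  polynomial in y.\<close>

lemma gen_eigenspace_0_kernel:
  assumes A: "endo A" shows "gen_eigenspace A 0 = {v. (A ^^ card Basis) v = 0}"
proof -
  let ?K = "\<lambda>k. {v. (A ^^ k) v = 0}"
  have sub: "subspace (?K k)" for k by (rule subspace_kernel_endo[OF endo_funpow[OF A]])
  have mono: "?K k \<subseteq> ?K (Suc k)" for k by (auto simp: endo.linear_0[OF A])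
  have "\<exists>k\<le>card Basis. ?K k = ?K (Suc k)"
  proof (rule ccontr)
    assume "\<not> ?thesis"
    then have ne: "?K k \<noteq> ?K (Suc k)" if "k \<le> card Basis" for k using that by blast
    have "k \<le> dim (?K k)" if "k \<le> Suc (card Basis)" for k
      using that
    proof (induction k)
      case (Suc k)
      have "dim (?K k) < dim (?K (Suc k))"
      proof (rule ccontr)
        assume "\<not> dim (?K k) < dim (?K (Suc k))"
        then have "?K k = ?K (Suc k)" by (intro subspace_dim_equal[OF sub sub mono]) simp
        then show False using ne Suc.prems by simp
      qed
      then show ?case using Suc by simp
    qed simp
    from this[of "Suc (card Basis)"] show False
      using dim_subset_UNIV[of "?K (Suc (card Basis))"] by (simp add: dimension_def)
  qed
  then obtain k where k: "k \<le> card Basis" "?K k = ?K (Suc k)" by blast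
  have "?K (k + j) \<subseteq> ?K k" for j
  proof (induction j)
    case (Suc j)
    show ?case
    proof
      fix v assume "v \<in> ?K (k + Suc j)"
      then have "(A ^^ (Suc k)) ((A ^^ j) v) = 0" by (simp add: funpow_add[symmetric, THEN fun_cong, unfolded o_apply] del: funpow.simps)
      then have "(A ^^ j) v \<in> ?K k" using k(2) by blast
      then have "v \<in> ?K (k + j)" by (simp add: funpow_add)
      then show "v \<in> ?K k" using Suc by blast
    qed
  qed simp
  then have all: "(A ^^ n) v = 0 \<Longrightarrow> (A ^^ k) v = 0" for n v
    using funpow_0_mono[OF A, of n v "k + n"] by fastforce
  show ?thesis
  proof
    show "gen_eigenspace A 0 \<subseteq> {v. (A ^^ card Basis) v = 0}"
      unfolding gen_eigenspace_def using all funpow_0_mono[OF A _ k(1)] by auto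
    show "{v. (A ^^ card Basis) v = 0} \<subseteq> gen_eigenspace A 0" unfolding gen_eigenspace_def by auto
  qed
qed

end

context lie_space
begin

abbreviation null :: "'a \<Rightarrow> 'a set" where
  "null y \<equiv> gen_eigenspace (bracket y) 0"

lemma subspace_null: "subspace (null y)"
  by (rule subspace_gen_eigenspace[OF endo_bracket])

lemma null_kernel: "null y = {v. (bracket y ^^ card Basis) v = 0}"
  by (rule gen_eigenspace_0_kernel[OF endo_bracket])

text \<open>The sum M of the other generalized eigenspaces of ad y is a complement of
  \<open>null y\<close>, stable under ad z for z in \<open>null y\<close>. On M the map ad y is
  bounded below, so ad (y + z) stays injective there for small z; as it preserves both summands, its
  null space lies in \<open>null y\<close>.\<close>

lemma null_near:
  "\<exists>\<epsilon>>0. \<forall>z\<in>null y. nrm z < \<epsilon> \<longrightarrow> null (y + z) \<subseteq> null y"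
proof -
  let ?A = "bracket y"
  have A: "endo ?A" and dA: "derivation ?A" by (rule endo_bracket, rule derivation_bracket)
  define M where "M = span (\<Union>\<mu>\<in>- {0}. gen_eigenspace ?A \<mu>)"
  have sM: "subspace M" by (simp add: M_def)
  have gM: "v \<in> M" if "v \<in> gen_eigenspace ?A \<mu>" "\<mu> \<noteq> 0" for v \<mu> unfolding M_def using that by (intro span_base) blast
  have zM: "bracket z m \<in> M" if "z \<in> null y" "m \<in> M" for z m
    using that(2) unfolding M_def
  proof (induction rule: span_induct_alt)
    case base
    then show ?case by (simp add: bracket_simps span_zero)
  next
    case (step c x m)
    then obtain \<mu> where \<mu>: "\<mu> \<noteq> 0" "x \<in> gen_eigenspace ?A \<mu>" by blast
    have "bracket z x \<in> gen_eigenspace ?A (0 + \<mu>)" by (rule bracket_in_gen[OF dA that(1) \<mu>(2)])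
    then have "bracket z x \<in> span (\<Union>\<mu>\<in>- {0}. gen_eigenspace ?A \<mu>)" using gM[of "bracket z x" \<mu>] \<mu>(1) by (simp add: M_def)
    then show ?case using step.IH by (simp add: bracket_simps span_add span_scale)
  qed
  have yn: "y \<in> null y" by (rule gen_eigenspaceI[where k = 1]) (simp add: bracket_self)
  have disj: "m = 0" if "m \<in> M" "m \<in> null y" for m
  proof -
    have "\<exists>X v. finite X \<and> 0 \<notin> X \<and> (\<forall>\<mu>\<in>X. v \<mu> \<in> gen_eigenspace ?A \<mu>) \<and> m = (\<Sum>\<mu>\<in>X. v \<mu>)"
      using that(1) unfolding M_def
    proof (induction rule: span_induct_alt)
      case base
      show ?case by (intro exI[of _ "{}"]) auto
    next
      case (step c x m)
      then obtain \<mu> where \<mu>: "\<mu> \<noteq> 0" "x \<in> gen_eigenspace ?A \<mu>" by blast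
      obtain X v where X: "finite X" "0 \<notin> X" "\<forall>\<mu>\<in>X. v \<mu> \<in> gen_eigenspace ?A \<mu>" "m = (\<Sum>\<mu>\<in>X. v \<mu>)" using step by blast
      define v' where "v' \<nu> = (if \<nu> \<in> X then v \<nu> else 0) + (if \<nu> = \<mu> then sc c x else 0)" for \<nu>
      have "v' \<nu> \<in> gen_eigenspace ?A \<nu>" for \<nu>
        unfolding v'_def using X(3) \<mu>(2) subspace_gen_eigenspace[OF A, of \<nu>]
        by (auto simp: subspace_add subspace_scale subspace_0)
      moreover have "(\<Sum>\<nu>\<in>insert \<mu> X. v' \<nu>) = m + sc c x"
        unfolding v'_def sum.distrib using X(1,4)
        by (cases "\<mu> \<in> X") (auto simp: insert_absorb sum.insert_if intro!: sum.cong)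
      ultimately show ?case using X(1,2) \<mu>(1)
        by (intro exI[of _ "insert \<mu> X"] exI[of _ v']) (simp add: add.commute)
    qed
    then obtain X v where X: "finite X" "0 \<notin> X" "\<forall>\<mu>\<in>X. v \<mu> \<in> gen_eigenspace ?A \<mu>" "m = (\<Sum>\<mu>\<in>X. v \<mu>)" by blast
    let ?v = "v(0 := - m)"
    have "?v 0 = 0"
    proof -
      have f: "finite (insert 0 X)" using X(1) by simp
      have g: "?v \<mu> \<in> gen_eigenspace ?A \<mu>" if "\<mu> \<in> insert 0 X" for \<mu>
        using that X(3) \<open>m \<in> null y\<close> subspace_neg[OF subspace_null, of m y] by (cases "\<mu> = 0") auto
      have "(\<Sum>\<mu>\<in>X. ?v \<mu>) = (\<Sum>\<mu>\<in>X. v \<mu>)" using X(2) by (intro sum.cong) auto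
      then have s: "(\<Sum>\<mu>\<in>insert 0 X. ?v \<mu>) = 0" using X(1,2,4) by simp
      show "?v 0 = 0" by (rule gen_eigenspace_component[where v = ?v, OF A f g s insertI1])
    qed
    then show ?thesis by simp
  qed
  have dec: "\<exists>n m. n \<in> null y \<and> m \<in> M \<and> x = n + m" for x
  proof -
    obtain X v where X: "finite X" "\<And>\<mu>. \<mu> \<in> X \<Longrightarrow> v \<mu> \<in> gen_eigenspace ?A \<mu>" "x = (\<Sum>\<mu>\<in>X. v \<mu>)"
      by (rule gen_decomposition[OF A, of x]) blast
    have m: "(\<Sum>\<mu>\<in>X - {0}. v \<mu>) \<in> M" using X(2) gM by (intro subspace_sum[OF sM]) auto
    show ?thesis
    proof (cases "0 \<in> X")
      case True
      then have "x = v 0 + (\<Sum>\<mu>\<in>X - {0}. v \<mu>)" using X(1,3) by (simp add: sum.remove)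
      then show ?thesis using X(2)[OF True] m by blast
    next
      case False
      then have "x = 0 + (\<Sum>\<mu>\<in>X - {0}. v \<mu>)" using X(3) by simp
      then show ?thesis using m subspace_0[OF subspace_null] by blast
    qed
  qed
  have "m = 0" if "m \<in> M" "?A m = 0" for m
    using disj[OF that(1)] gen_eigenspaceI[where A = ?A and \<mu> = 0 and k = 1 and v = m] that(2) by simp
  from injective_bound[OF A sM this] obtain C where C: "C > 0" "\<forall>m\<in>M. nrm m \<le> C * nrm (?A m)" by blast
  obtain D where D: "D \<ge> 0" "\<And>x y. nrm (bracket x y) \<le> D * nrm x * nrm y" using bracket_bound by blast
  \<comment> \<open>C bounds the inverse of ad y on M and D bounds the bracket, so C D \<epsilon> is
    at most 1/2. The summand 1 keeps the denominator positive if D = 0.\<close>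
  define \<epsilon> where "\<epsilon> = 1 / (2 * C * (D + 1))"
  have \<epsilon>: "\<epsilon> > 0" using C(1) D(1) by (simp add: \<epsilon>_def)
  have "null (y + z) \<subseteq> null y" if z: "z \<in> null y" "nrm z < \<epsilon>" for z
  proof
    fix x assume x: "x \<in> null (y + z)"
    let ?T = "bracket (y + z)"
    have inj: "m = 0" if m: "m \<in> M" "?T m = 0" for m
    proof -
      have "?A m = - bracket z m" using m(2) by (simp add: bracket_simps eq_neg_iff_add_eq_0)
      then have "nrm (?A m) \<le> D * nrm z * nrm m" using D(2)[of z m] by (simp only: nrm_minus)
      then have "nrm m \<le> C * (D * nrm z * nrm m)" using C m(1) by (meson mult_left_mono less_imp_le order_trans)
      also have "\<dots> \<le> C * (D * \<epsilon> * nrm m)" using z(2) D(1) C(1) by (intro mult_left_mono mult_right_mono) auto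
      also have "\<dots> = (C * D * \<epsilon>) * nrm m" by (simp only: mult_ac)
      also have "\<dots> \<le> 1/2 * nrm m"
      proof (rule mult_right_mono)
        have "2 * C * (D + 1) > 0" using C(1) D(1) by simp
        then show "C * D * \<epsilon> \<le> 1/2" using C(1) D(1) unfolding \<epsilon>_def times_divide_eq_right
          by (subst pos_divide_le_eq) (simp_all add: distrib_left)
      qed simp
      finally have "nrm m = 0" using nrm_nonneg[of m] by linarith
      then show ?thesis by (rule nrm_eq_0)
    qed
    obtain n m where nm: "n \<in> null y" "m \<in> M" "x = n + m" using dec by blast
    have TM: "?T v \<in> M" if "v \<in> M" for v using zM[OF yn that] zM[OF z(1) that] by (simp add: bracket_simps subspace_add[OF sM])
    have TN: "?T v \<in> null y" if "v \<in> null y" for v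
      using bracket_in_gen[OF dA yn that] bracket_in_gen[OF dA z(1) that] by (simp add: bracket_simps subspace_add[OF subspace_null])
    obtain k where k: "(?T ^^ k) x = 0" using x by (auto simp: gen_eigenspace_def)
    have iM: "(?T ^^ j) m \<in> M" for j by (induction j) (use nm TM in auto)
    have iN: "(?T ^^ j) n \<in> null y" for j by (induction j) (use nm TN in auto)
    have "(?T ^^ k) n + (?T ^^ k) m = 0"
      using k endo.linear_add[OF endo_funpow[OF endo_bracket], of k "y + z" n m] by (simp only: nm(3))
    then have "(?T ^^ k) m = - (?T ^^ k) n" by (simp add: eq_neg_iff_add_eq_0 add.commute)
    then have "(?T ^^ k) m \<in> null y" using iN[of k] subspace_neg[OF subspace_null] by metis
    then have "(?T ^^ k) m = 0" by (rule disj[OF iM])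
    then have "m = 0"
    proof (induction k)
      case (Suc k)
      then show ?case using inj[OF iM[of k]] by simp
    qed simp
    then show "x \<in> null y" using nm by simp
  qed
  then show ?thesis using \<epsilon> by blast
qed

text \<open>Extend a basis of the null part at t0 to a basis of L. The added vectors have
  independent images under the fixed power of ad at t0; these images are polynomial in t, so they
  stay independent for all but finitely many t, and then the span of the added vectors meets the
  null space trivially.\<close>

lemma dim_null_cofinite:
  assumes L: "subspace L"
  shows "finite {t. dim (L \<inter> null (a + sc t d)) > dim (L \<inter> null (a + sc t0 d))}"
proof -
  let ?K = "card Basis" and ?A = "\<lambda>t. bracket (a + sc t d)"
  let ?E = "\<lambda>t. L \<inter> null (a + sc t d)"
  have sE: "subspace (?E t)" for t by (rule subspace_inter[OF L subspace_null])
  obtain B0 where B0: "B0 \<subseteq> ?E t0" "independent B0" "span B0 = ?E t0" "finite B0" "card B0 = dim (?E t0)"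
    by (rule subspace_eq_span_basis[OF sE])
  have "B0 \<subseteq> L" using B0(1) by blast
  obtain B where B: "B0 \<subseteq> B" "B \<subseteq> L" "independent B" "L \<subseteq> span B"
    by (rule maximal_independent_subset_extend[OF \<open>B0 \<subseteq> L\<close> B0(2)])
  have fB: "finite B" by (rule finiteI_independent[OF B(3)])
  have spB: "span B = L" using B L by (intro antisym span_minimal) auto
  let ?J = "B - B0"
  define v where "v e t = (?A t ^^ ?K) e" for e t
  have pc: "poly_curve (v e)" for e
  proof -
    have "poly_curve (\<lambda>t. (?A t ^^ k) e)" for k
    proof (induction k)
      case 0
      show ?case unfolding poly_curve_def
      proof
        fix b
        have "\<forall>t. coord b ((?A t ^^ 0) e) = poly [:coord b e:] t" by simp
        then show "\<exists>p. \<forall>t. coord b ((?A t ^^ 0) e) = poly p t" by blast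
      qed
    next
      case (Suc k)
      let ?w = "\<lambda>t. (?A t ^^ k) e"
      show ?case unfolding poly_curve_def
      proof
        fix b
        obtain p where p: "\<forall>t. coord b (bracket a (?w t)) = poly p t"
          using poly_curve_functional[OF Suc functional_comp[OF functional_coord endo_bracket]] by blast
        obtain q where q: "\<forall>t. coord b (bracket d (?w t)) = poly q t"
          using poly_curve_functional[OF Suc functional_comp[OF functional_coord endo_bracket]] by blast
        have "\<forall>t. coord b ((?A t ^^ Suc k) e) = poly (p + pCons 0 q) t"
          using p q by (simp add: bracket_simps coord_simps)
        then show "\<exists>p. \<forall>t. coord b ((?A t ^^ Suc k) e) = poly p t" by blast
      qed
    qed
    then show ?thesis unfolding v_def .
  qed
  have lin: "(\<Sum>e\<in>?J. sc (x e) (v e t)) = (?A t ^^ ?K) (\<Sum>e\<in>?J. sc (x e) e)" for x t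
    unfolding v_def endo.linear_sum[OF endo_funpow[OF endo_bracket]] endo.linear_scale[OF endo_funpow[OF endo_bracket]] by (rule refl)
  have JL: "(\<Sum>e\<in>?J. sc (x e) e) \<in> L" for x using B(2) by (intro subspace_sum[OF L] subspace_scale[OF L]) auto
  have ind0: "\<forall>j\<in>?J. x j = 0" if "(\<Sum>e\<in>?J. sc (x e) (v e t0)) = 0" for x
  proof -
    let ?u = "\<Sum>e\<in>?J. sc (x e) e"
    have "?u \<in> span B0" using that JL unfolding lin B0(3) null_kernel by blast
    then obtain c where c: "(\<Sum>e\<in>B0. sc (c e) e) = ?u" using B0(4) by (auto simp: span_finite)
    let ?y = "\<lambda>e. if e \<in> B0 then - c e else x e"
    have "(\<Sum>e\<in>B. sc (?y e) e) = (\<Sum>e\<in>?J. sc (?y e) e) + (\<Sum>e\<in>B0. sc (?y e) e)"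
      by (rule sum.subset_diff[OF B(1) fB])
    also have "(\<Sum>e\<in>?J. sc (?y e) e) = ?u" by (rule sum.cong) auto
    also have "(\<Sum>e\<in>B0. sc (?y e) e) = - ?u" unfolding c[symmetric] sum_negf[symmetric] by (rule sum.cong) auto
    finally have "(\<Sum>e\<in>B. sc (?y e) e) = 0" by simp
    from independentD[OF B(3) fB subset_refl this] have z: "?y e = 0" if "e \<in> B" for e using that by simp
    show ?thesis
    proof
      fix j assume "j \<in> ?J"
      then show "x j = 0" using z[of j] by simp
    qed
  qed
  have fin: "finite {t. \<exists>x. (\<Sum>j\<in>?J. sc (x j) (v j t)) = 0 \<and> (\<exists>j\<in>?J. x j \<noteq> 0)}"
    by (rule independent_cofinite[OF _ pc ind0]) (use fB in auto)
  have "dim (?E t) \<le> dim (?E t0)" if good: "\<not> (\<exists>x. (\<Sum>j\<in>?J. sc (x j) (v j t)) = 0 \<and> (\<exists>j\<in>?J. x j \<noteq> 0))" for t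
  proof -
    have iJ: "independent ?J" using B(3) by (rule independent_mono) auto
    have fJ: "finite ?J" using fB by simp
    have "span ?J \<inter> ?E t = {0}"
    proof
      show "span ?J \<inter> ?E t \<subseteq> {0}"
      proof
        fix u assume u: "u \<in> span ?J \<inter> ?E t"
        then obtain x where x: "(\<Sum>e\<in>?J. sc (x e) e) = u" using fJ by (auto simp: span_finite)
        then have "(\<Sum>e\<in>?J. sc (x e) (v e t)) = 0" unfolding lin using u by (auto simp: null_kernel)
        then have "\<forall>j\<in>?J. x j = 0" using good by blast
        then have "u = 0" unfolding x[symmetric] by (intro sum.neutral) auto
        then show "u \<in> {0}" by simp
      qed
      show "{0} \<subseteq> span ?J \<inter> ?E t" using subspace_0[OF sE] span_zero by blast
    qed
    then have "dim {x + y |x y. x \<in> span ?J \<and> y \<in> ?E t} = dim (span ?J) + dim (?E t)"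
      using dim_sums_Int[OF subspace_span sE[of t], of ?J] by simp
    moreover have "{x + y |x y. x \<in> span ?J \<and> y \<in> ?E t} \<subseteq> L"
    proof -
      have "span ?J \<subseteq> L" using B(2) L by (intro span_minimal) auto
      then show ?thesis using subspace_add[OF L] by blast
    qed
    then have "dim {x + y |x y. x \<in> span ?J \<and> y \<in> ?E t} \<le> dim L" by (rule dim_subset)
    moreover have "dim (span ?J) = card B - card B0"
      using dim_span_eq_card_independent[OF iJ] card_Diff_subset[OF B0(4) B(1)] by simp
    moreover have "dim L = card B" using dim_span_eq_card_independent[OF B(3)] spB by simp
    moreover have "card B0 \<le> card B" using B(1) fB by (rule card_mono[rotated])
    ultimately show ?thesis using B0(5) by linarith
  qed
  then have "{t. dim (?E t) > dim (?E t0)} \<subseteq> {t. \<exists>x. (\<Sum>j\<in>?J. sc (x j) (v j t)) = 0 \<and> (\<exists>j\<in>?J. x j \<noteq> 0)}"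
    using leD by blast
  then show ?thesis using fin finite_subset by blast
qed

lemma automorphismD:
  assumes "h \<in> lie_automorphisms sc bracket"
  shows "endo h" "bij h" "h (bracket x y) = bracket (h x) (h y)"
  using assms by (auto simp: lie_automorphisms_def)

lemma automorphism_pow:
  assumes "h \<in> lie_automorphisms sc bracket"
  shows "h ((bracket y ^^ k) v) = (bracket (h y) ^^ k) (h v)"
  by (induction k) (simp_all add: automorphismD(3)[OF assms])

lemma automorphism_null:
  assumes h: "h \<in> lie_automorphisms sc bracket"
  shows "h ` null y = null (h y)"
proof -
  have inj: "inj h" and surj: "surj h" using automorphismD(2)[OF h] by (auto simp: bij_def)
  have h0: "h v = 0 \<longleftrightarrow> v = 0" for v
    using inj endo.linear_0[OF automorphismD(1)[OF h]] by (metis injD)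
  have iff: "h v \<in> null (h y) \<longleftrightarrow> v \<in> null y" for v
    by (simp add: null_kernel automorphism_pow[OF h, symmetric] h0)
  show ?thesis
  proof
    show "h ` null y \<subseteq> null (h y)" using iff by blast
    show "null (h y) \<subseteq> h ` null y"
    proof
      fix w assume w: "w \<in> null (h y)"
      obtain v where "w = h v" using surj by (metis surjD)
      then show "w \<in> h ` null y" using w iff by blast
    qed
  qed
qed

text \<open>The line from \<open>a\<close> to \<open>b\<close> meets the non-regular elements in a finite set, so its regular
  points form a connected set, on which the conjugacy class of the null space is locally constant.\<close>

theorem regular_null_conjugate:
  assumes L: "subspace L" and L0: "subspace L0" and L1: "subspace L1" and L1L: "L1 \<subseteq> L"
    and L01: "\<And>u v. u \<in> L0 \<Longrightarrow> v \<in> L1 \<Longrightarrow> bracket u v \<in> L1"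
    and split: "\<And>y v. y \<in> L1 \<Longrightarrow> v \<in> L1 \<Longrightarrow> \<exists>u\<in>L0. v - bracket u y \<in> L1 \<inter> null y"
    and H: "\<And>h. h \<in> H \<Longrightarrow> h \<in> lie_automorphisms sc bracket" "\<And>h. h \<in> H \<Longrightarrow> h ` L = L"
      "\<And>h k. h \<in> H \<Longrightarrow> k \<in> H \<Longrightarrow> h \<circ> k \<in> H" "\<And>h. h \<in> H \<Longrightarrow> inv_into UNIV h \<in> H"
      "\<And>u. u \<in> L0 \<Longrightarrow> expo (bracket u) 1 \<in> H"
    and a: "a \<in> L1" "\<exists>\<delta>>0. \<forall>v\<in>L1. nrm v < \<delta> \<longrightarrow> dim (L \<inter> null (a + v)) = dim (L \<inter> null a)"
    and b: "b \<in> L1" "\<exists>\<delta>>0. \<forall>v\<in>L1. nrm v < \<delta> \<longrightarrow> dim (L \<inter> null (b + v)) = dim (L \<inter> null b)"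
  shows "\<exists>h\<in>H. L \<inter> null b = h ` (L \<inter> null a)"
proof -
  let ?N = "\<lambda>y. L \<inter> null y"
  have sN: "subspace (?N y)" for y by (rule subspace_inter[OF L subspace_null])
  \<comment> \<open>A point near which the dimension is constant attains the minimum over L1: on the
    line from it to y, all but finitely many parameters have dimension at most that at y, and some
    of them are arbitrarily small.\<close>
  have minimal: "dim (?N a) \<le> dim (?N y)"
    if a: "a \<in> L1" "\<exists>\<delta>>0. \<forall>v\<in>L1. nrm v < \<delta> \<longrightarrow> dim (?N (a + v)) = dim (?N a)" and y: "y \<in> L1" for a y
  proof -
    obtain \<delta> where \<delta>: "\<delta> > 0" "\<forall>v\<in>L1. nrm v < \<delta> \<longrightarrow> dim (?N (a + v)) = dim (?N a)" using a(2) by blast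
    let ?d = "y - a"
    have dL: "?d \<in> L1" using subspace_diff[OF L1 y a(1)] .
    let ?r = "\<delta> / (nrm ?d + 1)"
    have r: "?r > 0" using \<delta>(1) by (simp add: add_nonneg_pos)
    have "infinite (ball (0::complex) ?r)"
    proof
      assume "finite (ball (0::complex) ?r)"
      then have "ball (0::complex) ?r = {}" using finite_imp_not_open[of "ball (0::complex) ?r"] open_ball by blast
      then show False using centre_in_ball[of "0::complex" ?r] r by blast
    qed
    moreover have "finite {t. dim (?N (a + sc t ?d)) > dim (?N (a + sc 1 ?d))}" by (rule dim_null_cofinite[OF L])
    ultimately obtain t where t: "t \<in> ball 0 ?r" "dim (?N (a + sc t ?d)) \<le> dim (?N (a + sc 1 ?d))"
      by (metis (mono_tags, lifting) finite_subset mem_Collect_eq not_le_imp_less subsetI)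
    have "cmod t * nrm ?d \<le> cmod t * (nrm ?d + 1)" by (intro mult_left_mono) auto
    also have "\<dots> < \<delta>" using t(1) by (simp add: pos_less_divide_eq add_nonneg_pos)
    finally have "dim (?N (a + sc t ?d)) = dim (?N a)" using \<delta>(2) subspace_scale[OF L1 dL] by (simp add: nrm_scale)
    then show ?thesis using t(2) by simp
  qed
  have ab: "dim (?N b) = dim (?N a)" using minimal[OF a b(1)] minimal[OF b a(1)] by simp
  define y where "y t = a + sc t (b - a)" for t
  have y01: "y 0 = a" "y 1 = b" by (simp_all add: y_def)
  have dL: "b - a \<in> L1" using subspace_diff[OF L1 b(1) a(1)] .
  have yL: "y t \<in> L1" for t unfolding y_def using subspace_add[OF L1 a(1) subspace_scale[OF L1 dL]] .
  define G where "G = - {t. dim (?N (y t)) > dim (?N (y 0))}"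
  have "finite {t. dim (?N (y t)) > dim (?N (y 0))}" unfolding y_def by (rule dim_null_cofinite[OF L])
  then have conG: "connected G"
    unfolding G_def Compl_eq_Diff_UNIV by (intro connected_open_delete_finite) auto
  have regG: "dim (?N (y t)) = dim (?N a)" if "t \<in> G" for t
    using that minimal[OF a yL[of t]] by (simp add: G_def y01)
  have "0 \<in> G" "1 \<in> G" using ab by (simp_all add: G_def y01)
  define R where "R t t' \<longleftrightarrow> (\<exists>h\<in>H. ?N (y t') = h ` ?N (y t))" for t t'
  have img: "h ` ?N x = ?N (h x)" if h: "h \<in> H" for h x
  proof -
    have "inj h" using automorphismD(2)[OF H(1)[OF h]] by (rule bij_is_inj)
    then show ?thesis using H(2)[OF h] automorphism_null[OF H(1)[OF h]] by (simp add: image_Int)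
  qed
  have "R 0 1"
  proof (rule connected_equivalence_relation[OF conG \<open>0 \<in> G\<close> \<open>1 \<in> G\<close>])
    fix t t' assume "R t t'"
    then obtain h where h: "h \<in> H" "?N (y t') = h ` ?N (y t)" by (auto simp: R_def)
    have "inj h" using automorphismD(2)[OF H(1)[OF h(1)]] by (rule bij_is_inj)
    then have "?N (y t) = inv_into UNIV h ` ?N (y t')" unfolding h(2) by (simp add: image_image)
    then show "R t' t" unfolding R_def using H(4)[OF h(1)] by blast
  next
    fix t t' t'' assume "R t t'" "R t' t''"
    then obtain h k where h: "h \<in> H" "?N (y t') = h ` ?N (y t)" and k: "k \<in> H" "?N (y t'') = k ` ?N (y t')"
      by (auto simp: R_def)
    have "?N (y t'') = (k \<circ> h) ` ?N (y t)" unfolding k(2) h(2) by (simp only: image_comp)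
    then show "R t t''" unfolding R_def using H(3)[OF k(1) h(1)] by blast
  next
    \<comment> \<open>A nearby y s is conjugate under H to y t + z with z small in the null space of
      y t. Then the null part of y t + z lies in that of y t, and the equality of dimensions on G
      makes them coincide.\<close>
    fix t assume t: "t \<in> G"
    obtain \<epsilon> where \<epsilon>: "\<epsilon> > 0" "\<forall>z\<in>null (y t). nrm z < \<epsilon> \<longrightarrow> null (y t + z) \<subseteq> null (y t)" using null_near by blast
    have N1: "subspace (L1 \<inter> null (y t))" by (rule subspace_inter[OF L1 subspace_null])
    obtain \<delta> where \<delta>: "\<delta> > 0" "\<forall>v\<in>L1. nrm v < \<delta> \<longrightarrow>
        (\<exists>u\<in>L0. \<exists>z\<in>L1 \<inter> null (y t). nrm z < \<epsilon> \<and> expo (bracket u) 1 (y t + z) = y t + v)"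
      using local_conjugation[OF L0 L1 N1 yL L01 Int_lower1 split[OF yL] \<epsilon>(1)] by blast
    let ?r = "\<delta> / (nrm (b - a) + 1)"
    have r: "?r > 0" using \<delta>(1) by (simp add: add_nonneg_pos)
    show "\<exists>T. openin (top_of_set G) T \<and> t \<in> T \<and> (\<forall>x\<in>T. R t x)"
    proof (intro exI conjI ballI)
      show "openin (top_of_set G) (G \<inter> ball t ?r)" by (simp add: openin_open_Int)
      show "t \<in> G \<inter> ball t ?r" using t r by simp
      fix s assume s: "s \<in> G \<inter> ball t ?r"
      let ?v = "sc (s - t) (b - a)"
      have ys: "y s = y t + ?v" by (simp add: y_def scale_left_diff_distrib)
      have vL: "?v \<in> L1" by (rule subspace_scale[OF L1 dL])
      have "cmod (s - t) * nrm (b - a) \<le> cmod (s - t) * (nrm (b - a) + 1)" by (intro mult_left_mono) auto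
      also have "\<dots> < \<delta>" using s by (simp add: pos_less_divide_eq add_nonneg_pos dist_norm norm_minus_commute)
      finally have "nrm ?v < \<delta>" by (simp add: nrm_scale)
      then obtain u z where uz: "u \<in> L0" "z \<in> L1 \<inter> null (y t)" "nrm z < \<epsilon>" "expo (bracket u) 1 (y t + z) = y t + ?v"
        using \<delta>(2) vL by blast
      let ?h = "expo (bracket u) 1"
      have hH: "?h \<in> H" by (rule H(5)[OF uz(1)])
      have e: "?N (y s) = ?h ` ?N (y t + z)" unfolding img[OF hH] uz(4) ys by (rule refl)
      have "inj_on ?h (span (?N (y t + z)))"
        using automorphismD(2)[OF H(1)[OF hH]] by (meson bij_is_inj inj_on_subset subset_UNIV)
      then have "dim (?N (y s)) = dim (?N (y t + z))"
        unfolding e by (rule endo.dim_image_eq[OF automorphismD(1)[OF H(1)[OF hH]]])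
      then have "dim (?N (y t)) \<le> dim (?N (y t + z))" using regG[of s] regG[OF t] s by simp
      moreover have "?N (y t + z) \<subseteq> ?N (y t)" using \<epsilon>(2) uz by blast
      ultimately have "?N (y t + z) = ?N (y t)" by (intro subspace_dim_equal[OF sN sN])
      then show "R t s" unfolding R_def using hH e by auto
    qed
  qed
  then show ?thesis by (simp add: R_def y01)
qed

section \<open>Automorphisms and the adjoint group\<close>

lemma automorphism_id: "id \<in> lie_automorphisms sc bracket"
  by (auto simp: lie_automorphisms_def intro!: endoI)

lemma automorphism_comp:
  assumes h: "h \<in> lie_automorphisms sc bracket" and k: "k \<in> lie_automorphisms sc bracket"
  shows "h \<circ> k \<in> lie_automorphisms sc bracket"
proof -
  have "endo (h \<circ> k)" using endo_comp[OF automorphismD(1)[OF h] automorphismD(1)[OF k]] by (simp add: comp_def)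
  then show ?thesis using bij_comp[OF automorphismD(2)[OF k] automorphismD(2)[OF h]]
    by (simp add: lie_automorphisms_def automorphismD(3)[OF h] automorphismD(3)[OF k])
qed

lemma automorphism_inv:
  assumes h: "h \<in> lie_automorphisms sc bracket"
  shows "inv_into UNIV h \<in> lie_automorphisms sc bracket"
proof -
  have b: "bij h" by (rule automorphismD(2)[OF h])
  have "inv_into UNIV h (bracket x y) = bracket (inv_into UNIV h x) (inv_into UNIV h y)" for x y
  proof -
    have "h (bracket (inv_into UNIV h x) (inv_into UNIV h y)) = bracket x y"
      by (simp add: automorphismD(3)[OF h] surj_f_inv_f[OF bij_is_surj[OF b]])
    then show ?thesis by (rule inv_f_eq[OF bij_is_inj[OF b]])
  qed
  then show ?thesis using endo_inv[OF automorphismD(1)[OF h] b] bij_imp_bij_inv[OF b]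
    by (simp add: lie_automorphisms_def)
qed

lemma automorphism_group_space: "linear_group_space sc Basis (lie_automorphisms sc bracket)"
proof (rule linear_group_space.intro[OF fd_space_axioms], rule linear_group_space_axioms.intro)
  show "id \<in> lie_automorphisms sc bracket" by (rule automorphism_id)
  show "h \<circ> k \<in> lie_automorphisms sc bracket"
    if "h \<in> lie_automorphisms sc bracket" "k \<in> lie_automorphisms sc bracket" for h k
    by (rule automorphism_comp[OF that])
  show "endo h" "bij h" if "h \<in> lie_automorphisms sc bracket" for h
    using automorphismD[OF that] by auto
qed

abbreviation automorphism_topology :: "('a \<Rightarrow> 'a) topology" where
  "automorphism_topology \<equiv> zariski (lie_automorphisms sc bracket) (regular_functions (lie_automorphisms sc bracket))"

lemma continuous_automorphism_translate:
  assumes k: "k \<in> lie_automorphisms sc bracket"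
  shows "continuous_map automorphism_topology automorphism_topology (\<lambda>x. k \<circ> x)"
proof -
  let ?X = "lie_automorphisms sc bracket"
  interpret A: linear_group_space sc Basis ?X by (rule automorphism_group_space)
  have "continuous_map automorphism_topology
      (topology_generated_by {{x \<in> ?X. f x \<noteq> 0} |f. f \<in> regular_functions ?X}) (\<lambda>x. k \<circ> x)"
  proof (rule continuous_on_generated_topo)
    fix U assume "U \<in> {{x \<in> ?X. f x \<noteq> 0} |f. f \<in> regular_functions ?X}"
    then obtain f where f: "f \<in> regular_functions ?X" "U = {x \<in> ?X. f x \<noteq> 0}" by blast
    let ?f = "\<lambda>x\<in>?X. f (k \<circ> x)"
    have "{x \<in> ?X. ?f x \<noteq> 0} \<in> {{x \<in> ?X. f x \<noteq> 0} |f. f \<in> regular_functions ?X}"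
      using A.regular_translate[OF f(1) subset_refl k] by blast
    then have "openin automorphism_topology {x \<in> ?X. ?f x \<noteq> 0}"
      unfolding zariski_def by (rule topology_generated_by_Basis)
    moreover have "(\<lambda>x. k \<circ> x) -` U \<inter> topspace automorphism_topology = {x \<in> ?X. ?f x \<noteq> 0}"
      unfolding topspace_zariski f(2) using automorphism_comp[OF k] by auto
    ultimately show "openin automorphism_topology ((\<lambda>x. k \<circ> x) -` U \<inter> topspace automorphism_topology)"
      by (simp only:)
  next
    show "(\<lambda>x. k \<circ> x) ` topspace automorphism_topology \<subseteq> \<Union> {{x \<in> ?X. f x \<noteq> 0} |f. f \<in> regular_functions ?X}"
    proof
      fix y assume "y \<in> (\<lambda>x. k \<circ> x) ` topspace automorphism_topology"
      then have y: "y \<in> ?X" using automorphism_comp[OF k] by auto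
      have "{x \<in> ?X. (\<lambda>x\<in>?X. (1::complex)) x \<noteq> 0} \<in> {{x \<in> ?X. f x \<noteq> 0} |f. f \<in> regular_functions ?X}"
        using function_algebra.const by blast
      then show "y \<in> \<Union> {{x \<in> ?X. f x \<noteq> 0} |f. f \<in> regular_functions ?X}" by (rule UnionI) (use y in simp)
    qed
  qed
  then show ?thesis by (simp add: zariski_def)
qed

lemma adjoint_group_eq: "adjoint_group sc bracket = connected_component_of_set automorphism_topology id"
  by (simp add: adjoint_group_def regular_linear_group) (simp add: linear_group_def)

lemma adjoint_group_subset: "adjoint_group sc bracket \<subseteq> lie_automorphisms sc bracket"
  unfolding adjoint_group_eq using connected_component_of_subset_topspace[of automorphism_topology id] by simp

lemma adjoint_groupI:
  assumes "connectedin automorphism_topology S" "id \<in> S" "g \<in> S"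
  shows "g \<in> adjoint_group sc bracket"
  unfolding adjoint_group_eq using assms by (auto simp: connected_component_of_def)

lemma expo_in_adjoint_group:
  assumes D: "derivation D" shows "expo D t \<in> adjoint_group sc bracket"
proof -
  let ?X = "lie_automorphisms sc bracket"
  have A: "endo D" using D by (simp add: derivation_def)
  have aut: "expo D t \<in> ?X" for t by (rule expo_automorphism[OF D])
  have cont: "continuous_on UNIV (\<lambda>t. l (expo B t v))" if l: "functional l" and B: "endo B" for l v B
    using has_vdD[OF has_vd_expo[OF B] l] by (intro continuous_at_imp_continuous_on ballI DERIV_isCont) blast
  have "connectedin automorphism_topology (range (expo D))"
  proof (rule connectedin_zariski_curve[OF aut])
    fix f assume "f \<in> regular_functions ?X"
    then show "continuous_on UNIV (\<lambda>t. f (expo D t))"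
    proof induction
      case (generator f)
      then show ?case
      proof (cases rule: matrix_coeffs_cases)
        case (1 l v)
        then show ?thesis using aut cont[OF 1(1) A] by simp
      next
        case (2 l v)
        then show ?thesis using aut cont[OF 2(1) endo_uminus[OF A]] by (simp add: inv_expo[OF A])
      qed
    next
      case (const c)
      then show ?case using aut by simp
    next
      case (add f g)
      then show ?case using aut by (simp add: continuous_on_add)
    next
      case (mult f g)
      then show ?case using aut by (simp add: continuous_on_mult)
    qed
  qed
  moreover have "expo D 0 = id" using A by (simp add: fun_eq_iff)
  then have "id \<in> range (expo D)" by (metis rangeI)
  ultimately show ?thesis by (rule adjoint_groupI) (rule rangeI)
qed

text \<open>Translating by the inverse of k a connected set that joins \<open>id\<close> to k gives
  one that joins the inverse to \<open>id\<close>; only the continuity of translations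
  enters.\<close>

lemma adjoint_group_inv:
  assumes k: "k \<in> adjoint_group sc bracket"
  shows "inv_into UNIV k \<in> adjoint_group sc bracket"
proof -
  have kA: "k \<in> lie_automorphisms sc bracket" using k adjoint_group_subset by blast
  let ?k = "inv_into UNIV k"
  obtain S where S: "connectedin automorphism_topology S" "id \<in> S" "k \<in> S"
    using k unfolding adjoint_group_eq by (auto simp: connected_component_of_def)
  have "connectedin automorphism_topology ((\<lambda>x. ?k \<circ> x) ` S)"
    by (rule connectedin_continuous_map_image[OF continuous_automorphism_translate[OF automorphism_inv[OF kA]] S(1)])
  moreover have "?k \<circ> k = id" using automorphismD(2)[OF kA] by (simp add: bij_is_inj)
  then have "id \<in> (\<lambda>x. ?k \<circ> x) ` S" using S(3) by (metis image_eqI)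
  moreover have "?k \<in> (\<lambda>x. ?k \<circ> x) ` S" using S(2) by (metis image_eqI comp_id)
  ultimately show ?thesis by (rule adjoint_groupI)
qed

end

section \<open>The group of degree zero\<close>

locale graded_space = graded_lie_algebra_automorphism sc bracket m gr \<omega> \<theta> + semisimple_lie_space sc bracket Basis
  for sc :: "complex \<Rightarrow> 'a::ab_group_add \<Rightarrow> 'a" and bracket m gr \<omega> \<theta> Basis +
  fixes G0 :: "('a \<Rightarrow> 'a) set"
  assumes G0_connected: "connected_subgroup_with_lie_algebra sc bracket (gr 0) G0"
begin

lemma G0_closed_connected:
  "subgroup G0 (linear_group sc (adjoint_group sc bracket))"
  "closedin (zariski (adjoint_group sc bracket) (regular_functions (adjoint_group sc bracket))) G0"
  "connectedin (zariski (adjoint_group sc bracket) (regular_functions (adjoint_group sc bracket))) G0"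
proof -
  have "connected_closed_subgroup G0 (linear_group sc (adjoint_group sc bracket))"
    using G0_connected by (simp add: connected_subgroup_with_lie_algebra_def)
  moreover have "carrier (linear_group sc (adjoint_group sc bracket)) = adjoint_group sc bracket"
    by (simp add: linear_group_def)
  ultimately show "subgroup G0 (linear_group sc (adjoint_group sc bracket))"
  "closedin (zariski (adjoint_group sc bracket) (regular_functions (adjoint_group sc bracket))) G0"
  "connectedin (zariski (adjoint_group sc bracket) (regular_functions (adjoint_group sc bracket))) G0"
    by (simp_all add: connected_closed_subgroup_def regular_linear_group)
qed

lemma G0_adjoint: "G0 \<subseteq> adjoint_group sc bracket"
  using subgroup.subset[OF G0_closed_connected(1)] by (simp add: linear_group_def)

lemma G0_automorphism: "g \<in> G0 \<Longrightarrow> g \<in> lie_automorphisms sc bracket"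
  using G0_adjoint adjoint_group_subset by blast

text \<open>\<open>m_inv\<close> is a definite description over the carrier, so the inverse map has
  to be placed in the adjoint group before it can be identified with the group inverse.\<close>

lemma G0_inv:
  assumes g: "g \<in> G0" shows "inv_into UNIV g \<in> G0"
proof -
  let ?A = "linear_group sc (adjoint_group sc bracket)"
  have b: "bij g" using automorphismD(2)[OF G0_automorphism[OF g]] .
  have "m_inv ?A g = inv_into UNIV g"
    unfolding m_inv_def
  proof (rule the_equality)
    have "inv_into UNIV g \<in> adjoint_group sc bracket" using adjoint_group_inv G0_adjoint g by blast
    then show "inv_into UNIV g \<in> carrier ?A \<and> g \<otimes>\<^bsub>?A\<^esub> inv_into UNIV g = \<one>\<^bsub>?A\<^esub> \<and> inv_into UNIV g \<otimes>\<^bsub>?A\<^esub> g = \<one>\<^bsub>?A\<^esub>"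
      using b by (simp add: linear_group_def bij_is_inj bij_is_surj surj_iff[symmetric])
  next
    fix y assume "y \<in> carrier ?A \<and> g \<otimes>\<^bsub>?A\<^esub> y = \<one>\<^bsub>?A\<^esub> \<and> y \<otimes>\<^bsub>?A\<^esub> g = \<one>\<^bsub>?A\<^esub>"
    then have "g \<circ> y = id" "y \<circ> g = id" by (simp_all add: linear_group_def)
    then show "y = inv_into UNIV g" by (metis inv_unique_comp)
  qed
  then show ?thesis using subgroup.m_inv_closed[OF G0_closed_connected(1) g] by simp
qed

sublocale G: linear_group_space sc Basis G0
proof (rule linear_group_space.intro[OF fd_space_axioms], rule linear_group_space_axioms.intro)
  show "id \<in> G0" using subgroup.one_closed[OF G0_closed_connected(1)] by (simp add: linear_group_def)
  show "g \<circ> k \<in> G0" if "g \<in> G0" "k \<in> G0" for g k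
    using subgroup.m_closed[OF G0_closed_connected(1) that] by (simp add: linear_group_def)
  show "endo g" "bij g" if "g \<in> G0" for g
    using automorphismD[OF G0_automorphism[OF that]] by auto
qed

lemma G0_differential:
  assumes "D \<in> tangent_space (linear_group sc G0)"
  shows "differential sc (linear_group sc G0) (\<lambda>g. g) D \<in> bracket ` gr 0"
  using assms G0_connected unfolding connected_subgroup_with_lie_algebra_def lie_algebra_of_def by blast

text \<open>\<open>G0\<close> is closed relative to the adjoint group, so the one-parameter group
  must first be shown to lie in the adjoint group.\<close>

lemma G0_expo:
  assumes u: "u \<in> gr 0" shows "expo (bracket u) t \<in> G0"
proof -
  have "bracket u \<in> lie_algebra_of sc G0"
    using G0_connected u by (simp add: connected_subgroup_with_lie_algebra_def)
  then obtain D where D: "D \<in> tangent_space (linear_group sc G0)"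
    "bracket u = differential sc (linear_group sc G0) (\<lambda>g. g) D"
    unfolding lie_algebra_of_def by blast
  show ?thesis
  proof (rule G.expo_in_closed_group[OF D(1) endo_bracket _ G0_adjoint _ G0_closed_connected(2)])
    show "D (\<lambda>g\<in>G0. l (g v)) = l (bracket u v)" if "functional l" for l v
      unfolding D(2) by (rule G.differential_coeff[OF D(1) that])
    show "expo (bracket u) t \<in> adjoint_group sc bracket" for t
      by (rule expo_in_adjoint_group[OF derivation_bracket])
  qed
qed

lemma G0_gr:
  assumes g: "g \<in> G0" and v: "v \<in> gr i" shows "g v \<in> gr i"
proof (rule G.invariant_subspace_connected_group[OF gr_subspace _ G0_inv G0_closed_connected(3) g v])
  fix D v assume D: "D \<in> tangent_space (linear_group sc G0)" and v: "v \<in> gr i"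
  obtain u where u: "u \<in> gr 0" "differential sc (linear_group sc G0) (\<lambda>g. g) D = bracket u"
    using G0_differential[OF D] by blast
  show "differential sc (linear_group sc G0) (\<lambda>g. g) D v \<in> gr i"
    unfolding u(2) using gr_bracket[OF u(1) v] by simp
qed

end

section \<open>Semisimple parts under linear and conjugate-linear maps\<close>

context fd_space
begin

lemma diagonalizable_combination:
  assumes A: "diagonalizable A" and B: "diagonalizable B" and AB: "\<And>v. A (B v) = B (A v)"
  shows "diagonalizable (\<lambda>v. sc a (A v) + sc b (B v))"
proof -
  let ?C = "\<lambda>v. sc a (A v) + sc b (B v)"
  have e: "endo A" "endo B" using A B by (auto simp: diagonalizable_def)
  have "endo ?C"
    by (rule endoI) (simp_all add: endo_simps[OF e(1)] endo_simps[OF e(2)] scale_right_distrib mult.commute)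
  moreover have "span {v. \<forall>X\<in>{A, B}. \<exists>\<mu>. X v = sc \<mu> v} = UNIV"
    by (rule joint_eigenvectors) (use A B AB in auto)
  moreover have "{v. \<forall>X\<in>{A, B}. \<exists>\<mu>. X v = sc \<mu> v} \<subseteq> {v. \<exists>\<mu>. ?C v = sc \<mu> v}"
  proof
    fix v assume "v \<in> {v. \<forall>X\<in>{A, B}. \<exists>\<mu>. X v = sc \<mu> v}"
    then obtain \<mu> \<nu> where "A v = sc \<mu> v" "B v = sc \<nu> v" by auto
    then have "?C v = sc (a * \<mu> + b * \<nu>) v" by (simp add: scale_left_distrib)
    then show "v \<in> {v. \<exists>\<mu>. ?C v = sc \<mu> v}" by blast
  qed
  ultimately show ?thesis unfolding diagonalizable_def using span_mono by blast
qed

lemma diagonalizable_kernel: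
  assumes "diagonalizable A" shows "gen_eigenspace A 0 = {v. A v = 0}"
  using diagonalizable_gen[OF assms, of _ 0] gen_eigenspaceI[where A = A and \<mu> = 0 and k = 1] by auto

lemma kernel_semisimple_part:
  assumes A: "endo A" and v: "semisimple_part A v = 0" shows "v \<in> gen_eigenspace A 0"
proof -
  let ?S = "semisimple_part A"
  have S: "endo ?S" by (rule endo_gen_scaling[OF A])
  obtain X w where X: "finite X" "\<And>\<mu>. \<mu> \<in> X \<Longrightarrow> w \<mu> \<in> gen_eigenspace A \<mu>" "v = (\<Sum>\<mu>\<in>X. w \<mu>)"
    by (rule gen_decomposition[OF A, of v]) blast
  have "(\<Sum>\<mu>\<in>X. ?S (w \<mu>)) = 0" using v unfolding X(3) endo.linear_sum[OF S] .
  moreover have "?S (w \<mu>) \<in> gen_eigenspace A \<mu>" if "\<mu> \<in> X" for \<mu>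
    using X(2)[OF that] by (simp add: gen_scaling_eq[OF A] subspace_scale[OF subspace_gen_eigenspace[OF A]])
  ultimately have "?S (w \<mu>) = 0" if "\<mu> \<in> X" for \<mu>
    using gen_eigenspace_component[OF A X(1), of "\<lambda>\<mu>. ?S (w \<mu>)" \<mu>] that by blast
  then have w: "w \<mu> = 0" if "\<mu> \<in> X" "\<mu> \<noteq> 0" for \<mu>
    using gen_scaling_eq[OF A X(2)[OF that(1)], of "\<lambda>\<mu>. \<mu>"] that by simp
  have "w \<mu> \<in> gen_eigenspace A 0" if "\<mu> \<in> X" for \<mu>
    using X(2)[OF that] w[OF that] subspace_0[OF subspace_gen_eigenspace[OF A]] by (cases "\<mu> = 0") auto
  then show ?thesis unfolding X(3) by (rule subspace_sum[OF subspace_gen_eigenspace[OF A]])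
qed

text \<open>\<tau> maps eigenvectors to eigenvectors. Semilinearity with respect to \<phi> lets the
  lemma serve both the real structure, with \<phi> = \<open>cnj\<close>, and automorphisms, with
  \<phi> the identity.\<close>

lemma diagonalizable_conjugate:
  assumes A: "diagonalizable A" and \<tau>: "\<And>x y. \<tau> (x + y) = \<tau> x + \<tau> y" "\<And>r x. \<tau> (sc r x) = sc (\<phi> r) (\<tau> x)" "surj \<tau>"
    and B: "endo B" "\<And>v. B (\<tau> v) = \<tau> (A v)"
  shows "diagonalizable B"
proof -
  let ?E = "{v. \<exists>\<mu>. B v = sc \<mu> v}"
  have t0: "\<tau> 0 = 0" using \<tau>(1)[of 0 0] by simp
  have e: "\<tau> v \<in> ?E" if "A v = sc \<mu> v" for v \<mu> using that by (auto simp: B(2) \<tau>(2))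
  have "\<tau> v \<in> span ?E" if "v \<in> span {v. \<exists>\<mu>. A v = sc \<mu> v}" for v
    using that
  proof (induction rule: span_induct_alt)
    case (step r x y)
    then have "\<tau> x \<in> span ?E" using e by (blast intro: span_base)
    then show ?case unfolding \<tau>(1,2) by (intro span_add span_scale step.IH)
  qed (simp add: t0 span_zero)
  then have "\<tau> v \<in> span ?E" for v using A by (simp add: diagonalizable_def)
  then have "range \<tau> \<subseteq> span ?E" by blast
  then have "span ?E = UNIV" unfolding \<tau>(3) by (rule top_le)
  then show ?thesis using B(1) by (simp add: diagonalizable_def)
qed

text \<open>\<tau> carries the generalized eigenspace of A for \<mu> into that of B for \<phi>
  \<mu>, where both sides multiply by \<phi> \<mu>.\<close>

lemma semisimple_part_conjugate:
  assumes A: "endo A" and B: "endo B"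
    and \<tau>: "\<And>x y. \<tau> (x + y) = \<tau> x + \<tau> y" "\<And>r x. \<tau> (sc r x) = sc (\<phi> r) (\<tau> x)"
    and BA: "\<And>v. B (\<tau> v) = \<tau> (A v)"
  shows "semisimple_part B (\<tau> v) = \<tau> (semisimple_part A v)"
proof -
  let ?S = "semisimple_part A" and ?R = "semisimple_part B"
  have S: "endo ?S" and R: "endo ?R" by (rule endo_gen_scaling[OF A], rule endo_gen_scaling[OF B])
  have t0: "\<tau> 0 = 0" using \<tau>(1)[of 0 0] by simp
  have tm: "\<tau> (x - y) = \<tau> x - \<tau> y" for x y using \<tau>(1)[of "x - y" y] by simp
  obtain X w where X: "finite X" "\<And>\<mu>. \<mu> \<in> X \<Longrightarrow> w \<mu> \<in> gen_eigenspace A \<mu>" "v = (\<Sum>\<mu>\<in>X. w \<mu>)"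
    by (rule gen_decomposition[OF A, of v]) blast
  have ts: "\<tau> (sum f Y) = (\<Sum>y\<in>Y. \<tau> (f y))" for f :: "complex \<Rightarrow> 'a" and Y
    by (induction Y rule: infinite_finite_induct) (simp_all add: t0 \<tau>(1))
  have g: "\<tau> x \<in> gen_eigenspace B (\<phi> \<mu>)" if x: "x \<in> gen_eigenspace A \<mu>" for x \<mu>
  proof -
    obtain k where k: "(shift A \<mu> ^^ k) x = 0" using x by (auto simp: gen_eigenspace_def)
    have "(shift B (\<phi> \<mu>) ^^ k) (\<tau> x) = \<tau> ((shift A \<mu> ^^ k) x)"
      by (induction k) (simp_all add: shift_def BA tm \<tau>(2))
    then show ?thesis using k by (auto simp: t0 gen_eigenspace_def)
  qed
  have "?R (\<tau> (w \<mu>)) = \<tau> (?S (w \<mu>))" if "\<mu> \<in> X" for \<mu>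
    by (simp add: gen_scaling_eq[OF B g[OF X(2)[OF that]]] gen_scaling_eq[OF A X(2)[OF that]] \<tau>(2))
  then show ?thesis unfolding X(3) endo.linear_sum[OF S] ts endo.linear_sum[OF R] by (rule sum.cong[OF refl])
qed

end

section \<open>The Jordan decomposition in degree one\<close>

lemma (in graded_space) theta_bracket: "\<theta> (bracket x y) = bracket (\<theta> x) (\<theta> y)"
proof -
  note th = endo_simps[OF theta_linear]
  obtain c d where c: "c \<in> (\<Pi>\<^sub>E i\<in>{..<m}. gr i)" "x = (\<Sum>i<m. c i)" and d: "d \<in> (\<Pi>\<^sub>E i\<in>{..<m}. gr i)" "y = (\<Sum>i<m. d i)"
    using gr_direct_sum[of x] gr_direct_sum[of y] by blast
  have "\<theta> (bracket (c i) (d j)) = bracket (\<theta> (c i)) (\<theta> (d j))" if "i < m" "j < m" for i j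
  proof -
    have g: "c i \<in> gr i" "d j \<in> gr j" using c(1) d(1) that by auto
    show ?thesis using theta_gr[OF gr_bracket[OF g]] theta_gr[OF g(1)] theta_gr[OF g(2)]
      by (simp add: bracket_simps power_add)
  qed
  then show ?thesis unfolding c(2) d(2) bracket_sum_left bracket_sum_right th(6)
    by (intro sum.cong refl) auto
qed

lemma (in graded_space) theta_eigenvector: assumes "\<theta> x = sc \<omega> x" shows "x \<in> gr 1"
proof -
  note th = endo_simps[OF theta_linear]
  obtain c where c: "c \<in> (\<Pi>\<^sub>E i\<in>{..<m}. gr i)" "x = (\<Sum>i<m. c i)" using gr_direct_sum[of x] by blast
  have cg: "c i \<in> gr i" if "i < m" for i using c(1) that by auto
  let ?d = "\<lambda>i\<in>{..<m}. sc (\<omega> ^ i) (c i)" and ?e = "\<lambda>i\<in>{..<m}. sc \<omega> (c i)"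
  have "?d \<in> (\<Pi>\<^sub>E i\<in>{..<m}. gr i)" "?e \<in> (\<Pi>\<^sub>E i\<in>{..<m}. gr i)"
    using cg by (auto simp: subspace_scale[OF gr_subspace])
  moreover have "\<theta> x = (\<Sum>i<m. ?d i)" unfolding c(2) th(6) by (rule sum.cong) (use cg theta_gr in auto)
  moreover have "\<theta> x = (\<Sum>i<m. ?e i)" unfolding assms unfolding c(2) scale_sum_right by (rule sum.cong) auto
  ultimately have "?d = ?e" using gr_direct_sum[of "\<theta> x"] by blast
  have eq: "sc (\<omega> ^ i) (c i) = sc \<omega> (c i)" if "i < m" for i using fun_cong[OF \<open>?d = ?e\<close>, of i] that by simp
  have "c i \<in> gr 1" if i: "i < m" for i
  proof (cases "\<omega> ^ i = \<omega>")
    case True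
    have w0: "\<omega> \<noteq> 0" using primitive_root[of m] m_pos by (auto simp: power_0_left)
    \<comment> \<open>The index 0 occurs only if \<omega> = 1, that is m = 1, where the components
      of degree 0 and 1 coincide.\<close>
    have "i mod m = 1 mod m"
    proof (cases i)
      case 0
      then show ?thesis using True primitive_root[of 1] by simp
    next
      case (Suc k)
      then have "\<omega> ^ k = 1" using True w0 by simp
      then have "m dvd k" using primitive_root by blast
      then show ?thesis using Suc i by (metis dvd_imp_mod_0 mod_Suc_eq One_nat_def)
    qed
    then show ?thesis using cg[OF i] gr_mod[of i] gr_mod[of 1] by simp
  next
    case False
    then have "c i = 0" using eq[OF i] by simp
    then show ?thesis by (simp add: subspace_0[OF gr_subspace])
  qed
  then show ?thesis unfolding c(2) by (intro subspace_sum[OF gr_subspace]) auto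
qed

text \<open>The semisimple part is inner, say ad s. As \<theta> x = \<omega> x, comparing its action
  before and after \<theta> yields \<theta> s = \<omega> s, and the \<omega>-eigenvectors of
  \<theta> have degree one.\<close>

lemma (in graded_space) jordan_graded:
  assumes x: "x \<in> gr 1"
  obtains s where "s \<in> gr 1" "bracket s = semisimple_part (bracket x)"
proof -
  note th = endo_simps[OF theta_linear]
  obtain s where s: "bracket s = semisimple_part (bracket x)" by (rule jordan_semisimple)
  have w0: "\<omega> \<noteq> 0" using primitive_root[of m] m_pos by (auto simp: power_0_left)
  have key: "\<theta> (bracket s v) = bracket (sc \<omega> s) (\<theta> v)" for v
  proof -
    have thx: "\<theta> x = sc \<omega> x" using theta_gr[OF x] by simp
    \<comment> \<open>Moving \<theta> past ad x costs a factor \<omega>, so eigenvalues are divided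
      by \<omega>; the induction keeps the powers of \<omega> on one side.\<close>
    have g: "\<theta> u \<in> gen_eigenspace (bracket x) (\<mu> / \<omega>)" if u: "u \<in> gen_eigenspace (bracket x) \<mu>" for u \<mu>
    proof -
      obtain k where k: "(shift (bracket x) \<mu> ^^ k) u = 0" using u by (auto simp: gen_eigenspace_def)
      have "sc (\<omega> ^ k) ((shift (bracket x) (\<mu> / \<omega>) ^^ k) (\<theta> u)) = \<theta> ((shift (bracket x) \<mu> ^^ k) u)" for k
      proof (induction k)
        case (Suc k)
        define w where "w = (shift (bracket x) (\<mu> / \<omega>) ^^ k) (\<theta> u)"
        have S: "sc (\<omega> ^ k) w = \<theta> ((shift (bracket x) \<mu> ^^ k) u)" using Suc by (simp only: w_def)
        have "\<theta> ((shift (bracket x) \<mu> ^^ Suc k) u) = sc \<omega> (bracket x (sc (\<omega> ^ k) w)) - sc \<mu> (sc (\<omega> ^ k) w)"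
          by (simp add: shift_def th theta_bracket thx bracket_simps S)
        moreover have "sc (\<omega> ^ Suc k) (shift (bracket x) (\<mu> / \<omega>) w) = sc \<omega> (bracket x (sc (\<omega> ^ k) w)) - sc \<mu> (sc (\<omega> ^ k) w)"
          using w0 by (simp add: shift_def bracket_simps scale_right_diff_distrib mult.commute)
        ultimately show ?case by (simp only: funpow.simps(2) comp_apply w_def)
      qed simp
      from this[of k] have "(shift (bracket x) (\<mu> / \<omega>) ^^ k) (\<theta> u) = 0" using w0 by (simp add: k th)
      then show ?thesis by (auto simp: gen_eigenspace_def)
    qed
    have "(\<lambda>v. \<theta> (bracket s v)) = (\<lambda>v. bracket (sc \<omega> s) (\<theta> v))"
    proof (rule endo_eq_on_gen[OF endo_bracket[of x]])
      show "endo (\<lambda>v. \<theta> (bracket s v))" by (rule endo_comp[OF theta_linear endo_bracket])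
      show "endo (\<lambda>v. bracket (sc \<omega> s) (\<theta> v))" by (rule endo_comp[OF endo_bracket theta_linear])
      show "\<theta> (bracket s v) = bracket (sc \<omega> s) (\<theta> v)" if v: "v \<in> gen_eigenspace (bracket x) \<mu>" for \<mu> v
        using w0 by (simp add: bracket_simps s gen_scaling_eq[OF endo_bracket v] gen_scaling_eq[OF endo_bracket g[OF v]] th)
    qed
    then show ?thesis by (rule fun_cong)
  qed
  have "surj \<theta>"
  proof -
    obtain k where k: "m = Suc k" using m_pos gr0_implies_Suc by blast
    have "(\<theta> ^^ m) = id" using theta_order[of m] by (simp only: dvd_refl)
    then have "\<theta> ((\<theta> ^^ k) v) = v" for v by (simp add: k fun_eq_iff)
    then show ?thesis by (rule surjI)
  qed
  have "\<theta> s = sc \<omega> s"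
  proof (rule bracket_eqI)
    fix z
    obtain v where "z = \<theta> v" using \<open>surj \<theta>\<close> by (metis surjD)
    then show "bracket (\<theta> s) z = bracket (sc \<omega> s) z" using key[of v] by (simp add: theta_bracket)
  qed
  then show ?thesis using that[OF theta_eigenvector s] by blast
qed

section \<open>Cartan subspaces\<close>

locale real_graded_space = graded_space +
  fixes \<sigma> :: "'a \<Rightarrow> 'a" and h :: "'a set"
  assumes sigma_conjugation: "conjugation sc bracket \<sigma>" and sigma_gr: "\<sigma> ` gr i \<subseteq> gr i"
    and cartan: "real_cartan_subspace sc bracket (real_points \<sigma> (gr 1)) h"
begin

lemma sigma_add: "\<sigma> (x + y) = \<sigma> x + \<sigma> y" and sigma_scale: "\<sigma> (sc c x) = sc (cnj c) (\<sigma> x)"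
  and sigma_sigma: "\<sigma> (\<sigma> x) = x" and sigma_bracket: "\<sigma> (bracket x y) = bracket (\<sigma> x) (\<sigma> y)"
  using sigma_conjugation by (simp_all add: conjugation_def)

lemma sigma_0: "\<sigma> 0 = 0"
  using sigma_add[of 0 0] by simp

lemma sigma_diff: "\<sigma> (x - y) = \<sigma> x - \<sigma> y"
  using sigma_add[of "x - y" y] by simp

lemma sigma_surj: "surj \<sigma>"
  by (rule surjI[of \<sigma> \<sigma>]) (rule sigma_sigma)

lemma sigma_in_gr: "x \<in> gr i \<Longrightarrow> \<sigma> x \<in> gr i"
  using sigma_gr by blast

lemma h_real_cartan:
  "real_subspace sc h" "h \<subseteq> real_points \<sigma> (gr 1)" "commuting_semisimple sc bracket h"
  "\<And>h'. real_subspace sc h' \<Longrightarrow> h' \<subseteq> real_points \<sigma> (gr 1) \<Longrightarrow> commuting_semisimple sc bracket h' \<Longrightarrow> h \<subseteq> h' \<Longrightarrow> h' = h"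
  using cartan unfolding real_cartan_subspace_def by blast+

lemma h_elem:
  assumes "x \<in> h" shows "x \<in> gr 1" "\<sigma> x = x" "diagonalizable (bracket x)" "y \<in> h \<Longrightarrow> bracket x y = 0"
proof -
  show "x \<in> gr 1" "\<sigma> x = x" using assms h_real_cartan(2) unfolding real_points_def by blast+
  show "diagonalizable (bracket x)"
    using assms h_real_cartan(3) unfolding commuting_semisimple_def semisimple_endomorphism_iff by blast
  show "y \<in> h \<Longrightarrow> bracket x y = 0" using assms h_real_cartan(3) unfolding commuting_semisimple_def by blast
qed

lemma bracket_commute: "bracket x y = 0 \<Longrightarrow> bracket x (bracket y v) = bracket y (bracket x v)"
  using jacobi_derivation[of x y v] by (simp add: bracket_simps)

lemma diagonalizable_bracket_combination:
  assumes "diagonalizable (bracket x)" "diagonalizable (bracket y)" "bracket x y = 0"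
  shows "diagonalizable (bracket (sc a x + sc b y))"
proof -
  have "bracket (sc a x + sc b y) = (\<lambda>v. sc a (bracket x v) + sc b (bracket y v))"
    by (simp add: fun_eq_iff bracket_simps)
  then show ?thesis using diagonalizable_combination[OF assms(1,2) bracket_commute[OF assms(3)], of a b] by (simp only:)
qed

lemma h_subspace:
  "0 \<in> h" "x \<in> h \<Longrightarrow> y \<in> h \<Longrightarrow> x + y \<in> h" "x \<in> h \<Longrightarrow> sc (complex_of_real r) x \<in> h"
proof -
  interpret R: vector_space "\<lambda>r. sc (complex_of_real r)"
    by unfold_locales (simp_all add: scale_right_distrib scale_left_distrib)
  have "R.subspace h" using h_real_cartan(1) by (simp add: real_subspace_def)
  then show "0 \<in> h" "x \<in> h \<Longrightarrow> y \<in> h \<Longrightarrow> x + y \<in> h" "x \<in> h \<Longrightarrow> sc (complex_of_real r) x \<in> h"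
    by (auto simp: R.subspace_def)
qed

text \<open>h together with the real multiples of y is again a real subspace of commuting semisimple
  elements.\<close>

lemma h_maximal:
  assumes y: "y \<in> gr 1" "\<sigma> y = y" "diagonalizable (bracket y)" "\<And>x. x \<in> h \<Longrightarrow> bracket x y = 0"
  shows "y \<in> h"
proof -
  define h' where "h' = {x + sc (complex_of_real r) y | x r. x \<in> h}"
  have mem: "x + sc (complex_of_real r) y \<in> h'" if "x \<in> h" for x r unfolding h'_def using that by blast
  interpret R: vector_space "\<lambda>r. sc (complex_of_real r)"
    by unfold_locales (simp_all add: scale_right_distrib scale_left_distrib)
  have "R.subspace h'"
  proof (rule R.subspaceI)
    show "0 \<in> h'" using mem[OF h_subspace(1), of 0] by simp
  next
    fix u v assume "u \<in> h'" "v \<in> h'"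
    then obtain x r x' r' where u: "u = x + sc (complex_of_real r) y" "x \<in> h" and v: "v = x' + sc (complex_of_real r') y" "x' \<in> h"
      unfolding h'_def by blast
    have "u + v = (x + x') + sc (complex_of_real (r + r')) y" by (simp add: u v scale_left_distrib)
    then show "u + v \<in> h'" using mem[OF h_subspace(2)[OF u(2) v(2)], of "r + r'"] by simp
  next
    fix c u assume "u \<in> h'"
    then obtain x r where u: "u = x + sc (complex_of_real r) y" "x \<in> h" unfolding h'_def by blast
    have "sc (complex_of_real c) u = sc (complex_of_real c) x + sc (complex_of_real (c * r)) y"
      by (simp add: u scale_right_distrib)
    then show "sc (complex_of_real c) u \<in> h'" using mem[OF h_subspace(3)[OF u(2)], of c "c * r"] by (simp only:)
  qed
  moreover have "h' \<subseteq> real_points \<sigma> (gr 1)"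
    unfolding h'_def real_points_def using h_elem(1,2) y(1,2)
    by (auto simp: sigma_add sigma_scale intro!: subspace_add[OF gr_subspace] subspace_scale[OF gr_subspace])
  moreover have "commuting_semisimple sc bracket h'"
    unfolding commuting_semisimple_def semisimple_endomorphism_iff
  proof (intro conjI ballI)
    fix u assume "u \<in> h'"
    then obtain x r where u: "u = x + sc (complex_of_real r) y" "x \<in> h" unfolding h'_def by blast
    show "diagonalizable (bracket u)"
      using diagonalizable_bracket_combination[OF h_elem(3)[OF u(2)] y(3) y(4)[OF u(2)], of 1 "complex_of_real r"] by (simp add: u(1))
    fix v assume "v \<in> h'"
    then obtain x' r' where v: "v = x' + sc (complex_of_real r') y" "x' \<in> h" unfolding h'_def by blast
    have "bracket y x' = 0" using y(4)[OF v(2)] bracket_swap[of y x'] by simp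
    then show "bracket u v = 0" using y(4)[OF u(2)] h_elem(4)[OF u(2) v(2)] by (simp add: u(1) v(1) bracket_simps bracket_self)
  qed
  moreover have "h \<subseteq> h'" using mem[of _ 0] by auto
  ultimately have "h' = h" by (intro h_real_cartan(4)) (simp_all add: real_subspace_def)
  then show ?thesis using mem[OF h_subspace(1), of 1] by simp
qed

abbreviation hC :: "'a set" where "hC \<equiv> span h"

lemma hC_gr: "x \<in> hC \<Longrightarrow> x \<in> gr 1"
  using span_minimal[OF _ gr_subspace, of h 1] h_elem(1) by blast

lemma hC_commute:
  assumes "x \<in> hC" "y \<in> hC" shows "bracket x y = 0"
proof -
  have "hC \<subseteq> {y. bracket x y = 0}" if "x \<in> h" for x
    by (rule span_minimal[OF _ subspace_centralizer]) (use h_elem(4)[OF that] in blast)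
  then have "bracket y x = 0" if "x \<in> h" for x using that assms(2) bracket_swap[of y x] by auto
  then have "hC \<subseteq> {x. bracket y x = 0}" by (intro span_minimal[OF _ subspace_centralizer]) blast
  then show ?thesis using assms(1) bracket_swap[of x y] by auto
qed

lemma hC_diagonalizable:
  assumes "x \<in> hC" shows "diagonalizable (bracket x)"
proof -
  have "x \<in> hC \<and> diagonalizable (bracket x)"
    using assms
  proof (induction rule: span_induct_alt)
    case base
    have "{v. \<exists>\<mu>. bracket 0 v = sc \<mu> v} = UNIV" by (auto simp: bracket_simps intro: exI[of _ 0])
    then show ?case unfolding diagonalizable_def using endo_bracket[of 0] span_zero by simp
  next
    case (step c x y)
    have x: "x \<in> hC" using step.hyps by (rule span_base)
    have "diagonalizable (bracket (sc c x + sc 1 y))"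
      by (rule diagonalizable_bracket_combination[OF h_elem(3)[OF step.hyps(1)] conjunct2[OF step.IH] hC_commute[OF x conjunct1[OF step.IH]]])
    then show ?case using x step.IH by (simp add: span_add span_scale)
  qed
  then show ?thesis by blast
qed

lemma hC_sigma:
  assumes "x \<in> hC" shows "\<sigma> x \<in> hC"
  using assms
proof (induction rule: span_induct_alt)
  case base
  then show ?case by (simp add: sigma_0 span_zero)
next
  case (step c x y)
  then show ?case using span_base[of x h] h_elem(2)[of x] by (simp add: sigma_add sigma_scale span_add span_scale)
qed

definition hcent :: "'a set" where "hcent = {v. \<forall>x\<in>hC. bracket x v = 0}"

lemma hcentD: "v \<in> hcent \<Longrightarrow> x \<in> hC \<Longrightarrow> bracket x v = 0" "v \<in> hcent \<Longrightarrow> x \<in> hC \<Longrightarrow> bracket v x = 0"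
  unfolding hcent_def using bracket_swap[of v x] by auto

lemma subspace_hcent: "subspace hcent"
  unfolding hcent_def by (rule subspaceI) (simp_all add: bracket_simps)

lemma hC_hcent: "hC \<subseteq> hcent"
  unfolding hcent_def using hC_commute by blast

lemma hcent_sigma:
  assumes "x \<in> hcent" shows "\<sigma> x \<in> hcent"
  unfolding hcent_def
proof (intro CollectI ballI)
  fix y assume "y \<in> hC"
  then have "bracket (\<sigma> y) x = 0" using hcentD(1)[OF assms hC_sigma] by simp
  then have "\<sigma> (bracket (\<sigma> y) x) = 0" by (simp add: sigma_0)
  then show "bracket y (\<sigma> x) = 0" by (simp add: sigma_bracket sigma_sigma)
qed

lemma real_decomposition:
  obtains a b c d c' d' where "x = a + sc \<i> b" "a = sc c x + sc d (\<sigma> x)" "b = sc c' x + sc d' (\<sigma> x)"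
    "\<sigma> a = a" "\<sigma> b = b"
proof -
  \<comment> \<open>Here d = -\<i>/2, so that b is (x - \<sigma> x) / (2 \<i>); only these two
    properties of d are used.\<close>
  obtain d where d: "\<i> * d = 1/2" "cnj d = - d"
  proof
    show "\<i> * (- \<i> / 2) = 1/2" "cnj (- \<i> / 2) = - (- \<i> / 2)" by simp_all
  qed
  let ?a = "sc (1/2) x + sc (1/2) (\<sigma> x)" and ?b = "sc d x + sc (- d) (\<sigma> x)"
  have "?a + sc \<i> ?b = (sc (1/2) x + sc (1/2) x) + (sc (1/2) (\<sigma> x) - sc (1/2) (\<sigma> x))"
    by (simp add: scale_right_diff_distrib d(1))
  also have "sc (1/2) x + sc (1/2) x = sc (1/2 + 1/2) x" by (simp only: scale_left_distrib)
  finally have "x = ?a + sc \<i> ?b" by simp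
  moreover have "\<sigma> ?a = ?a" "\<sigma> ?b = ?b" by (simp_all add: sigma_add sigma_diff sigma_scale sigma_sigma d(2) add.commute)
  ultimately show ?thesis using that[of ?a ?b "1/2" "1/2" d "- d"] by blast
qed

text \<open>The semisimple part of ad x is ad s with s real of degree one and commuting with h, so s
  lies in h by maximality. Elements of \<open>hcent\<close> commute with s, which leaves only the
  nilpotent part of ad x on them.\<close>

lemma hcent_nilpotent_real:
  assumes x: "x \<in> gr 1" "\<sigma> x = x" "x \<in> hcent" shows "hcent \<subseteq> null x"
proof -
  obtain s where s: "s \<in> gr 1" "bracket s = semisimple_part (bracket x)" by (rule jordan_graded[OF x(1)])
  have "bracket x (\<sigma> v) = \<sigma> (bracket x v)" for v by (simp add: sigma_bracket x(2))
  then have S: "bracket s (\<sigma> v) = \<sigma> (bracket s v)" for v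
    unfolding s(2) by (rule semisimple_part_conjugate[OF endo_bracket endo_bracket sigma_add sigma_scale])
  have "\<sigma> s = s"
  proof (rule bracket_eqI)
    fix z
    show "bracket (\<sigma> s) z = bracket s z" using S[of "\<sigma> z"] by (simp add: sigma_bracket sigma_sigma)
  qed
  moreover have "diagonalizable (bracket s)" unfolding s(2) by (rule gen_scaling_diagonalizable[OF endo_bracket])
  moreover have "bracket y s = 0" if "y \<in> h" for y
  proof -
    have "bracket x y = 0" using hcentD(2)[OF x(3) span_base[OF that]] .
    then have "y \<in> null x" by (intro gen_eigenspaceI[where k = 1]) simp
    then have "bracket s y = 0" unfolding s(2) by (simp add: gen_scaling_eq[OF endo_bracket])
    then show ?thesis using bracket_swap[of y s] by simp
  qed
  ultimately have "s \<in> h" using h_maximal s(1) by blast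
  then have "semisimple_part (bracket x) v = 0" if "v \<in> hcent" for v
    using hcentD(1)[OF that span_base] unfolding s(2)[symmetric] by blast
  then show ?thesis using kernel_semisimple_part[OF endo_bracket] by blast
qed

text \<open>Nilpotency on the centralizer is a closed condition, so it passes from the real points to their complex span.\<close>

lemma hcent_nilpotent:
  assumes x: "x \<in> gr 1" "x \<in> hcent" shows "hcent \<subseteq> null x"
proof -
  obtain a b c d c' d' where ab: "x = a + sc \<i> b" "a = sc c x + sc d (\<sigma> x)" "b = sc c' x + sc d' (\<sigma> x)"
    "\<sigma> a = a" "\<sigma> b = b" by (rule real_decomposition)
  have mem: "a \<in> gr 1" "b \<in> gr 1" "a \<in> hcent" "b \<in> hcent"
    unfolding ab(2,3) using x sigma_in_gr[OF x(1)] hcent_sigma[OF x(2)]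
    by (auto intro!: subspace_add[OF gr_subspace] subspace_scale[OF gr_subspace] subspace_add[OF subspace_hcent] subspace_scale[OF subspace_hcent])
  \<comment> \<open>The line a + t b passes through x at t = \<i>. Its real points are infinitely
    many, so one of them avoids the finite exceptional set of \<open>dim_null_cofinite\<close> at
    \<i>.\<close>
  have real: "hcent \<subseteq> null (a + sc (complex_of_real t) b)" for t
    by (rule hcent_nilpotent_real)
      (auto simp: mem ab(4,5) sigma_add sigma_scale simp del: One_nat_def intro!: subspace_add[OF gr_subspace] subspace_scale[OF gr_subspace] subspace_add[OF subspace_hcent] subspace_scale[OF subspace_hcent])
  have "finite {t. dim (hcent \<inter> null (a + sc t b)) > dim (hcent \<inter> null (a + sc \<i> b))}"
    by (rule dim_null_cofinite[OF subspace_hcent])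
  moreover have "infinite (range complex_of_real)"
    using infinite_UNIV_char_0 finite_imageD[of complex_of_real UNIV] inj_of_real by (auto simp: inj_def)
  ultimately have "\<not> range complex_of_real \<subseteq> {t. dim (hcent \<inter> null (a + sc t b)) > dim (hcent \<inter> null (a + sc \<i> b))}"
    using finite_subset by blast
  then obtain t where "\<not> dim (hcent \<inter> null (a + sc (complex_of_real t) b)) > dim (hcent \<inter> null (a + sc \<i> b))"
    by blast
  then have "dim hcent \<le> dim (hcent \<inter> null x)" using real[of t] by (simp only: Int_absorb2 ab(1)[symmetric] not_less)
  then have "hcent \<inter> null x = hcent"
    by (intro subspace_dim_equal[OF subspace_inter[OF subspace_hcent subspace_null] subspace_hcent]) auto
  then show ?thesis by blast
qed

text \<open>By nilpotency on \<open>hcent\<close> and semisimplicity of ad x, the element x commutes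
  with its conjugate. Hence its real and imaginary parts are semisimple, and each lies in h by
  maximality.\<close>

lemma hcent_semisimple:
  assumes x: "x \<in> gr 1" "x \<in> hcent" "diagonalizable (bracket x)" shows "x \<in> hC"
proof -
  obtain a b c d c' d' where ab: "x = a + sc \<i> b" "a = sc c x + sc d (\<sigma> x)" "b = sc c' x + sc d' (\<sigma> x)"
    "\<sigma> a = a" "\<sigma> b = b" by (rule real_decomposition)
  have mem: "a \<in> gr 1" "b \<in> gr 1" "a \<in> hcent" "b \<in> hcent"
    unfolding ab(2,3) using x sigma_in_gr[OF x(1)] hcent_sigma[OF x(2)]
    by (auto intro!: subspace_add[OF gr_subspace] subspace_scale[OF gr_subspace] subspace_add[OF subspace_hcent] subspace_scale[OF subspace_hcent])
  have "\<sigma> x \<in> null x" using hcent_nilpotent[OF x(1,2)] hcent_sigma[OF x(2)] by blast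
  then have 0: "bracket x (\<sigma> x) = 0" unfolding diagonalizable_kernel[OF x(3)] by simp
  have d: "diagonalizable (bracket (\<sigma> x))"
    by (rule diagonalizable_conjugate[where A = "bracket x" and \<tau> = \<sigma> and \<phi> = cnj])
      (simp_all add: x(3) sigma_add sigma_scale sigma_surj endo_bracket sigma_bracket)
  have "diagonalizable (bracket a)" "diagonalizable (bracket b)"
    unfolding ab(2,3) by (rule diagonalizable_bracket_combination[OF x(3) d 0])+
  then have "a \<in> h" "b \<in> h" using h_maximal mem ab(4,5) hcentD(1) span_base by auto
  then show ?thesis unfolding ab(1) by (intro span_add span_scale span_base)
qed

text \<open>Take a with null space of least dimension in \<open>hC\<close>. For small t > 0 the null
  space of a + t y lies in that of a and equals it by minimality, so a and a + t y, and with them y,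
  kill this space.\<close>

lemma generic_element:
  obtains a where "a \<in> hC" "null a = hcent"
proof -
  obtain a where a: "a \<in> hC" "\<And>y. y \<in> hC \<Longrightarrow> dim (null a) \<le> dim (null y)"
    using ex_has_least_nat[of "\<lambda>x. x \<in> hC" 0 "\<lambda>x. dim (null x)"] span_zero by blast
  have k: "null x = {v. bracket x v = 0}" if "x \<in> hC" for x by (rule diagonalizable_kernel[OF hC_diagonalizable[OF that]])
  have "bracket y v = 0" if v: "v \<in> null a" and y: "y \<in> hC" for v y
  proof -
    obtain \<epsilon> where \<epsilon>: "\<epsilon> > 0" "\<forall>z\<in>null a. nrm z < \<epsilon> \<longrightarrow> null (a + z) \<subseteq> null a" using null_near by blast
    define t where "t = \<epsilon> / (2 * (nrm y + 1))"
    have half: "\<epsilon> / (2 * N) * N = \<epsilon> / 2" if "N > 0" for N :: real using that by simp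
    have n1: "nrm y + 1 > 0" using nrm_nonneg[of y] by linarith
    have t: "t > 0" using \<epsilon>(1) n1 by (simp add: t_def)
    let ?z = "sc (complex_of_real t) y"
    have z: "?z \<in> hC" using y by (rule span_scale)
    have "nrm ?z = t * nrm y" using t by (simp add: nrm_scale)
    also have "\<dots> \<le> t * (nrm y + 1)" using t by simp
    also have "\<dots> = \<epsilon> / 2" unfolding t_def by (rule half[OF n1])
    also have "\<dots> < \<epsilon>" using \<epsilon>(1) by simp
    finally have "null (a + ?z) \<subseteq> null a" using \<epsilon>(2) k[OF a(1)] hC_commute[OF a(1) z] by auto
    then have "null (a + ?z) = null a"
      by (intro subspace_dim_equal[OF subspace_null subspace_null]) (auto intro: a span_add z)
    then have "bracket a v = 0" "bracket (a + ?z) v = 0"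
      using v k[OF a(1)] k[OF span_add[OF a(1) z]] by blast+
    then have "sc (complex_of_real t) (bracket y v) = 0" by (simp add: bracket_simps)
    then show ?thesis using t by simp
  qed
  then have "null a \<subseteq> hcent" unfolding hcent_def by blast
  moreover have "hcent \<subseteq> null a" unfolding k[OF a(1)] using hcentD(1)[OF _ a(1)] by blast
  ultimately show ?thesis using that a(1) by blast
qed

end

section \<open>Graded centralizers\<close>

context graded_space
begin

abbreviation centralizer :: "'a \<Rightarrow> 'a set" where
  "centralizer q \<equiv> {v. bracket q v = 0}"

lemma centralizer_bracket:
  assumes "x \<in> centralizer q" "y \<in> centralizer q" shows "bracket x y \<in> centralizer q"
  using jacobi_derivation[of q x y] assms by (simp add: bracket_simps)

lemma bracket_pow_gr: "y \<in> gr 1 \<Longrightarrow> v \<in> gr i \<Longrightarrow> (bracket y ^^ k) v \<in> gr (i + k)"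
proof (induction k)
  case (Suc k)
  then show ?case using gr_bracket[of y 1 "(bracket y ^^ k) v" "i + k"] by simp
qed simp

lemma bracket_pow_centralizer: "y \<in> centralizer q \<Longrightarrow> v \<in> centralizer q \<Longrightarrow> (bracket y ^^ k) v \<in> centralizer q"
proof (induction k)
  case (Suc k)
  then show ?case using centralizer_bracket[of y q "(bracket y ^^ k) v"] by simp
qed simp

lemma gr_mult_m: "gr (i + m * k) = gr i"
  using gr_mod[of "i + m * k"] gr_mod[of i] by simp

text \<open>Fitting's decomposition under powers of (ad y)^m, which preserve the degree. The image
  part of v is (ad y)^(m K) w; since m K > 0, this is a bracket of y with an element of degree m K,
  that is of degree zero.\<close>

lemma centralizer_split:
  assumes y: "y \<in> centralizer q \<inter> gr 1" and v: "v \<in> centralizer q \<inter> gr 1"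
  shows "\<exists>u\<in>centralizer q \<inter> gr 0. v - bracket u y \<in> (centralizer q \<inter> gr 1) \<inter> null y"
proof -
  let ?L = "centralizer q \<inter> gr 1"
  let ?T = "\<lambda>k. bracket y ^^ (m * k)"
  have sL: "subspace ?L" by (rule subspace_inter[OF subspace_centralizer gr_subspace])
  have T: "?T k x \<in> ?L" if "x \<in> ?L" for k x
    using that y bracket_pow_gr[of y x 1 "m * k"] bracket_pow_centralizer[of y q x "m * k"] gr_mult_m[of 1 k] by simp
  have e: "endo (?T k)" for k by (rule endo_funpow[OF endo_bracket])
  have sT: "subspace (?T k ` ?L)" for k by (rule endo.linear_subspace_image[OF e sL])
  \<comment> \<open>For the image of least dimension, doubling the exponent leaves the image
    unchanged, which provides w. K is kept positive so that one factor ad y can be split off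
    below.\<close>
  obtain K where K: "K > 0" "\<And>k. k > 0 \<Longrightarrow> dim (?T K ` ?L) \<le> dim (?T k ` ?L)"
    using ex_has_least_nat[of "\<lambda>k. k > 0" 1 "\<lambda>k. dim (?T k ` ?L)"] by auto
  have comp: "?T (K + K) x = ?T K (?T K x)" for x by (simp add: distrib_left funpow_add)
  have "?T (K + K) ` ?L = ?T K ` ?L"
  proof (rule subspace_dim_equal[OF sT sT])
    show "?T (K + K) ` ?L \<subseteq> ?T K ` ?L" unfolding comp using T by blast
    show "dim (?T K ` ?L) \<le> dim (?T (K + K) ` ?L)" using K by simp
  qed
  then obtain w where w: "w \<in> ?L" "?T K v = ?T K (?T K w)" using v unfolding comp by blast
  let ?z = "v - ?T K w"
  have "?T K ?z = 0" using w(2) by (simp only: endo.linear_diff[OF e]) simp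
  then have "?z \<in> null y" by (auto simp: gen_eigenspace_def)
  moreover have "?z \<in> ?L" using subspace_diff[OF sL v T[OF w(1)]] .
  moreover obtain n where n: "m * K = Suc n" using K(1) m_pos by (metis gr0_implies_Suc nat_0_less_mult_iff)
  let ?u = "- (bracket y ^^ n) w"
  have "?T K w = bracket ?u y" using bracket_swap[of y "(bracket y ^^ n) w"] by (simp add: n bracket_simps)
  moreover have "?u \<in> centralizer q \<inter> gr 0"
  proof -
    have "(bracket y ^^ n) w \<in> gr (1 + n)" using bracket_pow_gr y w(1) by blast
    also have "1 + n = 0 + m * K" using n by simp
    finally have "(bracket y ^^ n) w \<in> gr 0" unfolding gr_mult_m .
    moreover have "(bracket y ^^ n) w \<in> centralizer q" using bracket_pow_centralizer y w(1) by blast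
    ultimately show ?thesis using subspace_neg[OF gr_subspace] by (simp add: bracket_simps)
  qed
  ultimately show ?thesis by auto
qed

lemma G0_bracket: "g \<in> G0 \<Longrightarrow> g (bracket x y) = bracket (g x) (g y)"
  by (rule automorphismD(3)[OF G0_automorphism])

lemma G0_inverse:
  assumes "g \<in> G0" shows "inv_into UNIV g (g x) = x" "g (inv_into UNIV g x) = x"
  using G.G0_bij[OF assms] by (simp_all add: bij_is_inj bij_is_surj surj_f_inv_f)

lemma G0_centralizer:
  assumes g: "g \<in> G0" shows "g v \<in> centralizer (g q) \<longleftrightarrow> v \<in> centralizer q"
proof -
  have "bracket (g q) (g v) = g (bracket q v)" by (simp add: G0_bracket[OF g])
  moreover have "g x = 0 \<longleftrightarrow> x = 0" for x
    using G0_inverse(1)[OF g, of x] G0_inverse(1)[OF g, of 0] endo.linear_0[OF G.G0_endo[OF g]] by auto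
  ultimately show ?thesis by simp
qed

lemma G0_centralizer_image:
  assumes g: "g \<in> G0" shows "g ` centralizer q = centralizer (g q)"
proof
  show "g ` centralizer q \<subseteq> centralizer (g q)" using G0_centralizer[OF g] by blast
  show "centralizer (g q) \<subseteq> g ` centralizer q"
  proof
    fix v assume v: "v \<in> centralizer (g q)"
    have "inv_into UNIV g v \<in> centralizer q"
      using v G0_centralizer[OF g, of "inv_into UNIV g v" q] unfolding G0_inverse(2)[OF g] by blast
    then show "v \<in> g ` centralizer q" using G0_inverse(2)[OF g, of v] by (metis image_eqI)
  qed
qed

lemma G0_dim_image:
  assumes g: "g \<in> G0" shows "dim (g ` S) = dim S"
proof (rule endo.dim_image_eq[OF G.G0_endo[OF g]])
  show "inj_on g (span S)" using G.G0_bij[OF g] by (meson bij_is_inj inj_on_subset subset_UNIV)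
qed

lemma G0_null_image:
  assumes g: "g \<in> G0" shows "g ` (centralizer q \<inter> null x) = centralizer (g q) \<inter> null (g x)"
  using G0_centralizer_image[OF g] automorphism_null[OF G0_automorphism[OF g]] G.G0_bij[OF g]
  by (simp add: image_Int bij_is_inj)

lemma G0_centralizer_expo:
  assumes "u \<in> centralizer q \<inter> gr 0" shows "expo (bracket u) t \<in> G0" "expo (bracket u) t q = q"
proof -
  show "expo (bracket u) t \<in> G0" using G0_expo assms by blast
  have "bracket u q = 0" using assms bracket_swap[of u q] by simp
  then show "expo (bracket u) t q = q" by (rule expo_fixed[OF endo_bracket])
qed

text \<open>Small v are pulled back by the inverse of g; C + 1 is a positive bound for its
  norm.\<close>

lemma G0_stable:
  assumes g: "g \<in> G0"
    and st: "\<exists>\<delta>>0. \<forall>v\<in>centralizer q \<inter> gr 1. nrm v < \<delta> \<longrightarrow> dim (centralizer q \<inter> null (a + v)) = dim (centralizer q \<inter> null a)"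
  shows "\<exists>\<delta>>0. \<forall>v\<in>centralizer (g q) \<inter> gr 1. nrm v < \<delta> \<longrightarrow>
    dim (centralizer (g q) \<inter> null (g a + v)) = dim (centralizer (g q) \<inter> null (g a))"
proof -
  let ?g = "inv_into UNIV g"
  obtain \<delta> where \<delta>: "\<delta> > 0" "\<And>v. v \<in> centralizer q \<inter> gr 1 \<Longrightarrow> nrm v < \<delta> \<Longrightarrow>
      dim (centralizer q \<inter> null (a + v)) = dim (centralizer q \<inter> null a)" using st by blast
  obtain C where C: "C \<ge> 0" "\<forall>v. nrm (?g v) \<le> C * nrm v" using endo_bound[OF G.G0_endo[OF G0_inv[OF g]]] by blast
  show ?thesis
  proof (intro exI conjI ballI impI)
    show "\<delta> / (C + 1) > 0" using \<delta>(1) C(1) by simp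
    fix v assume v: "v \<in> centralizer (g q) \<inter> gr 1" "nrm v < \<delta> / (C + 1)"
    have "C * nrm v \<le> (C + 1) * nrm v" by (simp add: mult_right_mono)
    also have "\<dots> < \<delta>" using v(2) C(1) by (simp add: pos_less_divide_eq mult.commute)
    finally have "nrm (?g v) < \<delta>" using C(2) by (meson le_less_trans)
    moreover have "?g v \<in> centralizer q \<inter> gr 1"
      using v(1) G0_centralizer[OF g, of "?g v" q] G0_gr[OF G0_inv[OF g]] unfolding G0_inverse(2)[OF g] by blast
    ultimately have "dim (centralizer q \<inter> null (a + ?g v)) = dim (centralizer q \<inter> null a)" by (rule \<delta>(2)[rotated])
    then have "dim (g ` (centralizer q \<inter> null (a + ?g v))) = dim (g ` (centralizer q \<inter> null a))"
      unfolding G0_dim_image[OF g] .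
    then show "dim (centralizer (g q) \<inter> null (g a + v)) = dim (centralizer (g q) \<inter> null (g a))"
      unfolding G0_null_image[OF g] by (simp add: endo.linear_add[OF G.G0_endo[OF g]] G0_inverse(2)[OF g])
  qed
qed

end

section \<open>Conjugacy inside the Cartan subspace\<close>

context real_graded_space
begin

text \<open>Near a, every a + v is conjugate by an element fixing q to some a + z with z in
  \<open>null a\<close>, which is \<open>hcent\<close>. For small z the null space of a + z lies in
  \<open>null a\<close>, and it contains \<open>hcent\<close> by
  \<open>hcent_nilpotent\<close>.\<close>

lemma generic_stable:
  assumes a: "a \<in> hC" "null a = hcent" and q: "q \<in> hC"
  shows "\<exists>\<delta>>0. \<forall>v\<in>centralizer q \<inter> gr 1. nrm v < \<delta> \<longrightarrow> dim (centralizer q \<inter> null (a + v)) = dim (centralizer q \<inter> null a)"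
proof -
  let ?L = "centralizer q" let ?A = "?L \<inter> gr 0" and ?B = "?L \<inter> gr 1"
  have aL: "a \<in> ?B" using hC_gr[OF a(1)] hC_commute[OF q a(1)] by blast
  have s0: "subspace ?A" and s1: "subspace ?B"
    by (rule subspace_inter[OF subspace_centralizer gr_subspace])+
  have N: "subspace (?B \<inter> null a)" by (rule subspace_inter[OF s1 subspace_null])
  have L01: "bracket u v \<in> ?B" if "u \<in> ?A" "v \<in> ?B" for u v
    using that centralizer_bracket[of u q v] gr_bracket[of u 0 v 1] by simp
  obtain \<epsilon> where \<epsilon>: "\<epsilon> > 0" "\<forall>z\<in>null a. nrm z < \<epsilon> \<longrightarrow> null (a + z) \<subseteq> null a" using null_near by blast
  obtain \<delta> where \<delta>: "\<delta> > 0" "\<forall>v\<in>?B. nrm v < \<delta> \<longrightarrow>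
      (\<exists>u\<in>?A. \<exists>z\<in>?B \<inter> null a. nrm z < \<epsilon> \<and> expo (bracket u) 1 (a + z) = a + v)"
    using local_conjugation[OF s0 s1 N aL L01 Int_lower1 centralizer_split[OF aL] \<epsilon>(1)] by blast
  show ?thesis
  proof (intro exI conjI ballI impI)
    show "\<delta> > 0" by fact
    fix v assume "v \<in> ?B" "nrm v < \<delta>"
    then obtain u z where uz: "u \<in> ?A" "z \<in> ?B \<inter> null a" "nrm z < \<epsilon>" "expo (bracket u) 1 (a + z) = a + v"
      using \<delta>(2) by blast
    let ?e = "expo (bracket u) 1"
    have e: "?e \<in> G0" "?e q = q" by (rule G0_centralizer_expo[OF uz(1)])+
    have az: "a + z \<in> gr 1" "a + z \<in> hcent"
      using uz(2) aL a hC_hcent by (auto intro!: subspace_add[OF gr_subspace] subspace_add[OF subspace_hcent] simp del: One_nat_def)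
    have "null (a + z) = null a"
    proof
      show "null (a + z) \<subseteq> null a" using \<epsilon>(2) uz by blast
      show "null a \<subseteq> null (a + z)" unfolding a(2) by (rule hcent_nilpotent[OF az])
    qed
    then have "?e ` (?L \<inter> null a) = ?L \<inter> null (a + v)"
      using G0_null_image[OF e(1), of q "a + z"] unfolding e(2) uz(4) by simp
    then show "dim (?L \<inter> null (a + v)) = dim (?L \<inter> null a)"
      using G0_dim_image[OF e(1), of "?L \<inter> null a"] by simp
  qed
qed

lemma hC_image_eq:
  assumes g: "g \<in> G0" and sub: "g ` hC \<subseteq> hC" shows "g ` hC = hC"
  using subspace_dim_equal[OF endo.linear_subspace_image[OF G.G0_endo[OF g] subspace_span] subspace_span sub]
    G0_dim_image[OF g, of hC] by simp

text \<open>Vinberg's theorem. The centralizers of \<open>hC\<close> and of its image under \<open>g\<close> are null spaces of regular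
  elements in the centralizer of \<open>q'\<close>, so they are conjugate under the stabilizer of \<open>q'\<close>, which
  corrects \<open>g\<close> to an element preserving \<open>hC\<close>.\<close>

theorem conjugate_imp_weyl_conjugate:
  assumes q: "q \<in> hC" "q' \<in> hC" and g: "g \<in> G0" "g q = q'"
  obtains w where "w \<in> G0" "w ` hC = hC" "w q = q'"
proof -
  let ?L = "centralizer q'" let ?A = "?L \<inter> gr 0" and ?B = "?L \<inter> gr 1"
  obtain a where a: "a \<in> hC" "null a = hcent" by (rule generic_element)
  have aL: "a \<in> ?B" using hC_gr[OF a(1)] hC_commute[OF q(2) a(1)] by blast
  have bL: "g a \<in> ?B"
    using G0_gr[OF g(1) hC_gr[OF a(1)]] hC_commute[OF q(1) a(1)] G0_centralizer[OF g(1), of a q] unfolding g(2) by blast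
  have s0: "subspace ?A" and s1: "subspace ?B"
    by (rule subspace_inter[OF subspace_centralizer gr_subspace])+
  have L01: "bracket u v \<in> ?B" if "u \<in> ?A" "v \<in> ?B" for u v
    using that centralizer_bracket[of u q' v] gr_bracket[of u 0 v 1] by simp
  have "\<exists>h\<in>{k \<in> G0. k q' = q'}. ?L \<inter> null (g a) = h ` (?L \<inter> null a)"
  proof (rule regular_null_conjugate[OF subspace_centralizer s0 s1 Int_lower1 L01 centralizer_split])
    fix k assume "k \<in> {k \<in> G0. k q' = q'}"
    then have k: "k \<in> G0" "k q' = q'" by auto
    show "k \<in> lie_automorphisms sc bracket" by (rule G0_automorphism[OF k(1)])
    show "k ` ?L = ?L" using G0_centralizer_image[OF k(1), of q'] unfolding k(2) .
    show "inv_into UNIV k \<in> {k \<in> G0. k q' = q'}" using G0_inv[OF k(1)] G0_inverse(1)[OF k(1), of q'] k(2) by simp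
    show "k \<circ> k' \<in> {k \<in> G0. k q' = q'}" if "k' \<in> {k \<in> G0. k q' = q'}" for k'
      using that G.G0_comp[OF k(1)] k(2) by simp
  next
    show "expo (bracket u) 1 \<in> {k \<in> G0. k q' = q'}" if "u \<in> ?A" for u
      using G0_centralizer_expo[OF that] by simp
    show "\<exists>\<delta>>0. \<forall>v\<in>?B. nrm v < \<delta> \<longrightarrow> dim (?L \<inter> null (a + v)) = dim (?L \<inter> null a)"
      by (rule generic_stable[OF a q(2)])
    show "\<exists>\<delta>>0. \<forall>v\<in>?B. nrm v < \<delta> \<longrightarrow> dim (?L \<inter> null (g a + v)) = dim (?L \<inter> null (g a))"
      using G0_stable[OF g(1) generic_stable[OF a q(1)]] unfolding g(2) .
  qed (use aL bL in auto)
  then obtain k where k: "k \<in> G0" "k q' = q'" "?L \<inter> null (g a) = k ` (?L \<inter> null a)" by blast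
  have "hcent \<subseteq> ?L" using hcentD(1)[OF _ q(2)] by blast
  then have 1: "?L \<inter> null a = hcent" unfolding a(2) by blast
  have "hcent \<subseteq> centralizer q" using hcentD(1)[OF _ q(1)] by blast
  then have "g ` hcent = ?L \<inter> null (g a)" using G0_null_image[OF g(1), of q a] unfolding g(2) a(2) by (simp add: Int_absorb1)
  then have gk: "g ` hcent = k ` hcent" using k(3) unfolding 1 by simp
  \<comment> \<open>Both g and k map \<open>hcent\<close> onto the same space, so \<open>?w\<close>
    preserves \<open>hcent\<close>; moreover it sends q' to q. The element sought is its
    inverse.\<close>
  let ?g = "inv_into UNIV g"
  let ?w = "?g \<circ> k"
  have w: "?w \<in> G0" by (rule G.G0_comp[OF G0_inv[OF g(1)] k(1)])
  have wz: "?w ` hcent = hcent"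
  proof -
    have "?w ` hcent = ?g ` (k ` hcent)" by (rule image_comp[symmetric])
    also have "\<dots> = hcent" unfolding gk[symmetric] image_image by (simp add: G0_inverse(1)[OF g(1)])
    finally show ?thesis .
  qed
  \<comment> \<open>\<open>hC\<close> consists of the semisimple elements of degree one in
    \<open>hcent\<close>, and \<open>?w\<close> preserves all three conditions.\<close>
  have "?w x \<in> hC" if x: "x \<in> hC" for x
  proof (rule hcent_semisimple)
    show "?w x \<in> gr 1" by (rule G0_gr[OF w hC_gr[OF x]])
    show "?w x \<in> hcent" using wz x hC_hcent by blast
    show "diagonalizable (bracket (?w x))"
      by (rule diagonalizable_conjugate[where A = "bracket x" and \<tau> = ?w and \<phi> = "\<lambda>r. r", OF hC_diagonalizable[OF x]])
        (simp_all only: endo_simps[OF G.G0_endo[OF w]] G0_bracket[OF w] endo_bracket bij_is_surj[OF G.G0_bij[OF w]])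
  qed
  then have wc: "?w ` hC = hC" by (intro hC_image_eq[OF w]) blast
  let ?v = "inv_into UNIV ?w"
  have "?v ` hC = ?v ` (?w ` hC)" unfolding wc by (rule refl)
  also have "\<dots> = hC" unfolding image_image G0_inverse(1)[OF w] by simp
  finally have "?v ` hC = hC" .
  moreover have "?w q' = q" using k(2) G0_inverse(1)[OF g(1), of q] g(2) by simp
  then have "?v q = q'" using G0_inverse(1)[OF w, of q'] by simp
  ultimately show ?thesis using that G0_inv[OF w] by blast
qed

section \<open>Finiteness of the Weyl group and rigidity of strata\<close>

abbreviation hC_stabilizer :: "('a \<Rightarrow> 'a) set" where
  "hC_stabilizer \<equiv> {w \<in> G0. w ` hC = hC}"

text \<open>The Weyl group is finite: it permutes the points of the Cartan subspace whose weights lie in a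
  given finite set, and the weights of \<open>w b\<close> are eigenvalues of \<open>ad b\<close>.\<close>

lemma finite_weyl_representatives:
  obtains R where "finite R" "R \<subseteq> hC_stabilizer" "\<And>w. w \<in> hC_stabilizer \<Longrightarrow> \<exists>\<rho>\<in>R. \<forall>x\<in>hC. w x = \<rho> x"
proof -
  obtain B0 where B0: "B0 \<subseteq> hC" "independent B0" "span B0 = hC" "finite B0"
    by (rule subspace_eq_span_basis[OF subspace_span]) blast
  define E where "E = {v. \<forall>A\<in>bracket ` B0. \<exists>\<mu>. A v = sc \<mu> v}"
  have "span E = UNIV" unfolding E_def
  proof (rule joint_eigenvectors)
    show "finite (bracket ` B0)" using B0(4) by simp
    show "diagonalizable A" if "A \<in> bracket ` B0" for A using that hC_diagonalizable B0(1) by blast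
    show "A (B v) = B (A v)" if AB: "A \<in> bracket ` B0" "B \<in> bracket ` B0" for A B v
    proof -
      obtain x y where "x \<in> hC" "A = bracket x" "y \<in> hC" "B = bracket y" using AB B0(1) by blast
      then show ?thesis using bracket_commute[OF hC_commute[of x y], of v] by simp
    qed
  qed
  then obtain D where D: "D \<subseteq> E" "independent D" "span D = UNIV" "finite D"
    by (rule spanning_set_basis) blast
  have weight: "\<exists>\<mu>. bracket x d = sc \<mu> d" if "x \<in> hC" "d \<in> D" for x d
  proof -
    have "x \<in> span B0" using that(1) B0(3) by simp
    then show ?thesis
    proof (induction rule: span_induct_alt)
      case base
      show ?case by (auto simp: bracket_simps intro: exI[of _ 0])
    next
      case (step c x y)
      obtain \<mu> where "bracket x d = sc \<mu> d" using D(1) \<open>d \<in> D\<close> step.hyps unfolding E_def by blast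
      moreover obtain \<nu> where "bracket y d = sc \<nu> d" using step.IH by blast
      ultimately have "bracket (sc c x + y) d = sc (c * \<mu> + \<nu>) d" by (simp add: bracket_simps scale_left_distrib)
      then show ?case by blast
    qed
  qed
  define S where "S b = {\<mu>. \<exists>v. v \<noteq> 0 \<and> bracket b v = sc \<mu> v}" for b
  have fS: "finite (S b)" if b: "b \<in> hC" for b
  proof -
    have "\<exists>l. \<forall>d\<in>D. bracket b d = sc (l d) d" using weight[OF b] by (intro bchoice) blast
    then obtain l where l: "\<And>d. d \<in> D \<Longrightarrow> bracket b d = sc (l d) d" by blast
    have "S b \<subseteq> l ` D"
    proof
      fix \<mu> assume "\<mu> \<in> S b"
      then obtain v where v: "v \<noteq> 0" "bracket b v = sc \<mu> v" by (auto simp: S_def)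
      have "v \<in> span D" using D(3) by simp
      then obtain c where c: "(\<Sum>d\<in>D. sc (c d) d) = v" using D(4) by (auto simp: span_finite)
      have 1: "bracket b v = (\<Sum>d\<in>D. sc (c d * l d) d)"
        unfolding c[symmetric] bracket_sum_right by (rule sum.cong) (simp_all add: l bracket_simps)
      have "(\<Sum>d\<in>D. sc (c d * l d - \<mu> * c d) d) = bracket b v - sc \<mu> v"
        unfolding 1 unfolding c[symmetric] scale_sum_right sum_subtractf[symmetric]
        by (rule sum.cong) (simp_all add: scale_left_diff_distrib)
      then have 0: "(\<Sum>d\<in>D. sc (c d * l d - \<mu> * c d) d) = 0" using v(2) by simp
      have z: "c d * l d - \<mu> * c d = 0" if "d \<in> D" for d
        using independentD[OF D(2) D(4) subset_refl 0 that] .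
      show "\<mu> \<in> l ` D"
      proof (rule ccontr)
        assume n: "\<mu> \<notin> l ` D"
        have "c d = 0" if "d \<in> D" for d
        proof -
          have "c d * (l d - \<mu>) = 0" using z[OF that] by (simp add: right_diff_distrib mult.commute)
          moreover have "l d \<noteq> \<mu>" using n that by blast
          ultimately show ?thesis by simp
        qed
        then have "v = 0" unfolding c[symmetric] by (intro sum.neutral) simp
        then show False using v(1) by simp
      qed
    qed
    then show ?thesis using D(4) finite_surj by blast
  qed
  \<comment> \<open>A point of \<open>hC\<close> is determined by its weights on the joint
    eigenbasis D, because ad is injective. Restricting the weights to the finite set S b leaves
    finitely many points.\<close>
  define T where "T b = {x \<in> hC. \<forall>d\<in>D. \<exists>\<mu>\<in>S b. bracket x d = sc \<mu> d}" for b
  have fT: "finite (T b)" if b: "b \<in> hC" for b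
  proof -
    have "\<exists>l. \<forall>x\<in>T b. l x \<in> (\<Pi>\<^sub>E d\<in>D. S b) \<and> (\<forall>d\<in>D. bracket x d = sc (l x d) d)"
    proof (rule bchoice, rule ballI)
      fix x assume "x \<in> T b"
      then have "\<exists>l. \<forall>d\<in>D. l d \<in> S b \<and> bracket x d = sc (l d) d" unfolding T_def by (intro bchoice) blast
      then obtain l where "\<forall>d\<in>D. l d \<in> S b \<and> bracket x d = sc (l d) d" by blast
      then have "restrict l D \<in> (\<Pi>\<^sub>E d\<in>D. S b) \<and> (\<forall>d\<in>D. bracket x d = sc (restrict l D d) d)" by auto
      then show "\<exists>l. l \<in> (\<Pi>\<^sub>E d\<in>D. S b) \<and> (\<forall>d\<in>D. bracket x d = sc (l d) d)" by blast
    qed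
    then obtain l where l: "\<And>x. x \<in> T b \<Longrightarrow> l x \<in> (\<Pi>\<^sub>E d\<in>D. S b)" "\<And>x d. x \<in> T b \<Longrightarrow> d \<in> D \<Longrightarrow> bracket x d = sc (l x d) d"
      by blast
    have "inj_on l (T b)"
    proof (rule inj_onI)
      fix x y assume xy: "x \<in> T b" "y \<in> T b" "l x = l y"
      have "bracket x = bracket y"
        by (rule endo_eqI[OF endo_bracket endo_bracket D(3)]) (simp add: l(2) xy)
      then have "bracket x z = bracket y z" for z by simp
      then show "x = y" by (rule bracket_eqI)
    qed
    moreover have "l ` T b \<subseteq> (\<Pi>\<^sub>E d\<in>D. S b)" using l(1) by blast
    moreover have "finite (\<Pi>\<^sub>E d\<in>D. S b)" using D(4) fS[OF b] by (intro finite_PiE)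
    ultimately show ?thesis by (meson finite_imageD finite_subset)
  qed
  have wT: "w b \<in> T b" if w: "w \<in> hC_stabilizer" and b: "b \<in> hC" for w b
  proof -
    have wG: "w \<in> G0" "w b \<in> hC" using w b by auto
    let ?w = "inv_into UNIV w"
    have "\<exists>\<mu>\<in>S b. bracket (w b) d = sc \<mu> d" if d: "d \<in> D" for d
    proof -
      obtain \<mu> where \<mu>: "bracket (w b) d = sc \<mu> d" using weight[OF wG(2) d] by blast
      have "d \<noteq> 0" using D(2) d dependent_zero by blast
      then have "?w d \<noteq> 0" using G0_inverse(2)[OF wG(1), of d] endo.linear_0[OF G.G0_endo[OF wG(1)]] by force
      moreover have "bracket b (?w d) = sc \<mu> (?w d)"
      proof -
        have "?w (bracket (w b) d) = bracket (?w (w b)) (?w d)" by (rule G0_bracket[OF G0_inv[OF wG(1)]])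
        then show ?thesis by (simp add: \<mu> G0_inverse(1)[OF wG(1)] endo.linear_scale[OF G.G0_endo[OF G0_inv[OF wG(1)]]])
      qed
      ultimately have "\<mu> \<in> S b" unfolding S_def by blast
      then show ?thesis using \<mu> by blast
    qed
    then show ?thesis unfolding T_def using wG(2) by blast
  qed
  let ?r = "\<lambda>w. restrict w B0"
  have "?r ` hC_stabilizer \<subseteq> (\<Pi>\<^sub>E b\<in>B0. T b)" using wT B0(1) by (auto simp: subset_iff)
  moreover have "finite (\<Pi>\<^sub>E b\<in>B0. T b)" using B0(1,4) fT by (intro finite_PiE) auto
  ultimately have fin: "finite (?r ` hC_stabilizer)" by (rule finite_subset)
  \<comment> \<open>On \<open>hC\<close> an element of the stabilizer is determined by its
    restriction to the basis B0; one representative is chosen for each restriction.\<close>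
  let ?R = "inv_into hC_stabilizer ?r ` ?r ` hC_stabilizer"
  have RN: "inv_into hC_stabilizer ?r (?r w) \<in> hC_stabilizer" "?r (inv_into hC_stabilizer ?r (?r w)) = ?r w" if "w \<in> hC_stabilizer" for w
    using that inv_into_into[of "?r w" ?r hC_stabilizer] f_inv_into_f[of "?r w" ?r hC_stabilizer] by blast+
  have "\<exists>\<rho>\<in>?R. \<forall>x\<in>hC. w x = \<rho> x" if w: "w \<in> hC_stabilizer" for w
  proof (rule bexI)
    let ?\<rho> = "inv_into hC_stabilizer ?r (?r w)"
    show "?\<rho> \<in> ?R" using w by blast
    have e: "endo w" "endo ?\<rho>" using w RN(1)[OF w] G.G0_endo by blast+
    have b: "w b = ?\<rho> b" if "b \<in> B0" for b using fun_cong[OF RN(2)[OF w], of b] that by simp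
    show "\<forall>x\<in>hC. w x = ?\<rho> x"
    proof
      fix x assume "x \<in> hC"
      then have "x \<in> span B0" using B0(3) by simp
      then show "w x = ?\<rho> x" by (rule endo.linear_eq_on[OF e]) (rule b)
    qed
  qed
  moreover have "?R \<subseteq> hC_stabilizer" using RN(1) by blast
  ultimately show ?thesis using that[of ?R] fin by blast
qed

lemma affine_line_agree:
  assumes A: "endo A" and B: "endo B" and st: "s \<noteq> t"
    and eq: "A (p + sc s d) = B (p + sc s d)" "A (p + sc t d) = B (p + sc t d)"
  shows "A p = B p" "A d = B d"
proof -
  have 1: "A p + sc s (A d) = B p + sc s (B d)" "A p + sc t (A d) = B p + sc t (B d)"
    using eq by (simp_all add: endo_simps[OF A] endo_simps[OF B])
  have "sc (s - t) (A d) = (A p + sc s (A d)) - (A p + sc t (A d))" by (simp add: scale_left_diff_distrib)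
  also have "\<dots> = sc (s - t) (B d)" unfolding 1 by (simp add: scale_left_diff_distrib)
  finally show d: "A d = B d" using st by simp
  show "A p = B p" using 1(1) unfolding d by simp
qed

text \<open>On the line through \<open>p\<close> and \<open>q\<close> the element \<open>u\<close> agrees with Weyl group elements at all but
  finitely many points, hence with a single one by finiteness of the Weyl group.\<close>

theorem fixes_stratum:
  assumes p: "p \<in> hC" and F: "F = {q \<in> hC. \<forall>w\<in>hC_stabilizer. w q = q \<longleftrightarrow> w p = p}"
    and u: "u \<in> G0" "u p = p" "u ` F \<subseteq> F" and q: "q \<in> F"
  shows "u q = q"
proof -
  obtain R where R: "finite R" "R \<subseteq> hC_stabilizer" "\<And>w. w \<in> hC_stabilizer \<Longrightarrow> \<exists>\<rho>\<in>R. \<forall>x\<in>hC. w x = \<rho> x"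
    by (rule finite_weyl_representatives) blast
  let ?d = "q - p"
  define y where "y t = p + sc t ?d" for t
  have qC: "q \<in> hC" using q F by blast
  have y: "y t \<in> hC" for t unfolding y_def using p qC by (intro span_add span_scale span_diff)
  have RG: "\<rho> \<in> G0" if "\<rho> \<in> R" for \<rho> using that R(2) by blast
  have few: "finite {t. A (y t) = B (y t)}" if A: "endo A" and B: "endo B" and ne: "A p \<noteq> B p \<or> A ?d \<noteq> B ?d" for A B
  proof (rule ccontr)
    assume inf: "infinite {t. A (y t) = B (y t)}"
    then obtain s where s: "A (y s) = B (y s)" using infinite_imp_nonempty by blast
    have "infinite ({t. A (y t) = B (y t)} - {s})" using inf by simp
    then obtain t where t: "A (y t) = B (y t)" "s \<noteq> t" using infinite_imp_nonempty by blast
    show False using affine_line_agree[OF A B t(2) s[unfolded y_def] t(1)[unfolded y_def]] ne by blast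
  qed
  have eid: "endo (\<lambda>x. x)" by (rule endoI) simp_all
  \<comment> \<open>The parameters at which y t is fixed by some representative that moves p. At all
    others y t is in the stratum, since an element fixing p also fixes q and hence the whole
    line.\<close>
  define Bad where "Bad = (\<Union>\<rho>\<in>{\<rho> \<in> R. \<rho> p \<noteq> p}. {t. \<rho> (y t) = y t})"
  have fB: "finite Bad" unfolding Bad_def
  proof (rule finite_UN_I)
    show "finite {\<rho> \<in> R. \<rho> p \<noteq> p}" using R(1) by simp
    show "finite {t. \<rho> (y t) = y t}" if "\<rho> \<in> {\<rho> \<in> R. \<rho> p \<noteq> p}" for \<rho>
      using few[OF G.G0_endo[OF RG] eid, of \<rho>] that by blast
  qed
  have yF: "y t \<in> F" if t: "t \<notin> Bad" for t
    unfolding F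
  proof (intro CollectI conjI ballI)
    show "y t \<in> hC" by (rule y)
    fix w assume w: "w \<in> hC_stabilizer"
    then obtain \<rho> where \<rho>: "\<rho> \<in> R" "\<forall>x\<in>hC. w x = \<rho> x" using R(3) by blast
    have e: "endo w" using w G.G0_endo by blast
    show "w (y t) = y t \<longleftrightarrow> w p = p"
    proof
      assume "w (y t) = y t"
      then have "\<rho> (y t) = y t" using \<rho>(2) y by simp
      then have "\<rho> p = p" using t \<rho>(1) unfolding Bad_def by blast
      then show "w p = p" using \<rho>(2) p by simp
    next
      assume "w p = p"
      moreover then have "w q = q" using q w unfolding F by blast
      ultimately show "w (y t) = y t" by (simp add: y_def endo_simps[OF e])
    qed
  qed
  \<comment> \<open>Off \<open>Bad\<close> the points y t and u (y t) both lie in F, so by Vinberg's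
    theorem u acts on y t like some \<rho> in the finite set R. One \<rho> occurs for infinitely
    many t and therefore agrees with u at p and at q - p.\<close>
  have "- Bad \<subseteq> (\<Union>\<rho>\<in>R. {t. \<rho> (y t) = u (y t)})"
  proof
    fix t assume "t \<in> - Bad"
    then have "u (y t) \<in> F" using yF u(3) by blast
    then have uy: "u (y t) \<in> hC" unfolding F by blast
    obtain w where w: "w \<in> G0" "w ` hC = hC" "w (y t) = u (y t)"
      by (rule conjugate_imp_weyl_conjugate[OF y uy u(1) refl])
    then obtain \<rho> where "\<rho> \<in> R" "\<forall>x\<in>hC. w x = \<rho> x" using R(3) by blast
    then show "t \<in> (\<Union>\<rho>\<in>R. {t. \<rho> (y t) = u (y t)})" using w(3) y[of t] by auto
  qed
  moreover have "infinite (- Bad)" using fB infinite_UNIV_char_0[where 'a = complex] by (simp add: Compl_eq_Diff_UNIV)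
  ultimately have "infinite (\<Union>\<rho>\<in>R. {t. \<rho> (y t) = u (y t)})" using finite_subset by blast
  then obtain \<rho> where \<rho>: "\<rho> \<in> R" "infinite {t. \<rho> (y t) = u (y t)}" using R(1) by blast
  then have e: "\<rho> p = u p" "\<rho> ?d = u ?d" using few[OF G.G0_endo[OF RG[OF \<rho>(1)]] G.G0_endo[OF u(1)]] by blast+
  then have "\<rho> p = p" using u(2) by simp
  then have "\<rho> q = q" using q \<rho>(1) R(2) unfolding F by blast
  then have "u ?d = ?d" using e(2) \<open>\<rho> p = p\<close> by (simp add: endo_simps[OF G.G0_endo[OF RG[OF \<rho>(1)]]])
  then show ?thesis using u(2) by (simp add: endo_simps[OF G.G0_endo[OF u(1)]])
qed

end

section \<open>Strata and Galois cohomology\<close>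

text \<open>What the cohomological argument uses of the Weyl group. The laws for the action are
  required only for the carrier and on c, because \<open>coset_act\<close> is meaningful only where
  all members of a coset agree.\<close>

locale galois_action =
  fixes W :: "'w monoid" and act :: "'w \<Rightarrow> 'a \<Rightarrow> 'a" and c :: "'a set" and \<tau> :: "'w \<Rightarrow> 'w" and \<sigma> :: "'a \<Rightarrow> 'a" and p :: 'a
  assumes group_W: "group W"
    and act_closed: "v \<in> carrier W \<Longrightarrow> x \<in> c \<Longrightarrow> act v x \<in> c"
    and act_one: "x \<in> c \<Longrightarrow> act \<one>\<^bsub>W\<^esub> x = x"
    and act_mult: "v \<in> carrier W \<Longrightarrow> w \<in> carrier W \<Longrightarrow> x \<in> c \<Longrightarrow> act (v \<otimes>\<^bsub>W\<^esub> w) x = act v (act w x)"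
    and tau_hom: "\<tau> \<in> hom W W" and tau_tau: "w \<in> carrier W \<Longrightarrow> \<tau> (\<tau> w) = w"
    and sigma_sigma: "\<sigma> (\<sigma> x) = x" and sigma_closed: "x \<in> c \<Longrightarrow> \<sigma> x \<in> c"
    and sigma_act: "w \<in> carrier W \<Longrightarrow> x \<in> c \<Longrightarrow> \<sigma> (act w x) = act (\<tau> w) (\<sigma> x)"
    and p_closed: "p \<in> c" and sigma_p: "\<sigma> p = p"
begin

interpretation W: group W by (rule group_W)

abbreviation Wp :: "'w set" where "Wp \<equiv> stabilizer W act p"
abbreviation F :: "'a set" where "F \<equiv> {q \<in> c. stabilizer W act q = Wp}"
abbreviation Nz :: "'w set" where "Nz \<equiv> normalizer W Wp"
abbreviation Q :: "'w set monoid" where "Q \<equiv> normalizer_quotient W Wp"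
abbreviation cls :: "'w \<Rightarrow> 'w set" where "cls w \<equiv> Wp #>\<^bsub>W\<^esub> w"
abbreviation \<gamma> :: "'w set \<Rightarrow> 'w set" where "\<gamma> C \<equiv> \<tau> ` C"

lemma act_inv:
  assumes "w \<in> carrier W" "x \<in> c" shows "act (inv\<^bsub>W\<^esub> w) (act w x) = x" "act w (act (inv\<^bsub>W\<^esub> w) x) = x"
  using act_mult[of "inv\<^bsub>W\<^esub> w" w x] act_mult[of w "inv\<^bsub>W\<^esub> w" x] assms act_one by simp_all

lemma stabilizer_subgroup: "x \<in> c \<Longrightarrow> subgroup (stabilizer W act x) W"
proof (rule W.subgroupI)
  assume x: "x \<in> c"
  show "stabilizer W act x \<subseteq> carrier W" by (auto simp: stabilizer_def)
  show "stabilizer W act x \<noteq> {}" using act_one[OF x] by (auto simp: stabilizer_def)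
  show "inv\<^bsub>W\<^esub> w \<in> stabilizer W act x" if "w \<in> stabilizer W act x" for w
    using that act_inv(1)[of w x] x by (auto simp: stabilizer_def)
  show "v \<otimes>\<^bsub>W\<^esub> w \<in> stabilizer W act x" if "v \<in> stabilizer W act x" "w \<in> stabilizer W act x" for v w
    using that act_mult[of v w x] x by (auto simp: stabilizer_def)
qed

lemma stabilizer_act:
  assumes w: "w \<in> carrier W" and x: "x \<in> c"
  shows "stabilizer W act (act w x) = w <#\<^bsub>W\<^esub> stabilizer W act x #>\<^bsub>W\<^esub> inv\<^bsub>W\<^esub> w"
proof
  show "stabilizer W act (act w x) \<subseteq> w <#\<^bsub>W\<^esub> stabilizer W act x #>\<^bsub>W\<^esub> inv\<^bsub>W\<^esub> w"
  proof
    fix v assume "v \<in> stabilizer W act (act w x)"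
    then have v: "v \<in> carrier W" "act v (act w x) = act w x" by (auto simp: stabilizer_def)
    let ?u = "inv\<^bsub>W\<^esub> w \<otimes>\<^bsub>W\<^esub> (v \<otimes>\<^bsub>W\<^esub> w)"
    have "act ?u x = x" using v w x by (simp add: act_mult act_inv)
    then have u: "?u \<in> stabilizer W act x" using v w by (simp add: stabilizer_def)
    have "v = w \<otimes>\<^bsub>W\<^esub> ?u \<otimes>\<^bsub>W\<^esub> inv\<^bsub>W\<^esub> w" using v w by (simp add: W.m_assoc) (simp add: W.m_assoc[symmetric])
    then show "v \<in> w <#\<^bsub>W\<^esub> stabilizer W act x #>\<^bsub>W\<^esub> inv\<^bsub>W\<^esub> w" using u unfolding l_coset_def r_coset_def by blast
  qed
  show "w <#\<^bsub>W\<^esub> stabilizer W act x #>\<^bsub>W\<^esub> inv\<^bsub>W\<^esub> w \<subseteq> stabilizer W act (act w x)"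
  proof
    fix v assume "v \<in> w <#\<^bsub>W\<^esub> stabilizer W act x #>\<^bsub>W\<^esub> inv\<^bsub>W\<^esub> w"
    then obtain u where u: "u \<in> carrier W" "act u x = x" "v = w \<otimes>\<^bsub>W\<^esub> u \<otimes>\<^bsub>W\<^esub> inv\<^bsub>W\<^esub> w"
      unfolding l_coset_def r_coset_def stabilizer_def by blast
    have "act v (act w x) = act w x" using u w x by (simp add: act_mult act_inv act_closed)
    then show "v \<in> stabilizer W act (act w x)" using u w by (simp add: stabilizer_def)
  qed
qed

lemma p_stratum: "p \<in> F"
  using p_closed by simp

text \<open>The stabilizer of w q is the conjugate of Wp by w, so a single point of the stratum
  decides.\<close>

lemma normalizer_iff:
  assumes "q \<in> F" shows "w \<in> Nz \<longleftrightarrow> w \<in> carrier W \<and> act w q \<in> F"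
proof -
  have "Wp \<subseteq> carrier W" by (auto simp: stabilizer_def)
  then show ?thesis using stabilizer_act[of w q] assms act_closed[of w q]
    by (auto simp: normalizer_def stabilizer_def[of W "\<lambda>g. \<lambda>H\<in>{H. H \<subseteq> carrier W}. g <#\<^bsub>W\<^esub> H #>\<^bsub>W\<^esub> inv\<^bsub>W\<^esub> g"])
qed

lemma Nz_subgroup: "subgroup Nz W"
  by (rule W.normalizer_imp_subgroup) (auto simp: stabilizer_def)

lemma NzD: "w \<in> Nz \<Longrightarrow> w \<in> carrier W" "w \<in> Nz \<Longrightarrow> q \<in> F \<Longrightarrow> act w q \<in> F"
  using normalizer_iff[OF p_stratum] normalizer_iff[of q w] by blast+

lemma Wp_normal: "Wp \<lhd> W\<lparr>carrier := Nz\<rparr>"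
  by (rule W.subgroup_in_normalizer[OF stabilizer_subgroup[OF p_closed]])

lemma group_Q: "group Q"
  unfolding normalizer_quotient_def by (rule normal.factorgroup_is_group[OF Wp_normal])

lemma carrier_Q: "carrier Q = cls ` Nz"
  unfolding normalizer_quotient_def carrier_FactGroup by (simp add: r_coset_def)

lemma mult_Q:
  assumes "v \<in> Nz" "w \<in> Nz" shows "cls v \<otimes>\<^bsub>Q\<^esub> cls w = cls (v \<otimes>\<^bsub>W\<^esub> w)"
  using normal.rcos_sum[OF Wp_normal, of v w] assms
  by (simp add: normalizer_quotient_def r_coset_def set_mult_def)

lemma one_Q: "\<one>\<^bsub>Q\<^esub> = cls \<one>\<^bsub>W\<^esub>"
proof -
  have "Wp \<subseteq> carrier W" by (auto simp: stabilizer_def)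
  then show ?thesis by (simp add: normalizer_quotient_def)
qed

lemma cls_eq_iff:
  assumes v: "v \<in> carrier W" and w: "w \<in> carrier W"
  shows "cls v = cls w \<longleftrightarrow> v \<otimes>\<^bsub>W\<^esub> inv\<^bsub>W\<^esub> w \<in> Wp"
proof
  have sub: "subgroup Wp W" by (rule stabilizer_subgroup[OF p_closed])
  show "v \<otimes>\<^bsub>W\<^esub> inv\<^bsub>W\<^esub> w \<in> Wp" if "cls v = cls w"
  proof -
    have "v \<in> cls w" using W.rcos_self[OF v sub] that by simp
    then obtain u where "u \<in> Wp" "v = u \<otimes>\<^bsub>W\<^esub> w" unfolding r_coset_def by blast
    then show ?thesis using w subgroup.mem_carrier[OF sub] by (simp add: W.m_assoc)
  qed
  show "cls v = cls w" if "v \<otimes>\<^bsub>W\<^esub> inv\<^bsub>W\<^esub> w \<in> Wp"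
  proof -
    have "v = (v \<otimes>\<^bsub>W\<^esub> inv\<^bsub>W\<^esub> w) \<otimes>\<^bsub>W\<^esub> w" using v w by (simp add: W.m_assoc)
    then have "v \<in> cls w" using that unfolding r_coset_def by blast
    then show ?thesis using W.repr_independence[OF _ w sub] by blast
  qed
qed

text \<open>All stabilizers on the stratum equal Wp, so a class modulo Wp is determined by its
  effect on one point.\<close>

lemma cls_eqI:
  assumes "v \<in> Nz" "w \<in> Nz" "x \<in> F" "act v x = act w x" shows "cls v = cls w"
proof -
  have vw: "v \<in> carrier W" "w \<in> carrier W" using NzD(1) assms(1,2) by auto
  have xw: "act w x \<in> F" using NzD(2)[OF assms(2,3)] .
  have "act (v \<otimes>\<^bsub>W\<^esub> inv\<^bsub>W\<^esub> w) (act w x) = act w x"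
    using assms(3,4) vw xw act_inv(1)[OF vw(2), of x] by (simp add: act_mult)
  then have "v \<otimes>\<^bsub>W\<^esub> inv\<^bsub>W\<^esub> w \<in> stabilizer W act (act w x)" using vw by (simp add: stabilizer_def)
  then show ?thesis unfolding cls_eq_iff[OF vw] using xw by simp
qed

text \<open>The coset is Wp w, and Wp fixes \<open>act w x\<close> because this point is again in
  the stratum.\<close>

lemma coset_act_cls:
  assumes w: "w \<in> Nz" and x: "x \<in> F" shows "coset_act act (cls w) x = act w x"
proof -
  have w': "w \<in> carrier W" "act w x \<in> F" using NzD(1)[OF w] NzD(2)[OF w x] by auto
  have "act (u \<otimes>\<^bsub>W\<^esub> w) x = act w x" if "u \<in> Wp" for u
  proof -
    have "u \<in> stabilizer W act (act w x)" using that w'(2) by simp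
    then show ?thesis using w'(1) x by (simp add: act_mult stabilizer_def)
  qed
  moreover have "Wp \<noteq> {}" using act_one[OF p_closed] by (auto simp: stabilizer_def)
  ultimately have "(\<lambda>u. act (u \<otimes>\<^bsub>W\<^esub> w) x) ` Wp = {act w x}" by auto
  moreover have "(\<lambda>v. act v x) ` cls w = (\<lambda>u. act (u \<otimes>\<^bsub>W\<^esub> w) x) ` Wp" unfolding r_coset_def by blast
  ultimately have "(\<lambda>v. act v x) ` cls w = {act w x}" by (simp only:)
  then show ?thesis by (simp add: coset_act_def)
qed

lemma tau_closed: "w \<in> carrier W \<Longrightarrow> \<tau> w \<in> carrier W"
  using tau_hom by (rule hom_in_carrier)

lemma stabilizer_sigma:
  assumes x: "x \<in> c" shows "stabilizer W act (\<sigma> x) = \<tau> ` stabilizer W act x"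
proof -
  have mem: "\<tau> w \<in> stabilizer W act (\<sigma> x)" if "w \<in> stabilizer W act x" "x \<in> c" for w x
    using that sigma_act[of w x] tau_closed by (simp add: stabilizer_def)
  show ?thesis
  proof
    show "\<tau> ` stabilizer W act x \<subseteq> stabilizer W act (\<sigma> x)" using mem x by blast
    show "stabilizer W act (\<sigma> x) \<subseteq> \<tau> ` stabilizer W act x"
    proof
      fix w assume w: "w \<in> stabilizer W act (\<sigma> x)"
      then have "\<tau> w \<in> stabilizer W act x" using mem[OF w sigma_closed[OF x]] by (simp add: sigma_sigma)
      moreover have "w = \<tau> (\<tau> w)" using w tau_tau by (simp add: stabilizer_def)
      ultimately show "w \<in> \<tau> ` stabilizer W act x" by blast
    qed
  qed
qed

lemma tau_Wp: "\<tau> ` Wp = Wp"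
  using stabilizer_sigma[OF p_closed] by (simp add: sigma_p)

lemma sigma_stratum: "q \<in> F \<Longrightarrow> \<sigma> q \<in> F"
  using stabilizer_sigma[of q] tau_Wp sigma_closed by simp

lemma tau_Nz: assumes w: "w \<in> Nz" shows "\<tau> w \<in> Nz"
  unfolding normalizer_iff[OF p_stratum]
proof
  show "\<tau> w \<in> carrier W" using tau_closed NzD(1)[OF w] .
  have "act (\<tau> w) p = \<sigma> (act w p)" using sigma_act[OF NzD(1)[OF w] p_closed] by (simp add: sigma_p)
  then show "act (\<tau> w) p \<in> F" using sigma_stratum[OF NzD(2)[OF w p_stratum]] by (simp only:)
qed

lemma gamma_cls:
  assumes w: "w \<in> Nz" shows "\<gamma> (cls w) = cls (\<tau> w)"
proof -
  have "\<tau> ` (\<Union>h\<in>Wp. {h \<otimes>\<^bsub>W\<^esub> w}) = (\<Union>h\<in>Wp. {\<tau> (h \<otimes>\<^bsub>W\<^esub> w)})" by blast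
  also have "\<dots> = (\<Union>h\<in>Wp. {\<tau> h \<otimes>\<^bsub>W\<^esub> \<tau> w})"
    using hom_mult[OF tau_hom] NzD(1)[OF w] by (auto simp: stabilizer_def)
  also have "\<dots> = (\<Union>h\<in>\<tau> ` Wp. {h \<otimes>\<^bsub>W\<^esub> \<tau> w})" by blast
  finally show ?thesis unfolding r_coset_def tau_Wp .
qed

lemma inv_Q:
  assumes w: "w \<in> Nz" shows "inv\<^bsub>Q\<^esub> (cls w) = cls (inv\<^bsub>W\<^esub> w)"
proof -
  interpret Q: group Q by (rule group_Q)
  have v: "inv\<^bsub>W\<^esub> w \<in> Nz" using subgroup.m_inv_closed[OF Nz_subgroup w] .
  have "cls (inv\<^bsub>W\<^esub> w) \<otimes>\<^bsub>Q\<^esub> cls w = \<one>\<^bsub>Q\<^esub>" using NzD(1)[OF w] by (simp add: mult_Q[OF v w] one_Q)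
  then show ?thesis using w v by (intro Q.inv_equality) (auto simp: carrier_Q)
qed

text \<open>The description, which is the body of \<open>component_map\<close>, uses left cosets and
  the factor group uses right cosets; they agree because Wp is normal in its normalizer.\<close>

lemma component_map_eq:
  assumes w: "w \<in> Nz" and eq: "act w p = \<psi> n p"
  shows "(THE C. \<exists>v\<in>Nz. act v p = \<psi> n p \<and> C = v <#\<^bsub>W\<^esub> Wp) = cls w"
proof -
  interpret N: normal Wp "W\<lparr>carrier := Nz\<rparr>" by (rule Wp_normal)
  have lr: "v <#\<^bsub>W\<^esub> Wp = cls v" if "v \<in> Nz" for v
    using N.coset_eq that by (simp add: l_coset_def r_coset_def)
  show ?thesis
  proof (rule the_equality)
    show "\<exists>v\<in>Nz. act v p = \<psi> n p \<and> cls w = v <#\<^bsub>W\<^esub> Wp" using w eq lr by auto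
    fix C assume "\<exists>v\<in>Nz. act v p = \<psi> n p \<and> C = v <#\<^bsub>W\<^esub> Wp"
    then obtain v where v: "v \<in> Nz" "act v p = \<psi> n p" "C = cls v" using lr by auto
    show "C = cls w" unfolding v(3) by (rule cls_eqI[OF v(1) w p_stratum]) (simp add: v(2) eq)
  qed
qed

text \<open>The cohomological part, separated from Lie theory. \<open>conj\<close> stands for
  Vinberg's theorem, \<open>lift\<close> for the surjectivity of \<psi>, and \<open>rigid\<close>
  says that an element preserving the stratum acts on it as the Weyl element prescribed by its value
  at p.\<close>

lemma real_point_criterion:
  fixes Ghat :: "'g alg_group" and \<psi> :: "'g \<Rightarrow> 'a \<Rightarrow> 'a" and n g :: "nat \<Rightarrow> 'g"
  assumes Ghat: "group Ghat" and psi_one: "\<psi> \<one>\<^bsub>Ghat\<^esub> = id"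
    and psi_mult: "\<And>k l. k \<in> carrier Ghat \<Longrightarrow> l \<in> carrier Ghat \<Longrightarrow> \<psi> (k \<otimes>\<^bsub>Ghat\<^esub> l) = \<psi> k \<circ> \<psi> l"
    and sigma_psi: "\<And>k x. k \<in> carrier Ghat \<Longrightarrow> \<sigma>hat k \<in> carrier Ghat \<and> \<sigma> (\<psi> k x) = \<psi> (\<sigma>hat k) (\<sigma> x)"
    and conj: "\<And>k x. k \<in> carrier Ghat \<Longrightarrow> x \<in> c \<Longrightarrow> \<psi> k x \<in> c \<Longrightarrow> \<exists>w\<in>carrier W. act w x = \<psi> k x"
    and lift: "\<And>w. w \<in> carrier W \<Longrightarrow> \<exists>k\<in>carrier Ghat. \<forall>x\<in>c. \<psi> k x = act w x"
    and rigid: "\<And>k w x. k \<in> carrier Ghat \<Longrightarrow> \<forall>x\<in>F. \<psi> k x \<in> F \<Longrightarrow> w \<in> Nz \<Longrightarrow> act w p = \<psi> k p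
      \<Longrightarrow> x \<in> F \<Longrightarrow> \<psi> k x = act w x"
    and H1: "H1 Q \<gamma> = (\<lambda>i. cohomology_class Q \<gamma> (\<delta> i)) ` {1..s}"
    and delta: "\<And>i. i \<in> {1..s} \<Longrightarrow> \<delta> i \<in> carrier Q"
    and n: "\<And>i. i \<in> {1..s} \<Longrightarrow> n i \<in> carrier Ghat \<and> (\<forall>x\<in>F. \<psi> (n i) x \<in> F) \<and>
      (THE C. \<exists>v\<in>Nz. act v p = \<psi> (n i) p \<and> C = v <#\<^bsub>W\<^esub> Wp) = \<delta> i"
    and g: "\<And>i. i \<in> {1..s} \<Longrightarrow> g i \<in> carrier Ghat \<and> inv\<^bsub>Ghat\<^esub> (g i) \<otimes>\<^bsub>Ghat\<^esub> \<sigma>hat (g i) = n i"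
    and q: "q \<in> F"
  shows "((\<exists>x\<in>orbit Ghat \<psi> q. \<sigma> x = x) \<longleftrightarrow>
      (\<exists>q'\<in>orbit Ghat \<psi> q \<inter> F. \<exists>i\<in>{1..s}. \<sigma> q' = coset_act act (inv\<^bsub>Q\<^esub> (\<delta> i)) q')) \<and>
    (\<forall>i\<in>{1..s}. \<forall>q'\<in>orbit Ghat \<psi> q \<inter> F. \<sigma> q' = coset_act act (inv\<^bsub>Q\<^esub> (\<delta> i)) q' \<longrightarrow>
      \<psi> (g i) q' \<in> orbit Ghat \<psi> q \<and> \<sigma> (\<psi> (g i) q') = \<psi> (g i) q')"
proof -
  interpret H: group Ghat by (rule Ghat)
  interpret Q: group Q by (rule group_Q)
  have psi_inv: "\<psi> (inv\<^bsub>Ghat\<^esub> k) (\<psi> k x) = x" if "k \<in> carrier Ghat" for k x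
    using psi_mult[of "inv\<^bsub>Ghat\<^esub> k" k] that psi_one by (simp add: fun_eq_iff)
  have orb: "\<psi> k y \<in> orbit Ghat \<psi> q" if y: "y \<in> orbit Ghat \<psi> q" and k: "k \<in> carrier Ghat" for k y
  proof -
    obtain l where l: "l \<in> carrier Ghat" "y = \<psi> l q" using y unfolding orbit_def by blast
    have "\<psi> k y = \<psi> (k \<otimes>\<^bsub>Ghat\<^esub> l) q" by (simp add: psi_mult[OF k l(1)] l(2))
    then show ?thesis unfolding orbit_def using H.m_closed[OF k l(1)] by blast
  qed
  \<comment> \<open>With g^-1 \<sigma>(g) = n one has \<sigma>(g q') = g n \<sigma>(q') = g \<delta>
    \<delta>^-1 q' = g q'. Here n acts on \<sigma> q', in general a point other than p, which is why
    \<open>rigid\<close> is called upon.\<close>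
  have real: "\<sigma> (\<psi> (g i) q') = \<psi> (g i) q'"
    if i: "i \<in> {1..s}" and q': "q' \<in> F" "\<sigma> q' = coset_act act (inv\<^bsub>Q\<^esub> (\<delta> i)) q'" for i q'
  proof -
    have ni: "n i \<in> carrier Ghat" "\<forall>x\<in>F. \<psi> (n i) x \<in> F" using n[OF i] by blast+
    have "\<psi> (n i) p \<in> F" using ni(2) p_stratum by blast
    then obtain w where w: "w \<in> carrier W" "act w p = \<psi> (n i) p" using conj[OF ni(1) p_closed] by blast
    have wN: "w \<in> Nz" unfolding normalizer_iff[OF p_stratum] w(2) using w(1) \<open>\<psi> (n i) p \<in> F\<close> by blast
    have d: "\<delta> i = cls w" using n[OF i] component_map_eq[of w \<psi> "n i", OF wN w(2)] by simp
    have vN: "inv\<^bsub>W\<^esub> w \<in> Nz" using subgroup.m_inv_closed[OF Nz_subgroup wN] .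
    have sq: "\<sigma> q' = act (inv\<^bsub>W\<^esub> w) q'" using q'(2) unfolding d inv_Q[OF wN] coset_act_cls[OF vN q'(1)] .
    have vF: "act (inv\<^bsub>W\<^esub> w) q' \<in> F" by (rule NzD(2)[OF vN q'(1)])
    have gi: "g i \<in> carrier Ghat" and ni': "n i = inv\<^bsub>Ghat\<^esub> (g i) \<otimes>\<^bsub>Ghat\<^esub> \<sigma>hat (g i)" using g[OF i] by auto
    have sg: "\<sigma>hat (g i) \<in> carrier Ghat" using sigma_psi[OF gi] by blast
    have gs: "\<sigma>hat (g i) = g i \<otimes>\<^bsub>Ghat\<^esub> n i" unfolding ni' using gi sg by (simp add: H.m_assoc[symmetric])
    have "\<sigma> (\<psi> (g i) q') = \<psi> (g i) (\<psi> (n i) (\<sigma> q'))" using sigma_psi[OF gi] unfolding gs by (simp add: psi_mult[OF gi ni(1)])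
    also have "\<psi> (n i) (\<sigma> q') = act w (act (inv\<^bsub>W\<^esub> w) q')" unfolding sq by (rule rigid[OF ni wN w(2) vF])
    also have "\<dots> = q'" using act_inv(2)[OF w(1)] q'(1) by blast
    finally show ?thesis .
  qed
  have "\<exists>q'\<in>orbit Ghat \<psi> q \<inter> F. \<exists>i\<in>{1..s}. \<sigma> q' = coset_act act (inv\<^bsub>Q\<^esub> (\<delta> i)) q'"
    if x: "x \<in> orbit Ghat \<psi> q" "\<sigma> x = x" for x
  proof -
    obtain k where k: "k \<in> carrier Ghat" "x = \<psi> k q" using x(1) unfolding orbit_def by blast
    have sF: "\<sigma> q \<in> F" by (rule sigma_stratum[OF q])
    \<comment> \<open>Reality of \<psi> k q says exactly that this element carries q to \<sigma>
      q.\<close>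
    let ?k = "inv\<^bsub>Ghat\<^esub> \<sigma>hat k \<otimes>\<^bsub>Ghat\<^esub> k"
    have sk: "\<sigma>hat k \<in> carrier Ghat" "\<sigma> (\<psi> k q) = \<psi> (\<sigma>hat k) (\<sigma> q)" using sigma_psi[OF k(1)] by blast+
    have "\<psi> ?k q = \<psi> (inv\<^bsub>Ghat\<^esub> \<sigma>hat k) (\<psi> (\<sigma>hat k) (\<sigma> q))"
      using psi_mult[OF H.inv_closed[OF sk(1)] k(1)] sk(2) x(2) k(2) by simp
    then have sq: "\<psi> ?k q = \<sigma> q" by (simp add: psi_inv[OF sk(1)])
    obtain w where w: "w \<in> carrier W" "act w q = \<sigma> q" using conj[of ?k q] k(1) sk(1) q sF unfolding sq by auto
    have wN: "w \<in> Nz" unfolding normalizer_iff[OF q] w(2) using w(1) sF by blast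
    have tN: "\<tau> w \<in> Nz" by (rule tau_Nz[OF wN])
    have vN: "inv\<^bsub>W\<^esub> w \<in> Nz" and tvN: "\<tau> (inv\<^bsub>W\<^esub> w) \<in> Nz"
      using subgroup.m_inv_closed[OF Nz_subgroup wN] tau_Nz by blast+
    have return: "act (inv\<^bsub>W\<^esub> w) (\<sigma> q) = q" unfolding w(2)[symmetric] using act_inv(1)[OF w(1)] q by blast
    \<comment> \<open>The inverse of w is taken as the cocycle, in accordance with the inverse of
      \<delta> in the condition on q'.\<close>
    have "act (inv\<^bsub>W\<^esub> w \<otimes>\<^bsub>W\<^esub> \<tau> (inv\<^bsub>W\<^esub> w)) q = q"
    proof -
      have "act (\<tau> (inv\<^bsub>W\<^esub> w)) q = act (\<tau> (inv\<^bsub>W\<^esub> w)) (\<sigma> (\<sigma> q))" by (simp add: sigma_sigma)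
      also have "\<dots> = \<sigma> (act (inv\<^bsub>W\<^esub> w) (\<sigma> q))" using sigma_act[of "inv\<^bsub>W\<^esub> w" "\<sigma> q"] w(1) sF by simp
      also have "\<dots> = \<sigma> q" by (simp only: return)
      finally have 1: "act (\<tau> (inv\<^bsub>W\<^esub> w)) q = \<sigma> q" .
      have "act (inv\<^bsub>W\<^esub> w \<otimes>\<^bsub>W\<^esub> \<tau> (inv\<^bsub>W\<^esub> w)) q = act (inv\<^bsub>W\<^esub> w) (\<sigma> q)"
        using act_mult[of "inv\<^bsub>W\<^esub> w" "\<tau> (inv\<^bsub>W\<^esub> w)" q] NzD(1)[OF vN] NzD(1)[OF tvN] q 1 by simp
      also have "\<dots> = q" by (rule return)
      finally show ?thesis .
    qed
    then have "cls (inv\<^bsub>W\<^esub> w \<otimes>\<^bsub>W\<^esub> \<tau> (inv\<^bsub>W\<^esub> w)) = cls \<one>\<^bsub>W\<^esub>"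
      using act_one q by (intro cls_eqI[OF subgroup.m_closed[OF Nz_subgroup vN tvN] subgroup.one_closed[OF Nz_subgroup] q]) auto
    then have "cls (inv\<^bsub>W\<^esub> w) \<in> cocycles Q \<gamma>"
      unfolding cocycles_def using vN by (simp add: carrier_Q gamma_cls[OF vN] mult_Q[OF vN tvN] one_Q)
    then have co: "cls (inv\<^bsub>W\<^esub> w) \<in> cohomology_class Q \<gamma> (cls (inv\<^bsub>W\<^esub> w))" "cohomology_class Q \<gamma> (cls (inv\<^bsub>W\<^esub> w)) \<in> H1 Q \<gamma>"
    proof -
      assume z: "cls (inv\<^bsub>W\<^esub> w) \<in> cocycles Q \<gamma>"
      then have zc: "cls (inv\<^bsub>W\<^esub> w) \<in> carrier Q" by (simp add: cocycles_def)
      have 1: "\<gamma> \<one>\<^bsub>Q\<^esub> = \<one>\<^bsub>Q\<^esub>"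
        unfolding one_Q gamma_cls[OF subgroup.one_closed[OF Nz_subgroup]] using group_hom.hom_one[OF group_hom.intro[OF group_W group_W group_hom_axioms.intro[OF tau_hom]]] by simp
      have "cls (inv\<^bsub>W\<^esub> w) = inv\<^bsub>Q\<^esub> \<one>\<^bsub>Q\<^esub> \<otimes>\<^bsub>Q\<^esub> cls (inv\<^bsub>W\<^esub> w) \<otimes>\<^bsub>Q\<^esub> \<gamma> \<one>\<^bsub>Q\<^esub>" unfolding 1 using zc by simp
      then show "cls (inv\<^bsub>W\<^esub> w) \<in> cohomology_class Q \<gamma> (cls (inv\<^bsub>W\<^esub> w))"
        unfolding cohomology_class_def using z Q.one_closed by blast
      show "cohomology_class Q \<gamma> (cls (inv\<^bsub>W\<^esub> w)) \<in> H1 Q \<gamma>" unfolding H1_def using z by blast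
    qed
    obtain i where i: "i \<in> {1..s}" "cohomology_class Q \<gamma> (cls (inv\<^bsub>W\<^esub> w)) = cohomology_class Q \<gamma> (\<delta> i)"
      using co(2) unfolding H1 by blast
    then obtain B where B: "B \<in> carrier Q" "cls (inv\<^bsub>W\<^esub> w) = inv\<^bsub>Q\<^esub> B \<otimes>\<^bsub>Q\<^esub> \<delta> i \<otimes>\<^bsub>Q\<^esub> \<gamma> B"
      using co(1) unfolding cohomology_class_def by blast
    obtain b where b: "b \<in> Nz" "B = cls b" using B(1) unfolding carrier_Q by blast
    obtain d where d: "d \<in> Nz" "\<delta> i = cls d" using delta[OF i(1)] unfolding carrier_Q by blast
    have bN: "inv\<^bsub>W\<^esub> b \<in> Nz" "\<tau> b \<in> Nz" "inv\<^bsub>W\<^esub> d \<in> Nz"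
      using subgroup.m_inv_closed[OF Nz_subgroup] b(1) d(1) tau_Nz by blast+
    note Nc = NzD(1)
    let ?q = "act b q"
    have qF: "?q \<in> F" by (rule NzD(2)[OF b(1) q])
    have "\<gamma> B = cls (\<tau> b)" unfolding b(2) by (rule gamma_cls[OF b(1)])
    then have gB: "\<gamma> B \<in> carrier Q" using bN(2) carrier_Q by blast
    \<comment> \<open>The coboundary relation, solved for the class of w, reads \<gamma>(B) [w] =
      \<delta>^-1 B. Applied to q it becomes \<sigma>(b q) = \<tau>(b) w q = d^-1 b q, the condition
      for q' = b q.\<close>
    have "\<gamma> B \<otimes>\<^bsub>Q\<^esub> inv\<^bsub>Q\<^esub> (cls (inv\<^bsub>W\<^esub> w)) = inv\<^bsub>Q\<^esub> (\<delta> i) \<otimes>\<^bsub>Q\<^esub> B"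
      unfolding B(2) using B(1) gB delta[OF i(1)]
      by (simp add: Q.inv_mult_group Q.m_assoc) (simp add: Q.m_assoc[symmetric])
    moreover have "inv\<^bsub>Q\<^esub> (cls (inv\<^bsub>W\<^esub> w)) = cls w" using inv_Q[OF vN] w(1) by simp
    ultimately have "cls (\<tau> b \<otimes>\<^bsub>W\<^esub> w) = cls (inv\<^bsub>W\<^esub> d \<otimes>\<^bsub>W\<^esub> b)"
      unfolding d(2) b(2) inv_Q[OF d(1)] mult_Q[OF bN(3) b(1)] by (simp only: gamma_cls[OF b(1)] mult_Q[OF bN(2) wN])
    moreover have "\<tau> b \<otimes>\<^bsub>W\<^esub> w \<in> Nz" "inv\<^bsub>W\<^esub> d \<otimes>\<^bsub>W\<^esub> b \<in> Nz"
      using subgroup.m_closed[OF Nz_subgroup] bN wN b(1) by blast+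
    ultimately have "act (\<tau> b \<otimes>\<^bsub>W\<^esub> w) q = act (inv\<^bsub>W\<^esub> d \<otimes>\<^bsub>W\<^esub> b) q"
      using coset_act_cls[OF _ q] by metis
    then have "act (\<tau> b) (act w q) = act (inv\<^bsub>W\<^esub> d) ?q"
      using act_mult[of "\<tau> b" w q] act_mult[of "inv\<^bsub>W\<^esub> d" b q] Nc bN wN b(1) q by simp
    then have "\<sigma> ?q = act (inv\<^bsub>W\<^esub> d) ?q" unfolding w(2) using sigma_act[of b q] Nc[OF b(1)] q by simp
    also have "\<dots> = coset_act act (inv\<^bsub>Q\<^esub> (\<delta> i)) ?q" unfolding d(2) inv_Q[OF d(1)] coset_act_cls[OF bN(3) qF] by (rule refl)
    finally have "\<sigma> ?q = coset_act act (inv\<^bsub>Q\<^esub> (\<delta> i)) ?q" .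
    moreover have "?q \<in> orbit Ghat \<psi> q"
    proof -
      obtain l where "l \<in> carrier Ghat" "\<forall>x\<in>c. \<psi> l x = act b x" using lift[OF Nc[OF b(1)]] by blast
      then show ?thesis using q unfolding orbit_def by force
    qed
    ultimately show ?thesis using qF i(1) by blast
  qed
  then show ?thesis using real orb g by blast
qed

end

section \<open>The Weyl group as a group with Galois action\<close>

context real_graded_space
begin

abbreviation stabilizer_group :: "('a \<Rightarrow> 'a) monoid" where
  "stabilizer_group \<equiv> \<lparr>carrier = hC_stabilizer, monoid.mult = (\<circ>), one = id\<rparr>"

abbreviation fixer :: "('a \<Rightarrow> 'a) set" where
  "fixer \<equiv> {g \<in> G0. \<forall>x\<in>hC. g x = x}"

abbreviation weyl_class :: "('a \<Rightarrow> 'a) \<Rightarrow> ('a \<Rightarrow> 'a) set" where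
  "weyl_class w \<equiv> fixer #>\<^bsub>stabilizer_group\<^esub> w"

lemma weyl_class_eq: "weyl_class w = {k \<circ> w | k. k \<in> fixer}"
  by (auto simp: r_coset_def)

lemma hC_stabilizer_inv:
  assumes w: "w \<in> hC_stabilizer" shows "inv_into UNIV w \<in> hC_stabilizer"
proof -
  have wG: "w \<in> G0" "w ` hC = hC" using w by auto
  have "inv_into UNIV w ` hC = inv_into UNIV w ` (w ` hC)" unfolding wG(2) by (rule refl)
  also have "\<dots> = hC" unfolding image_image G0_inverse(1)[OF wG(1)] by simp
  finally show ?thesis using G0_inv[OF wG(1)] by simp
qed

lemma hC_stabilizer_comp:
  assumes "v \<in> hC_stabilizer" "w \<in> hC_stabilizer" shows "v \<circ> w \<in> hC_stabilizer"
proof -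
  have "(v \<circ> w) ` hC = v ` (w ` hC)" by (rule image_comp[symmetric])
  then have "(v \<circ> w) ` hC = hC" using assms by simp
  then show ?thesis using G.G0_comp[of v w] assms by blast
qed

lemma group_stabilizer: "group stabilizer_group"
proof (rule groupI)
  show "\<one>\<^bsub>stabilizer_group\<^esub> \<in> carrier stabilizer_group" using G.G0_id by simp
  show "v \<otimes>\<^bsub>stabilizer_group\<^esub> w \<in> carrier stabilizer_group"
    if "v \<in> carrier stabilizer_group" "w \<in> carrier stabilizer_group" for v w
    using hC_stabilizer_comp that by (simp only: partial_object.select_convs monoid.select_convs)
  show "\<exists>v\<in>carrier stabilizer_group. v \<otimes>\<^bsub>stabilizer_group\<^esub> w = \<one>\<^bsub>stabilizer_group\<^esub>" if "w \<in> carrier stabilizer_group" for w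
  proof (rule bexI)
    have w: "w \<in> hC_stabilizer" using that by simp
    show "inv_into UNIV w \<in> carrier stabilizer_group" using hC_stabilizer_inv[OF w] by simp
    show "inv_into UNIV w \<otimes>\<^bsub>stabilizer_group\<^esub> w = \<one>\<^bsub>stabilizer_group\<^esub>"
      using w G0_inverse(1)[of w] by (simp add: fun_eq_iff)
  qed
qed (simp_all add: comp_assoc)

lemma inv_stabilizer:
  assumes w: "w \<in> hC_stabilizer" shows "inv\<^bsub>stabilizer_group\<^esub> w = inv_into UNIV w"
proof (rule group.inv_equality[OF group_stabilizer])
  show "inv_into UNIV w \<otimes>\<^bsub>stabilizer_group\<^esub> w = \<one>\<^bsub>stabilizer_group\<^esub>"
    using w G0_inverse(1)[of w] by (simp add: fun_eq_iff)
qed (use w hC_stabilizer_inv[OF w] in simp_all)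

lemma fixer_inv: "k \<in> fixer \<Longrightarrow> inv_into UNIV k \<in> fixer"
proof -
  assume k: "k \<in> fixer"
  then have kG: "k \<in> G0" by blast
  have "inv_into UNIV k x = x" if "x \<in> hC" for x using k that G0_inverse(1)[OF kG, of x] by simp
  then show ?thesis using G0_inv[OF kG] by blast
qed

lemma fixer_stabilizer: "fixer \<subseteq> hC_stabilizer"
  by force

lemma fixer_normal: "fixer \<lhd> stabilizer_group"
proof -
  interpret S: group stabilizer_group by (rule group_stabilizer)
  have "subgroup fixer stabilizer_group"
  proof (rule S.subgroupI)
    show "fixer \<subseteq> carrier stabilizer_group" using fixer_stabilizer by simp
    show "fixer \<noteq> {}" using G.G0_id by force
    show "inv\<^bsub>stabilizer_group\<^esub> k \<in> fixer" if "k \<in> fixer" for k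
      using fixer_inv[OF that] inv_stabilizer[of k] fixer_stabilizer that by (metis (no_types, lifting) subsetD)
    show "k \<otimes>\<^bsub>stabilizer_group\<^esub> l \<in> fixer" if "k \<in> fixer" "l \<in> fixer" for k l
      using that G.G0_comp[of k l] by simp
  qed
  moreover have "w \<otimes>\<^bsub>stabilizer_group\<^esub> k \<otimes>\<^bsub>stabilizer_group\<^esub> inv\<^bsub>stabilizer_group\<^esub> w \<in> fixer"
    if "w \<in> carrier stabilizer_group" "k \<in> fixer" for w k
  proof -
    have w: "w \<in> hC_stabilizer" and wi: "inv_into UNIV w \<in> hC_stabilizer" using that(1) hC_stabilizer_inv by auto
    have wG: "w \<in> G0" "inv_into UNIV w \<in> G0" using w wi by blast+
    have "inv_into UNIV w x \<in> hC" if "x \<in> hC" for x using wi that by blast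
    then have "(w \<circ> k \<circ> inv_into UNIV w) x = x" if "x \<in> hC" for x
      using that \<open>k \<in> fixer\<close> G0_inverse(2)[OF wG(1)] by simp
    moreover have "w \<circ> k \<circ> inv_into UNIV w \<in> G0" using G.G0_comp wG \<open>k \<in> fixer\<close> by blast
    ultimately show ?thesis unfolding inv_stabilizer[OF w] by simp
  qed
  ultimately show ?thesis unfolding S.normal_inv_iff by blast
qed

lemma weyl_group_eq: "weyl_group G0 hC = stabilizer_group Mod fixer"
  by (simp add: weyl_group_def)

lemma carrier_weyl: "carrier (weyl_group G0 hC) = weyl_class ` hC_stabilizer"
  unfolding weyl_group_eq carrier_FactGroup by simp

lemma mult_weyl:
  assumes "v \<in> hC_stabilizer" "w \<in> hC_stabilizer"
  shows "weyl_class v \<otimes>\<^bsub>weyl_group G0 hC\<^esub> weyl_class w = weyl_class (v \<circ> w)"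
  using normal.rcos_sum[OF fixer_normal, of v w] assms unfolding weyl_group_eq by simp

lemma one_weyl: "\<one>\<^bsub>weyl_group G0 hC\<^esub> = weyl_class id"
  unfolding weyl_group_eq one_FactGroup weyl_class_eq by auto

lemma group_weyl: "group (weyl_group G0 hC)"
  unfolding weyl_group_eq by (rule normal.factorgroup_is_group[OF fixer_normal])

lemma weyl_act_class:
  assumes "w \<in> hC_stabilizer" "x \<in> hC" shows "weyl_act (weyl_class w) x = w x"
proof -
  have "w x \<in> hC" using assms by blast
  then have "g x = w x" if "g \<in> weyl_class w" for g using that unfolding weyl_class_eq by auto
  moreover have "id \<in> fixer" using G.G0_id by simp
  then have "id \<circ> w \<in> weyl_class w" unfolding weyl_class_eq by blast
  then have "w \<in> weyl_class w" by (simp only: id_comp)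
  then have "w x \<in> (\<lambda>g. g x) ` weyl_class w" by (rule imageI)
  ultimately have "(\<lambda>g. g x) ` weyl_class w = {w x}" by blast
  then show ?thesis by (simp add: coset_act_def)
qed

lemma conj_map_apply: "conj_map \<sigma> g x = \<sigma> (g (\<sigma> x))"
  by (simp add: conj_map_def)

lemma conj_map_comp: "conj_map \<sigma> (f \<circ> g) = conj_map \<sigma> f \<circ> conj_map \<sigma> g"
  by (simp add: fun_eq_iff conj_map_apply sigma_sigma)

lemma conj_map_conj_map: "conj_map \<sigma> (conj_map \<sigma> g) = g"
  by (simp add: fun_eq_iff conj_map_apply sigma_sigma)

lemma conj_map_stabilizer:
  assumes stable: "\<And>k. k \<in> G0 \<Longrightarrow> conj_map \<sigma> k \<in> G0" and w: "w \<in> hC_stabilizer"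
  shows "conj_map \<sigma> w \<in> hC_stabilizer"
proof -
  have "conj_map \<sigma> w x \<in> hC" if "x \<in> hC" for x
    unfolding conj_map_apply using w hC_sigma[OF that] by (intro hC_sigma) blast
  then have "conj_map \<sigma> w ` hC = hC" using stable w by (intro hC_image_eq) blast+
  then show ?thesis using stable w by blast
qed

lemma conj_map_class:
  assumes stable: "\<And>k. k \<in> G0 \<Longrightarrow> conj_map \<sigma> k \<in> G0"
  shows "conj_map \<sigma> ` weyl_class w = weyl_class (conj_map \<sigma> w)"
proof -
  have K: "conj_map \<sigma> k \<in> fixer" if "k \<in> fixer" for k
    using that stable[of k] by (auto simp: conj_map_apply hC_sigma sigma_sigma)
  show ?thesis
  proof
    show "conj_map \<sigma> ` weyl_class w \<subseteq> weyl_class (conj_map \<sigma> w)"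
      unfolding weyl_class_eq using K by (auto simp: conj_map_comp)
    show "weyl_class (conj_map \<sigma> w) \<subseteq> conj_map \<sigma> ` weyl_class w"
    proof
      fix u assume "u \<in> weyl_class (conj_map \<sigma> w)"
      then obtain k where k: "k \<in> fixer" "u = k \<circ> conj_map \<sigma> w" unfolding weyl_class_eq by blast
      have "u = conj_map \<sigma> (conj_map \<sigma> k \<circ> w)" by (simp add: k(2) conj_map_comp conj_map_conj_map)
      then show "u \<in> conj_map \<sigma> ` weyl_class w" unfolding weyl_class_eq using K[OF k(1)] by blast
    qed
  qed
qed

lemma galois_action_weyl:
  assumes stable: "\<And>k. k \<in> G0 \<Longrightarrow> conj_map \<sigma> k \<in> G0" and p: "p \<in> h"
  shows "galois_action (weyl_group G0 hC) weyl_act hC (\<lambda>w. conj_map \<sigma> ` w) \<sigma> p"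
proof (rule galois_action.intro)
  let ?W = "weyl_group G0 hC"
  have conjN: "conj_map \<sigma> w \<in> hC_stabilizer" if "w \<in> hC_stabilizer" for w
    by (rule conj_map_stabilizer[OF _ that]) (rule stable)
  have conjC: "conj_map \<sigma> ` weyl_class w = weyl_class (conj_map \<sigma> w)" for w
    by (rule conj_map_class) (rule stable)
  show "group ?W" by (rule group_weyl)
  show "weyl_act C x \<in> hC" if C: "C \<in> carrier ?W" and x: "x \<in> hC" for C x
  proof -
    obtain v where v: "v \<in> hC_stabilizer" "C = weyl_class v" using C unfolding carrier_weyl by blast
    show ?thesis unfolding v(2) weyl_act_class[OF v(1) x] using v(1) x by blast
  qed
  show "weyl_act \<one>\<^bsub>?W\<^esub> x = x" if "x \<in> hC" for x
    unfolding one_weyl using weyl_act_class[of id x] that G.G0_id by simp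
  show "weyl_act (C \<otimes>\<^bsub>?W\<^esub> D) x = weyl_act C (weyl_act D x)" if CD: "C \<in> carrier ?W" "D \<in> carrier ?W" and x: "x \<in> hC" for C D x
  proof -
    obtain v w where v: "v \<in> hC_stabilizer" "C = weyl_class v" and w: "w \<in> hC_stabilizer" "D = weyl_class w"
      using CD unfolding carrier_weyl by blast
    have wx: "w x \<in> hC" using w(1) x by blast
    show ?thesis unfolding v(2) w(2) mult_weyl[OF v(1) w(1)] weyl_act_class[OF w(1) x] weyl_act_class[OF v(1) wx]
      weyl_act_class[OF hC_stabilizer_comp[OF v(1) w(1)] x] by simp
  qed
  show "(\<lambda>w. conj_map \<sigma> ` w) \<in> hom ?W ?W"
  proof (rule homI)
    show "conj_map \<sigma> ` C \<in> carrier ?W" if C: "C \<in> carrier ?W" for C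
    proof -
      obtain v where v: "v \<in> hC_stabilizer" "C = weyl_class v" using C unfolding carrier_weyl by blast
      show ?thesis unfolding v(2) conjC carrier_weyl using conjN[OF v(1)] by blast
    qed
    show "conj_map \<sigma> ` (C \<otimes>\<^bsub>?W\<^esub> D) = conj_map \<sigma> ` C \<otimes>\<^bsub>?W\<^esub> conj_map \<sigma> ` D"
      if CD: "C \<in> carrier ?W" "D \<in> carrier ?W" for C D
    proof -
      obtain v w where v: "v \<in> hC_stabilizer" "C = weyl_class v" and w: "w \<in> hC_stabilizer" "D = weyl_class w"
        using CD unfolding carrier_weyl by blast
      show ?thesis unfolding v(2) w(2) mult_weyl[OF v(1) w(1)] conjC mult_weyl[OF conjN[OF v(1)] conjN[OF w(1)]]
        by (simp only: conj_map_comp)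
    qed
  qed
  show "conj_map \<sigma> ` conj_map \<sigma> ` C = C" for C
    by (simp only: image_image conj_map_conj_map image_ident)
  show "\<sigma> (\<sigma> x) = x" for x by (rule sigma_sigma)
  show "\<sigma> x \<in> hC" if "x \<in> hC" for x by (rule hC_sigma[OF that])
  show "\<sigma> (weyl_act C x) = weyl_act (conj_map \<sigma> ` C) (\<sigma> x)" if C: "C \<in> carrier ?W" and x: "x \<in> hC" for C x
  proof -
    obtain v where v: "v \<in> hC_stabilizer" "C = weyl_class v" using C unfolding carrier_weyl by blast
    show ?thesis unfolding v(2) conjC weyl_act_class[OF v(1) x] weyl_act_class[OF conjN[OF v(1)] hC_sigma[OF x]]
      by (simp add: conj_map_apply sigma_sigma)
  qed
  show "p \<in> hC" using p by (rule span_base)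
  show "\<sigma> p = p" by (rule h_elem(2)[OF p])
qed

text \<open>Passes from stabilizers in the Weyl group, which are sets of cosets, to elements of
  \<open>G0\<close>; this is the form in which \<open>fixes_stratum\<close> describes the
  stratum.\<close>

lemma stratum_eq:
  assumes "p \<in> hC"
  shows "{q \<in> hC. stabilizer (weyl_group G0 hC) weyl_act q = stabilizer (weyl_group G0 hC) weyl_act p}
    = {q \<in> hC. \<forall>w\<in>hC_stabilizer. w q = q \<longleftrightarrow> w p = p}"
proof -
  have mem: "weyl_class w \<in> stabilizer (weyl_group G0 hC) weyl_act q \<longleftrightarrow> w q = q"
    if "w \<in> hC_stabilizer" "q \<in> hC" for w q
  proof -
    have "weyl_class w \<in> carrier (weyl_group G0 hC)" unfolding carrier_weyl using that(1) by (rule imageI)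
    then show ?thesis by (simp only: stabilizer_def mem_Collect_eq weyl_act_class[OF that] simp_thms)
  qed
  have sub: "stabilizer (weyl_group G0 hC) weyl_act q \<subseteq> weyl_class ` hC_stabilizer" for q
    by (auto simp: stabilizer_def carrier_weyl)
  have iff: "stabilizer (weyl_group G0 hC) weyl_act q = stabilizer (weyl_group G0 hC) weyl_act p
      \<longleftrightarrow> (\<forall>w\<in>hC_stabilizer. w q = q \<longleftrightarrow> w p = p)" (is "?l = ?r") if "q \<in> hC" for q
  proof
    show ?r if e: ?l
    proof
      fix w assume w: "w \<in> hC_stabilizer"
      show "w q = q \<longleftrightarrow> w p = p" using mem[OF w \<open>q \<in> hC\<close>] mem[OF w assms] unfolding e by (rule subst)
    qed
    show ?l if r: ?r
    proof (rule Set.set_eqI)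
      fix C
      show "C \<in> stabilizer (weyl_group G0 hC) weyl_act q \<longleftrightarrow> C \<in> stabilizer (weyl_group G0 hC) weyl_act p"
      proof (cases "C \<in> weyl_class ` hC_stabilizer")
        case True
        then obtain w where w: "w \<in> hC_stabilizer" "C = weyl_class w" by blast
        show ?thesis unfolding w(2) mem[OF w(1) \<open>q \<in> hC\<close>] mem[OF w(1) assms] using r w(1) by blast
      next
        case False
        then show ?thesis using sub by blast
      qed
    qed
  qed
  show ?thesis by (rule Collect_cong, rule conj_cong[OF refl], rule iff)
qed

end

theorem proposition4p14:
  fixes sc :: "complex \<Rightarrow> 'a::ab_group_add \<Rightarrow> 'a"
    and bracket :: "'a \<Rightarrow> 'a \<Rightarrow> 'a"
    and m :: nat and gr :: "nat \<Rightarrow> 'a set" and \<omega> :: complex and \<theta> :: "'a \<Rightarrow> 'a"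
    and G0 :: "('a \<Rightarrow> 'a) set"
    and Ghat :: "'g alg_group" and \<psi> :: "'g \<Rightarrow> 'a \<Rightarrow> 'a"
    and \<sigma> :: "'a \<Rightarrow> 'a" and \<sigma>hat :: "'g \<Rightarrow> 'g"
    and h hC :: "'a set"
    and W :: "('a \<Rightarrow> 'a) set monoid"
    and N j0 :: nat and ps :: "nat \<Rightarrow> 'a" and p :: 'a
    and F :: "'a set"
    and Wp :: "('a \<Rightarrow> 'a) set set"
    and \<Gamma>p :: "('a \<Rightarrow> 'a) set set monoid"
    and \<gamma>p :: "('a \<Rightarrow> 'a) set set \<Rightarrow> ('a \<Rightarrow> 'a) set set"
    and NF :: "'g set"
    and \<phi> :: "'g \<Rightarrow> ('a \<Rightarrow> 'a) set set"
    and s :: nat and \<delta> :: "nat \<Rightarrow> ('a \<Rightarrow> 'a) set set" and n g :: "nat \<Rightarrow> 'g"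
    and q :: 'a and \<O> :: "'a set"
  assumes graded: "graded_lie_algebra_automorphism sc bracket m gr \<omega> \<theta>"
    and G0: "connected_subgroup_with_lie_algebra sc bracket (gr 0) G0"
    and Ghat: "reductive_group Ghat"
    and \<psi>: "surjective_morphism_with_lie_algebra_iso sc bracket (gr 0) G0 Ghat \<psi>"
    and \<sigma>: "conjugation sc bracket \<sigma>" "\<And>i. \<sigma> ` gr i \<subseteq> gr i"
    and \<sigma>hat: "antiregular_involution Ghat \<sigma>hat"
    and \<psi>_\<sigma>: "\<And>x. x \<in> carrier Ghat \<Longrightarrow> \<psi> (\<sigma>hat x) = conj_map \<sigma> (\<psi> x)"
    and h: "real_cartan_subspace sc bracket (real_points \<sigma> (gr 1)) h"
    and hC: "hC = module.span sc h"
    and W: "W = weyl_group G0 hC"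
    and ps: "\<And>j. j \<in> {1..N} \<Longrightarrow> ps j \<in> h"
      "\<And>r. r \<in> hC \<Longrightarrow> \<exists>!j. j \<in> {1..N} \<and>
         conjugate_subgroups W (weyl_stabilizer W r) (weyl_stabilizer W (ps j))"
    and p: "j0 \<in> {1..N}" "p = ps j0"
    and F: "F = stratum W hC p"
    and Wp: "Wp = weyl_stabilizer W p"
    and \<Gamma>p: "\<Gamma>p = normalizer_quotient W Wp"
    and \<gamma>p: "\<gamma>p = (\<lambda>C. (\<lambda>w. conj_map \<sigma> ` w) ` C)"
    and NF: "NF = set_normalizer Ghat \<psi> F"
    and \<phi>: "\<phi> = component_map W p \<psi>"
    and H1_Ghat: "H1 Ghat \<sigma>hat = {cohomology_class Ghat \<sigma>hat \<one>\<^bsub>Ghat\<^esub>}"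
    and \<delta>: "\<And>i. i \<in> {1..s} \<Longrightarrow> \<delta> i \<in> cocycles \<Gamma>p \<gamma>p"
      "H1 \<Gamma>p \<gamma>p = (\<lambda>i. cohomology_class \<Gamma>p \<gamma>p (\<delta> i)) ` {1..s}"
    and n: "\<And>i. i \<in> {1..s} \<Longrightarrow> n i \<in> cocycles (Ghat\<lparr>carrier := NF\<rparr>) \<sigma>hat \<and> \<phi> (n i) = \<delta> i"
    and g: "\<And>i. i \<in> {1..s} \<Longrightarrow>
         g i \<in> carrier Ghat \<and> inv\<^bsub>Ghat\<^esub> (g i) \<otimes>\<^bsub>Ghat\<^esub> \<sigma>hat (g i) = n i"
    and q: "q \<in> F"
    and \<O>: "\<O> = orbit Ghat \<psi> q"
  shows "((\<exists>x\<in>\<O>. \<sigma> x = x) \<longleftrightarrow>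
           (\<exists>q'\<in>\<O> \<inter> F. \<exists>i\<in>{1..s}. \<sigma> q' = coset_act weyl_act (inv\<^bsub>\<Gamma>p\<^esub> (\<delta> i)) q')) \<and>
         (\<forall>i\<in>{1..s}. \<forall>q'\<in>\<O> \<inter> F. \<sigma> q' = coset_act weyl_act (inv\<^bsub>\<Gamma>p\<^esub> (\<delta> i)) q' \<longrightarrow>
           \<psi> (g i) q' \<in> \<O> \<and> \<sigma> (\<psi> (g i) q') = \<psi> (g i) q')"
proof -
  interpret graded_lie_algebra_automorphism sc bracket m gr \<omega> \<theta> by (rule graded)
  obtain B where B: "finite B" "span B = UNIV" using finite_dimensional by blast
  obtain Basis where Basis: "Basis \<subseteq> B" "independent Basis" "B \<subseteq> span Basis"
    by (rule maximal_independent_subset)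
  have spB: "span Basis = UNIV" using span_minimal[OF Basis(3) subspace_span] B(2) by blast
  interpret real_graded_space sc bracket m gr \<omega> \<theta> Basis G0 \<sigma> h
  proof unfold_locales
    show "finite Basis" using Basis(1) B(1) by (rule finite_subset)
  qed (fact Basis(2) spB G0 \<sigma> h)+
  have psi: "\<psi> \<in> hom Ghat (linear_group sc G0)" "\<psi> ` carrier Ghat = G0"
    using \<psi> by (simp_all add: surjective_morphism_with_lie_algebra_iso_def)
  have group_Ghat: "group Ghat" using Ghat by (simp add: reductive_group_def algebraic_group_def)
  interpret H: group Ghat by (rule group_Ghat)
  have psi_G0: "\<psi> k \<in> G0" if "k \<in> carrier Ghat" for k using psi(2) that by blast
  have psi_mult: "\<psi> (k \<otimes>\<^bsub>Ghat\<^esub> l) = \<psi> k \<circ> \<psi> l" if "k \<in> carrier Ghat" "l \<in> carrier Ghat" for k l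
    using hom_mult[OF psi(1) that] by (simp add: linear_group_def)
  \<comment> \<open>\<open>hom\<close> only records products; the image of the unit is an idempotent
    injective map, hence the identity.\<close>
  have psi_one: "\<psi> \<one>\<^bsub>Ghat\<^esub> = id"
  proof
    fix x
    have "\<psi> \<one>\<^bsub>Ghat\<^esub> (\<psi> \<one>\<^bsub>Ghat\<^esub> x) = \<psi> \<one>\<^bsub>Ghat\<^esub> x" using psi_mult[of "\<one>\<^bsub>Ghat\<^esub>" "\<one>\<^bsub>Ghat\<^esub>"] by (simp add: fun_eq_iff)
    then show "\<psi> \<one>\<^bsub>Ghat\<^esub> x = id x"
      using bij_is_inj[OF G.G0_bij[OF psi_G0[OF H.one_closed]]] by (simp add: inj_eq)
  qed
  have sigma_hat: "\<sigma>hat k \<in> carrier Ghat" if "k \<in> carrier Ghat" for k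
    using \<sigma>hat hom_in_carrier[OF _ that] unfolding antiregular_involution_def by blast
  \<comment> \<open>Stability of \<open>G0\<close> under the conjugation is inherited from
    \<open>Ghat\<close>, as \<psi> is onto and intertwines the two involutions.\<close>
  have stable: "conj_map \<sigma> k \<in> G0" if k: "k \<in> G0" for k
  proof -
    obtain l where l: "l \<in> carrier Ghat" "k = \<psi> l" using k psi(2) by blast
    show ?thesis unfolding l(2) \<psi>_\<sigma>[OF l(1), symmetric] by (rule psi_G0[OF sigma_hat[OF l(1)]])
  qed
  have ph: "p \<in> h" using ps(1)[OF p(1)] p(2) by simp
  then have pC: "p \<in> hC" unfolding hC by (rule span_base)
  interpret A: galois_action W weyl_act hC "\<lambda>w. conj_map \<sigma> ` w" \<sigma> p
    unfolding W hC by (rule galois_action_weyl[OF stable ph])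
  have F_eq: "F = A.F" unfolding F stratum_def by (rule refl)
  have F_eq': "A.F = {q \<in> hC. \<forall>w\<in>hC_stabilizer. w q = q \<longleftrightarrow> w p = p}"
    using stratum_eq[OF pC[unfolded hC]] unfolding W hC .
  have conjugate: "\<exists>w\<in>carrier W. weyl_act w x = \<psi> k x" if k: "k \<in> carrier Ghat" "x \<in> hC" "\<psi> k x \<in> hC" for k x
  proof -
    obtain w where w: "w \<in> G0" "w ` span h = span h" "w x = \<psi> k x"
      by (rule conjugate_imp_weyl_conjugate[OF k(2,3)[unfolded hC] psi_G0[OF k(1)] refl])
    then have wN: "w \<in> hC_stabilizer" by simp
    have "weyl_class w \<in> carrier W" unfolding W hC carrier_weyl using wN by (rule imageI)
    moreover have "weyl_act (weyl_class w) x = \<psi> k x" using weyl_act_class[OF wN k(2)[unfolded hC]] w(3) by simp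
    ultimately show ?thesis by blast
  qed
  have lift: "\<exists>k\<in>carrier Ghat. \<forall>x\<in>hC. \<psi> k x = weyl_act w x" if wW: "w \<in> carrier W" for w
  proof -
    obtain v where v: "v \<in> hC_stabilizer" "w = weyl_class v" using wW unfolding W hC carrier_weyl by blast
    then have "v \<in> \<psi> ` carrier Ghat" using psi(2) by simp
    then obtain k where k: "k \<in> carrier Ghat" "v = \<psi> k" by blast
    show ?thesis using k weyl_act_class[OF v(1)] unfolding v(2) hC by auto
  qed
  \<comment> \<open>Dividing \<psi> k by a representative v of w gives an element of
    \<open>G0\<close> that fixes p and maps the stratum into itself, to which
    \<open>fixes_stratum\<close> applies.\<close>
  have rigid: "\<psi> k x = weyl_act w x"
    if k: "k \<in> carrier Ghat" "\<forall>x\<in>A.F. \<psi> k x \<in> A.F" and w: "w \<in> A.Nz" "weyl_act w p = \<psi> k p" and x: "x \<in> A.F" for k w x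
  proof -
    have wW: "w \<in> carrier W" by (rule A.NzD(1)[OF w(1)])
    obtain v where v: "v \<in> hC_stabilizer" "w = weyl_class v" using wW unfolding W hC carrier_weyl by blast
    let ?v = "inv_into UNIV v"
    have vG: "v \<in> G0" "?v \<in> G0" using v(1) hC_stabilizer_inv[OF v(1)] by blast+
    have vx: "weyl_act w y = v y" if "y \<in> hC" for y using weyl_act_class[OF v(1)] that unfolding v(2) hC by blast
    have viF: "?v y \<in> A.F" if y: "y \<in> A.F" for y
    proof -
      have iN: "inv\<^bsub>W\<^esub> w \<in> A.Nz" using subgroup.m_inv_closed[OF A.Nz_subgroup w(1)] .
      have z: "weyl_act (inv\<^bsub>W\<^esub> w) y \<in> A.F" by (rule A.NzD(2)[OF iN y])
      have "v (weyl_act (inv\<^bsub>W\<^esub> w) y) = y" using A.act_inv(2)[OF wW, of y] y z vx by simp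
      then have "?v y = weyl_act (inv\<^bsub>W\<^esub> w) y" using G0_inverse(1)[OF vG(1)] by metis
      then show ?thesis using z by (simp only:)
    qed
    let ?u = "?v \<circ> \<psi> k"
    have "?u x = x"
    proof (rule fixes_stratum[OF pC[unfolded hC] F_eq'[unfolded hC]])
      show "?u \<in> G0" by (rule G.G0_comp[OF vG(2) psi_G0[OF k(1)]])
      show "?u p = p" using w(2) vx[OF pC] G0_inverse(1)[OF vG(1), of p] by simp
      show "?u ` {q \<in> span h. weyl_stabilizer W q = A.Wp} \<subseteq> {q \<in> span h. weyl_stabilizer W q = A.Wp}"
        using viF k(2) unfolding hC by auto
      show "x \<in> {q \<in> span h. weyl_stabilizer W q = A.Wp}" using x unfolding hC .
    qed
    then have "v (?v (\<psi> k x)) = v x" by simp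
    then show ?thesis using x vx unfolding G0_inverse(2)[OF vG(1)] by simp
  qed
  have NF_eq: "n i \<in> carrier Ghat \<and> (\<forall>x\<in>A.F. \<psi> (n i) x \<in> A.F)" if "i \<in> {1..s}" for i
    using n[OF that] unfolding cocycles_def NF set_normalizer_def F_eq by simp
  have Q_eq: "\<Gamma>p = A.Q" unfolding \<Gamma>p Wp by (rule refl)
  show ?thesis
    unfolding \<O> F_eq Q_eq
  proof (rule A.real_point_criterion[OF group_Ghat psi_one psi_mult _ conjugate lift rigid])
    show "\<sigma>hat k \<in> carrier Ghat \<and> \<sigma> (\<psi> k x) = \<psi> (\<sigma>hat k) (\<sigma> x)" if "k \<in> carrier Ghat" for k x
      using sigma_hat[OF that] by (simp add: \<psi>_\<sigma>[OF that] conj_map_apply sigma_sigma)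
    show "H1 A.Q A.\<gamma> = (\<lambda>i. cohomology_class A.Q A.\<gamma> (\<delta> i)) ` {1..s}"
      using \<delta>(2) unfolding Q_eq \<gamma>p .
    show "\<delta> i \<in> carrier A.Q" if "i \<in> {1..s}" for i
      using \<delta>(1)[OF that] unfolding Q_eq cocycles_def by blast
    show "n i \<in> carrier Ghat \<and> (\<forall>x\<in>A.F. \<psi> (n i) x \<in> A.F) \<and>
        (THE C. \<exists>v\<in>A.Nz. weyl_act v p = \<psi> (n i) p \<and> C = v <#\<^bsub>W\<^esub> A.Wp) = \<delta> i" if "i \<in> {1..s}" for i
      using NF_eq[OF that] n[OF that] unfolding \<phi> component_map_def by blast
    show "g i \<in> carrier Ghat \<and> inv\<^bsub>Ghat\<^esub> (g i) \<otimes>\<^bsub>Ghat\<^esub> \<sigma>hat (g i) = n i" if "i \<in> {1..s}" for i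
      by (rule g[OF that])
    show "q \<in> A.F" using q unfolding F_eq .
  qed
qed

end
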